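(* Let $n\ge 2$ and let $\Omega_\gamma\subset\mathbb{R}^n$ be the outward cuspidal domain and $w$ the boundary weight described in the context. Consider the weighted Steklov eigenvalue problem $$-\Delta u=0 \text{ in }\Omega_\gamma,\qquad \nabla u\cdot\nu=\lambda\, w\, u \text{ on }\partial\Omega_\gamma,$$ where $(\lambda,u)\in\mathbb{R}\times(W^{1,2}(\Omega_\gamma)\setminus\{0\})$ is called an eigenpair if $$\int_{\Omega_\gamma}\nabla u\cdot\nabla v\,dx=\lambda\int_{\partial\Omega_\gamma}u\,v\,w\,ds \quad\text{for every } v\in W^{1,2}(\Omega_\gamma).$$ Then the spectrum of this problem is discrete and is given by a non-decreasing sequence $$0=\lambda_0<\lambda_1\le\lambda_2\le\dots\le\lambda_k\le\dots,$$ where each eigenvalue is repeated according to its finite algebraic multiplicity, and $\lambda_k\to\infty$ as $k\to\infty$.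
   Context: Let $\gamma:[0,1]\to[0,\infty)$ be continuous, increasing and differentiable with $\gamma(0)=0$, $\gamma(1)=1$, $\gamma'$ increasing on $(0,1)$ and $\lim_{t\to0^+}\gamma'(t)=0$ (e.g. $\gamma(t)=t^\alpha$, $\alpha>1$). Writing $x=(x',x_n)\in\mathbb{R}^{n-1}\times\mathbb{R}$, the outward cuspidal domain is $$\Omega_\gamma=\{(x',x_n): |x'|<\gamma(x_n),\ 0<x_n\le 1\}\cup B^n\big((0,2),\sqrt2\big),$$ where $B^n((0,2),\sqrt2)$ is the open ball of radius $\sqrt2$ centred at $(0,\dots,0,2)$. The continuous weight $w:\partial\Omega_\gamma\to\mathbb{R}$ is $w(x)=\gamma(x_n)$ at boundary points with $|x'|=\gamma(x_n)<1$, and $w(x)=1$ at the remaining boundary points. $ds$ denotes $(n-1)$-dimensional surface (Hausdorff) measure on $\partial\Omega_\gamma$, $\nu$ the unit outward normal, $W^{1,2}(\Omega_\gamma)$ the usual Sobolev space, and boundary integrals of Sobolev functions are understood in the sense of traces. *)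

theory Defs
  imports "HOL-Analysis.Analysis"
begin

text \<open>Points of R^n are vectors of type real^'n; the coordinate e plays the role of x_n,
  and x' is the vector of the remaining coordinates (embedded with e-component 0).\<close>

definition xprime :: "'n \<Rightarrow> real^'n \<Rightarrow> real^'n" where
  "xprime e x = (\<chi> i. if i = e then 0 else x $ i)"

definition cusp_domain :: "(real \<Rightarrow> real) \<Rightarrow> 'n \<Rightarrow> (real^'n) set" where
  "cusp_domain \<gamma> e =
     {x. norm (xprime e x) < \<gamma> (x $ e) \<and> 0 < x $ e \<and> x $ e \<le> 1}
     \<union> ball (axis e 2) (sqrt 2)"

text \<open>The boundary weight: gamma(x_n) at boundary points with |x'| = gamma(x_n) < 1
  (gamma is only defined on [0,1], so 0 <= x_n <= 1 there), and 1 elsewhere.\<close>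

definition cusp_weight :: "(real \<Rightarrow> real) \<Rightarrow> 'n \<Rightarrow> real^'n \<Rightarrow> real" where
  "cusp_weight \<gamma> e x =
     (if 0 \<le> x $ e \<and> x $ e \<le> 1 \<and> norm (xprime e x) = \<gamma> (x $ e) \<and> \<gamma> (x $ e) < 1
      then \<gamma> (x $ e) else 1)"

definition hausdorff_const :: "real \<Rightarrow> real" where
  "hausdorff_const s = pi powr (s / 2) / Gamma (s / 2 + 1)"

definition hausdorff_outer :: "real \<Rightarrow> 'a::euclidean_space set \<Rightarrow> ennreal" where
  "hausdorff_outer s A =
     (SUP \<delta>\<in>{0<..}. INF C\<in>{C :: nat \<Rightarrow> 'a set. A \<subseteq> (\<Union>i. C i) \<and>
                                   (\<forall>i. bounded (C i) \<and> diameter (C i) \<le> \<delta>)}.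
        (\<Sum>i. ennreal (hausdorff_const s * (diameter (C i) / 2) powr s)))"

definition hausdorff_measure_on :: "real \<Rightarrow> 'a::euclidean_space set \<Rightarrow> 'a measure" where
  "hausdorff_measure_on s X =
     measure_of X (lambda_system X (Pow X) (hausdorff_outer s)) (hausdorff_outer s)"

definition partial_deriv :: "'n \<Rightarrow> (real^'n \<Rightarrow> real) \<Rightarrow> real^'n \<Rightarrow> real" where
  "partial_deriv i f x = frechet_derivative f (at x) (axis i 1)"

primrec C_k :: "nat \<Rightarrow> (real^'n \<Rightarrow> real) set" where
  "C_k 0 = {f. continuous_on UNIV f}"
| "C_k (Suc k) = {f. f differentiable_on UNIV \<and> (\<forall>i. partial_deriv i f \<in> C_k k)}"

definition C_infinity :: "(real^'n \<Rightarrow> real) set" where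
  "C_infinity = (\<Inter>k. C_k k)"

definition test_functions :: "(real^'n) set \<Rightarrow> (real^'n \<Rightarrow> real) set" where
  "test_functions \<Omega> = {\<phi> \<in> C_infinity. compact (closure {x. \<phi> x \<noteq> 0}) \<and> closure {x. \<phi> x \<noteq> 0} \<subseteq> \<Omega>}"

definition square_integrable_on :: "(real^'n) set \<Rightarrow> (real^'n \<Rightarrow> real) \<Rightarrow> bool" where
  "square_integrable_on \<Omega> u \<longleftrightarrow>
     u \<in> borel_measurable (lebesgue_on \<Omega>) \<and> integrable (lebesgue_on \<Omega>) (\<lambda>x. (u x)\<^sup>2)"

definition has_weak_gradient :: "(real^'n) set \<Rightarrow> (real^'n \<Rightarrow> real) \<Rightarrow> (real^'n \<Rightarrow> real^'n) \<Rightarrow> bool" where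
  "has_weak_gradient \<Omega> u g \<longleftrightarrow>
     (\<forall>\<phi>\<in>test_functions \<Omega>. \<forall>i.
        integral\<^sup>L (lebesgue_on \<Omega>) (\<lambda>x. u x * partial_deriv i \<phi> x)
        = - integral\<^sup>L (lebesgue_on \<Omega>) (\<lambda>x. g x $ i * \<phi> x))"

definition weak_gradient :: "(real^'n) set \<Rightarrow> (real^'n \<Rightarrow> real) \<Rightarrow> real^'n \<Rightarrow> real^'n" where
  "weak_gradient \<Omega> u = (SOME g. has_weak_gradient \<Omega> u g \<and> (\<forall>i. square_integrable_on \<Omega> (\<lambda>x. g x $ i)))"

definition sobolev_W12 :: "(real^'n) set \<Rightarrow> (real^'n \<Rightarrow> real) set" where
  "sobolev_W12 \<Omega> = {u. square_integrable_on \<Omega> u \<and>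
      (\<exists>g. has_weak_gradient \<Omega> u g \<and> (\<forall>i. square_integrable_on \<Omega> (\<lambda>x. g x $ i)))}"

definition boundary_trace :: "(real^'n) set \<Rightarrow> (real^'n \<Rightarrow> real) \<Rightarrow> real^'n \<Rightarrow> real" where
  "boundary_trace \<Omega> u x =
     Lim (at_right 0) (\<lambda>r. integral\<^sup>L (lebesgue_on (ball x r \<inter> \<Omega>)) u / measure lebesgue (ball x r \<inter> \<Omega>))"

definition steklov_form_eq ::
  "(real^'n) set \<Rightarrow> (real^'n \<Rightarrow> real) \<Rightarrow> real \<Rightarrow> (real^'n \<Rightarrow> real) \<Rightarrow> bool" where
  "steklov_form_eq \<Omega> w mu u \<longleftrightarrow>
     (\<forall>v\<in>sobolev_W12 \<Omega>.
        integral\<^sup>L (lebesgue_on \<Omega>) (\<lambda>x. weak_gradient \<Omega> u x \<bullet> weak_gradient \<Omega> v x)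
        = mu * integral\<^sup>L (hausdorff_measure_on (real CARD('n) - 1) (frontier \<Omega>))
                (\<lambda>x. boundary_trace \<Omega> u x * boundary_trace \<Omega> v x * w x))"

definition steklov_eigenpair ::
  "(real^'n) set \<Rightarrow> (real^'n \<Rightarrow> real) \<Rightarrow> real \<Rightarrow> (real^'n \<Rightarrow> real) \<Rightarrow> bool" where
  "steklov_eigenpair \<Omega> w mu u \<longleftrightarrow>
     u \<in> sobolev_W12 \<Omega> \<and> \<not> (AE x in lebesgue_on \<Omega>. u x = 0) \<and> steklov_form_eq \<Omega> w mu u"

definition steklov_eigenspace ::
  "(real^'n) set \<Rightarrow> (real^'n \<Rightarrow> real) \<Rightarrow> real \<Rightarrow> (real^'n \<Rightarrow> real) set" where
  "steklov_eigenspace \<Omega> w mu = {u \<in> sobolev_W12 \<Omega>. steklov_form_eq \<Omega> w mu u}"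

definition ae_lin_indep :: "(real^'n) set \<Rightarrow> (nat \<Rightarrow> real^'n \<Rightarrow> real) \<Rightarrow> nat \<Rightarrow> bool" where
  "ae_lin_indep \<Omega> us m \<longleftrightarrow>
     (\<forall>c :: nat \<Rightarrow> real. (AE x in lebesgue_on \<Omega>. (\<Sum>i<m. c i * us i x) = 0) \<longrightarrow> (\<forall>i<m. c i = 0))"

definition has_multiplicity ::
  "(real^'n) set \<Rightarrow> (real^'n \<Rightarrow> real) \<Rightarrow> real \<Rightarrow> nat \<Rightarrow> bool" where
  "has_multiplicity \<Omega> w mu m \<longleftrightarrow>
     (\<exists>us. (\<forall>i<m. us i \<in> steklov_eigenspace \<Omega> w mu) \<and> ae_lin_indep \<Omega> us m) \<and>
     \<not> (\<exists>us. (\<forall>i<Suc m. us i \<in> steklov_eigenspace \<Omega> w mu) \<and> ae_lin_indep \<Omega> us (Suc m))"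

end

theory Submission
 imports Defs "HOL-Library.Diagonal_Subsequence"
begin

text \<open>
The Dirichlet form a and the weighted boundary form b satisfy on the Sobolev space the three
conditions that make the minimax construction work: a + b is complete, b is compact relative to
a + b, and b has infinite rank. Eigenfunctions are successive minimizers of a on the b-unit sphere
of the b-orthogonal complement of their predecessors.

Every boundary point x of positive weight has a cone at scale w(x): for small c a ball of radius
r = c w(x) lies inside the domain near x, and the part of the domain within r of x can be moved into
it. By Poincare's inequality the averages over the balls of radius c w(x) 2^(-k) around x then differ by
the energy nearby, and integrating against w ds (Tonelli, and H(B(y,r)) bounded by a multiple of
r^(n-1)) gives an error of 2^(-k) times the energy. So the averages converge almost everywhere, the
trace is the limit of the maps u \<mapsto> averages at scale k uniformly on bounded sets, and these maps
send weakly convergent sequences to pointwise convergent ones. Near the tip the weight controls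
the trace by the function on a thin strip, which is small because the strip can be moved upwards
many times inside the domain. The domain itself satisfies a Poincare inequality, since moving it
up by one unit takes the cusp into the ball. Infinite rank is witnessed by polynomials in x_n, and
the eigenvalue 0 is simple because a function of zero energy is constant.
\<close>

text \<open>At a boundary point of scale r a trace inequality costs 1/r times the squared L2 norm
  plus r times the energy. On the cusp the available scale is of the order of \<gamma>(x_n), so 1/r
  blows up at the tip; the weight has the same order and cancels it. Hence the coefficient of the L2
  norm (\<open>C5\<close>) does not depend on the scale, and that of the energy
  (\<open>C4 * s^2\<close>) is quadratic in it. The trace is by definition a limit of averages, so
  averages are estimated directly, without extending functions or approximating them by smooth ones.
  The local estimates rest on one inequality, \<open>sob_translation\<close>: a shift along segments
  inside the domain changes a function in L2 by at most the length of the shift times the gradient.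
  The boundary is split into the side of the cusp and the sphere, because on each of them the weight
  is the restriction of a function that is Lipschitz on the whole space and can be evaluated at
  interior points, as Tonelli requires.\<close>

abbreviation nsq :: "'a measure \<Rightarrow> ('a \<Rightarrow> real) \<Rightarrow> ennreal" where
 "nsq M f \<equiv> (\<integral>\<^sup>+x. ennreal ((f x)^2) \<partial>M)"

abbreviation nsq_on :: "'a::euclidean_space set \<Rightarrow> ('a \<Rightarrow> real) \<Rightarrow> ennreal" where
 "nsq_on S f \<equiv> (\<integral>\<^sup>+x. ennreal ((f x)^2) * indicator S x \<partial>lborel)"

abbreviation rsq :: "'a measure \<Rightarrow> ('a \<Rightarrow> real) \<Rightarrow> real" where
 "rsq M f \<equiv> (\<integral>x. (f x)^2 \<partial>M)"

abbreviation dirichlet :: "('a::euclidean_space \<Rightarrow> 'b::euclidean_space) \<Rightarrow> real" where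
 "dirichlet q \<equiv> (\<integral>x. (norm (q x))^2 \<partial>lborel)"

abbreviation surface_outer :: "(real^'n) set \<Rightarrow> ennreal" where
 "surface_outer \<equiv> hausdorff_outer (real CARD('n) - 1)"

section \<open>Eigenvalues of a compact pair of quadratic forms\<close>

text \<open>Only semidefiniteness is asked for: functions equal almost everywhere are not
  identified, and neither form is definite on its own, since one kills constants and the other
  functions of zero trace.\<close>

locale semi_inner =
 fixes V :: "('x \<Rightarrow> real) set" and f :: "('x \<Rightarrow> real) \<Rightarrow> ('x \<Rightarrow> real) \<Rightarrow> real"
 assumes lin: "u \<in> V \<Longrightarrow> v \<in> V \<Longrightarrow> (\<lambda>x. c * u x + d * v x) \<in> V"
  and add_left: "u \<in> V \<Longrightarrow> v \<in> V \<Longrightarrow> z \<in> V \<Longrightarrow> f (\<lambda>x. c * u x + d * v x) z = c * f u z + d * f v z"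
  and sym: "u \<in> V \<Longrightarrow> v \<in> V \<Longrightarrow> f u v = f v u"
  and pos: "u \<in> V \<Longrightarrow> 0 \<le> f u u"
begin

lemma add_right: "u \<in> V \<Longrightarrow> v \<in> V \<Longrightarrow> z \<in> V \<Longrightarrow> f z (\<lambda>x. c * u x + d * v x) = c * f z u + d * f z v"
 by (simp add: sym[of z] lin add_left)

lemma quad: "u \<in> V \<Longrightarrow> v \<in> V \<Longrightarrow>
  f (\<lambda>x. c * u x + d * v x) (\<lambda>x. c * u x + d * v x) = c^2 * f u u + 2 * c * d * f u v + d^2 * f v v"
 by (simp add: add_left add_right lin sym[of v u] power2_eq_square algebra_simps)

lemma diff_in: "u \<in> V \<Longrightarrow> v \<in> V \<Longrightarrow> (\<lambda>x. u x - v x) \<in> V"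
 using lin[of u v 1 "-1"] by simp

lemma quad_diff: "u \<in> V \<Longrightarrow> v \<in> V \<Longrightarrow>
  f (\<lambda>x. u x - v x) (\<lambda>x. u x - v x) = f u u - 2 * f u v + f v v"
 using quad[of u v 1 "-1"] by simp

lemma diff_left: "u \<in> V \<Longrightarrow> v \<in> V \<Longrightarrow> z \<in> V \<Longrightarrow> f (\<lambda>x. u x - v x) z = f u z - f v z"
 using add_left[of u v z 1 "-1"] by simp

lemma cauchy_schwarz: assumes u: "u \<in> V" and v: "v \<in> V" shows "(f u v)^2 \<le> f u u * f v v"
proof -
 have p: "0 \<le> c^2 * f u u + 2 * c * d * f u v + d^2 * f v v" for c d
  using pos[OF lin[OF u v, of c d]] quad[OF u v, of c d] by simp
 show ?thesis
 proof (cases "f v v = 0")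
  case True
  have "f u v = 0"
  proof (rule ccontr)
   assume n: "f u v \<noteq> 0"
   \<comment> \<open>Since \<open>f v v = 0\<close> the quadratic is affine in \<open>d\<close>;
     this \<open>d\<close> is chosen so that its value is -1.\<close>
   have "0 \<le> f u u + 2 * (- (f u u + 1) / (2 * f u v)) * f u v"
    using p[of 1 "- (f u u + 1) / (2 * f u v)"] True by simp
   also have "... = -1" using n by (simp add: field_simps)
   finally show False by simp
  qed
  thus ?thesis using True by simp
 next
  case False
  hence "f v v > 0" using pos[OF v] by simp
  have "0 \<le> (f v v)^2 * f u u + 2 * (f v v) * (- f u v) * f u v + (- f u v)^2 * f v v"
   using p[of "f v v" "- f u v"] by simp
  also have "... = f v v * (f u u * f v v - (f u v)^2)"
   by (simp add: power2_eq_square algebra_simps)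
  finally show ?thesis using \<open>f v v > 0\<close> by (simp add: zero_le_mult_iff)
 qed
qed

lemma null_right: "u \<in> V \<Longrightarrow> v \<in> V \<Longrightarrow> f v v = 0 \<Longrightarrow> f u v = 0"
 using cauchy_schwarz[of u v] by simp

lemma scale_in: "u \<in> V \<Longrightarrow> (\<lambda>x. c * u x) \<in> V"
 using lin[of u u c 0] by simp

lemma scale_left: "u \<in> V \<Longrightarrow> z \<in> V \<Longrightarrow> f (\<lambda>x. c * u x) z = c * f u z"
 using add_left[of u u z c 0] by simp

lemma scale_quad: "u \<in> V \<Longrightarrow> f (\<lambda>x. c * u x) (\<lambda>x. c * u x) = c^2 * f u u"
 using quad[of u u c 0] by simp

lemma sum_in:
 fixes k :: nat
 assumes "v \<in> V" "\<And>j. j < k \<Longrightarrow> w j \<in> V"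
 shows "(\<lambda>x. v x - (\<Sum>j<k. c j * w j x)) \<in> V"
 using assms(2)
proof (induction k)
 case 0 thus ?case using assms(1) by simp
next
 case (Suc k)
 have "(\<lambda>x. 1 * (v x - (\<Sum>j<k. c j * w j x)) + (- c k) * w k x) \<in> V"
  by (intro lin Suc) auto
 thus ?case by (simp add: algebra_simps)
qed

lemma sum_left:
 fixes k :: nat
 assumes "v \<in> V" "z \<in> V" "\<And>j. j < k \<Longrightarrow> w j \<in> V"
 shows "f (\<lambda>x. v x - (\<Sum>j<k. c j * w j x)) z = f v z - (\<Sum>j<k. c j * f (w j) z)"
 using assms(3)
proof (induction k)
 case 0 thus ?case by simp
next
 case (Suc k)
 have "f (\<lambda>x. 1 * (v x - (\<Sum>j<k. c j * w j x)) + (- c k) * w k x) z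
   = 1 * f (\<lambda>x. v x - (\<Sum>j<k. c j * w j x)) z + (- c k) * f (w k) z"
  by (intro add_left sum_in assms(1,2)) (auto simp: Suc)
 thus ?case using Suc by (simp add: algebra_simps)
qed

end

text \<open>\<open>cpt\<close> expresses compactness of \<open>b\<close> by b-Cauchy subsequences,
  so no weak limits appear in the abstract setting. \<open>infrank\<close> guarantees that after any
  finite number of steps the orthogonal complement still contains a vector of positive b-norm to
  minimize over.\<close>

locale form_pair = A: semi_inner V a + B: semi_inner V b
 for V :: "('x \<Rightarrow> real) set" and a b +
 assumes cpt: "\<And>U C. (\<And>m. U m \<in> V) \<Longrightarrow> (\<And>m. a (U m) (U m) + b (U m) (U m) \<le> C) \<Longrightarrow>
   \<exists>r::nat\<Rightarrow>nat. strict_mono r \<and> (\<forall>\<epsilon>>0. \<exists>N. \<forall>m\<ge>N. \<forall>l\<ge>N.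
     b (\<lambda>x. U (r m) x - U (r l) x) (\<lambda>x. U (r m) x - U (r l) x) < \<epsilon>)"
  and cmpl: "\<And>U. (\<And>m::nat. U m \<in> V) \<Longrightarrow>
   (\<And>\<epsilon>. \<epsilon> > 0 \<Longrightarrow> \<exists>N. \<forall>m\<ge>N. \<forall>l\<ge>N. a (\<lambda>x. U m x - U l x) (\<lambda>x. U m x - U l x)
     + b (\<lambda>x. U m x - U l x) (\<lambda>x. U m x - U l x) < \<epsilon>) \<Longrightarrow>
   \<exists>u\<in>V. (\<lambda>m. a (\<lambda>x. U m x - u x) (\<lambda>x. U m x - u x)
     + b (\<lambda>x. U m x - u x) (\<lambda>x. U m x - u x)) \<longlonglongrightarrow> 0"
  and infrank: "\<And>k us. (\<And>j. j < k \<Longrightarrow> us j \<in> V) \<Longrightarrow> \<exists>u\<in>V. b u u > 0 \<and> (\<forall>j<k::nat. b u (us j) = 0)"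
begin

lemma form_tendsto:
 assumes S: "semi_inner V f" and "\<And>m. U m \<in> V" "u \<in> V" "v \<in> V"
  and "(\<lambda>m. f (\<lambda>x. U m x - u x) (\<lambda>x. U m x - u x)) \<longlonglongrightarrow> 0"
 shows "(\<lambda>m. f (U m) v) \<longlonglongrightarrow> f u v" "(\<lambda>m. f (U m) (U m)) \<longlonglongrightarrow> f u u"
proof -
 interpret S: semi_inner V f by fact
 let ?q = "\<lambda>m. f (\<lambda>x. U m x - u x) (\<lambda>x. U m x - u x)"
 have lim: "(\<lambda>m. f (U m) v) \<longlonglongrightarrow> f u v" if "v \<in> V" for v
 proof -
  have "(\<lambda>m. f (U m) v - f u v) \<longlonglongrightarrow> 0"
  proof (rule Lim_null_comparison)
   show "\<forall>\<^sub>F m in sequentially. norm (f (U m) v - f u v) \<le> sqrt (?q m * f v v)"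
   proof (rule always_eventually, rule allI)
    fix m
    have "(f (U m) v - f u v)^2 \<le> ?q m * f v v"
     using S.cauchy_schwarz[of "\<lambda>x. U m x - u x" v] S.diff_in assms that
     by (simp add: S.diff_left)
    thus "norm (f (U m) v - f u v) \<le> sqrt (?q m * f v v)"
     using real_le_rsqrt by (metis power2_abs real_norm_def)
   qed
   have "(\<lambda>m. sqrt (?q m * f v v)) \<longlonglongrightarrow> sqrt (0 * f v v)"
    by (intro tendsto_intros assms)
   thus "(\<lambda>m. sqrt (?q m * f v v)) \<longlonglongrightarrow> 0" by simp
  qed
  thus ?thesis by (simp add: LIM_zero_iff)
 qed
 show "(\<lambda>m. f (U m) v) \<longlonglongrightarrow> f u v" using lim assms by blast
 have "(\<lambda>m. ?q m + 2 * f (U m) u - f u u) \<longlonglongrightarrow> 0 + 2 * f u u - f u u"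
  by (intro tendsto_intros lim assms)
 moreover have "?q m + 2 * f (U m) u - f u u = f (U m) (U m)" for m
  using S.quad_diff assms by simp
 ultimately show "(\<lambda>m. f (U m) (U m)) \<longlonglongrightarrow> f u u" by simp
qed

text \<open>A minimizing sequence has a b-Cauchy subsequence by compactness, and by the parallelogram
 law that subsequence is Cauchy for a as well; no weak convergence is needed.\<close>

lemma minimizer:
 fixes k :: nat
 assumes us: "\<And>j. j < k \<Longrightarrow> us j \<in> V"
 shows "\<exists>u\<in>V. b u u = 1 \<and> (\<forall>j<k. b u (us j) = 0) \<and>
   (\<forall>v\<in>V. (\<forall>j<k. b v (us j) = 0) \<longrightarrow> a u u * b v v \<le> a v v)"
proof -
 define W where "W = {v\<in>V. \<forall>j<k. b v (us j) = 0}"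
 define R where "R = {a v v |v. v \<in> W \<and> b v v = 1}"
 define l where "l = Inf R"
 have Wlin: "(\<lambda>x. c * u x + d * v x) \<in> W" if "u \<in> W" "v \<in> W" for u v c d
  using that us by (auto simp: W_def A.lin B.add_left)
 have scale: "(\<lambda>x. c * u x) \<in> W" if "u \<in> W" for u c
  using that us by (auto simp: W_def A.scale_in B.scale_left)
 have norm1: "(\<lambda>x. (1 / sqrt (b v v)) * v x) \<in> W"
  "b (\<lambda>x. (1 / sqrt (b v v)) * v x) (\<lambda>x. (1 / sqrt (b v v)) * v x) = 1"
  "a (\<lambda>x. (1 / sqrt (b v v)) * v x) (\<lambda>x. (1 / sqrt (b v v)) * v x) = a v v / b v v"
  if "v \<in> W" "b v v > 0" for v
 proof -
  have v: "v \<in> V" using that W_def by auto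
  show "(\<lambda>x. (1 / sqrt (b v v)) * v x) \<in> W" by (rule scale) fact
  show "b (\<lambda>x. (1 / sqrt (b v v)) * v x) (\<lambda>x. (1 / sqrt (b v v)) * v x) = 1"
   using B.scale_quad[OF v, of "1 / sqrt (b v v)"] that by (simp add: power_divide)
  show "a (\<lambda>x. (1 / sqrt (b v v)) * v x) (\<lambda>x. (1 / sqrt (b v v)) * v x) = a v v / b v v"
   using A.scale_quad[OF v, of "1 / sqrt (b v v)"] that by (simp add: power_divide)
 qed
 have "R \<noteq> {}"
 proof -
  obtain u where "u \<in> W" "b u u > 0" using infrank[of k us] us W_def by auto
  thus ?thesis using norm1[of u] unfolding R_def by blast
 qed
 have Rpos: "0 \<le> r" if "r \<in> R" for r using that A.pos by (auto simp: R_def W_def)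
 hence bdd: "bdd_below R" by (rule bdd_belowI)
 have lle: "l * b v v \<le> a v v" if "v \<in> W" for v
 proof (cases "b v v > 0")
  case True
  have "a v v / b v v \<in> R" using norm1[OF that True] unfolding R_def by force
  hence "l \<le> a v v / b v v" unfolding l_def using bdd by (rule cInf_lower)
  thus ?thesis using True by (simp add: field_simps)
 next
  case False
  hence "b v v = 0" using B.pos[of v] that W_def by simp
  thus ?thesis using A.pos that W_def by auto
 qed
 have l0: "0 \<le> l" unfolding l_def using \<open>R \<noteq> {}\<close> Rpos by (rule cInf_greatest)
 have "\<exists>U. \<forall>m. U m \<in> W \<and> b (U m) (U m) = 1 \<and> a (U m) (U m) < l + 1 / real (Suc m)"
 proof (rule choice, rule allI)
  fix m
  have "Inf R < l + 1 / real (Suc m)" unfolding l_def by simp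
  then obtain r where "r \<in> R" "r < l + 1 / real (Suc m)"
   using cInf_lessD[OF \<open>R \<noteq> {}\<close>] by blast
  thus "\<exists>u. u \<in> W \<and> b u u = 1 \<and> a u u < l + 1 / real (Suc m)" unfolding R_def by auto
 qed
 then obtain U0 where U0: "\<And>m. U0 m \<in> W" "\<And>m. b (U0 m) (U0 m) = 1"
   "\<And>m. a (U0 m) (U0 m) < l + 1 / real (Suc m)" by blast
 have "\<exists>r::nat\<Rightarrow>nat. strict_mono r \<and> (\<forall>\<epsilon>>0. \<exists>N. \<forall>m\<ge>N. \<forall>l\<ge>N.
     b (\<lambda>x. U0 (r m) x - U0 (r l) x) (\<lambda>x. U0 (r m) x - U0 (r l) x) < \<epsilon>)"
 proof (rule cpt[of U0 "l + 2"])
  show "U0 m \<in> V" for m using U0(1) W_def by auto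
  show "a (U0 m) (U0 m) + b (U0 m) (U0 m) \<le> l + 2" for m
  proof -
   have "1 / real (Suc m) \<le> 1" by simp
   thus ?thesis using U0(2,3)[of m] by linarith
  qed
 qed
 then obtain r :: "nat \<Rightarrow> nat" where r: "strict_mono r" and
  rc: "\<And>\<epsilon>. \<epsilon> > 0 \<Longrightarrow> \<exists>N. \<forall>m\<ge>N. \<forall>l\<ge>N.
     b (\<lambda>x. U0 (r m) x - U0 (r l) x) (\<lambda>x. U0 (r m) x - U0 (r l) x) < \<epsilon>" by blast
 define U where "U m = U0 (r m)" for m
 have UW: "U m \<in> W" and UV: "U m \<in> V" and Ub: "b (U m) (U m) = 1" for m
  using U0 unfolding U_def W_def by auto
 have Ua: "a (U m) (U m) < l + 1 / real (Suc m)" for m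
 proof -
  have "m \<le> r m" using r by (rule seq_suble)
  hence "1 / real (Suc (r m)) \<le> 1 / real (Suc m)" by (simp add: frac_le)
  thus ?thesis using U0(3)[of "r m"] unfolding U_def by linarith
 qed
 have para: "a (\<lambda>x. U m x - U n x) (\<lambda>x. U m x - U n x) \<le> 2 / real (Suc m) + 2 / real (Suc n)
   + l * b (\<lambda>x. U m x - U n x) (\<lambda>x. U m x - U n x)" for m n
 proof -
  let ?s = "\<lambda>x. 1 * U m x + 1 * U n x"
  have s: "?s \<in> W" using UW by (intro Wlin)
  have "l * b ?s ?s \<le> a ?s ?s" using lle s by blast
  moreover have "a ?s ?s = a (U m) (U m) + 2 * a (U m) (U n) + a (U n) (U n)"
   using A.quad[OF UV UV, of 1 m 1 n] by simp
  moreover have "b ?s ?s = b (U m) (U m) + 2 * b (U m) (U n) + b (U n) (U n)"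
   using B.quad[OF UV UV, of 1 m 1 n] by simp
  ultimately have *: "l * (2 + 2 * b (U m) (U n)) \<le> a (U m) (U m) + 2 * a (U m) (U n) + a (U n) (U n)"
   using Ub by simp
  have e: "a (\<lambda>x. U m x - U n x) (\<lambda>x. U m x - U n x) = a (U m) (U m) - 2 * a (U m) (U n) + a (U n) (U n)"
   using A.quad_diff UV by blast
  have f: "l * b (\<lambda>x. U m x - U n x) (\<lambda>x. U m x - U n x) = l * (2 - 2 * b (U m) (U n))"
   using B.quad_diff[of "U m" "U n"] UV Ub by simp
  show ?thesis unfolding e f using * Ua[of m] Ua[of n] by (simp add: algebra_simps)
 qed
 have "\<exists>u\<in>V. (\<lambda>m. a (\<lambda>x. U m x - u x) (\<lambda>x. U m x - u x)
     + b (\<lambda>x. U m x - u x) (\<lambda>x. U m x - u x)) \<longlonglongrightarrow> 0"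
 proof (rule cmpl)
  show "U m \<in> V" for m by (rule UV)
  fix \<epsilon> :: real assume "\<epsilon> > 0"
  then obtain N where N: "\<And>m n. m\<ge>N \<Longrightarrow> n\<ge>N \<Longrightarrow> b (\<lambda>x. U m x - U n x) (\<lambda>x. U m x - U n x) < \<epsilon> / (2 * (l + 1))"
   using rc[of "\<epsilon> / (2 * (l + 1))"] l0 unfolding U_def by auto
  obtain M where M: "1 / real (Suc M) < \<epsilon> / 8" using \<open>\<epsilon> > 0\<close> nat_approx_posE[of "\<epsilon>/8"] by auto
  show "\<exists>N. \<forall>m\<ge>N. \<forall>l\<ge>N. a (\<lambda>x. U m x - U l x) (\<lambda>x. U m x - U l x)
     + b (\<lambda>x. U m x - U l x) (\<lambda>x. U m x - U l x) < \<epsilon>"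
  proof (intro exI[of _ "max M N"] allI impI)
   fix m n assume mn: "max M N \<le> m" "max M N \<le> n"
   let ?b = "b (\<lambda>x. U m x - U n x) (\<lambda>x. U m x - U n x)"
   have "1 / real (Suc m) \<le> 1 / real (Suc M)" "1 / real (Suc n) \<le> 1 / real (Suc M)"
    using mn by (simp_all add: frac_le)
   hence "2 / real (Suc m) + 2 / real (Suc n) < \<epsilon> / 2" using M by simp
   moreover have "(l + 1) * ?b < \<epsilon> / 2" using N[of m n] mn l0 by (simp add: field_simps)
   ultimately show "a (\<lambda>x. U m x - U n x) (\<lambda>x. U m x - U n x) + ?b < \<epsilon>"
    using para[of m n] by (simp add: algebra_simps)
  qed
 qed
 then obtain u where u: "u \<in> V" and ul: "(\<lambda>m. a (\<lambda>x. U m x - u x) (\<lambda>x. U m x - u x)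
     + b (\<lambda>x. U m x - u x) (\<lambda>x. U m x - u x)) \<longlonglongrightarrow> 0" by blast
 have qa: "(\<lambda>m. a (\<lambda>x. U m x - u x) (\<lambda>x. U m x - u x)) \<longlonglongrightarrow> 0"
  by (rule tendsto_sandwich[OF _ _ tendsto_const ul]) (auto intro!: always_eventually A.pos B.pos A.diff_in UV u)
 have qb: "(\<lambda>m. b (\<lambda>x. U m x - u x) (\<lambda>x. U m x - u x)) \<longlonglongrightarrow> 0"
  by (rule tendsto_sandwich[OF _ _ tendsto_const ul]) (auto intro!: always_eventually A.pos B.pos A.diff_in UV u)
 note la = form_tendsto[OF A.semi_inner_axioms UV u _ qa]
 note lb = form_tendsto[OF B.semi_inner_axioms UV u _ qb]
 have bu: "b u u = 1" using lb(2)[OF u] Ub by (simp add: LIMSEQ_const_iff)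
 have orth: "b u (us j) = 0" if "j < k" for j
  using lb(1)[OF us[OF that]] UW that unfolding W_def by (simp add: LIMSEQ_const_iff)
 have "a u u \<le> l"
 proof (rule LIMSEQ_le[OF la(2)[OF u]])
  show "(\<lambda>m. l + 1 / real (Suc m)) \<longlonglongrightarrow> l"
   using tendsto_add[OF tendsto_const[of l] LIMSEQ_inverse_real_of_nat] by (simp add: divide_inverse)
  show "\<exists>N. \<forall>n\<ge>N. a (U n) (U n) \<le> l + 1 / real (Suc n)" using Ua less_imp_le by blast
 qed
 hence "a u u * b v v \<le> a v v" if "v \<in> W" for v
  using lle[OF that] mult_right_mono[of "a u u" l "b v v"] B.pos[of v] that W_def by auto
 thus ?thesis using u bu orth W_def by blast
qed

text \<open>Successive minimizers are chosen by well-founded recursion. The last clause, a lower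
  bound on the complement of the first \<open>k\<close> vectors, is kept because it later excludes
  eigenvalues outside the sequence.\<close>

lemma eigen_sequence:
 obtains us :: "nat \<Rightarrow> 'x \<Rightarrow> real" and lam :: "nat \<Rightarrow> real"
 where "\<And>k. us k \<in> V" "\<And>k j. b (us k) (us j) = (if k = j then 1 else 0)"
  "\<And>k v. v \<in> V \<Longrightarrow> a (us k) v = lam k * b (us k) v"
  "mono lam" "filterlim lam at_top sequentially" "0 \<le> lam 0"
  "\<And>v k. v \<in> V \<Longrightarrow> (\<forall>j<k. b v (us j) = 0) \<Longrightarrow> lam k * b v v \<le> a v v"
proof -
 define P where "P us k u \<longleftrightarrow> u \<in> V \<and> b u u = 1 \<and> (\<forall>j<k. b u (us j) = 0) \<and>
   (\<forall>v\<in>V. (\<forall>j<k. b v (us j) = 0) \<longrightarrow> a u u * b v v \<le> a v v)" for us :: "nat \<Rightarrow> 'x \<Rightarrow> real" and k u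
 have "\<exists>us. \<forall>k. P us k (us k)"
 proof (rule dependent_wellorder_choice)
  fix r :: "'x \<Rightarrow> real" and f g :: "nat \<Rightarrow> 'x \<Rightarrow> real" and x :: nat
  assume "\<And>y. y < x \<Longrightarrow> f y = g y"
  thus "P f x r = P g x r" unfolding P_def by auto
 next
  fix x :: nat and f :: "nat \<Rightarrow> 'x \<Rightarrow> real"
  assume "\<And>y. y < x \<Longrightarrow> P f y (f y)"
  hence "f y \<in> V" if "y < x" for y using that P_def by blast
  thus "\<exists>r. P f x r" using minimizer[of x f] unfolding P_def by blast
 qed
 then obtain us where us: "\<And>k. P us k (us k)" by blast
 define lam where "lam k = a (us k) (us k)" for k
 have V: "us k \<in> V" for k using us P_def by blast
 have on: "b (us k) (us j) = (if k = j then 1 else 0)" for k j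
 proof (cases k j rule: linorder_cases)
  case less
  have "b (us k) (us j) = b (us j) (us k)" using V B.sym by blast
  thus ?thesis using us[of j] less unfolding P_def by auto
 next
  case equal thus ?thesis using us[of k] P_def by auto
 next
  case greater thus ?thesis using us[of k] P_def by auto
 qed
 have min: "lam k * b v v \<le> a v v" if "v \<in> V" "\<forall>j<k. b v (us j) = 0" for v k
  using us[of k] that unfolding P_def lam_def by blast
 \<comment> \<open>First variation: \<open>us k + t * v\<close> is admissible when \<open>v\<close>
   is orthogonal to the earlier vectors, and minimality for all \<open>t\<close> kills the linear
   coefficient \<open>D\<close>.\<close>
 have EL: "a (us k) v = lam k * b (us k) v" if "v \<in> V" "\<forall>j<k. b v (us j) = 0" for k v
 proof -
  have p: "0 \<le> 2 * t * (a (us k) v - lam k * b (us k) v) + t^2 * (a v v - lam k * b v v)" for t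
  proof -
   let ?w = "\<lambda>x. 1 * us k x + t * v x"
   have w: "?w \<in> V" using V that by (intro A.lin)
   have "b ?w (us j) = 0" if "j < k" for j
    using B.add_left[OF V \<open>v \<in> V\<close> V, of 1 k t j] \<open>\<forall>j<k. b v (us j) = 0\<close> on that by simp
   hence "\<forall>j<k. b ?w (us j) = 0" by blast
   hence "lam k * b ?w ?w \<le> a ?w ?w" using min w by blast
   thus ?thesis using A.quad[OF V that(1), of 1 k t] B.quad[OF V that(1), of 1 k t] on[of k k]
    by (simp add: lam_def algebra_simps)
  qed
  define D Q where "D = a (us k) v - lam k * b (us k) v" and "Q = a v v - lam k * b v v"
  have Q: "Q \<ge> 0" using min[OF that] Q_def by simp
  have p': "0 \<le> 2 * t * D + t^2 * Q" for t using p[of t] unfolding D_def Q_def .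
  \<comment> \<open>This \<open>t\<close> is nearly optimal; the added 1 keeps the denominator
    positive when \<open>Q = 0\<close>.\<close>
  have "0 \<le> 2 * (- D / (Q + 1)) * D + (D / (Q + 1))^2 * Q"
   using p'[of "- D / (Q+1)"] by simp
  also have "... = - (D^2) * (Q + 2) / (Q + 1)^2"
   using Q by (simp add: divide_simps power2_eq_square) (simp add: algebra_simps)
  finally have "D^2 * (Q + 2) / (Q + 1)^2 \<le> 0" by simp
  hence "D^2 * (Q + 2) \<le> 0" using Q by (simp add: divide_le_0_iff)
  hence "D = 0" using Q by (smt (verit) mult_nonneg_nonneg mult_pos_pos zero_less_power2)
  thus ?thesis using D_def by simp
 qed
 \<comment> \<open>For arbitrary \<open>v\<close> the b-projection to the earlier vectors is
   subtracted. The removed part does not contribute: \<open>us k\<close> is an admissible direction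
   for each earlier \<open>us j\<close>, so the two are a-orthogonal as well.\<close>
 have eig: "a (us k) v = lam k * b (us k) v" if v: "v \<in> V" for k v
 proof -
  define z where "z = (\<lambda>x. v x - (\<Sum>j<k. b v (us j) * us j x))"
  have z: "z \<in> V" unfolding z_def using v V by (intro A.sum_in)
  have bz: "b z y = b v y - (\<Sum>j<k. b v (us j) * b (us j) y)" if "y \<in> V" for y
   unfolding z_def using v V that by (intro B.sum_left)
  have az: "a z y = a v y - (\<Sum>j<k. b v (us j) * a (us j) y)" if "y \<in> V" for y
   unfolding z_def using v V that by (intro A.sum_left)
  have "\<forall>j<k. b z (us j) = 0"
  proof (intro allI impI)
   fix j assume "j < k"
   have "(\<Sum>i<k. b v (us i) * b (us i) (us j)) = (\<Sum>i<k. if i = j then b v (us i) else 0)"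
    by (intro sum.cong) (auto simp: on)
   thus "b z (us j) = 0" using \<open>j < k\<close> bz[OF V] by simp
  qed
  hence 1: "a (us k) z = lam k * b (us k) z" using EL z by blast
  have "a (us j) (us k) = 0" if "j < k" for j
   using EL[of "us k" j] that on V by simp
  hence "a z (us k) = a v (us k)" using az[OF V] by simp
  moreover have "b z (us k) = b v (us k)" using bz[OF V] on by simp
  ultimately show ?thesis using 1 A.sym B.sym V v z by metis
 qed
 have mono: "mono lam"
 proof (rule mono_iff_le_Suc[THEN iffD2], rule allI)
  fix k
  show "lam k \<le> lam (Suc k)" using min[of "us (Suc k)" k] V on unfolding lam_def by simp
 qed
 \<comment> \<open>If \<open>lam\<close> were bounded, compactness would give a b-Cauchy subsequence
   of a b-orthonormal sequence, whose members have squared b-distance 2.\<close>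
 have top: "filterlim lam at_top sequentially"
 proof (rule ccontr)
  assume "\<not> filterlim lam at_top sequentially"
  then obtain Z where Z: "\<not> (\<forall>\<^sub>F k in sequentially. Z \<le> lam k)" unfolding filterlim_at_top by blast
  have bd: "lam k \<le> Z" for k
  proof (rule ccontr)
   assume "\<not> lam k \<le> Z"
   hence "\<forall>j\<ge>k. Z \<le> lam j" using mono unfolding mono_def by (meson le_cases order_trans)
   thus False using Z eventually_sequentially by auto
  qed
  obtain r :: "nat \<Rightarrow> nat" where r: "strict_mono r" and rc: "\<forall>\<epsilon>>0. \<exists>N. \<forall>m\<ge>N. \<forall>l\<ge>N.
     b (\<lambda>x. us (r m) x - us (r l) x) (\<lambda>x. us (r m) x - us (r l) x) < \<epsilon>"
   using cpt[of us "Z + 1"] V bd on unfolding lam_def by force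
  then obtain N where N: "\<forall>m\<ge>N. \<forall>l\<ge>N.
     b (\<lambda>x. us (r m) x - us (r l) x) (\<lambda>x. us (r m) x - us (r l) x) < 1" by (meson zero_less_one)
  have "r N \<noteq> r (Suc N)" using r by (metis n_not_Suc_n strict_mono_eq)
  hence "b (\<lambda>x. us (r N) x - us (r (Suc N)) x) (\<lambda>x. us (r N) x - us (r (Suc N)) x) = 2"
   using B.quad_diff V on by simp
  thus False using N by (metis le_refl le_SucI one_less_numeral_iff order.asym semiring_norm(76))
 qed
 have "0 \<le> lam 0" using A.pos V lam_def by auto
 show ?thesis by (rule that[OF V on eig mono top \<open>0 \<le> lam 0\<close> min])
qed

end

section \<open>Test functions\<close>

lemma partial_deriv_eq: "(f has_derivative f') (at x) \<Longrightarrow> partial_deriv i f x = f' (axis i 1)"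
 unfolding partial_deriv_def by (metis frechet_derivative_at)

lemma C_k_Suc_subset: "f \<in> C_k (Suc k) \<Longrightarrow> f \<in> C_k k"
proof (induction k arbitrary: f)
 case 0 thus ?case by (simp add: differentiable_imp_continuous_on)
next
 case (Suc k) thus ?case by simp
qed

lemma C_k_const: "(\<lambda>x. c) \<in> C_k k"
proof (induction k arbitrary: c)
 case (Suc k)
 have "partial_deriv i (\<lambda>x::real^'a. c) = (\<lambda>x. 0)" for i
  by (rule ext, subst partial_deriv_eq[OF has_derivative_const]) simp
 thus ?case using Suc by simp
qed simp

lemma C_k_add: "f \<in> C_k k \<Longrightarrow> g \<in> C_k k \<Longrightarrow> (\<lambda>x. f x + g x) \<in> C_k k"
proof (induction k arbitrary: f g)
 case 0 thus ?case by (simp add: continuous_on_add)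
next
 case (Suc k)
 have d: "f differentiable (at x)" "g differentiable (at x)" for x
  using Suc.prems by (auto simp: differentiable_on_def)
 have "partial_deriv i (\<lambda>x. f x + g x) = (\<lambda>x. partial_deriv i f x + partial_deriv i g x)" for i
  by (rule ext, subst partial_deriv_eq[OF has_derivative_add])
    (use d in \<open>auto simp: frechet_derivative_works partial_deriv_def\<close>)
 thus ?case using Suc by (auto intro: differentiable_on_add)
qed

lemma C_k_mult: "f \<in> C_k k \<Longrightarrow> g \<in> C_k k \<Longrightarrow> (\<lambda>x. f x * g x) \<in> C_k k"
proof (induction k arbitrary: f g)
 case 0 thus ?case by (simp add: continuous_on_mult)
next
 case (Suc k)
 have d: "f differentiable (at x)" "g differentiable (at x)" for x
  using Suc.prems by (auto simp: differentiable_on_def)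
 have "partial_deriv i (\<lambda>x. f x * g x) = (\<lambda>x. f x * partial_deriv i g x + partial_deriv i f x * g x)" for i
  by (rule ext, subst partial_deriv_eq[OF has_derivative_mult])
    (use d in \<open>auto simp: frechet_derivative_works partial_deriv_def\<close>)
 moreover have "f \<in> C_k k" "g \<in> C_k k" using Suc.prems C_k_Suc_subset by blast+
 ultimately show ?case using Suc by (auto intro!: C_k_add differentiable_on_mult)
qed

lemma C_k_prod: "finite I \<Longrightarrow> (\<And>i. i \<in> I \<Longrightarrow> f i \<in> C_k k) \<Longrightarrow> (\<lambda>x. \<Prod>i\<in>I. f i x) \<in> C_k k"
 by (induction I rule: finite_induct) (auto intro: C_k_const C_k_mult)

lemma C_k_translate: "f \<in> C_k k \<Longrightarrow> (\<lambda>x. f (x - h)) \<in> C_k k"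
 and partial_deriv_translate: "f differentiable_on UNIV \<Longrightarrow>
   partial_deriv i (\<lambda>x. f (x - h)) = (\<lambda>x. partial_deriv i f (x - h))"
proof -
 have D: "((\<lambda>x. f (x - h)) has_derivative frechet_derivative f (at (x - h))) (at x)"
  if "f differentiable_on UNIV" for f :: "real^'a \<Rightarrow> real" and x
 proof -
  have "(f has_derivative frechet_derivative f (at (x - h))) (at (x - h))"
   using that by (auto simp: differentiable_on_def frechet_derivative_works[symmetric])
  moreover have "((\<lambda>x. x - h) has_derivative (\<lambda>x. x)) (at x)" by (auto intro!: derivative_eq_intros)
  ultimately show ?thesis using has_derivative_compose[of "\<lambda>x. x - h" "\<lambda>x. x" x UNIV f] by simp
 qed
 have P: "partial_deriv i (\<lambda>x. f (x - h)) = (\<lambda>x. partial_deriv i f (x - h))"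
  if "f differentiable_on UNIV" for i and f :: "real^'a \<Rightarrow> real"
  by (rule ext, subst partial_deriv_eq[OF D[OF that]]) (simp add: partial_deriv_def)
 show "f differentiable_on UNIV \<Longrightarrow>
   partial_deriv i (\<lambda>x. f (x - h)) = (\<lambda>x. partial_deriv i f (x - h))" by (rule P)
 show "f \<in> C_k k \<Longrightarrow> (\<lambda>x. f (x - h)) \<in> C_k k"
 proof (induction k arbitrary: f)
  case 0 thus ?case
   by (auto intro!: continuous_on_compose2[of UNIV f UNIV "\<lambda>x. x - h"] continuous_intros)
 next
  case (Suc k)
  hence "(\<lambda>x. f (x - h)) differentiable_on UNIV"
   using D[of f] by (auto simp: differentiable_on_def differentiable_def)
  thus ?case using Suc P[of f] by auto
 qed
qed

text \<open>\<open>D\<close> lists a function of one variable with all its derivatives, so the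
  induction on \<open>k\<close> moves along the list. The instances are the flat functions and
  polynomials in one coordinate.\<close>

lemma C_k_coord:
 assumes "\<And>m t. (D m has_real_derivative D (Suc m) t) (at t)"
 shows "(\<lambda>x. D m (x $ i)) \<in> C_k k"
proof (induction k arbitrary: m)
 case 0
 have "continuous_on UNIV (D m)"
  using assms DERIV_continuous_on by blast
 thus ?case by (auto intro!: continuous_on_compose2[of UNIV "D m" UNIV "\<lambda>x. x $ i"] continuous_intros)
next
 case (Suc k)
 have D: "((\<lambda>x. D m (x $ i)) has_derivative (\<lambda>h. D (Suc m) (x $ i) * h $ i)) (at x)" for x
  using has_derivative_compose[OF _ assms[unfolded has_field_derivative_def], of "\<lambda>x. x $ i" "\<lambda>x. x $ i" x UNIV m]
  by (simp add: bounded_linear_imp_has_derivative bounded_linear_vec_nth)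
 have "partial_deriv j (\<lambda>x. D m (x $ i)) = (\<lambda>x. (if i = j then 1 else 0) * D (Suc m) (x $ i))" for j
  by (rule ext, subst partial_deriv_eq[OF D]) (auto simp: axis_def)
 moreover have "(\<lambda>x. D m (x $ i)) differentiable_on UNIV"
  unfolding differentiable_on_def differentiable_def using D by blast
 ultimately show ?case using C_k_mult[OF C_k_const Suc] by simp
qed

text \<open>The functions p(1/t) exp(-1/t), p a polynomial, are closed under differentiation.\<close>

definition flat :: "real poly \<Rightarrow> real \<Rightarrow> real" where
 "flat p t = (if t > 0 then poly p (1 / t) * exp (- 1 / t) else 0)"

lemma poly_exp_tendsto_0: "((\<lambda>y::real. poly p y * exp (- y)) \<longlongrightarrow> 0) at_top"
proof -
 have "((\<lambda>y::real. \<Sum>i\<le>degree p. coeff p i * (y ^ i / exp y)) \<longlongrightarrow> (\<Sum>i\<le>degree p. coeff p i * 0)) at_top"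
  by (intro tendsto_intros tendsto_power_div_exp_0)
 moreover have "(\<lambda>y::real. \<Sum>i\<le>degree p. coeff p i * (y ^ i / exp y)) = (\<lambda>y. poly p y * exp (- y))"
  by (rule ext) (simp add: poly_altdef sum_distrib_right exp_minus divide_inverse mult.assoc)
 ultimately show ?thesis by simp
qed

lemma flat_deriv: "(flat p has_real_derivative flat ([:0,0,1:] * (p - pderiv p)) t) (at t)"
proof (cases t "0::real" rule: linorder_cases)
 case less
 have "(flat p has_real_derivative 0) (at t) \<longleftrightarrow> ((\<lambda>x. 0::real) has_real_derivative 0) (at t)"
  by (rule DERIV_cong_ev) (use less in \<open>auto simp: flat_def intro!: eventually_mono[OF eventually_nhds_in_open[of "{..<0}"]]\<close>)
 thus ?thesis using less by (simp add: flat_def)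
next
 case greater
 have "((\<lambda>t. poly p (1 / t) * exp (- 1 / t)) has_real_derivative flat ([:0,0,1:] * (p - pderiv p)) t) (at t)"
 proof -
  have i: "((\<lambda>t. 1 / t) has_real_derivative - 1 / t^2) (at t)"
   using greater by (auto intro!: derivative_eq_intros simp: power2_eq_square)
  have e: "((\<lambda>t. exp (- 1 / t)) has_real_derivative exp (- 1 / t) * (1 / t^2)) (at t)"
   using greater by (auto intro!: derivative_eq_intros simp: power2_eq_square)
  have "((\<lambda>t. poly p (1 / t)) has_real_derivative poly (pderiv p) (1 / t) * (- 1 / t^2)) (at t)"
   by (rule DERIV_chain2[OF poly_DERIV i])
  from DERIV_mult[OF this e] show ?thesis
   by (rule DERIV_cong) (use greater in \<open>simp add: flat_def power2_eq_square divide_inverse algebra_simps\<close>)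
 qed
 moreover have "(flat p has_real_derivative y) (at t) \<longleftrightarrow> ((\<lambda>t. poly p (1 / t) * exp (- 1 / t)) has_real_derivative y) (at t)" for y
  by (rule DERIV_cong_ev) (use greater in \<open>auto simp: flat_def intro!: eventually_mono[OF eventually_nhds_in_open[of "{0<..}"]]\<close>)
 ultimately show ?thesis by simp
next
 case equal
 \<comment> \<open>With y = 1/h the quotient from the right is y p(y) exp(-y), again a polynomial
   times the exponential; the quotient from the left is 0. So the derivative at 0 agrees with the
   value 0 of \<open>flat\<close>.\<close>
 have "((\<lambda>h. flat p h / h) \<longlongrightarrow> 0) (at 0)"
 proof (rule filterlim_split_at)
  have "((\<lambda>h. 0::real) \<longlongrightarrow> 0) (at_left (0::real))" by simp
  thus "((\<lambda>h. flat p h / h) \<longlongrightarrow> 0) (at_left 0)"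
   by (rule Lim_transform_eventually) (auto simp: flat_def eventually_at_filter)
  have "((\<lambda>y. poly ([:0,1:] * p) y * exp (- y)) \<longlongrightarrow> 0) at_top" by (rule poly_exp_tendsto_0)
  hence "((\<lambda>h. poly ([:0,1:] * p) (inverse h) * exp (- inverse h)) \<longlongrightarrow> 0) (at_right (0::real))"
   by (rule filterlim_compose) (rule filterlim_inverse_at_top_right)
  thus "((\<lambda>h. flat p h / h) \<longlongrightarrow> 0) (at_right 0)"
   by (rule Lim_transform_eventually) (auto simp: flat_def eventually_at_filter field_simps)
 qed
 thus ?thesis using equal by (simp add: has_field_derivative_iff flat_def)
qed

definition flat_poly :: "nat \<Rightarrow> real poly" where
 "flat_poly k = ((\<lambda>p. [:0,0,1:] * (p - pderiv p)) ^^ k) 1"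

lemma flat_affine_deriv:
 "((\<lambda>t. c ^ m * flat (flat_poly m) (c * t + d)) has_real_derivative
   c ^ Suc m * flat (flat_poly (Suc m)) (c * t + d)) (at t)"
proof -
 have "(flat (flat_poly m) has_real_derivative flat (flat_poly (Suc m)) (c * t + d)) (at (c * t + d))"
  using flat_deriv[of "flat_poly m"] by (simp add: flat_poly_def)
 moreover have "((\<lambda>t. c * t + d) has_real_derivative c) (at t)" by (auto intro!: derivative_eq_intros)
 ultimately have "((\<lambda>t. flat (flat_poly m) (c * t + d)) has_real_derivative flat (flat_poly (Suc m)) (c * t + d) * c) (at t)"
  by (rule DERIV_chain2)
 from DERIV_cmult[OF this, of "c ^ m"] show ?thesis by (simp add: mult_ac)
qed

text \<open>Each factor is exp(-1/t) in a multiple of the distance to a face of the box. Raising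
  \<open>m\<close> drives the factors to 1 inside while the support stays in the closed box, so
  indicators of open boxes are limits of test functions bounded by 1.\<close>

definition bump :: "real^'n \<Rightarrow> real^'n \<Rightarrow> nat \<Rightarrow> real^'n \<Rightarrow> real" where
 "bump a b m x = (\<Prod>i\<in>UNIV. flat 1 (real (Suc m) * (x $ i - a $ i)) * flat 1 (real (Suc m) * (b $ i - x $ i)))"

lemma flat_1: "0 \<le> flat 1 t" "flat 1 t \<le> 1" "t \<le> 0 \<Longrightarrow> flat 1 t = 0"
 by (auto simp: flat_def)

lemma flat_coord_C_k: "(\<lambda>x. flat 1 (c * (x $ i) + d)) \<in> C_k k"
 using C_k_coord[of "\<lambda>m t. c ^ m * flat (flat_poly m) (c * t + d)" 0 i k] flat_affine_deriv
 by (simp add: flat_poly_def)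

lemma bump_C_infinity: "bump a b m \<in> C_infinity"
proof -
 have "(\<lambda>x. \<Prod>i\<in>UNIV. flat 1 (real (Suc m) * (x $ i) + (- real (Suc m) * a $ i)) *
    flat 1 (- real (Suc m) * (x $ i) + real (Suc m) * b $ i)) \<in> C_k k" for k
  by (intro C_k_prod C_k_mult flat_coord_C_k) auto
 moreover have "bump a b m = (\<lambda>x. \<Prod>i\<in>UNIV. flat 1 (real (Suc m) * (x $ i) + (- real (Suc m) * a $ i)) *
    flat 1 (- real (Suc m) * (x $ i) + real (Suc m) * b $ i))"
  by (rule ext) (simp add: bump_def algebra_simps)
 ultimately show ?thesis unfolding C_infinity_def by simp
qed

lemma bump_zero: "x \<notin> box a b \<Longrightarrow> bump a b m x = 0"
proof -
 assume "x \<notin> box a b"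
 then obtain i where "x $ i - a $ i \<le> 0 \<or> b $ i - x $ i \<le> 0"
  unfolding mem_box_cart by (metis diff_le_0_iff_le not_less)
 hence "flat 1 (real (Suc m) * (x $ i - a $ i)) * flat 1 (real (Suc m) * (b $ i - x $ i)) = 0"
  using flat_1(3) mult_nonneg_nonpos[of "real (Suc m)"] by (metis mult_eq_0_iff of_nat_0_le_iff)
 thus ?thesis unfolding bump_def by (intro prod_zero) auto
qed

lemma bump_bounds: "0 \<le> bump a b m x" "bump a b m x \<le> 1"
proof -
 have *: "0 \<le> flat 1 s * flat 1 t \<and> flat 1 s * flat 1 t \<le> 1" for s t
  using flat_1 by (simp add: mult_le_one)
 show "0 \<le> bump a b m x" unfolding bump_def by (rule prod_nonneg) (use * in blast)
 show "bump a b m x \<le> 1" unfolding bump_def by (rule prod_le_1) (use * in blast)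
qed

lemma bump_test: "cbox a b \<subseteq> \<Omega> \<Longrightarrow> bump a b m \<in> test_functions \<Omega>"
proof -
 assume c: "cbox a b \<subseteq> \<Omega>"
 have "closure {x. bump a b m x \<noteq> 0} \<subseteq> cbox a b"
  using bump_zero box_subset_cbox by (intro closure_minimal closed_cbox) fast
 thus ?thesis using c bump_C_infinity unfolding test_functions_def
  by (auto intro: compact_closure[THEN iffD2] bounded_subset[OF bounded_cbox[of a b]] closure_subset[THEN subsetD])
qed

lemma flat_tendsto_1: "t > 0 \<Longrightarrow> (\<lambda>m. flat 1 (real (Suc m) * t)) \<longlonglongrightarrow> 1"
proof -
 assume t: "t > 0"
 have "(\<lambda>m. exp (- (inverse (real (Suc m)) * (1/t)))) \<longlonglongrightarrow> exp (- (0 * (1/t)))"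
  by (intro tendsto_intros LIMSEQ_inverse_real_of_nat)
 moreover have "flat 1 (real (Suc m) * t) = exp (- (inverse (real (Suc m)) * (1/t)))" for m
 proof -
  have "real (Suc m) * t > 0" using t by simp
  thus ?thesis unfolding flat_def by (simp add: divide_inverse)
 qed
 ultimately show ?thesis by simp
qed

lemma bump_tendsto: "(\<lambda>m. bump a b m x) \<longlonglongrightarrow> indicator (box a b) x"
proof (cases "x \<in> box a b")
 case True
 hence "(\<lambda>m. \<Prod>i\<in>(UNIV::'a set). flat 1 (real (Suc m) * (x $ i - a $ i)) * flat 1 (real (Suc m) * (b $ i - x $ i)))
   \<longlonglongrightarrow> (\<Prod>i\<in>(UNIV::'a set). 1 * 1)"
  by (intro tendsto_intros flat_tendsto_1) (auto simp: mem_box_cart)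
 thus ?thesis using True by (simp add: bump_def)
qed (simp add: bump_zero)

section \<open>Calculus of test functions and the fundamental lemma of the calculus of
  variations\<close>

lemma C_infinity_derivative:
 assumes "\<phi> \<in> C_infinity"
 shows "(\<phi> has_derivative (\<lambda>h. \<Sum>i\<in>UNIV. h $ i * partial_deriv i \<phi> x)) (at x)"
  and "continuous_on UNIV \<phi>" "continuous_on UNIV (partial_deriv i \<phi>)"
proof -
 have 0: "\<phi> \<in> C_k k" for k using assms C_infinity_def by blast
 from 0[of 0] show "continuous_on UNIV \<phi>" by simp
 from 0[of "Suc 0"] show "continuous_on UNIV (partial_deriv i \<phi>)" by simp
 have d: "(\<phi> has_derivative frechet_derivative \<phi> (at x)) (at x)"
  using 0[of "Suc 0"] by (simp add: differentiable_on_def frechet_derivative_works[symmetric])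
 have "frechet_derivative \<phi> (at x) h = (\<Sum>i\<in>UNIV. h $ i * partial_deriv i \<phi> x)" for h
 proof -
  have l: "linear (frechet_derivative \<phi> (at x))" using d has_derivative_linear by blast
  have "frechet_derivative \<phi> (at x) h = frechet_derivative \<phi> (at x) (\<Sum>i\<in>UNIV. h $ i *s axis i 1)"
   by (simp add: basis_expansion)
  thus ?thesis by (simp add: linear_sum[OF l] linear_scale[OF l] scalar_mult_eq_scaleR partial_deriv_def)
 qed
 hence "frechet_derivative \<phi> (at x) = (\<lambda>h. \<Sum>i\<in>UNIV. h $ i * partial_deriv i \<phi> x)" by (rule ext)
 thus "(\<phi> has_derivative (\<lambda>h. \<Sum>i\<in>UNIV. h $ i * partial_deriv i \<phi> x)) (at x)" using d by simp
qed

lemma test_functionsD: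
 assumes "\<phi> \<in> test_functions \<Omega>"
 shows "\<phi> \<in> C_infinity" "compact (closure {x. \<phi> x \<noteq> 0})" "closure {x. \<phi> x \<noteq> 0} \<subseteq> \<Omega>"
 using assms unfolding test_functions_def by auto

lemma partial_deriv_zero:
 assumes "x \<notin> closure {x. \<phi> x \<noteq> 0}" shows "partial_deriv i \<phi> x = 0"
proof -
 have "((\<lambda>x. 0) has_derivative (\<lambda>h. 0)) (at x)" by simp
 hence "(\<phi> has_derivative (\<lambda>h. 0)) (at x)"
  by (rule has_derivative_transform_within_open[of _ _ _ _ "- closure {x. \<phi> x \<noteq> 0}"])
    (use assms closure_subset[of "{x. \<phi> x \<noteq> 0}"] in \<open>auto simp: open_Compl\<close>)
 thus ?thesis by (simp add: partial_deriv_eq)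
qed

lemma compact_support_bounded:
 fixes f :: "real^'n \<Rightarrow> real"
 assumes "continuous_on UNIV f" "compact S" "\<And>x. x \<notin> S \<Longrightarrow> f x = 0"
 obtains K where "K \<ge> 0" "\<And>x. \<bar>f x\<bar> \<le> K"
proof -
 have "compact (f ` S)" using assms continuous_on_subset compact_continuous_image by blast
 then obtain K where K: "\<forall>y\<in>f ` S. norm y \<le> K" using compact_imp_bounded bounded_iff by blast
 have "\<bar>f x\<bar> \<le> max K 0" for x using K assms(3)[of x] by (cases "x \<in> S") (auto simp: max_def)
 thus ?thesis using that[of "max K 0"] by simp
qed

lemma test_functions_bounded:
 assumes "\<phi> \<in> test_functions \<Omega>"
 obtains K where "K \<ge> 0" "\<And>x. \<bar>\<phi> x\<bar> \<le> K" "\<And>x i. \<bar>partial_deriv i \<phi> x\<bar> \<le> K"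
proof -
 note t = test_functionsD[OF assms] and d = C_infinity_derivative[OF test_functionsD(1)[OF assms]]
 obtain K where K: "K \<ge> 0" "\<And>x. \<bar>\<phi> x\<bar> \<le> K"
  by (rule compact_support_bounded[OF d(2) t(2)]) (use closure_subset[of "{x. \<phi> x \<noteq> 0}"] in auto)
 have "\<forall>i. \<exists>K. K \<ge> 0 \<and> (\<forall>x. \<bar>partial_deriv i \<phi> x\<bar> \<le> K)"
  using compact_support_bounded[OF d(3) t(2) partial_deriv_zero] by metis
 then obtain Q where Q: "\<And>i. Q i \<ge> 0" "\<And>i x. \<bar>partial_deriv i \<phi> x\<bar> \<le> Q i" by metis
 have "Q i \<le> sum Q UNIV" for i by (intro member_le_sum) (auto simp: Q)
 hence "\<bar>partial_deriv i \<phi> x\<bar> \<le> K + sum Q UNIV" for i x using Q(2)[where i=i and x=x] K(1) by (smt (verit))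
 moreover have "sum Q UNIV \<ge> 0" using Q(1) by (simp add: sum_nonneg)
 moreover have "\<bar>\<phi> x\<bar> \<le> K + sum Q UNIV" for x using K(2)[of x] \<open>sum Q UNIV \<ge> 0\<close> by simp
 ultimately show ?thesis using that[of "K + sum Q UNIV"] K(1) by simp
qed

lemma test_functions_integrable:
 assumes "\<phi> \<in> test_functions \<Omega>"
 shows "integrable lborel \<phi>" "integrable lborel (partial_deriv i \<phi>)"
proof -
 note t = test_functionsD[OF assms] and d = C_infinity_derivative[OF test_functionsD(1)[OF assms]]
 have 1: "integrable lborel f" if "continuous_on UNIV f" "\<And>x. x \<notin> closure {x. \<phi> x \<noteq> 0} \<Longrightarrow> f x = 0" for f :: "real^'a \<Rightarrow> real"
 proof -
  have "integrable lborel (\<lambda>x. indicator (closure {x. \<phi> x \<noteq> 0}) x *\<^sub>R f x)"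
   by (rule borel_integrable_compact[OF t(2) continuous_on_subset[OF that(1)]]) auto
  moreover have "(\<lambda>x. indicator (closure {x. \<phi> x \<noteq> 0}) x *\<^sub>R f x) = f"
   using that(2) by (intro ext) (auto split: split_indicator)
  ultimately show ?thesis by simp
 qed
 show "integrable lborel \<phi>" by (rule 1[OF d(2)]) (use closure_subset[of "{x. \<phi> x \<noteq> 0}"] in auto)
 show "integrable lborel (partial_deriv i \<phi>)" by (rule 1[OF d(3) partial_deriv_zero])
qed

lemma test_function_lipschitz:
 fixes \<phi> :: "real^'n \<Rightarrow> real"
 assumes "\<phi> \<in> C_infinity" "\<And>x. \<bar>partial_deriv i \<phi> x\<bar> \<le> K"
 shows "\<bar>\<phi> (x + axis i t) - \<phi> x\<bar> \<le> K * \<bar>t\<bar>"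
proof -
 have "norm (\<phi> (x + axis i t) - \<phi> (x + axis i 0)) \<le> K * norm (t - 0)"
 proof (rule field_differentiable_bound[of UNIV _ "\<lambda>s. partial_deriv i \<phi> (x + axis i s)"])
  show "((\<lambda>s. \<phi> (x + axis i s)) has_field_derivative partial_deriv i \<phi> (x + axis i s)) (at s within UNIV)" for s
  proof -
   have "((\<lambda>s. x + s *\<^sub>R axis i 1) has_derivative (\<lambda>s. s *\<^sub>R axis i 1)) (at s)"
    by (auto intro!: derivative_eq_intros)
   hence line: "((\<lambda>s. x + s *\<^sub>R axis i 1) has_derivative (\<lambda>s. s *\<^sub>R axis i 1)) (at s)" .
   have "((\<lambda>s. \<phi> (x + s *\<^sub>R axis i 1)) has_derivative (\<lambda>h. h * partial_deriv i \<phi> (x + s *\<^sub>R axis i 1))) (at s)"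
   proof -
    have "(\<Sum>j\<in>UNIV. (h *\<^sub>R axis i 1) $ j * partial_deriv j \<phi> z) = h * partial_deriv i \<phi> z" for h z
     by (subst sum.remove[of _ i]) (auto simp: axis_def intro!: sum.neutral)
    thus ?thesis
     using has_derivative_compose[OF line C_infinity_derivative(1)[OF assms(1)]] by simp
   qed
   moreover have "s *\<^sub>R axis i 1 = (axis i s :: real^'n)" for s by (simp add: axis_def vec_eq_iff)
   moreover have "(\<lambda>h. h * d) = (*) d" for d :: real by (rule ext) (rule mult.commute)
   ultimately show ?thesis by (simp add: has_field_derivative_def)
  qed
 qed (use assms in auto)
 moreover have "(axis i 0 :: real^'n) = 0" by (simp add: axis_def vec_eq_iff)
 ultimately show ?thesis by simp
qed

text \<open>Open boxes generate the Borel sets and are stable under intersection, so Dynkin's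
  argument makes the integral over every Borel set vanish, in particular over the sets where
  \<open>F\<close> is positive or negative.\<close>

lemma AE_zero_of_box_integrals:
 fixes F :: "'a::euclidean_space \<Rightarrow> real"
 assumes F: "integrable lborel F"
  and z: "\<And>a b. (LBINT x. indicator (box a b) x * F x) = 0"
 shows "AE x in lborel. F x = 0"
proof -
 have [measurable]: "F \<in> borel_measurable borel" using F by auto
 have int: "integrable lborel (\<lambda>x. indicator A x * F x)" if "A \<in> sets borel" for A
  using integrable_real_mult_indicator[OF _ F, of A] that by (simp add: mult.commute)
 \<comment> \<open>The whole space is not a box, yet the complement step of the induction needs its
   integral; it is the limit over growing boxes.\<close>
 have whole: "(LBINT x. F x) = 0"
 proof -
  have "(\<lambda>n. \<integral>x. indicator (box (- real n *\<^sub>R One) (real n *\<^sub>R One)) x * F x \<partial>lborel) \<longlonglongrightarrow> (LBINT x. F x)"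
  proof (rule integral_dominated_convergence[where w="\<lambda>x. \<bar>F x\<bar>"])
   show "AE x in lborel. (\<lambda>n. indicator (box (- real n *\<^sub>R One) (real n *\<^sub>R One)) x * F x) \<longlonglongrightarrow> F x"
   proof (rule AE_I2)
    fix x :: 'a
    obtain N where "norm x < real N" using reals_Archimedean2 by blast
    hence "x \<in> box (- real n *\<^sub>R One) (real n *\<^sub>R One)" if "N \<le> n" for n
    proof -
     have "\<bar>x \<bullet> i\<bar> < real n" if "i \<in> Basis" for i
      using Basis_le_norm[OF that, of x] \<open>norm x < real N\<close> \<open>N \<le> n\<close> by linarith
     thus ?thesis by (force simp: mem_box abs_less_iff)
    qed
    hence "\<forall>\<^sub>F n in sequentially. indicator (box (- real n *\<^sub>R One) (real n *\<^sub>R One)) x * F x = F x"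
     by (intro eventually_sequentiallyI[of N]) simp
    thus "(\<lambda>n. indicator (box (- real n *\<^sub>R One) (real n *\<^sub>R One)) x * F x) \<longlonglongrightarrow> F x"
     by (rule tendsto_eventually)
   qed
  qed (use F in \<open>auto simp: indicator_def\<close>)
  thus ?thesis using z by (simp add: LIMSEQ_const_iff)
 qed
 have all: "(LBINT x. indicator A x * F x) = 0" if "A \<in> sets borel" for A
 proof -
  have "A \<in> sigma_sets UNIV (range (\<lambda>(a, b). box a b :: 'a set))"
   using that by (simp add: borel_eq_box)
  moreover have "Int_stable (range (\<lambda>(a, b). box a b :: 'a set))"
   by (auto simp: Int_stable_def box_Int_box)
  moreover have "range (\<lambda>(a, b). box a b :: 'a set) \<subseteq> Pow UNIV" by simp
  ultimately show ?thesis
  proof (rule_tac sigma_sets_induct_disjoint[where G="range (\<lambda>(a, b). box a b :: 'a set)" and \<Omega>=UNIV and A=A], goal_cases)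
   case (4 A) thus ?case using z by auto
  next
   case (6 A)
   hence A: "A \<in> sets borel" by (simp add: borel_eq_box)
   have "(LBINT x. indicator (UNIV - A) x * F x) = (LBINT x. F x - indicator A x * F x)"
    by (intro Bochner_Integration.integral_cong) (auto simp: indicator_def)
   thus ?case using 6 whole int[OF A] F by simp
  next
   case (7 A)
   hence A: "A i \<in> sets borel" for i by (simp add: borel_eq_box subset_eq)
   have "(LINT x:(\<Union>i. A i)|lborel. F x) = (\<Sum>i. (LINT x:(A i)|lborel. F x))"
    by (rule lebesgue_integral_countable_add)
      (use A 7(4) int[of "\<Union>i. A i"] in \<open>auto simp: disjoint_family_on_def set_integrable_def\<close>)
   thus ?case using 7 by (simp add: set_lebesgue_integral_def)
  qed auto
 qed
 have "AE x in lborel. indicator {x. F x > 0} x * F x = 0"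
  by (subst integral_nonneg_eq_0_iff_AE[symmetric])
    (use all[of "{x. F x > 0}"] int[of "{x. F x > 0}"] in \<open>auto simp: indicator_def\<close>)
 moreover have "AE x in lborel. indicator {x. F x < 0} x * (- F x) = 0"
  by (subst integral_nonneg_eq_0_iff_AE[symmetric])
    (use all[of "{x. F x < 0}"] int[of "{x. F x < 0}"] in \<open>auto simp: indicator_def\<close>)
 ultimately show ?thesis
  by eventually_elim (auto simp: indicator_def split: if_splits)
qed

text \<open>Bumps tend to the indicator of a box in \<open>E\<close> with |F| as majorant, and the
  open set \<open>E\<close> is a countable union of closed boxes.\<close>

lemma AE_zero_of_test_integrals:
 fixes F :: "real^'n \<Rightarrow> real"
 assumes E: "open E" and F: "integrable lborel F"
  and z: "\<And>\<phi>. \<phi> \<in> test_functions E \<Longrightarrow> (LBINT x. F x * \<phi> x) = 0"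
 shows "AE x in lborel. x \<in> E \<longrightarrow> F x = 0"
proof -
 have [measurable]: "F \<in> borel_measurable borel" using F by auto
 have [measurable]: "bump a b m \<in> borel_measurable borel" for a b :: "real^'n" and m
  using C_infinity_derivative(2)[OF bump_C_infinity] by (rule borel_measurable_continuous_onI)
 have box0: "(LBINT x. indicator (box a b) x * F x) = 0" if "cbox a b \<subseteq> E" for a b
 proof -
  have "(\<lambda>m. \<integral>x. bump a b m x * F x \<partial>lborel) \<longlonglongrightarrow> (LBINT x. indicator (box a b) x * F x)"
  proof (rule integral_dominated_convergence[where w="\<lambda>x. \<bar>F x\<bar>"])
   show "AE x in lborel. norm (bump a b m x * F x) \<le> \<bar>F x\<bar>" for m
    using bump_bounds[of a b m] by (auto simp: abs_mult intro!: mult_left_le_one_le)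
  qed (use F in \<open>auto intro!: tendsto_intros bump_tendsto\<close>)
  thus ?thesis using z[OF bump_test[OF that]] by (simp add: mult.commute LIMSEQ_const_iff)
 qed
 \<comment> \<open>\<open>F\<close> is cut off to one box inside \<open>E\<close>: every other box
   meets it in a box contained in \<open>E\<close>, so the lemma on box integrals applies in the
   whole space. The boundary of the box is a null set.\<close>
 have cb: "AE x in lborel. x \<in> cbox c d \<longrightarrow> F x = 0" if "cbox c d \<subseteq> E" for c d
 proof -
  have "AE x in lborel. indicator (box c d) x * F x = 0"
  proof (rule AE_zero_of_box_integrals)
   show "integrable lborel (\<lambda>x. indicator (box c d) x * F x)"
    using integrable_real_mult_indicator[OF _ F, of "box c d"] by (simp add: mult.commute)
   fix a b :: "real^'n"
   obtain a' b' where ab: "cbox a b \<inter> cbox c d = cbox a' b'" "box a b \<inter> box c d = box a' b'"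
    using Int_interval[of a b c d] box_Int_box[of a b c d] by blast
   have "(LBINT x. indicator (box a' b') x * F x) = 0" using ab that by (intro box0) auto
   thus "(LBINT x. indicator (box a b) x * (indicator (box c d) x * F x)) = 0"
    by (simp add: ab(2)[symmetric] indicator_inter_arith mult.assoc)
  qed
  moreover have "cbox c d - box c d \<in> null_sets lborel"
   using negligible_frontier_interval[of c d]
   by (simp add: negligible_iff_null_sets null_sets_completion_iff)
  hence "AE x in lborel. x \<notin> cbox c d - box c d" by (rule AE_not_in)
  ultimately show ?thesis by eventually_elim (auto simp: indicator_def split: if_splits)
 qed
 obtain D where D: "countable D" "D \<subseteq> Pow E" "\<And>X. X \<in> D \<Longrightarrow> \<exists>a b. X = cbox a b" "\<Union>D = E"
  using open_countable_Union_open_cbox[OF E] by metis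
 have "AE x in lborel. \<forall>X\<in>D. x \<in> X \<longrightarrow> F x = 0"
 proof (rule AE_ball_countable'[OF _ D(1)])
  fix X assume X: "X \<in> D"
  then obtain a b where "X = cbox a b" using D(3) by blast
  thus "AE x in lborel. x \<in> X \<longrightarrow> F x = 0" using cb[of a b] D(2) X by blast
 qed
 thus ?thesis using D(4) by auto
qed

text \<open>By translation invariance difference quotients have integral 0. They are bounded by the
  Lipschitz constant and, for steps of length at most 1, vanish outside a fixed ball, so dominated
  convergence passes to the derivative.\<close>

lemma integral_partial_deriv_zero:
 assumes "\<phi> \<in> test_functions \<Omega>"
 shows "(LBINT x. partial_deriv i \<phi> x) = 0"
proof -
 note t = test_functionsD[OF assms] and d = C_infinity_derivative[OF test_functionsD(1)[OF assms]]
 have [measurable]: "\<phi> \<in> borel_measurable borel" "partial_deriv i \<phi> \<in> borel_measurable borel"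
  using d by (auto intro: borel_measurable_continuous_onI)
 obtain K where K: "K \<ge> 0" "\<And>x. \<bar>\<phi> x\<bar> \<le> K" "\<And>x i. \<bar>partial_deriv i \<phi> x\<bar> \<le> K"
  using test_functions_bounded[OF assms] by blast
 obtain R where R: "\<And>x. x \<in> closure {x. \<phi> x \<noteq> 0} \<Longrightarrow> norm x \<le> R"
  using compact_imp_bounded[OF t(2)] bounded_iff by metis
 define h where "h m = inverse (real (Suc m))" for m
 have h: "0 < h m" "h m \<le> 1" for m by (auto simp: h_def inverse_le_1_iff)
 define s where "s m x = (\<phi> (axis i (h m) + x) - \<phi> x) / h m" for m x
 have [measurable]: "(\<lambda>x. \<phi> (axis i (h m) + x)) \<in> borel_measurable borel" for m
  by measurable
 have zero: "(LBINT x. s m x) = 0" for m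
 proof -
  have "integrable (distr lborel borel ((+) (axis i (h m)))) \<phi>"
   using test_functions_integrable(1)[OF assms] by (simp add: lborel_distr_plus)
  hence i1: "integrable lborel (\<lambda>x. \<phi> (axis i (h m) + x))"
   by (subst (asm) integrable_distr_eq) auto
  have "(\<integral>x. \<phi> x \<partial>distr lborel borel ((+) (axis i (h m)))) = (LBINT x. \<phi> (axis i (h m) + x))"
   by (rule integral_distr) auto
  hence "(LBINT x. \<phi> (axis i (h m) + x)) = (LBINT x. \<phi> x)" by (simp add: lborel_distr_plus)
  thus ?thesis unfolding s_def using i1 test_functions_integrable(1)[OF assms] by simp
 qed
 have "(\<lambda>m. \<integral>x. s m x \<partial>lborel) \<longlonglongrightarrow> (LBINT x. partial_deriv i \<phi> x)"
 proof (rule integral_dominated_convergence[where w="\<lambda>x. K * indicator (cball 0 (R + 1)) x"])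
  have "emeasure lborel (cball (0::real^'a) (R + 1)) < \<infinity>" by (intro emeasure_bounded_finite) auto
  hence "integrable lborel (indicator (cball (0::real^'a) (R + 1)) :: _ \<Rightarrow> real)" by simp
  thus "integrable lborel (\<lambda>x::real^'a. K * indicator (cball 0 (R + 1)) x)" by simp
  show "s m \<in> borel_measurable lborel" for m unfolding s_def by measurable
  show "AE x in lborel. norm (s m x) \<le> K * indicator (cball 0 (R + 1)) x" for m
  proof (rule AE_I2)
   fix x
   show "norm (s m x) \<le> K * indicator (cball 0 (R + 1)) x"
   proof (cases "x \<in> cball 0 (R + 1)")
    case True
    have "\<bar>\<phi> (x + axis i (h m)) - \<phi> x\<bar> \<le> K * \<bar>h m\<bar>"
     using test_function_lipschitz[OF t(1) K(3)] .
    thus ?thesis using True h[of m] by (simp add: s_def add.commute abs_divide divide_le_eq)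
   next
    case False
    have "norm (axis i (h m) :: real^'a) = h m" using h[of m] proof -
     have "axis i (h m) = h m *\<^sub>R (axis i 1 :: real^'a)" by (simp add: axis_def vec_eq_iff)
     thus ?thesis using h[of m] by simp
    qed
    hence "norm x \<le> norm (axis i (h m) + x) + h m" by (metis add.commute norm_triangle_ineq4 add_diff_cancel_left')
    hence "\<not> norm x \<le> R" "\<not> norm (axis i (h m) + x) \<le> R" using False h[of m] by auto
    hence "\<phi> x = 0" "\<phi> (axis i (h m) + x) = 0" using R closure_subset[of "{x. \<phi> x \<noteq> 0}"] by blast+
    thus ?thesis using False by (simp add: s_def)
   qed
  qed
  show "AE x in lborel. (\<lambda>m. s m x) \<longlonglongrightarrow> partial_deriv i \<phi> x"
  proof (rule AE_I2)
   fix x :: "real^'a"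
   have "((\<lambda>t. x + t *\<^sub>R axis i 1) has_derivative (\<lambda>t. t *\<^sub>R axis i 1)) (at 0)"
    by (auto intro!: derivative_eq_intros)
   moreover have "(\<phi> has_derivative (\<lambda>h. \<Sum>i\<in>UNIV. h $ i * partial_deriv i \<phi> x)) (at (x + 0 *\<^sub>R axis i 1))"
    using d(1)[of x] by simp
   ultimately have "((\<lambda>t. \<phi> (x + t *\<^sub>R axis i 1)) has_derivative (\<lambda>t. \<Sum>j\<in>UNIV. (t *\<^sub>R axis i 1) $ j * partial_deriv j \<phi> x)) (at 0)"
    by (rule has_derivative_compose)
   moreover have "(\<Sum>j\<in>UNIV. (t *\<^sub>R axis i 1) $ j * partial_deriv j \<phi> x) = partial_deriv i \<phi> x * t" for t
    by (subst sum.remove[of _ i]) (auto simp: axis_def intro!: sum.neutral)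
   ultimately have "((\<lambda>t. \<phi> (x + t *\<^sub>R axis i 1)) has_real_derivative partial_deriv i \<phi> x) (at 0)"
    by (simp add: has_field_derivative_def)
   hence l: "((\<lambda>t. (\<phi> (x + t *\<^sub>R axis i 1) - \<phi> x) / t) \<longlongrightarrow> partial_deriv i \<phi> x) (at 0)"
    by (simp add: has_field_derivative_iff)
   have "filterlim h (at 0) sequentially"
    unfolding filterlim_at h_def using LIMSEQ_inverse_real_of_nat by auto
   from filterlim_compose[OF l this]
   have "(\<lambda>m. (\<phi> (x + h m *\<^sub>R axis i 1) - \<phi> x) / h m) \<longlonglongrightarrow> partial_deriv i \<phi> x" .
   moreover have "h m *\<^sub>R axis i 1 = (axis i (h m) :: real^'a)" for m by (simp add: axis_def vec_eq_iff)
   ultimately show "(\<lambda>m. s m x) \<longlonglongrightarrow> partial_deriv i \<phi> x" by (simp add: s_def add.commute)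
  qed
 qed measurable
 thus ?thesis by (simp add: zero LIMSEQ_const_iff)
qed

lemma test_function_line_integral:
 assumes "\<phi> \<in> C_infinity"
 shows "(LBINT s. (\<Sum>i\<in>UNIV. h $ i * partial_deriv i \<phi> (y - s *\<^sub>R h)) * indicator {0..1} s)
  = \<phi> y - \<phi> (y - h)"
proof -
 note d = C_infinity_derivative[OF assms]
 have "(LBINT s. (\<Sum>i\<in>UNIV. h $ i * partial_deriv i \<phi> (y - s *\<^sub>R h)) * indicator {0..1} s)
  = (- \<phi> (y - 1 *\<^sub>R h)) - (- \<phi> (y - 0 *\<^sub>R h))"
 proof (rule integral_FTC_Icc_real)
  fix s :: real
  have "((\<lambda>s. y - s *\<^sub>R h) has_derivative (\<lambda>t. - (t *\<^sub>R h))) (at s)"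
   by (auto intro!: derivative_eq_intros)
  from has_derivative_minus[OF has_derivative_compose[OF this d(1)]]
  have "((\<lambda>s. - \<phi> (y - s *\<^sub>R h)) has_derivative (\<lambda>t. - (\<Sum>i\<in>UNIV. (- (t *\<^sub>R h)) $ i * partial_deriv i \<phi> (y - s *\<^sub>R h)))) (at s)" .
  moreover have "- (\<Sum>i\<in>UNIV. (- (t *\<^sub>R h)) $ i * partial_deriv i \<phi> (y - s *\<^sub>R h))
    = (\<Sum>i\<in>UNIV. h $ i * partial_deriv i \<phi> (y - s *\<^sub>R h)) * t" for t
   by (simp add: sum_negf sum_distrib_right) (simp add: mult_ac)
  ultimately show "((\<lambda>s. - \<phi> (y - s *\<^sub>R h)) has_real_derivative (\<Sum>i\<in>UNIV. h $ i * partial_deriv i \<phi> (y - s *\<^sub>R h))) (at s)"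
   by (simp add: has_field_derivative_def)
  have "continuous_on UNIV (\<lambda>s. \<Sum>i\<in>UNIV. h $ i * partial_deriv i \<phi> (y - s *\<^sub>R h))"
   by (intro continuous_intros continuous_on_compose2[OF d(3)]) auto
  thus "isCont (\<lambda>s. \<Sum>i\<in>UNIV. h $ i * partial_deriv i \<phi> (y - s *\<^sub>R h)) s"
   by (simp add: continuous_on_eq_continuous_at)
 qed simp
 thus ?thesis by simp
qed

section \<open>Hausdorff measure\<close>

definition hausdorff_pre :: "real \<Rightarrow> real \<Rightarrow> 'a::euclidean_space set \<Rightarrow> ennreal" where
 "hausdorff_pre s \<delta> A = (INF C\<in>{C :: nat \<Rightarrow> 'a set. A \<subseteq> (\<Union>i. C i) \<and>
   (\<forall>i. bounded (C i) \<and> diameter (C i) \<le> \<delta>)}.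
    (\<Sum>i. ennreal (hausdorff_const s * (diameter (C i) / 2) powr s)))"

lemma hausdorff_outer_pre: "hausdorff_outer s A = (SUP \<delta>\<in>{0<..}. hausdorff_pre s \<delta> A)"
 unfolding hausdorff_outer_def hausdorff_pre_def ..

lemma hausdorff_const_pos: "0 \<le> s \<Longrightarrow> 0 < hausdorff_const s"
 unfolding hausdorff_const_def by (intro divide_pos_pos Gamma_real_pos) auto

lemma hausdorff_pre_le:
 assumes "A \<subseteq> (\<Union>i. C i)" "\<And>i. bounded (C i)" "\<And>i. diameter (C i) \<le> \<delta>"
 shows "hausdorff_pre s \<delta> A \<le> (\<Sum>i::nat. ennreal (hausdorff_const s * (diameter (C i) / 2) powr s))"
 unfolding hausdorff_pre_def by (rule INF_lower) (use assms in auto)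

lemma hausdorff_pre_approx:
 assumes "hausdorff_pre s \<delta> A < x"
 obtains C :: "nat \<Rightarrow> 'a::euclidean_space set" where "A \<subseteq> (\<Union>i. C i)" "\<And>i. bounded (C i)" "\<And>i. diameter (C i) \<le> \<delta>"
  "(\<Sum>i. ennreal (hausdorff_const s * (diameter (C i) / 2) powr s)) < x"
 using assms unfolding hausdorff_pre_def INF_less_iff by auto

lemma hausdorff_pre_empty: "\<delta> > 0 \<Longrightarrow> hausdorff_pre s \<delta> {} = 0"
 using hausdorff_pre_le[of "{}" "\<lambda>_. {}" \<delta> s] by (simp add: diameter_def)

lemma hausdorff_pre_mono: "A \<subseteq> B \<Longrightarrow> hausdorff_pre s \<delta> A \<le> hausdorff_pre s \<delta> B"
 unfolding hausdorff_pre_def by (rule INF_superset_mono) auto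

lemma hausdorff_pre_antimono: "\<delta> \<le> \<epsilon> \<Longrightarrow> hausdorff_pre s \<epsilon> A \<le> hausdorff_pre s \<delta> A"
 unfolding hausdorff_pre_def by (rule INF_superset_mono) (auto intro: order_trans)

lemma hausdorff_pre_le_outer: "\<delta> > 0 \<Longrightarrow> hausdorff_pre s \<delta> A \<le> hausdorff_outer s A"
 unfolding hausdorff_outer_pre by (rule SUP_upper) simp

lemma hausdorff_outer_empty: "hausdorff_outer s {} = 0"
 unfolding hausdorff_outer_pre by (subst SUP_cong[OF refl, of _ _ "\<lambda>_. 0"]) (auto simp: hausdorff_pre_empty)

lemma hausdorff_outer_mono: "A \<subseteq> B \<Longrightarrow> hausdorff_outer s A \<le> hausdorff_outer s B"
 unfolding hausdorff_outer_pre by (intro SUP_mono) (auto intro: hausdorff_pre_mono)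

lemma hausdorff_pre_subadditive:
 fixes A :: "nat \<Rightarrow> 'a::euclidean_space set"
 shows "hausdorff_pre s \<delta> (\<Union>n. A n) \<le> (\<Sum>n. hausdorff_pre s \<delta> (A n))"
proof (rule ennreal_le_epsilon)
 fix e :: real assume fin: "(\<Sum>n. hausdorff_pre s \<delta> (A n)) < top" and e: "0 < e"
 let ?f = "\<lambda>D :: 'a set. ennreal (hausdorff_const s * (diameter D / 2) powr s)"
 have "\<exists>C. A n \<subseteq> (\<Union>i. C i) \<and> (\<forall>i. bounded (C i)) \<and> (\<forall>i. diameter (C i) \<le> \<delta>) \<and>
   (\<Sum>i::nat. ?f (C i)) \<le> hausdorff_pre s \<delta> (A n) + ennreal (e * (1/2) ^ Suc n)" for n
 proof -
  have "hausdorff_pre s \<delta> (A n) \<le> (\<Sum>n. hausdorff_pre s \<delta> (A n))"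
   using sum_le_suminf[of "\<lambda>n. hausdorff_pre s \<delta> (A n)" "{n}"] by simp
  hence "hausdorff_pre s \<delta> (A n) < top" using fin by (rule le_less_trans)
  hence "hausdorff_pre s \<delta> (A n) + 0 < hausdorff_pre s \<delta> (A n) + ennreal (e * (1/2) ^ Suc n)"
   using e by (intro ennreal_add_left_cancel_less[THEN iffD2]) (auto simp: less_top)
  thus ?thesis using hausdorff_pre_approx[of s \<delta> "A n"] by (metis add.right_neutral less_imp_le)
 qed
 then obtain C where C: "\<And>n. A n \<subseteq> (\<Union>i. C n i)" "\<And>n i. bounded (C n i)" "\<And>n i. diameter (C n i) \<le> \<delta>"
   "\<And>n. (\<Sum>i::nat. ?f (C n i)) \<le> hausdorff_pre s \<delta> (A n) + ennreal (e * (1/2) ^ Suc n)" by metis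
 define D where "D k = (case prod_decode k of (n, i) \<Rightarrow> C n i)" for k
 have "hausdorff_pre s \<delta> (\<Union>n. A n) \<le> (\<Sum>k. ?f (D k))"
 proof (rule hausdorff_pre_le)
  show "(\<Union>n. A n) \<subseteq> (\<Union>k. D k)"
  proof
   fix x assume "x \<in> (\<Union>n. A n)"
   then obtain n i where "x \<in> C n i" using C(1) by blast
   thus "x \<in> (\<Union>k. D k)" by (intro UN_I[of "prod_encode (n, i)"]) (auto simp: D_def)
  qed
 qed (use C in \<open>auto simp: D_def split: prod.split\<close>)
 also have "... = (\<Sum>k. (\<lambda>(n,i). ?f (C n i)) (prod_decode k))"
  by (intro suminf_cong) (simp add: D_def split: prod.split)
 also have "... = (\<Sum>n. \<Sum>i. ?f (C n i))" by (rule suminf_ennreal_2dimen) simp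
 also have "... \<le> (\<Sum>n. hausdorff_pre s \<delta> (A n) + ennreal (e * (1/2) ^ Suc n))"
  by (rule suminf_le) (use C(4) in auto)
 also have "... = (\<Sum>n. hausdorff_pre s \<delta> (A n)) + (\<Sum>n. ennreal (e * (1/2) ^ Suc n))"
  by (rule suminf_add[symmetric]) auto
 also have "(\<Sum>n. ennreal (e * (1/2) ^ Suc n)) = ennreal e"
  using e sums_mult[OF power_half_series, of e]
  by (subst suminf_ennreal2) (auto simp: sums_iff)
 finally show "hausdorff_pre s \<delta> (\<Union>n. A n) \<le> (\<Sum>n. hausdorff_pre s \<delta> (A n)) + ennreal e" .
qed

lemma hausdorff_outer_subadditive:
 fixes A :: "nat \<Rightarrow> 'a::euclidean_space set"
 shows "hausdorff_outer s (\<Union>n. A n) \<le> (\<Sum>n. hausdorff_outer s (A n))"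
 unfolding hausdorff_outer_pre[of s "\<Union>n. A n"]
proof (rule SUP_least)
 fix \<delta> :: real assume "\<delta> \<in> {0<..}"
 thus "hausdorff_pre s \<delta> (\<Union>n. A n) \<le> (\<Sum>n. hausdorff_outer s (A n))"
  by (intro order_trans[OF hausdorff_pre_subadditive] suminf_le) (auto intro: hausdorff_pre_le_outer)
qed

lemma hausdorff_outer_Un: "hausdorff_outer s (A \<union> B) \<le> hausdorff_outer s A + hausdorff_outer s B"
proof -
 define F where "F n = (if n = 0 then A else if n = 1 then B else {})" for n :: nat
 have "A \<union> B = (\<Union>n. F n)" by (auto simp: F_def split: if_splits intro: exI[of _ "0::nat"] exI[of _ "1::nat"])
 hence "hausdorff_outer s (A \<union> B) \<le> (\<Sum>n. hausdorff_outer s (F n))" by (simp add: hausdorff_outer_subadditive)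
 also have "... = (\<Sum>n\<in>{0,1}. hausdorff_outer s (F n))"
  by (rule suminf_finite) (auto simp: F_def hausdorff_outer_empty)
 finally show ?thesis by (simp add: F_def)
qed

text \<open>Covering sets of diameter below the distance \<open>d\<close> cannot meet both
  \<open>A\<close> and \<open>B\<close>, so a fine cover of the union splits into a cover of
  each.\<close>

lemma hausdorff_outer_metric:
 fixes A B :: "'a::euclidean_space set"
 assumes d: "d > 0" "\<And>x y. x \<in> A \<Longrightarrow> y \<in> B \<Longrightarrow> d \<le> dist x y"
 shows "hausdorff_outer s A + hausdorff_outer s B \<le> hausdorff_outer s (A \<union> B)"
proof -
 have "(SUP \<delta>\<in>{0<..}. hausdorff_pre s \<delta> A) + (SUP \<delta>\<in>{0<..}. hausdorff_pre s \<delta> B)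
   = (SUP \<delta>\<in>{0<..}. hausdorff_pre s \<delta> A + hausdorff_pre s \<delta> B)"
 proof (rule SUP_add_directed_ennreal[symmetric])
  fix i j :: real assume "i \<in> {0<..}" "j \<in> {0<..}"
  thus "\<exists>k\<in>{0<..}. hausdorff_pre s i A + hausdorff_pre s j B \<le> hausdorff_pre s k A + hausdorff_pre s k B"
   by (intro bexI[of _ "min i j"] add_mono hausdorff_pre_antimono) auto
 qed
 also have "... \<le> hausdorff_outer s (A \<union> B)"
 proof (rule SUP_least)
  fix \<delta> :: real assume "\<delta> \<in> {0<..}"
  define \<epsilon> where "\<epsilon> = min \<delta> (d / 2)"
  have \<epsilon>: "\<epsilon> > 0" "\<epsilon> \<le> \<delta>" "\<epsilon> < d" using \<open>\<delta> \<in> {0<..}\<close> d(1) by (auto simp: \<epsilon>_def min_def)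
  let ?f = "\<lambda>D :: 'a set. ennreal (hausdorff_const s * (diameter D / 2) powr s)"
  have "hausdorff_pre s \<epsilon> A + hausdorff_pre s \<epsilon> B \<le> hausdorff_pre s \<epsilon> (A \<union> B)"
   unfolding hausdorff_pre_def[of s \<epsilon> "A \<union> B"]
  proof (rule INF_greatest)
   fix C :: "nat \<Rightarrow> 'a set"
   assume "C \<in> {C. A \<union> B \<subseteq> (\<Union>i. C i) \<and> (\<forall>i. bounded (C i) \<and> diameter (C i) \<le> \<epsilon>)}"
   hence C: "A \<union> B \<subseteq> (\<Union>i. C i)" "\<And>i. bounded (C i)" "\<And>i. diameter (C i) \<le> \<epsilon>" by auto
   define CA where "CA i = (if C i \<inter> A = {} then {} else C i)" for i
   define CB where "CB i = (if C i \<inter> B = {} then {} else C i)" for i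
   have one: "C i \<inter> A = {} \<or> C i \<inter> B = {}" for i
   proof (rule ccontr)
    assume "\<not> ?thesis"
    then obtain x y where "x \<in> C i" "x \<in> A" "y \<in> C i" "y \<in> B" by blast
    hence "d \<le> dist x y" "dist x y \<le> diameter (C i)"
     using d(2) C(2) diameter_bounded_bound by blast+
    thus False using C(3)[of i] \<epsilon>(3) by linarith
   qed
   have "A \<subseteq> (\<Union>i. CA i)"
   proof
    fix x assume "x \<in> A"
    moreover then obtain i where "x \<in> C i" using C(1) by blast
    ultimately have "x \<in> CA i" by (auto simp: CA_def)
    thus "x \<in> (\<Union>i. CA i)" by blast
   qed
   moreover have "bounded (CA i)" "diameter (CA i) \<le> \<epsilon>" for i
    using C(2,3)[of i] \<epsilon>(1) by (simp_all add: CA_def diameter_def[of "{}"])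
   ultimately have 1: "hausdorff_pre s \<epsilon> A \<le> (\<Sum>i. ?f (CA i))" by (rule hausdorff_pre_le)
   have 2: "hausdorff_pre s \<epsilon> B \<le> (\<Sum>i. ?f (CB i))"
   proof (rule hausdorff_pre_le)
    show "B \<subseteq> (\<Union>i. CB i)"
    proof
     fix x assume "x \<in> B"
     moreover then obtain i where "x \<in> C i" using C(1) by blast
     ultimately have "x \<in> CB i" by (auto simp: CB_def)
     thus "x \<in> (\<Union>i. CB i)" by blast
    qed
    show "bounded (CB i)" "diameter (CB i) \<le> \<epsilon>" for i
     using C(2,3)[of i] \<epsilon>(1) by (simp_all add: CB_def diameter_def[of "{}"])
   qed
   have "?f (CA i) + ?f (CB i) \<le> ?f (C i)" for i
    using one[of i] by (auto simp: CA_def CB_def diameter_def[of "{}"])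
   hence "(\<Sum>i. ?f (CA i) + ?f (CB i)) \<le> (\<Sum>i. ?f (C i))" by (intro suminf_le) auto
   moreover have "(\<Sum>i. ?f (CA i) + ?f (CB i)) = (\<Sum>i. ?f (CA i)) + (\<Sum>i. ?f (CB i))"
    by (rule suminf_add[symmetric]) auto
   ultimately have "(\<Sum>i. ?f (CA i)) + (\<Sum>i. ?f (CB i)) \<le> (\<Sum>i. ?f (C i))" by (simp only:)
   with add_mono[OF 1 2] show "hausdorff_pre s \<epsilon> A + hausdorff_pre s \<epsilon> B \<le> (\<Sum>i. ?f (C i))"
    by (rule order_trans)
  qed
  moreover have "hausdorff_pre s \<delta> A + hausdorff_pre s \<delta> B \<le> hausdorff_pre s \<epsilon> A + hausdorff_pre s \<epsilon> B"
   by (intro add_mono hausdorff_pre_antimono \<epsilon>)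
  moreover have "hausdorff_pre s \<epsilon> (A \<union> B) \<le> hausdorff_outer s (A \<union> B)" by (rule hausdorff_pre_le_outer) fact
  ultimately show "hausdorff_pre s \<delta> A + hausdorff_pre s \<delta> B \<le> hausdorff_outer s (A \<union> B)"
   by (meson order_trans)
 qed
 finally show ?thesis unfolding hausdorff_outer_pre[of s A] hausdorff_outer_pre[of s B] .
qed

lemma hausdorff_outer_measure_space: "outer_measure_space (Pow X) (hausdorff_outer s)"
 unfolding outer_measure_space_def
 by (auto simp: positive_def increasing_def countably_subadditive_def hausdorff_outer_empty
   hausdorff_outer_subadditive intro: hausdorff_outer_mono)

text \<open>By Caratheodory's lemma the lambda system is already a sigma-algebra, so
  \<open>measure_of\<close> generates no further sets and assigns to each measurable set its outer
  measure.\<close>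

lemma hausdorff_measure_on:
 shows "measure_space X (lambda_system X (Pow X) (hausdorff_outer s)) (hausdorff_outer s)"
  and space_hausdorff: "space (hausdorff_measure_on s X) = X"
  and sets_hausdorff: "sets (hausdorff_measure_on s X) = lambda_system X (Pow X) (hausdorff_outer s)"
  and emeasure_hausdorff: "A \<in> sets (hausdorff_measure_on s X) \<Longrightarrow>
    emeasure (hausdorff_measure_on s X) A = hausdorff_outer s A"
proof -
 show ms: "measure_space X (lambda_system X (Pow X) (hausdorff_outer s)) (hausdorff_outer s)"
  by (rule sigma_algebra.caratheodory_lemma[OF sigma_algebra_Pow hausdorff_outer_measure_space])
 have P: "lambda_system X (Pow X) (hausdorff_outer s) \<subseteq> Pow X" by (auto simp: lambda_system_def)
 show "space (hausdorff_measure_on s X) = X"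
  unfolding hausdorff_measure_on_def by (rule space_measure_of[OF P])
 have sig: "sigma_sets X (lambda_system X (Pow X) (hausdorff_outer s)) = lambda_system X (Pow X) (hausdorff_outer s)"
  using ms by (simp add: measure_space_def sigma_algebra.sigma_sets_eq)
 show S: "sets (hausdorff_measure_on s X) = lambda_system X (Pow X) (hausdorff_outer s)"
  unfolding hausdorff_measure_on_def by (simp add: sets_measure_of[OF P] sig)
 show "A \<in> sets (hausdorff_measure_on s X) \<Longrightarrow>
    emeasure (hausdorff_measure_on s X) A = hausdorff_outer s A"
  by (rule emeasure_measure_of[OF hausdorff_measure_on_def P])
    (use ms in \<open>auto simp: S measure_space_def\<close>)
qed

text \<open>Caratheodory's criterion: the layers at distance between 1/(k+2) and 1/(k+1) from a closed
 set F, taken over every second k, are mutually separated, so their outer measures are summable.\<close>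

lemma closed_in_lambda_system:
 fixes F :: "'a::euclidean_space set"
 assumes F: "closed F"
 shows "X \<inter> F \<in> lambda_system X (Pow X) (hausdorff_outer s)"
proof (cases "F = {}")
 case True thus ?thesis by (auto simp: lambda_system_def hausdorff_outer_empty Int_absorb1)
next
 case False
 let ?H = "hausdorff_outer s :: 'a set \<Rightarrow> ennreal"
 have main: "?H (T \<inter> F) + ?H (T - F) \<le> ?H T" for T
 proof (cases "?H T = top")
  case True thus ?thesis by simp
 next
  case fin: False
  define r where "r k = 1 / real (Suc k)" for k
  define Tk where "Tk k = {x\<in>T. r k \<le> infdist x F}" for k
  define R where "R k = {x\<in>T. r (Suc k) \<le> infdist x F \<and> infdist x F < r k}" for k
  have r: "r k > 0" "r (Suc k) < r k" for k by (auto simp: r_def frac_less2)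
  have ranti: "r k \<le> r j" if "j \<le> k" for j k using that by (simp add: r_def frac_le)
  have sep: "r (Suc i) - r (Suc (Suc i)) \<le> dist x y"
   if "infdist x F \<ge> r (Suc i)" "infdist y F < r (Suc (Suc i))" for x y i
   using infdist_triangle[of x F y] that by linarith
  \<comment> \<open>\<open>p\<close> is taken to be 0 or 1 and selects the parity; layers whose
    indices differ by at least two have a whole layer between them, which makes their distance
    positive.\<close>
  have chain: "(\<Sum>k<n. ?H (R (2 * k + p))) \<le> ?H T" for n and p :: nat
  proof -
   have "(\<Sum>k<n. ?H (R (2 * k + p))) \<le> ?H (\<Union>k<n. R (2 * k + p))"
   proof (induction n)
    case (Suc n)
    have "?H (\<Union>k<n. R (2 * k + p)) + ?H (R (2 * n + p)) \<le> ?H ((\<Union>k<n. R (2 * k + p)) \<union> R (2 * n + p))"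
    proof (cases n)
     case (Suc m)
     show ?thesis
     proof (rule hausdorff_outer_metric)
      let ?i = "2 * m + p"
      show "r (Suc ?i) - r (Suc (Suc ?i)) > 0" using r by simp
      fix x y assume "x \<in> (\<Union>k<n. R (2 * k + p))" "y \<in> R (2 * n + p)"
      then obtain k where "k \<le> m" "r (Suc (2 * k + p)) \<le> infdist x F" "infdist y F < r (Suc (Suc ?i))"
       using Suc by (auto simp: R_def less_Suc_eq_le)
      moreover have "r (Suc ?i) \<le> r (Suc (2 * k + p))" using \<open>k \<le> m\<close> by (intro ranti) simp
      ultimately show "r (Suc ?i) - r (Suc (Suc ?i)) \<le> dist x y" by (intro sep) auto
     qed
    qed (simp add: hausdorff_outer_empty)
    moreover have "(\<Union>k<n. R (2 * k + p)) \<union> R (2 * n + p) = (\<Union>k<Suc n. R (2 * k + p))"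
     by (auto simp: lessThan_Suc)
    ultimately have "?H (\<Union>k<n. R (2 * k + p)) + ?H (R (2 * n + p)) \<le> ?H (\<Union>k<Suc n. R (2 * k + p))" by simp
    moreover have "(\<Sum>k<Suc n. ?H (R (2 * k + p))) \<le> ?H (\<Union>k<n. R (2 * k + p)) + ?H (R (2 * n + p))"
     using add_right_mono[OF Suc.IH] by simp
    ultimately show ?case by (rule order_trans[rotated])
   qed (simp add: hausdorff_outer_empty)
   also have "... \<le> ?H T" by (rule hausdorff_outer_mono) (auto simp: R_def)
   finally show ?thesis .
  qed
  have chain': "(\<Sum>k. ?H (R (2 * k + p))) \<le> ?H T" for p :: nat
   by (subst suminf_eq_SUP) (intro SUP_least chain)
  have all: "(\<Sum>k. ?H (R k)) \<le> 2 * ?H T"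
  proof (subst suminf_eq_SUP, rule SUP_least)
   fix n
   have "(\<Sum>k<n. ?H (R k)) \<le> (\<Sum>k<2*n. ?H (R k))" by (intro sum_mono2) auto
   also have "... = (\<Sum>k<n. ?H (R (2 * k + 0))) + (\<Sum>k<n. ?H (R (2 * k + 1)))"
    by (induction n) (auto simp: algebra_simps)
   also have "... \<le> ?H T + ?H T" by (intro add_mono chain)
   finally show "(\<Sum>k<n. ?H (R k)) \<le> 2 * ?H T" by (simp add: mult_2)
  qed
  have "?H T < top" using fin by (simp add: less_top)
  hence lt: "(\<Sum>k. ?H (R k)) < top" using all by (rule_tac le_less_trans[OF all]) (simp add: ennreal_mult_less_top)
  define h where "h k = enn2real (?H (R k))" for k
  have hk: "?H (R k) = ennreal (h k)" for k
  proof -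
   have "?H (R k) \<le> ?H T" by (rule hausdorff_outer_mono) (auto simp: R_def)
   hence "?H (R k) < top" using \<open>?H T < top\<close> by (rule le_less_trans)
   thus ?thesis by (simp add: h_def)
  qed
  have h0: "h k \<ge> 0" for k by (simp add: h_def)
  have summ: "summable h" using lt by (simp add: hk summable_suminf_not_top h0 less_top)
  \<comment> \<open>Points of \<open>T\<close> off \<open>F\<close> have distance at least
    \<open>r k\<close> from \<open>F\<close> or lie in a layer of index at least \<open>k\<close>.
    The first set is separated from \<open>F\<close>, and the layers contribute the tail of a
    convergent series.\<close>
  have le: "?H (T \<inter> F) + ?H (T - F) \<le> ?H T + ennreal (\<Sum>j. h (j + k))" for k
  proof -
   have "T - F \<subseteq> Tk k \<union> (\<Union>j. R (j + k))"
   proof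
    fix x assume x: "x \<in> T - F"
    hence p: "infdist x F > 0" using F False in_closed_iff_infdist_zero infdist_nonneg
     by (metis DiffD2 less_eq_real_def)
    show "x \<in> Tk k \<union> (\<Union>j. R (j + k))"
    proof (cases "r k \<le> infdist x F")
     case True thus ?thesis using x by (simp add: Tk_def)
    next
     case nk: False
     obtain n where n: "r n < infdist x F" using nat_approx_posE[OF p] r_def by metis
     define m where "m = (LEAST n. r n \<le> infdist x F)"
     have m: "r m \<le> infdist x F" unfolding m_def by (rule LeastI[of _ n]) (use n in simp)
     have "m > k" using nk m ranti[of m k] by (meson leI order_trans)
     then obtain j where j: "m = Suc (j + k)" by (metis add.commute less_iff_Suc_add)
     have "\<not> r (j + k) \<le> infdist x F" using not_less_Least[of "j + k" "\<lambda>n. r n \<le> infdist x F"] j m_def by simp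
     hence "x \<in> R (j + k)" using m j x by (simp add: R_def)
     thus ?thesis by blast
    qed
   qed
   hence "?H (T - F) \<le> ?H (Tk k) + ?H (\<Union>j. R (j + k))"
    by (meson hausdorff_outer_mono hausdorff_outer_Un order_trans)
   also have "?H (\<Union>j. R (j + k)) \<le> (\<Sum>j. ?H (R (j + k)))" by (rule hausdorff_outer_subadditive)
   also have "(\<Sum>j. ?H (R (j + k))) = ennreal (\<Sum>j. h (j + k))"
    unfolding hk by (rule suminf_ennreal2) (use h0 summ in \<open>auto simp: summable_iff_shift\<close>)
   finally have 1: "?H (T - F) \<le> ?H (Tk k) + ennreal (\<Sum>j. h (j + k))" by (simp add: add_left_mono)
   have "?H (T \<inter> F) + ?H (Tk k) \<le> ?H ((T \<inter> F) \<union> Tk k)"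
   proof (rule hausdorff_outer_metric[OF r(1)[of k]])
    fix x y assume "x \<in> T \<inter> F" "y \<in> Tk k"
    thus "r k \<le> dist x y" using infdist_le[of x F y] by (simp add: Tk_def dist_commute)
   qed
   also have "... \<le> ?H T" by (rule hausdorff_outer_mono) (auto simp: Tk_def)
   finally have 2: "?H (T \<inter> F) + ?H (Tk k) \<le> ?H T" .
   have "?H (T \<inter> F) + ?H (T - F) \<le> ?H (T \<inter> F) + (?H (Tk k) + ennreal (\<Sum>j. h (j + k)))"
    using 1 by (rule add_left_mono)
   also have "... = (?H (T \<inter> F) + ?H (Tk k)) + ennreal (\<Sum>j. h (j + k))" by (simp add: add.assoc)
   also have "... \<le> ?H T + ennreal (\<Sum>j. h (j + k))" using 2 by (rule add_right_mono)
   finally show ?thesis .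
  qed
  show ?thesis
  proof (rule ennreal_le_epsilon)
   fix e :: real assume "e > 0"
   obtain k where k: "norm (\<Sum>j. h (j + k)) < e"
    using suminf_exist_split[OF \<open>e > 0\<close> summ] by auto
   hence "ennreal (\<Sum>j. h (j + k)) \<le> ennreal e" by (intro ennreal_leI) simp
   thus "?H (T \<inter> F) + ?H (T - F) \<le> ?H T + ennreal e"
    using le[of k] by (meson add_left_mono order_trans)
  qed
 qed
 show ?thesis unfolding lambda_system_def
 proof (intro CollectI conjI ballI)
  fix T assume "T \<in> Pow X"
  hence e: "X \<inter> F \<inter> T = T \<inter> F" "(X - X \<inter> F) \<inter> T = T - F" by auto
  have "?H T \<le> ?H (T \<inter> F) + ?H (T - F)" using hausdorff_outer_Un[of s "T \<inter> F" "T - F"] by (simp add: Int_Diff_Un)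
  thus "?H (X \<inter> F \<inter> T) + ?H ((X - X \<inter> F) \<inter> T) = ?H T" unfolding e using main[of T] by (rule antisym[rotated])
 qed simp
qed

lemma borel_in_hausdorff_sets:
 assumes "A \<in> sets borel"
 shows "X \<inter> A \<in> sets (hausdorff_measure_on s X)"
proof -
 have "A \<in> sigma_sets UNIV (Collect closed)" using assms by (simp add: borel_eq_closed)
 thus ?thesis
 proof induction
  case (Basic a) thus ?case by (simp add: sets_hausdorff closed_in_lambda_system)
 next
  case Empty show ?case by simp
 next
  case (Compl a)
  have "X \<inter> (UNIV - a) = space (hausdorff_measure_on s X) - (X \<inter> a)" by (auto simp: space_hausdorff)
  thus ?case using Compl by auto
 next
  case (Union a)
  have "X \<inter> (\<Union>i. a i) = (\<Union>i. X \<inter> a i)" by auto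
  moreover have "(\<Union>i. X \<inter> a i) \<in> sets (hausdorff_measure_on s X)"
   by (rule sets.countable_UN) (use Union.IH in blast)
  ultimately show ?case by simp
 qed
qed

lemma id_measurable_hausdorff: "(\<lambda>x. x) \<in> hausdorff_measure_on s X \<rightarrow>\<^sub>M borel"
proof (rule measurableI)
 fix A :: "'a set" assume "A \<in> sets borel"
 moreover have "(\<lambda>x. x) -` A \<inter> space (hausdorff_measure_on s X) = X \<inter> A" by (auto simp: space_hausdorff)
 ultimately show "(\<lambda>x. x) -` A \<inter> space (hausdorff_measure_on s X) \<in> sets (hausdorff_measure_on s X)"
  using borel_in_hausdorff_sets by simp
qed simp

lemma borel_measurable_hausdorff: "f \<in> borel_measurable borel \<Longrightarrow> f \<in> borel_measurable (hausdorff_measure_on s X)"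
 by (rule measurable_compose[OF id_measurable_hausdorff])

text \<open>Completeness of a Caratheodory measure. The integrand of the boundary form is only known
  to agree almost everywhere with a Borel function, and completeness is what makes it
  measurable.\<close>

lemma hausdorff_null_subset:
 assumes "N \<in> null_sets (hausdorff_measure_on s X)" "A \<subseteq> N"
 shows "A \<in> null_sets (hausdorff_measure_on s X)"
proof -
 have N: "N \<subseteq> X" "hausdorff_outer s N = 0"
  using assms(1) sets.sets_into_space[of N "hausdorff_measure_on s X"] emeasure_hausdorff[of N s X]
  by (simp_all add: null_sets_def space_hausdorff)
 have z: "hausdorff_outer s B = 0" if "B \<subseteq> N" for B
  using hausdorff_outer_mono[OF that, of s] N(2) by simp
 have "A \<in> lambda_system X (Pow X) (hausdorff_outer s)"
  unfolding lambda_system_def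
 proof (intro CollectI conjI ballI)
  show "A \<in> Pow X" using assms(2) N by auto
  fix T assume T: "T \<in> Pow X"
  have 1: "hausdorff_outer s (A \<inter> T) = 0" using assms(2) by (intro z) auto
  have "hausdorff_outer s T \<le> hausdorff_outer s (A \<inter> T) + hausdorff_outer s ((X - A) \<inter> T)"
   by (rule order_trans[OF hausdorff_outer_mono hausdorff_outer_Un]) (use T in auto)
  moreover have "hausdorff_outer s ((X - A) \<inter> T) \<le> hausdorff_outer s T" by (rule hausdorff_outer_mono) auto
  ultimately show "hausdorff_outer s (A \<inter> T) + hausdorff_outer s ((X - A) \<inter> T) = hausdorff_outer s T"
   unfolding 1 by simp
 qed
 hence "A \<in> sets (hausdorff_measure_on s X)" by (simp add: sets_hausdorff)
 thus ?thesis using z[OF assms(2)] emeasure_hausdorff[of A s X] by (simp add: null_sets_def)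
qed

section \<open>Surface measure of Lipschitz graphs and of projections\<close>

lemma hausdorff_pre_finite_cover:
 fixes C :: "'t \<Rightarrow> 'a::euclidean_space set"
 assumes I: "finite I" and cov: "A \<subseteq> (\<Union>t\<in>I. C t)" and b: "\<And>t. t \<in> I \<Longrightarrow> bounded (C t)"
  and d: "\<And>t. t \<in> I \<Longrightarrow> diameter (C t) \<le> \<delta>" and "\<delta> > 0"
 shows "hausdorff_pre s \<delta> A \<le> (\<Sum>t\<in>I. ennreal (hausdorff_const s * (diameter (C t) / 2) powr s))"
proof -
 obtain h where h: "bij_betw h {0..<card I} I" using ex_bij_betw_nat_finite[OF I] by blast
 define D where "D k = (if k < card I then C (h k) else {})" for k
 have hI: "h k \<in> I" if "k < card I" for k using h that by (auto simp: bij_betw_def)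
 have "hausdorff_pre s \<delta> A \<le> (\<Sum>k. ennreal (hausdorff_const s * (diameter (D k) / 2) powr s))"
 proof (rule hausdorff_pre_le)
  show "A \<subseteq> (\<Union>k. D k)"
  proof
   fix x assume "x \<in> A"
   then obtain t where t: "t \<in> I" "x \<in> C t" using cov by blast
   moreover have "h ` {0..<card I} = I" using h by (simp add: bij_betw_def)
   ultimately obtain k where "k < card I" "t = h k" by force
   hence "x \<in> D k" using t by (simp add: D_def)
   thus "x \<in> (\<Union>k. D k)" by blast
  qed
  show "bounded (D k)" "diameter (D k) \<le> \<delta>" for k
   using b d hI \<open>\<delta> > 0\<close> by (auto simp: D_def diameter_def[of "{}"])
 qed
 also have "... = (\<Sum>k\<in>{0..<card I}. ennreal (hausdorff_const s * (diameter (D k) / 2) powr s))"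
  by (rule suminf_finite) (auto simp: D_def diameter_def[of "{}"])
 also have "... = (\<Sum>k\<in>{0..<card I}. ennreal (hausdorff_const s * (diameter (C (h k)) / 2) powr s))"
  by (rule sum.cong) (auto simp: D_def)
 also have "... = (\<Sum>t\<in>I. ennreal (hausdorff_const s * (diameter (C t) / 2) powr s))"
  by (rule sum.reindex_bij_betw[OF h])
 finally show ?thesis .
qed

text \<open>\<open>P\<close> is a Lipschitz graph over the coordinates other than \<open>i\<close>.
  Cutting the base cube into N^(n-1) cells gives pieces of diameter at most 2nLr/N, and the
  resulting bound for the sum of their (n-1)-th powers does not depend on N; so the mesh can be made
  as fine as the Hausdorff measure demands.\<close>

lemma hausdorff_upper:
 fixes P :: "(real^'n) set"
 assumes n: "CARD('n) \<ge> 2" and L: "L \<ge> 1" and r: "r > 0"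
  and P: "\<And>x z d. x \<in> P \<Longrightarrow> z \<in> P \<Longrightarrow> (\<And>j. j \<noteq> i \<Longrightarrow> \<bar>x $ j - z $ j\<bar> \<le> d) \<Longrightarrow> \<bar>x $ i - z $ i\<bar> \<le> L * d"
 shows "surface_outer {x\<in>P. \<forall>j. j \<noteq> i \<longrightarrow> \<bar>x $ j - y $ j\<bar> \<le> r}
   \<le> ennreal (hausdorff_const (real CARD('n) - 1) * (real CARD('n) * L * r) ^ (CARD('n) - 1))"
 unfolding hausdorff_outer_pre
proof (rule SUP_least)
 fix \<delta> :: real assume "\<delta> \<in> {0<..}"
 hence \<delta>: "\<delta> > 0" by simp
 define m where "m = CARD('n) - 1"
 have m: "real CARD('n) - 1 = real m" using n by (simp add: m_def of_nat_diff)
 let ?c = "hausdorff_const (real m)"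
 have c: "?c > 0" by (rule hausdorff_const_pos) simp
 define w where "w = real CARD('n) * L * (2 * r)"
 have w: "w > 0" using n L r by (simp add: w_def)
 obtain N :: nat where N: "w / \<delta> < real N" using reals_Archimedean2 by blast
 hence N0: "N > 0" using w \<delta> by (metis divide_pos_pos gr0I of_nat_0 order.asym)
 have D: "w / real N \<le> \<delta>" using N N0 \<delta> by (simp add: field_simps)
 define I where "I = (UNIV - {i}) \<rightarrow>\<^sub>E {..<N}"
 define q where "q = 2 * r / real N"
 have q: "q > 0" using r N0 by (simp add: q_def)
 define C where "C f = {x\<in>P. \<forall>j. j \<noteq> i \<longrightarrow> y $ j - r + real (f j) * q \<le> x $ j \<and> x $ j \<le> y $ j - r + (real (f j) + 1) * q}" for f :: "'n \<Rightarrow> nat"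
 have nd: "norm (x - z) \<le> w / real N" if "x \<in> C f" "z \<in> C f" for x z f
 proof -
  have 1: "\<bar>x $ j - z $ j\<bar> \<le> q" if "j \<noteq> i" for j
   using \<open>x \<in> C f\<close> \<open>z \<in> C f\<close> that unfolding C_def by (auto simp: abs_le_iff algebra_simps) (smt (verit))+
  hence 2: "\<bar>x $ i - z $ i\<bar> \<le> L * q" using that P unfolding C_def by blast
  have "\<bar>(x - z) $ j\<bar> \<le> L * q" for j
  proof (cases "j = i")
   case False
   have "1 * q \<le> L * q" using L q by (intro mult_right_mono) auto
   thus ?thesis using 1[OF False] by simp
  qed (use 2 in simp)
  hence "(\<Sum>j\<in>UNIV. \<bar>(x - z) $ j\<bar>) \<le> (\<Sum>j\<in>(UNIV::'n set). L * q)" by (intro sum_mono)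
  hence "norm (x - z) \<le> real CARD('n) * (L * q)" using norm_le_l1_cart[of "x - z"] by simp
  also have "... = w / real N" by (simp add: w_def q_def)
  finally show ?thesis .
 qed
 have diam: "diameter (C f) \<le> w / real N" for f
  by (rule diameter_le) (use nd w N0 in auto)
 have bd: "bounded (C f)" for f
 proof (cases "C f = {}")
  case False
  then obtain x where "x \<in> C f" by blast
  hence "C f \<subseteq> cball x (w / real N)" using nd by (auto simp: dist_norm)
  thus ?thesis using bounded_subset bounded_cball by blast
 qed simp
 have fin: "finite I" unfolding I_def by (intro finite_PiE) auto
 have card: "card I = N ^ m" by (simp add: I_def card_PiE m_def)
 have cov: "{x\<in>P. \<forall>j. j \<noteq> i \<longrightarrow> \<bar>x $ j - y $ j\<bar> \<le> r} \<subseteq> (\<Union>f\<in>I. C f)"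
 proof
  fix x assume x: "x \<in> {x\<in>P. \<forall>j. j \<noteq> i \<longrightarrow> \<bar>x $ j - y $ j\<bar> \<le> r}"
  have "\<exists>k<N. y $ j - r + real k * q \<le> x $ j \<and> x $ j \<le> y $ j - r + (real k + 1) * q" if "j \<noteq> i" for j
  proof -
   define t where "t = (x $ j - y $ j + r) / q"
   have "\<bar>x $ j - y $ j\<bar> \<le> r" using x that by auto
   hence b: "0 \<le> x $ j - y $ j + r" "x $ j - y $ j + r \<le> 2 * r" by linarith+
   have t0: "0 \<le> t" using b q by (simp add: t_def)
   have "2 * r = real N * q" using N0 by (simp add: q_def)
   hence tN: "t \<le> real N" using b q by (simp add: t_def divide_le_eq)
   have xt: "x $ j = y $ j - r + t * q" using q by (simp add: t_def)
   show ?thesis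
   proof (cases "nat \<lfloor>t\<rfloor> < N")
    case True
    have "real (nat \<lfloor>t\<rfloor>) \<le> t" "t \<le> real (nat \<lfloor>t\<rfloor>) + 1" using t0 by linarith+
    thus ?thesis using True q xt by (intro exI[of _ "nat \<lfloor>t\<rfloor>"]) auto
   next
    \<comment> \<open>Only the right end of the range has index \<open>N\<close>; it is assigned to
      the last cell.\<close>
    case False
    hence "t = real N" using tN t0 by linarith
    thus ?thesis using N0 q xt by (intro exI[of _ "N - 1"]) (auto simp: of_nat_diff)
   qed
  qed
  then obtain f where f: "\<And>j. j \<noteq> i \<Longrightarrow> f j < N \<and> y $ j - r + real (f j) * q \<le> x $ j \<and> x $ j \<le> y $ j - r + (real (f j) + 1) * q"
   by metis
  have "restrict f (UNIV - {i}) \<in> I" using f by (auto simp: I_def)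
  moreover have "x \<in> C (restrict f (UNIV - {i}))" using f x by (auto simp: C_def)
  ultimately show "x \<in> (\<Union>f\<in>I. C f)" by blast
 qed
 have "hausdorff_pre (real m) \<delta> {x\<in>P. \<forall>j. j \<noteq> i \<longrightarrow> \<bar>x $ j - y $ j\<bar> \<le> r}
   \<le> (\<Sum>f\<in>I. ennreal (?c * (diameter (C f) / 2) powr real m))"
  by (rule hausdorff_pre_finite_cover[OF fin cov bd _ \<delta>]) (use diam D order_trans in blast)
 also have "... \<le> (\<Sum>f\<in>I. ennreal (?c * (w / real N / 2) ^ m))"
 proof (intro sum_mono ennreal_leI mult_left_mono)
  fix f
  have "(diameter (C f) / 2) powr real m \<le> (w / real N / 2) powr real m"
   by (intro powr_mono2) (use diam[of f] bd diameter_ge_0 in auto)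
  also have "... = (w / real N / 2) ^ m" using w N0 by (intro powr_realpow) simp
  finally show "(diameter (C f) / 2) powr real m \<le> (w / real N / 2) ^ m" .
 qed (use c in simp)
 also have "... = ennreal (real (N ^ m) * (?c * (w / real N / 2) ^ m))"
  using c w by (simp add: card ennreal_mult' ennreal_of_nat_eq_real_of_nat)
 also have "real (N ^ m) * (?c * (w / real N / 2) ^ m) = ?c * (real CARD('n) * L * r) ^ m"
  using N0 by (simp add: w_def power_divide power_mult_distrib)
 finally show "hausdorff_pre (real CARD('n) - 1) \<delta> {x\<in>P. \<forall>j. j \<noteq> i \<longrightarrow> \<bar>x $ j - y $ j\<bar> \<le> r}
   \<le> ennreal (hausdorff_const (real CARD('n) - 1) * (real CARD('n) * L * r) ^ (CARD('n) - 1))"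
  unfolding m m_def[symmetric] .
qed

text \<open>A covering set of diameter d lies over a box with half-sides d in the coordinates other
  than \<open>i\<close>; with height 1 in direction \<open>i\<close> this box has volume (2d)^(n-1),
  that is 4^(n-1) times (d/2)^(n-1). So the shadow of \<open>A\<close>, thickened to height 1,
  bounds the surface measure from below.\<close>

lemma hausdorff_lower:
 fixes A Q :: "(real^'n) set"
 assumes n: "CARD('n) \<ge> 2" and Q: "Q \<in> sets borel"
  and QA: "\<And>z. z \<in> Q \<Longrightarrow> 0 \<le> z $ i \<and> z $ i \<le> 1 \<and> (\<exists>x\<in>A. \<forall>j. j \<noteq> i \<longrightarrow> x $ j = z $ j)"
 shows "emeasure lborel Q \<le> ennreal (4 ^ (CARD('n) - 1) / hausdorff_const (real CARD('n) - 1)) * surface_outer A"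
proof -
 define m where "m = CARD('n) - 1"
 have m: "real CARD('n) - 1 = real m" "m \<ge> 1" using n by (auto simp: m_def of_nat_diff)
 let ?c = "hausdorff_const (real m)"
 have c: "?c > 0" by (rule hausdorff_const_pos) simp
 \<comment> \<open>Covers of mesh 1 suffice, since the volume estimate uses no smallness of the
   diameters.\<close>
 have "emeasure lborel Q \<le> ennreal (4 ^ m / ?c) * hausdorff_pre (real m) 1 A"
 proof (rule ccontr)
  assume "\<not> ?thesis"
  hence "ennreal (4 ^ m / ?c) * hausdorff_pre (real m) 1 A < emeasure lborel Q" by simp
  hence "ennreal (?c / 4 ^ m) * (ennreal (4 ^ m / ?c) * hausdorff_pre (real m) 1 A) < ennreal (?c / 4 ^ m) * emeasure lborel Q"
   using c by (intro ennreal_mult_strict_left_mono) auto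
  hence "hausdorff_pre (real m) 1 A < ennreal (?c / 4 ^ m) * emeasure lborel Q"
   using c by (simp add: mult.assoc[symmetric] ennreal_mult'[symmetric])
  then obtain C where C: "A \<subseteq> (\<Union>k. C k)" "\<And>k. bounded (C k)"
   "(\<Sum>k. ennreal (?c * (diameter (C k) / 2) powr real m)) < ennreal (?c / 4 ^ m) * emeasure lborel Q"
   by (rule hausdorff_pre_approx) blast
  define d where "d k = diameter (C k)" for k
  have d0: "d k \<ge> 0" for k using diameter_ge_0[OF C(2)[of k]] by (simp add: d_def)
  define p where "p k = (SOME x. x \<in> C k)" for k
  define B where "B k = (if C k = {} then {} else
    cbox (\<chi> j. if j = i then 0 else p k $ j - d k) (\<chi> j. if j = i then 1 else p k $ j + d k))" for k
  have Bm: "emeasure lborel (B k) \<le> ennreal (4 ^ m / ?c) * ennreal (?c * (d k / 2) powr real m)" for k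
  proof (cases "C k = {}")
   case False
   let ?a = "(\<chi> j. if j = i then 0 else p k $ j - d k) :: real^'n" and ?b = "(\<chi> j. if j = i then 1 else p k $ j + d k) :: real^'n"
   have ne: "cbox ?a ?b \<noteq> {}" unfolding interval_ne_empty_cart using d0[of k] by auto
   have "emeasure lborel (cbox ?a ?b) = ennreal (measure lborel (cbox ?a ?b))"
    by (rule emeasure_eq_ennreal_measure) (use emeasure_lborel_cbox_finite[of ?a ?b] in simp)
   also have "measure lborel (cbox ?a ?b) = (\<Prod>j\<in>UNIV. ?b $ j - ?a $ j)" by (rule content_cbox_cart[OF ne])
   also have "... = (?b $ i - ?a $ i) * (\<Prod>j\<in>UNIV - {i}. ?b $ j - ?a $ j)" by (rule prod.remove) auto
   also have "(\<Prod>j\<in>UNIV - {i}. ?b $ j - ?a $ j) = (\<Prod>j\<in>UNIV - {i}. 2 * d k)" by (rule prod.cong) auto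
   also have "... = (2 * d k) ^ m" by (simp add: m_def)
   also have "(?b $ i - ?a $ i) * (2 * d k) ^ m = (4 * (d k / 2)) ^ m" by simp
   also have "(4 * (d k / 2)) ^ m = 4 ^ m * (d k / 2) ^ m" by (rule power_mult_distrib)
   also have "(d k / 2) ^ m = (d k / 2) powr real m"
    using m(2) d0[of k] by (cases "d k = 0") (auto simp: powr_realpow)
   also have "4 ^ m * (d k / 2) powr real m = (4 ^ m / ?c) * (?c * (d k / 2) powr real m)" using c by simp
   also have "ennreal ... = ennreal (4 ^ m / ?c) * ennreal (?c * (d k / 2) powr real m)"
    using c by (intro ennreal_mult) auto
   finally show ?thesis using False by (simp add: B_def)
  qed (simp add: B_def)
  have "Q \<subseteq> (\<Union>k. B k)"
  proof
   fix z assume z: "z \<in> Q"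
   then obtain x where x: "x \<in> A" "\<forall>j. j \<noteq> i \<longrightarrow> x $ j = z $ j" using QA by blast
   then obtain k where k: "x \<in> C k" using C(1) by blast
   hence pk: "p k \<in> C k" unfolding p_def by (rule someI)
   have "\<bar>x $ j - p k $ j\<bar> \<le> d k" for j
    using component_le_norm_cart[of "x - p k" j] diameter_bounded_bound[OF C(2) k pk]
    by (simp add: dist_norm d_def)
   hence "z \<in> B k" using k x(2) QA[OF z] by (auto simp: B_def mem_box_cart abs_le_iff algebra_simps) (smt (verit))+
   thus "z \<in> (\<Union>k. B k)" by blast
  qed
  hence "emeasure lborel Q \<le> emeasure lborel (\<Union>k. B k)" by (rule emeasure_mono) (auto simp: B_def)
  also have "... \<le> (\<Sum>k. emeasure lborel (B k))" by (rule emeasure_subadditive_countably) (auto simp: B_def)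
  also have "... \<le> (\<Sum>k. ennreal (4 ^ m / ?c) * ennreal (?c * (d k / 2) powr real m))"
   by (rule suminf_le) (use Bm in auto)
  also have "... = ennreal (4 ^ m / ?c) * (\<Sum>k. ennreal (?c * (d k / 2) powr real m))" by simp
  finally have "ennreal (?c / 4 ^ m) * emeasure lborel Q \<le> ennreal (?c / 4 ^ m) * (ennreal (4 ^ m / ?c) * (\<Sum>k. ennreal (?c * (d k / 2) powr real m)))"
   by (rule mult_left_mono) simp
  also have "... = (\<Sum>k. ennreal (?c * (d k / 2) powr real m))"
   using c by (simp add: mult.assoc[symmetric] ennreal_mult'[symmetric])
  finally show False using C(3) by (simp add: d_def)
 qed
 also have "... \<le> ennreal (4 ^ m / ?c) * hausdorff_outer (real m) A"
  by (intro mult_left_mono hausdorff_pre_le_outer) auto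
 finally show ?thesis unfolding m m_def[symmetric] .
qed

section \<open>Sobolev functions\<close>

text \<open>Function and gradient are carried together, Borel and zero off the domain. Translations
  and Fubini then take place in the whole space, and no choice of a weak gradient is
  involved.\<close>

definition sob_pair :: "(real^'n) set \<Rightarrow> (real^'n \<Rightarrow> real) \<Rightarrow> (real^'n \<Rightarrow> real^'n) \<Rightarrow> bool" where
 "sob_pair \<Omega> u g \<longleftrightarrow> u \<in> borel_measurable borel \<and> g \<in> borel_measurable borel \<and>
   integrable lborel (\<lambda>x. (u x)^2) \<and> integrable lborel (\<lambda>x. (norm (g x))^2) \<and>
   (\<forall>x. x \<notin> \<Omega> \<longrightarrow> u x = 0 \<and> g x = 0) \<and>
   (\<forall>\<phi>\<in>test_functions \<Omega>. \<forall>i. (LBINT x. u x * partial_deriv i \<phi> x) = - (LBINT x. g x $ i * \<phi> x))"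

definition energy :: "(real^'n \<Rightarrow> real^'n) \<Rightarrow> (real^'n) set \<Rightarrow> ennreal" where
 "energy g S = nsq_on S (\<lambda>x. norm (g x))"

lemma nn_integral_translate:
 fixes f :: "'a::euclidean_space \<Rightarrow> ennreal"
 assumes "f \<in> borel_measurable borel"
 shows "(\<integral>\<^sup>+x. f (x + h) \<partial>lborel) = (\<integral>\<^sup>+x. f x \<partial>lborel)"
proof -
 have "(\<integral>\<^sup>+x. f x \<partial>distr lborel borel ((+) h)) = (\<integral>\<^sup>+x. f (h + x) \<partial>lborel)"
  by (rule nn_integral_distr) (use assms in auto)
 thus ?thesis by (simp add: lborel_distr_plus add.commute)
qed

lemma integral_translate:
 fixes f :: "'a::euclidean_space \<Rightarrow> 'b::{banach,second_countable_topology}"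
 assumes "f \<in> borel_measurable borel"
 shows "(LBINT x. f (x + h)) = (LBINT x. f x)"
proof -
 have "(\<integral>x. f x \<partial>distr lborel borel ((+) h)) = (LBINT x. f (h + x))"
  by (rule integral_distr) (use assms in auto)
 thus ?thesis by (simp add: lborel_distr_plus add.commute)
qed

lemma integrable_translate:
 fixes f :: "'a::euclidean_space \<Rightarrow> 'b::{banach,second_countable_topology}"
 assumes "integrable lborel f"
 shows "integrable lborel (\<lambda>x. f (x + h))"
proof -
 have "integrable (distr lborel borel ((+) h)) f" using assms by (simp add: lborel_distr_plus)
 hence "integrable lborel (\<lambda>x. f (h + x))" by (subst (asm) integrable_distr_eq) (use assms in auto)
 thus ?thesis by (simp add: add.commute)
qed

lemma integrable_of_square:
 fixes f :: "'a::euclidean_space \<Rightarrow> 'b::euclidean_space"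
 assumes [measurable]: "f \<in> borel_measurable borel" and i: "integrable lborel (\<lambda>x. (norm (f x))^2)"
  and b: "bounded S" "S \<in> sets borel" and z: "\<And>x. x \<notin> S \<Longrightarrow> f x = 0"
 shows "integrable lborel f"
proof (rule Bochner_Integration.integrable_bound)
 have "emeasure lborel S < \<infinity>" by (rule emeasure_bounded_finite[OF b(1)])
 thus "integrable lborel (\<lambda>x. indicator S x + (norm (f x))^2)" using b i by simp
 have "norm (f x) \<le> 1 + (norm (f x))^2" for x
 proof -
  have "0 \<le> (norm (f x) - 1 / 2)^2" by simp
  also have "... = (norm (f x))^2 - norm (f x) + 1 / 4" by (simp add: power2_eq_square algebra_simps)
  finally show ?thesis by simp
 qed
 thus "AE x in lborel. norm (f x) \<le> norm (indicator S x + (norm (f x))^2 :: real)"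
  using z by (intro AE_I2) (auto simp: indicator_def)
qed simp

lemma integrable_product_lborel:
 fixes f :: "'a::euclidean_space \<Rightarrow> real" and g :: "'b::euclidean_space \<Rightarrow> real"
 assumes "integrable lborel f" "integrable lborel g"
 shows "integrable (lborel \<Otimes>\<^sub>M lborel) (\<lambda>(x, y). f x * g y)"
proof (rule lborel_pair.Fubini_integrable)
 show "(\<lambda>(x, y). f x * g y) \<in> borel_measurable (lborel \<Otimes>\<^sub>M lborel)" using assms by measurable
 show "integrable lborel (\<lambda>x. \<integral>y. norm (case (x, y) of (x, y) \<Rightarrow> f x * g y) \<partial>lborel)"
  using assms by (simp add: abs_mult)
qed (use assms in auto)

lemma sob_pairD:
 assumes "sob_pair \<Omega> u g"
 shows "u \<in> borel_measurable borel" "g \<in> borel_measurable borel"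
  "integrable lborel (\<lambda>x. (u x)^2)" "integrable lborel (\<lambda>x. (norm (g x))^2)"
  "\<And>x. x \<notin> \<Omega> \<Longrightarrow> u x = 0" "\<And>x. x \<notin> \<Omega> \<Longrightarrow> g x = 0"
  "\<And>\<phi> i. \<phi> \<in> test_functions \<Omega> \<Longrightarrow> (LBINT x. u x * partial_deriv i \<phi> x) = - (LBINT x. g x $ i * \<phi> x)"
 using assms unfolding sob_pair_def by auto

context
 fixes \<Omega> :: "(real^'n) set" and u g
 assumes \<Omega>: "open \<Omega>" "bounded \<Omega>" and sp: "sob_pair \<Omega> u g"
begin

lemma sob_meas: "u \<in> borel_measurable borel" "g \<in> borel_measurable borel"
 using sob_pairD[OF sp] by auto

lemma sob_integrable: "integrable lborel u" "integrable lborel g"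
 by (rule integrable_of_square[of _ \<Omega>]; use sob_pairD[OF sp] \<Omega> in simp)+

text \<open>Tested against a test function of E, both sides agree by Fubini and the weak derivative;
 so the fundamental theorem of calculus along h holds almost everywhere without mollification.\<close>

lemma sob_translation_AE:
 assumes E: "open E" and seg: "\<And>y s. y \<in> E \<Longrightarrow> 0 \<le> s \<Longrightarrow> s \<le> 1 \<Longrightarrow> y + s *\<^sub>R h \<in> \<Omega>"
 shows "AE y in lborel. y \<in> E \<longrightarrow>
   u (y + h) - u y = (LBINT s. indicator {0..1} s * (g (y + s *\<^sub>R h) \<bullet> h))"
proof -
 note [measurable] = sob_meas
 define J where "J = (\<lambda>(s::real, y). indicator {0..1} s * (g (y + s *\<^sub>R h) \<bullet> h))"
 have [measurable]: "J \<in> borel_measurable (lborel \<Otimes>\<^sub>M lborel)"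
  unfolding J_def by measurable
 have Jint: "integrable (lborel \<Otimes>\<^sub>M lborel) J"
 proof (rule Bochner_Integration.integrable_bound)
  show "integrable (lborel \<Otimes>\<^sub>M lborel) (\<lambda>(s::real, y). (indicator {0..1} s * norm (g (y + s *\<^sub>R h))) * norm h)"
  proof (rule lborel_pair.Fubini_integrable)
   have "(LBINT y. norm (g (y + s *\<^sub>R h))) = (LBINT y. norm (g y))" for s
    by (rule integral_translate) measurable
   thus "integrable lborel (\<lambda>x::real. LINT y|lborel. norm (case (x, y) of (s, y) \<Rightarrow> indicat_real {0..1} s * norm (g (y + s *\<^sub>R h)) * norm h))"
    by (simp add: abs_mult)
  qed (auto intro!: integrable_translate sob_integrable)
  show "AE x in lborel \<Otimes>\<^sub>M lborel. norm (J x) \<le> norm (case x of (s::real, y) \<Rightarrow> indicat_real {0..1} s * norm (g (y + s *\<^sub>R h)) * norm h)"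
   by (intro AE_I2) (auto simp: J_def indicator_def Cauchy_Schwarz_ineq2)
 qed measurable
 define G where "G y = (LBINT s. J (s, y))" for y
 have Gint: "integrable lborel G" unfolding G_def
  using lborel_pair.integrable_snd[of "\<lambda>s y. J (s, y)"] Jint by simp
 define F where "F y = u (y + h) - u y - G y" for y
 have Fint: "integrable lborel F" unfolding F_def
  by (intro Bochner_Integration.integrable_diff integrable_translate sob_integrable Gint)
 have "AE y in lborel. y \<in> E \<longrightarrow> F y = 0"
 proof (rule AE_zero_of_test_integrals[OF E Fint])
  fix \<phi> assume \<phi>: "\<phi> \<in> test_functions E"
  note t = test_functionsD[OF \<phi>] and d = C_infinity_derivative[OF test_functionsD(1)[OF \<phi>]]
  have [measurable]: "\<phi> \<in> borel_measurable borel" "partial_deriv i \<phi> \<in> borel_measurable borel" for i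
   using d by (auto intro: borel_measurable_continuous_onI)
  obtain K where K: "K \<ge> 0" "\<And>x. \<bar>\<phi> x\<bar> \<le> K" "\<And>x i. \<bar>partial_deriv i \<phi> x\<bar> \<le> K"
   using test_functions_bounded[OF \<phi>] by metis
  have mb: "integrable lborel (\<lambda>x. f x * p x)" if "integrable lborel f" "p \<in> borel_measurable borel" "\<And>x. \<bar>p x\<bar> \<le> Q"
   for f p :: "real^'n \<Rightarrow> real" and Q
  proof (rule Bochner_Integration.integrable_bound)
   show "integrable lborel (\<lambda>x. f x * Q)" using that by simp
   show "AE x in lborel. norm (f x * p x) \<le> norm (f x * Q)"
    using that(3) by (intro AE_I2) (simp add: abs_mult mult_left_mono order_trans[OF _ abs_ge_self])
  qed (use that in measurable)
  \<comment> \<open>Here the segments must stay in the domain: the support of the shifted test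
    function is a compact subset of \<open>E\<close>, the support of \<phi>, moved by
    \<open>s\<close> times \<open>h\<close>.\<close>
  have test: "(\<lambda>y. \<phi> (y - s *\<^sub>R h)) \<in> test_functions \<Omega>" if "0 \<le> s" "s \<le> 1" for s
  proof -
   have e: "{y. \<phi> (y - s *\<^sub>R h) \<noteq> 0} = (\<lambda>y. s *\<^sub>R h + y) ` {y. \<phi> y \<noteq> 0}"
    by (force simp: image_iff intro: exI[of _ "_ - s *\<^sub>R h"])
   have cl: "closure {y. \<phi> (y - s *\<^sub>R h) \<noteq> 0} = (\<lambda>y. s *\<^sub>R h + y) ` closure {y. \<phi> y \<noteq> 0}"
    unfolding e by (rule closure_translation)
   have "(\<lambda>y. \<phi> (y - s *\<^sub>R h)) \<in> C_infinity"
    using t(1) C_k_translate unfolding C_infinity_def by blast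
   moreover have "compact (closure {y. \<phi> (y - s *\<^sub>R h) \<noteq> 0})"
    unfolding cl by (rule compact_translation[OF t(2)])
   moreover have "closure {y. \<phi> (y - s *\<^sub>R h) \<noteq> 0} \<subseteq> \<Omega>"
    unfolding cl using t(3) seg that by (auto simp: add.commute)
   ultimately show ?thesis by (simp add: test_functions_def)
  qed
  have pdt: "partial_deriv i (\<lambda>y. \<phi> (y - z)) = (\<lambda>y. partial_deriv i \<phi> (y - z))" for i z
   by (rule partial_deriv_translate) (use d(1) in \<open>auto simp: differentiable_on_def differentiable_def\<close>)
  \<comment> \<open>The integrand after the shift has been moved to the test function. Integrated in
    \<open>s\<close> it gives \<open>u\<close> times the difference of \<phi> along
    \<open>h\<close>; integrated in \<open>y\<close> first, the weak derivative turns it into the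
    gradient, and shifting back gives \<open>J\<close>.\<close>
  define P where "P = (\<lambda>(s::real, y). u y * (indicator {0..1} s * (\<Sum>i\<in>UNIV. h $ i * partial_deriv i \<phi> (y - s *\<^sub>R h))))"
  have [measurable]: "P \<in> borel_measurable (lborel \<Otimes>\<^sub>M lborel)" unfolding P_def by measurable
  have Pint: "integrable (lborel \<Otimes>\<^sub>M lborel) P"
  proof (rule Bochner_Integration.integrable_bound)
   show "integrable (lborel \<Otimes>\<^sub>M lborel) (\<lambda>(s::real, y). (indicator {0..1} s * (\<Sum>i\<in>UNIV. \<bar>h $ i\<bar> * K)) * \<bar>u y\<bar>)"
    by (rule integrable_product_lborel) (use sob_integrable in auto)
   have "\<bar>\<Sum>i\<in>UNIV. h $ i * partial_deriv i \<phi> z\<bar> \<le> (\<Sum>i\<in>UNIV. \<bar>h $ i\<bar> * K)" for z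
    by (rule order_trans[OF sum_abs]) (auto simp: abs_mult intro!: sum_mono mult_left_mono K)
   hence "\<bar>u y\<bar> * \<bar>\<Sum>i\<in>UNIV. h $ i * partial_deriv i \<phi> z\<bar> \<le> \<bar>(\<Sum>i\<in>UNIV. \<bar>h $ i\<bar> * K) * \<bar>u y\<bar>\<bar>" for y z
   proof -
    have "\<bar>u y\<bar> * \<bar>\<Sum>i\<in>UNIV. h $ i * partial_deriv i \<phi> z\<bar> \<le> \<bar>u y\<bar> * (\<Sum>i\<in>UNIV. \<bar>h $ i\<bar> * K)"
     by (rule mult_left_mono) (use \<open>\<And>z. \<bar>\<Sum>i\<in>UNIV. h $ i * partial_deriv i \<phi> z\<bar> \<le> (\<Sum>i\<in>UNIV. \<bar>h $ i\<bar> * K)\<close> in auto)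
    also have "... = (\<Sum>i\<in>UNIV. \<bar>h $ i\<bar> * K) * \<bar>u y\<bar>" by (rule mult.commute)
    finally show ?thesis by (rule order_trans) (rule abs_ge_self)
   qed
   thus "AE x in lborel \<Otimes>\<^sub>M lborel. norm (P x) \<le> norm (case x of (s::real, y) \<Rightarrow> (indicator {0..1} s * (\<Sum>i\<in>UNIV. \<bar>h $ i\<bar> * K)) * \<bar>u y\<bar>)"
    by (intro AE_I2) (auto simp: P_def indicator_def abs_mult)
  qed measurable
  have i1: "integrable lborel (\<lambda>y. u (y + h) * \<phi> y)" and i2: "integrable lborel (\<lambda>y. u y * \<phi> y)"
   by (rule mb[OF _ _ K(2)]; auto intro!: integrable_translate sob_integrable)+
  have i3: "integrable lborel (\<lambda>y. u y * \<phi> (y - h))"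
   by (rule mb[where Q=K]) (auto intro!: sob_integrable K)
  have i4: "integrable lborel (\<lambda>y. G y * \<phi> y)"
   by (rule mb[OF Gint _ K(2)]) measurable
  have "(LBINT y. (u (y + h) - u y) * \<phi> y) = (LBINT y. u (y + h) * \<phi> y) - (LBINT y. u y * \<phi> y)"
   using Bochner_Integration.integral_diff[OF i1 i2] by (simp add: left_diff_distrib)
  also have "(LBINT y. u (y + h) * \<phi> y) = (LBINT y. u y * \<phi> (y - h))"
   using integral_translate[of "\<lambda>y. u y * \<phi> (y - h)" h] by simp
  also have "... - (LBINT y. u y * \<phi> y) = (LBINT y. u y * (\<phi> (y - h) - \<phi> y))"
   using Bochner_Integration.integral_diff[OF i3 i2] by (simp add: right_diff_distrib)
  also have "... = - (LBINT y. (LBINT s. P (s, y)))"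
  proof -
   have "(LBINT s. P (s, y)) = - (u y * (\<phi> (y - h) - \<phi> y))" for y
   proof -
    have "(LBINT s. indicator {0..1::real} s * (\<Sum>i\<in>UNIV. h $ i * partial_deriv i \<phi> (y - s *\<^sub>R h))) = \<phi> y - \<phi> (y - h)"
     using test_function_line_integral[OF t(1), of h y] by (simp only: mult.commute)
    hence "(LBINT s. P (s, y)) = u y * (\<phi> y - \<phi> (y - h))" unfolding P_def by simp
    thus ?thesis by (simp add: right_diff_distrib)
   qed
   thus ?thesis by simp
  qed
  also have "(LBINT y. (LBINT s. P (s, y))) = (LBINT s. (LBINT y. P (s, y)))"
   using lborel_pair.Fubini_integral[of "\<lambda>s y. P (s, y)"] Pint by simp
  also have "(LBINT s. (LBINT y. P (s, y))) = (LBINT s. - (LBINT y. J (s, y) * \<phi> y))"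
  proof (rule Bochner_Integration.integral_cong[OF refl])
   fix s :: real
   show "(LBINT y. P (s, y)) = - (LBINT y. J (s, y) * \<phi> y)"
   proof (cases "s \<in> {0..1}")
    case False thus ?thesis by (simp add: P_def J_def)
   next
    case True
    hence T: "(\<lambda>y. \<phi> (y - s *\<^sub>R h)) \<in> test_functions \<Omega>" using test by simp
    have gi: "integrable lborel (\<lambda>x. g x $ i)" for i
     using integrable_inner_left[OF sob_integrable(2), of "axis i 1"] by (simp add: inner_axis)
    have "(LBINT y. P (s, y)) = (LBINT y. (\<Sum>i\<in>UNIV. h $ i * (u y * partial_deriv i \<phi> (y - s *\<^sub>R h))))"
     using True by (simp add: P_def sum_distrib_left mult_ac)
    also have "... = (\<Sum>i\<in>UNIV. h $ i * (LBINT y. u y * partial_deriv i \<phi> (y - s *\<^sub>R h)))"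
     by (subst Bochner_Integration.integral_sum)
       (auto intro!: integrable_mult_right mb[where Q=K] sob_integrable K)
    also have "... = (\<Sum>i\<in>UNIV. h $ i * - (LBINT y. g y $ i * \<phi> (y - s *\<^sub>R h)))"
     using sob_pairD(7)[OF sp T] by (simp add: pdt)
    also have "... = - (\<Sum>i\<in>UNIV. h $ i * (LBINT y. g y $ i * \<phi> (y - s *\<^sub>R h)))"
     by (simp add: sum_negf)
    also have "(\<Sum>i\<in>UNIV. h $ i * (LBINT y. g y $ i * \<phi> (y - s *\<^sub>R h))) =
      (LBINT y. (\<Sum>i\<in>UNIV. h $ i * (g y $ i * \<phi> (y - s *\<^sub>R h))))"
     by (subst Bochner_Integration.integral_sum)
       (auto intro!: integrable_mult_right mb[where Q=K] gi K)
    also have "... = (LBINT y. (g y \<bullet> h) * \<phi> (y - s *\<^sub>R h))"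
     by (rule Bochner_Integration.integral_cong[OF refl], simp add: inner_vec_def sum_distrib_right)
       (simp add: mult_ac)
    also have "... = (LBINT y. (g (y + s *\<^sub>R h) \<bullet> h) * \<phi> y)"
     using integral_translate[of "\<lambda>y. (g y \<bullet> h) * \<phi> (y - s *\<^sub>R h)" "s *\<^sub>R h"] by simp
    finally show ?thesis using True by (simp add: J_def)
   qed
  qed
  also have "(LBINT s. - (LBINT y. J (s, y) * \<phi> y)) = - (LBINT s. (LBINT y. J (s, y) * \<phi> y))" by simp
  also have "(LBINT s. (LBINT y. J (s, y) * \<phi> y)) = (LBINT y. (LBINT s. J (s, y) * \<phi> y))"
  proof (rule lborel_pair.Fubini_integral[of "\<lambda>s y. J (s, y) * \<phi> y", symmetric])
   show "integrable (lborel \<Otimes>\<^sub>M lborel) (\<lambda>(s, y). J (s, y) * \<phi> y)"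
   proof (rule Bochner_Integration.integrable_bound)
    show "integrable (lborel \<Otimes>\<^sub>M lborel) (\<lambda>z. K * J z)" using Jint by simp
    show "AE z in lborel \<Otimes>\<^sub>M lborel. norm (case z of (s, y) \<Rightarrow> J (s, y) * \<phi> y) \<le> norm (K * J z)"
     using K(1,2) by (intro AE_I2) (auto simp: abs_mult mult.commute[of K] mult_left_mono)
   qed measurable
  qed
  also have "... = (LBINT y. G y * \<phi> y)" by (simp add: G_def)
  finally have "(LBINT y. (u (y + h) - u y) * \<phi> y) = (LBINT y. G y * \<phi> y)" by simp
  moreover have "(LBINT y. F y * \<phi> y) = (LBINT y. (u (y + h) - u y) * \<phi> y) - (LBINT y. G y * \<phi> y)"
  proof -
   have "integrable lborel (\<lambda>y. (u (y + h) - u y) * \<phi> y)"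
    using Bochner_Integration.integrable_diff[OF i1 i2] by (simp add: left_diff_distrib)
   from Bochner_Integration.integral_diff[OF this i4] show ?thesis
    by (simp add: F_def left_diff_distrib)
  qed
  ultimately show "(LBINT y. F y * \<phi> y) = 0" by simp
 qed
 thus ?thesis by (simp add: F_def G_def J_def)
qed

text \<open>Cauchy-Schwarz in the segment parameter, then Tonelli: for fixed \<open>s\<close> the
  shifted copy of \<open>E\<close> lies in \<open>S\<close>, so by translation invariance its energy
  is at most that of \<open>S\<close>. The set \<open>S\<close> is kept apart from the domain in
  order to localize the energy.\<close>

lemma sob_translation:
 assumes E: "open E" and S[measurable]: "S \<in> sets borel"
  and seg: "\<And>y s. y \<in> E \<Longrightarrow> 0 \<le> s \<Longrightarrow> s \<le> 1 \<Longrightarrow> y + s *\<^sub>R h \<in> \<Omega> \<inter> S"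
 shows "nsq_on E (\<lambda>y. u (y + h) - u y) \<le> ennreal ((norm h)^2) * energy g S"
proof -
 note [measurable] = sob_meas
 have [measurable]: "E \<in> sets borel" using E by simp
 let ?I = "indicator {0..1::real} :: real \<Rightarrow> ennreal"
 have pt: "ennreal ((LBINT s. indicator {0..1} s * (g (y + s *\<^sub>R h) \<bullet> h))^2)
   \<le> ennreal ((norm h)^2) * (\<integral>\<^sup>+s. ennreal ((norm (g (y + s *\<^sub>R h)))^2) * ?I s \<partial>lborel)" for y
 proof -
  let ?j = "\<lambda>s::real. indicator {0..1} s * (g (y + s *\<^sub>R h) \<bullet> h)"
  have "ennreal (norm (LBINT s. ?j s)) \<le> (\<integral>\<^sup>+s. ennreal (norm (?j s)) \<partial>lborel)"
  proof (cases "integrable lborel ?j")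
   case True thus ?thesis by (rule integral_norm_bound_ennreal)
  next
   \<comment> \<open>A nonintegrable integrand has integral 0 by convention, so the bound is
     trivial.\<close>
   case False
   hence "(LBINT s. ?j s) = 0" by (rule not_integrable_integral_eq)
   thus ?thesis by simp
  qed
  also have "... \<le> (\<integral>\<^sup>+s. ?I s * (ennreal (norm h * norm (g (y + s *\<^sub>R h))) * ?I s) \<partial>lborel)"
   using Cauchy_Schwarz_ineq2[of "g _" h]
   by (intro nn_integral_mono) (auto simp: indicator_def mult.commute intro!: ennreal_leI)
  finally have "(ennreal (norm (LBINT s. ?j s)))^2 \<le> (\<integral>\<^sup>+s. ?I s * (ennreal (norm h * norm (g (y + s *\<^sub>R h))) * ?I s) \<partial>lborel)^2"
   by (rule power_mono) simp
  also have "... \<le> (\<integral>\<^sup>+s. (?I s)^2 \<partial>lborel) * (\<integral>\<^sup>+s. (ennreal (norm h * norm (g (y + s *\<^sub>R h))) * ?I s)^2 \<partial>lborel)"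
   by (rule Cauchy_Schwarz_nn_integral) measurable
  also have "(\<integral>\<^sup>+s. (?I s)^2 \<partial>lborel) = 1"
   by (subst nn_integral_cong[of _ _ ?I]) (auto simp: indicator_def)
  also have "(\<integral>\<^sup>+s. (ennreal (norm h * norm (g (y + s *\<^sub>R h))) * ?I s)^2 \<partial>lborel)
    = (\<integral>\<^sup>+s. ennreal ((norm h)^2) * (ennreal ((norm (g (y + s *\<^sub>R h)))^2) * ?I s) \<partial>lborel)"
   by (intro nn_integral_cong) (auto simp: indicator_def ennreal_power power_mult_distrib ennreal_mult)
  also have "... = ennreal ((norm h)^2) * (\<integral>\<^sup>+s. ennreal ((norm (g (y + s *\<^sub>R h)))^2) * ?I s \<partial>lborel)"
   by (rule nn_integral_cmult) measurable
  finally show ?thesis by (simp add: ennreal_power)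
 qed
 have "nsq_on E (\<lambda>y. u (y + h) - u y)
   \<le> (\<integral>\<^sup>+y. ennreal ((norm h)^2) * ((\<integral>\<^sup>+s. ennreal ((norm (g (y + s *\<^sub>R h)))^2) * ?I s \<partial>lborel) * indicator E y) \<partial>lborel)"
 proof (rule nn_integral_mono_AE)
  have "AE y in lborel. y \<in> E \<longrightarrow> u (y + h) - u y = (LBINT s. indicator {0..1} s * (g (y + s *\<^sub>R h) \<bullet> h))"
   by (rule sob_translation_AE[OF E]) (use seg in blast)
  thus "AE y in lborel. ennreal ((u (y + h) - u y)^2) * indicator E y \<le>
    ennreal ((norm h)^2) * ((\<integral>\<^sup>+s. ennreal ((norm (g (y + s *\<^sub>R h)))^2) * ?I s \<partial>lborel) * indicator E y)"
   by eventually_elim (use pt in \<open>auto simp: indicator_def\<close>)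
 qed
 also have "... = ennreal ((norm h)^2) * (\<integral>\<^sup>+y. (\<integral>\<^sup>+s. ennreal ((norm (g (y + s *\<^sub>R h)))^2) * ?I s \<partial>lborel) * indicator E y \<partial>lborel)"
  by (rule nn_integral_cmult) measurable
 also have "(\<integral>\<^sup>+y. (\<integral>\<^sup>+s. ennreal ((norm (g (y + s *\<^sub>R h)))^2) * ?I s \<partial>lborel) * indicator E y \<partial>lborel)
   = (\<integral>\<^sup>+y. (\<integral>\<^sup>+s. ennreal ((norm (g (y + s *\<^sub>R h)))^2) * ?I s * indicator E y \<partial>lborel) \<partial>lborel)"
  by (intro nn_integral_cong nn_integral_multc[symmetric]) measurable
 also have "... = (\<integral>\<^sup>+s. (\<integral>\<^sup>+y. ennreal ((norm (g (y + s *\<^sub>R h)))^2) * ?I s * indicator E y \<partial>lborel) \<partial>lborel)"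
  by (rule lborel_pair.Fubini') measurable
 also have "... \<le> (\<integral>\<^sup>+s. energy g S * ?I s \<partial>lborel)"
 proof (rule nn_integral_mono)
  fix s :: real
  show "(\<integral>\<^sup>+y. ennreal ((norm (g (y + s *\<^sub>R h)))^2) * ?I s * indicator E y \<partial>lborel) \<le> energy g S * ?I s"
  proof (cases "s \<in> {0..1}")
   case True
   have "(\<integral>\<^sup>+y. ennreal ((norm (g (y + s *\<^sub>R h)))^2) * ?I s * indicator E y \<partial>lborel)
     \<le> (\<integral>\<^sup>+y. ennreal ((norm (g (y + s *\<^sub>R h)))^2) * indicator S (y + s *\<^sub>R h) \<partial>lborel)"
    by (intro nn_integral_mono) (use True seg in \<open>auto simp: indicator_def\<close>)
   also have "... = energy g S" unfolding energy_def
    by (rule nn_integral_translate[of "\<lambda>y. ennreal ((norm (g y))^2) * indicator S y"]) measurable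
   finally show ?thesis using True by simp
  qed simp
 qed
 also have "... = energy g S" by (subst nn_integral_cmult_indicator) auto
 finally show ?thesis by (simp add: mult_left_mono)
qed

text \<open>Writing z = y + h turns the double integral into an integral over \<open>h\<close> of
  translation differences on the set where both points lie in \<open>B\<close>. Convexity keeps the
  segments in \<open>B\<close>, and only \<open>h\<close> of norm below \<open>d\<close>
  contribute.\<close>

lemma sob_poincare:
 assumes B: "open B" "convex B" "B \<subseteq> \<Omega>" and d: "\<And>y z. y \<in> B \<Longrightarrow> z \<in> B \<Longrightarrow> norm (z - y) < d"
 shows "(\<integral>\<^sup>+y. nsq_on B (\<lambda>z. u z - u y) * indicator B y \<partial>lborel)
   \<le> ennreal (d^2) * emeasure lborel (ball (0::real^'n) d) * energy g B"
proof -
 note [measurable] = sob_meas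
 have [measurable]: "B \<in> sets borel" using B by simp
 have "(\<integral>\<^sup>+y. nsq_on B (\<lambda>z. u z - u y) * indicator B y \<partial>lborel)
  = (\<integral>\<^sup>+y. (\<integral>\<^sup>+h. ennreal ((u (h + y) - u y)^2) * indicator B (h + y) * indicator B y \<partial>lborel) \<partial>lborel)"
 proof (rule nn_integral_cong)
  fix y
  have "nsq_on B (\<lambda>z. u z - u y) = (\<integral>\<^sup>+h. ennreal ((u (h + y) - u y)^2) * indicator B (h + y) \<partial>lborel)"
   by (rule nn_integral_translate[symmetric]) measurable
  thus "nsq_on B (\<lambda>z. u z - u y) * indicator B y =
    (\<integral>\<^sup>+h. ennreal ((u (h + y) - u y)^2) * indicator B (h + y) * indicator B y \<partial>lborel)"
   by (simp add: nn_integral_multc)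
 qed
 also have "... = (\<integral>\<^sup>+h. (\<integral>\<^sup>+y. ennreal ((u (h + y) - u y)^2) * indicator B (h + y) * indicator B y \<partial>lborel) \<partial>lborel)"
  by (rule lborel_pair.Fubini') measurable
 also have "... \<le> (\<integral>\<^sup>+h. (ennreal (d^2) * energy g B) * indicator (ball (0::real^'n) d) h \<partial>lborel)"
 proof (rule nn_integral_mono)
  fix h :: "real^'n"
  let ?E = "B \<inter> (\<lambda>y. h + y) -` B"
  show "(\<integral>\<^sup>+y. ennreal ((u (h + y) - u y)^2) * indicator B (h + y) * indicator B y \<partial>lborel)
   \<le> (ennreal (d^2) * energy g B) * indicator (ball 0 d) h"
  proof (cases "h \<in> ball 0 d")
   case True
   have "(\<integral>\<^sup>+y. ennreal ((u (h + y) - u y)^2) * indicator B (h + y) * indicator B y \<partial>lborel)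
     = nsq_on ?E (\<lambda>y. u (y + h) - u y)"
    by (intro nn_integral_cong) (auto simp: indicator_def add.commute)
   also have "... \<le> ennreal ((norm h)^2) * energy g B"
   proof (rule sob_translation)
    show "open ?E" using B(1) by (intro open_Int open_vimage) (auto intro!: continuous_intros)
    fix y s assume y: "y \<in> ?E" and s: "0 \<le> s" "s \<le> (1::real)"
    have "(1 - s) *\<^sub>R y + s *\<^sub>R (h + y) \<in> B"
     using B(2) y s unfolding convex_alt by auto
    moreover have "(1 - s) *\<^sub>R y + s *\<^sub>R (h + y) = y + s *\<^sub>R h" by (simp add: algebra_simps)
    ultimately show "y + s *\<^sub>R h \<in> \<Omega> \<inter> B" using B(3) by auto
   qed measurable
   also have "... \<le> ennreal (d^2) * energy g B"
    using True by (intro mult_right_mono ennreal_leI power_mono) auto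
   finally show ?thesis using True by simp
  next
   case False
   hence "\<not> (h + y \<in> B \<and> y \<in> B)" for y using d[of y "h + y"] by auto
   hence "(\<integral>\<^sup>+y. ennreal ((u (h + y) - u y)^2) * indicator B (h + y) * indicator B y \<partial>lborel) = 0"
    by (subst nn_integral_cong[of _ _ "\<lambda>_. 0"]) (auto simp: indicator_def)
   thus ?thesis by simp
  qed
 qed
 also have "... = (ennreal (d^2) * energy g B) * emeasure lborel (ball (0::real^'n) d)"
  by (subst nn_integral_cmult_indicator) auto
 finally show ?thesis by (simp add: mult_ac)
qed

end

section \<open>Square integrable functions\<close>

text \<open>Cauchy-Schwarz with the geometric weights \<open>s ^ k\<close>, whose sum is at most
  \<open>1 / (1 - s)\<close>.\<close>

lemma sum_sqrt_squared_le:
 fixes D :: "nat \<Rightarrow> real"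
 assumes "\<And>k. D k \<ge> 0" "0 < s" "s < 1"
 shows "(\<Sum>k<N. sqrt (D k))^2 \<le> (1 / (1 - s)) * (\<Sum>k<N. D k / s ^ k)"
proof -
 have "(\<Sum>k<N. sqrt (D k))^2 = (\<Sum>k<N. sqrt (s ^ k) * sqrt (D k / s ^ k))^2"
  using assms by (simp add: real_sqrt_mult[symmetric])
 also have "... \<le> (\<Sum>k<N. (sqrt (s ^ k))^2) * (\<Sum>k<N. (sqrt (D k / s ^ k))^2)"
  by (rule Cauchy_Schwarz_ineq_sum)
 also have "... = (\<Sum>k<N. s ^ k) * (\<Sum>k<N. D k / s ^ k)"
  using assms by simp
 also have "... \<le> (1 / (1 - s)) * (\<Sum>k<N. D k / s ^ k)"
 proof (rule mult_right_mono)
  have "(\<Sum>k<N. s ^ k) \<le> (\<Sum>k. s ^ k)" using assms by (intro sum_le_suminf summable_geometric) auto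
  thus "(\<Sum>k<N. s ^ k) \<le> 1 / (1 - s)" using assms by (simp add: suminf_geometric)
 qed (use assms in \<open>auto intro!: sum_nonneg divide_nonneg_nonneg\<close>)
 finally show ?thesis .
qed

text \<open>A substitute for Minkowski's inequality for infinitely many summands whose squared norms
 decay geometrically.\<close>

lemma sum_sqrt_AE:
 fixes D :: "nat \<Rightarrow> 'a \<Rightarrow> real"
 assumes [measurable]: "\<And>k. D k \<in> borel_measurable M" and pos: "\<And>k x. D k x \<ge> 0"
  and bd: "\<And>k. (\<integral>\<^sup>+x. ennreal (D k x) \<partial>M) \<le> ennreal (C * q ^ k)" and C: "C \<ge> 0" and q: "0 < q" "q < 1"
 shows "AE x in M. summable (\<lambda>k. sqrt (D k x))"
  and "nsq M (\<lambda>x. \<Sum>k. sqrt (D k x)) \<le> ennreal (C / (1 - sqrt q)^2)"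
proof -
 \<comment> \<open>The decay is split as q = s * s: one factor \<open>s ^ k\<close> pays for the
   weight in Cauchy-Schwarz, the other remains to make the norms summable.\<close>
 define s where "s = sqrt q"
 have s: "0 < s" "s < 1" "q = s * s" using q by (auto simp: s_def)
 define P where "P N x = ennreal ((\<Sum>k<N. sqrt (D k x))^2)" for N x
 have [measurable]: "P N \<in> borel_measurable M" for N unfolding P_def by measurable
 have mono: "mono (\<lambda>N. (\<Sum>k<N. sqrt (D k x))^2)" for x
 proof (rule mono_iff_le_Suc[THEN iffD2], rule allI, rule power_mono)
  show "(\<Sum>k<N. sqrt (D k x)) \<le> (\<Sum>k<Suc N. sqrt (D k x))" for N using pos by simp
 qed (use pos in \<open>auto intro: sum_nonneg\<close>)
 have PN: "(\<integral>\<^sup>+x. P N x \<partial>M) \<le> ennreal (C / (1 - s)^2)" for N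
 proof -
  have "(\<integral>\<^sup>+x. P N x \<partial>M) \<le> (\<integral>\<^sup>+x. (\<Sum>k<N. ennreal (1 / ((1 - s) * s ^ k)) * ennreal (D k x)) \<partial>M)"
  proof (rule nn_integral_mono)
   fix x
   have "(1 / (1 - s)) * (\<Sum>k<N. D k x / s ^ k) = (\<Sum>k<N. 1 / ((1 - s) * s ^ k) * D k x)"
    by (simp add: sum_distrib_left)
   hence "P N x \<le> ennreal (\<Sum>k<N. 1 / ((1 - s) * s ^ k) * D k x)"
    unfolding P_def using sum_sqrt_squared_le[of "\<lambda>k. D k x" s N] pos s by (intro ennreal_leI) simp
   also have "... = (\<Sum>k<N. ennreal (1 / ((1 - s) * s ^ k)) * ennreal (D k x))"
   proof -
    have "ennreal (1 / ((1 - s) * s ^ k)) * ennreal (D k x) = ennreal (1 / ((1 - s) * s ^ k) * D k x)" for k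
     using pos s by (intro ennreal_mult[symmetric]) auto
    thus ?thesis using pos s by (simp only:) (rule sum_ennreal[symmetric], auto)
   qed
   finally show "P N x \<le> (\<Sum>k<N. ennreal (1 / ((1 - s) * s ^ k)) * ennreal (D k x))" .
  qed
  also have "... = (\<Sum>k<N. ennreal (1 / ((1 - s) * s ^ k)) * (\<integral>\<^sup>+x. ennreal (D k x) \<partial>M))"
   by (subst nn_integral_sum) (auto simp: nn_integral_cmult)
  also have "... \<le> (\<Sum>k<N. ennreal (1 / ((1 - s) * s ^ k)) * ennreal (C * q ^ k))"
   by (intro sum_mono mult_left_mono bd) simp
  also have "... = (\<Sum>k<N. ennreal ((C / (1 - s)) * s ^ k))"
   using s C by (intro sum.cong) (auto simp: ennreal_mult[symmetric] power_mult_distrib field_simps)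
  also have "... = ennreal ((C / (1 - s)) * (\<Sum>k<N. s ^ k))"
   using s C by (subst sum_ennreal) (auto simp: sum_distrib_left)
  also have "... \<le> ennreal ((C / (1 - s)) * (1 / (1 - s)))"
  proof (intro ennreal_leI mult_left_mono)
   have "(\<Sum>k<N. s ^ k) \<le> (\<Sum>k. s ^ k)" using s by (intro sum_le_suminf summable_geometric) auto
   thus "(\<Sum>k<N. s ^ k) \<le> 1 / (1 - s)" using s by (simp add: suminf_geometric)
  qed (use s C in simp)
  finally show ?thesis by (simp add: power2_eq_square)
 qed
 have "(\<integral>\<^sup>+x. (SUP N. P N x) \<partial>M) = (SUP N. \<integral>\<^sup>+x. P N x \<partial>M)"
  by (rule nn_integral_monotone_convergence_SUP)
    (use mono in \<open>auto simp: incseq_def le_fun_def P_def mono_def intro!: ennreal_leI\<close>)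
 also have "... \<le> ennreal (C / (1 - s)^2)" by (rule SUP_least) (rule PN)
 finally have S: "(\<integral>\<^sup>+x. (SUP N. P N x) \<partial>M) \<le> ennreal (C / (1 - s)^2)" .
 have fin: "AE x in M. (SUP N. P N x) \<noteq> \<infinity>"
  by (rule nn_integral_PInf_AE) (use S in \<open>auto simp: top_unique\<close>)
 have key: "summable (\<lambda>k. sqrt (D k x)) \<and> ennreal ((\<Sum>k. sqrt (D k x))^2) \<le> (SUP N. P N x)"
  if f: "(SUP N. P N x) \<noteq> \<infinity>" for x
 proof -
  obtain B where B: "B \<ge> 0" "(SUP N. P N x) = ennreal B" using f by (cases "SUP N. P N x") auto
  have "(\<Sum>k<N. sqrt (D k x))^2 \<le> B" for N
  proof -
   have "P N x \<le> ennreal B" unfolding B(2)[symmetric] by (rule SUP_upper) simp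
   thus ?thesis using B(1) by (simp add: P_def)
  qed
  hence le: "(\<Sum>k<N. sqrt (D k x)) \<le> sqrt B" for N by (simp add: real_le_rsqrt)
  have sm: "summable (\<lambda>k. sqrt (D k x))"
  proof (rule bounded_imp_summable)
   show "sqrt (D k x) \<ge> 0" for k using pos by simp
   show "(\<Sum>k\<le>n. sqrt (D k x)) \<le> sqrt B" for n using le[of "Suc n"] by (simp add: lessThan_Suc_atMost)
  qed
  hence "(\<lambda>N. (\<Sum>k<N. sqrt (D k x))^2) \<longlonglongrightarrow> (\<Sum>k. sqrt (D k x))^2"
   by (intro tendsto_power summable_LIMSEQ)
  hence "(\<Sum>k. sqrt (D k x))^2 \<le> B" using \<open>\<And>N. (\<Sum>k<N. sqrt (D k x))^2 \<le> B\<close> by (intro LIMSEQ_le_const2) auto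
  thus ?thesis using sm B by (simp add: ennreal_leI)
 qed
 show "AE x in M. summable (\<lambda>k. sqrt (D k x))" using fin by eventually_elim (use key in blast)
 have "nsq M (\<lambda>x. \<Sum>k. sqrt (D k x)) \<le> (\<integral>\<^sup>+x. (SUP N. P N x) \<partial>M)"
  by (rule nn_integral_mono_AE) (use fin key in \<open>auto elim!: eventually_mono\<close>)
 also note S
 finally show "nsq M (\<lambda>x. \<Sum>k. sqrt (D k x)) \<le> ennreal (C / (1 - sqrt q)^2)" by (simp add: s_def)
qed

lemma summable_increments_limit:
 fixes f :: "nat \<Rightarrow> real"
 assumes "\<And>k. \<bar>f (Suc k) - f k\<bar> \<le> d k" "summable d"
 shows "convergent f" "\<bar>lim f - f 0\<bar> \<le> (\<Sum>k. d k)"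
proof -
 have a: "summable (\<lambda>k. \<bar>f (Suc k) - f k\<bar>)" by (rule summable_comparison_test'[OF assms(2)]) (use assms in auto)
 hence s: "summable (\<lambda>k. f (Suc k) - f k)" by (rule summable_rabs_cancel)
 have e: "(\<Sum>k<n. f (Suc k) - f k) = f n - f 0" for n by (rule sum_lessThan_telescope)
 have "(\<lambda>n. f n - f 0) \<longlonglongrightarrow> (\<Sum>k. f (Suc k) - f k)" using summable_LIMSEQ[OF s] by (simp add: e)
 hence "(\<lambda>n. (f n - f 0) + f 0) \<longlonglongrightarrow> (\<Sum>k. f (Suc k) - f k) + f 0" by (intro tendsto_intros)
 hence l: "f \<longlonglongrightarrow> (\<Sum>k. f (Suc k) - f k) + f 0" by simp
 thus "convergent f" by (rule convergentI)
 have "lim f = (\<Sum>k. f (Suc k) - f k) + f 0" using l by (rule limI)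
 moreover have "\<bar>\<Sum>k. f (Suc k) - f k\<bar> \<le> (\<Sum>k. \<bar>f (Suc k) - f k\<bar>)" by (rule summable_rabs[OF a])
 moreover have "(\<Sum>k. \<bar>f (Suc k) - f k\<bar>) \<le> (\<Sum>k. d k)" by (rule suminf_le[OF assms(1) a assms(2)])
 ultimately show "\<bar>lim f - f 0\<bar> \<le> (\<Sum>k. d k)" by simp
qed

lemma square_diff_le: "((a::real) - c)^2 \<le> 2 * (a - b)^2 + 2 * (b - c)^2"
proof -
 have "2 * (a - b)^2 + 2 * (b - c)^2 - (a - c)^2 = ((a - b) - (b - c))^2" by (simp add: power2_eq_square algebra_simps)
 thus ?thesis by (smt (verit) zero_le_power2)
qed

lemma nn_square_diff_le:
 assumes [measurable]: "f \<in> borel_measurable M" "g \<in> borel_measurable M" "h \<in> borel_measurable M"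
 shows "nsq M (\<lambda>x. f x - h x) \<le> 2 * nsq M (\<lambda>x. f x - g x) + 2 * nsq M (\<lambda>x. g x - h x)"
proof -
 have "nsq M (\<lambda>x. f x - h x) \<le> (\<integral>\<^sup>+x. 2 * ennreal ((f x - g x)^2) + 2 * ennreal ((g x - h x)^2) \<partial>M)"
 proof (rule nn_integral_mono)
  fix x
  have "ennreal ((f x - h x)^2) \<le> ennreal (2 * (f x - g x)^2 + 2 * (g x - h x)^2)"
   by (rule ennreal_leI) (rule square_diff_le)
  thus "ennreal ((f x - h x)^2) \<le> 2 * ennreal ((f x - g x)^2) + 2 * ennreal ((g x - h x)^2)"
   by (simp add: ennreal_plus ennreal_mult')
 qed
 also have "... = 2 * nsq M (\<lambda>x. f x - g x) + 2 * nsq M (\<lambda>x. g x - h x)"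
  by (subst nn_integral_add) (auto simp: nn_integral_cmult)
 finally show ?thesis .
qed

text \<open>Carries control of \<open>u\<close> from a region back along a shift that leads into it;
  used with the ball as target for the cusp and with higher strips as targets for the strip at the
  tip.\<close>

lemma nsq_on_shift:
 fixes u :: "'a::euclidean_space \<Rightarrow> real"
 assumes [measurable]: "u \<in> borel_measurable borel" "E \<in> sets borel" "T \<in> sets borel" and T: "\<And>y. y \<in> E \<Longrightarrow> y + h \<in> T"
 shows "nsq_on E (\<lambda>y. u y - m) \<le> 2 * nsq_on E (\<lambda>y. u (y + h) - u y) + 2 * nsq_on T (\<lambda>y. u y - m)"
proof -
 have "nsq_on E (\<lambda>y. u y - m)
   \<le> (\<integral>\<^sup>+y. 2 * (ennreal ((u (y + h) - u y)^2) * indicator E y) + 2 * (ennreal ((u (y + h) - m)^2) * indicator T (y + h)) \<partial>lborel)"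
 proof (rule nn_integral_mono)
  fix y
  have "ennreal ((u y - m)^2) \<le> ennreal (2 * (u (y + h) - u y)^2 + 2 * (u (y + h) - m)^2)"
   using square_diff_le[of "u y" m "u (y + h)"] by (intro ennreal_leI) (simp add: power2_commute)
  also have "... = 2 * ennreal ((u (y + h) - u y)^2) + 2 * ennreal ((u (y + h) - m)^2)"
   by (simp add: ennreal_plus ennreal_mult')
  finally show "ennreal ((u y - m)^2) * indicator E y
    \<le> 2 * (ennreal ((u (y + h) - u y)^2) * indicator E y) + 2 * (ennreal ((u (y + h) - m)^2) * indicator T (y + h))"
   using T[of y] by (cases "y \<in> E") auto
 qed
 also have "... = 2 * nsq_on E (\<lambda>y. u (y + h) - u y) + 2 * (\<integral>\<^sup>+y. ennreal ((u (y + h) - m)^2) * indicator T (y + h) \<partial>lborel)"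
  by (subst nn_integral_add) (auto simp: nn_integral_cmult)
 also have "(\<integral>\<^sup>+y. ennreal ((u (y + h) - m)^2) * indicator T (y + h) \<partial>lborel) = nsq_on T (\<lambda>y. u y - m)"
  by (rule nn_integral_translate) measurable
 finally show ?thesis .
qed

text \<open>Along a subsequence with squared increments below 4^(-k) the pointwise limit exists
  almost everywhere by \<open>sum_sqrt_AE\<close>. Because the limit is taken pointwise with
  \<open>lim\<close>, functions vanishing off the domain have a limit that vanishes there exactly,
  which is the last clause.\<close>

lemma L2_complete:
 fixes f :: "nat \<Rightarrow> 'a \<Rightarrow> real"
 assumes [measurable]: "\<And>k. f k \<in> borel_measurable M"
  and cau: "\<And>\<epsilon>. \<epsilon> > 0 \<Longrightarrow> \<exists>N. \<forall>m\<ge>N. \<forall>l\<ge>N. nsq M (\<lambda>x. f m x - f l x) < ennreal \<epsilon>"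
 obtains F where "F \<in> borel_measurable M" "\<And>\<epsilon>. \<epsilon> > 0 \<Longrightarrow> \<exists>N. \<forall>m\<ge>N. nsq M (\<lambda>x. f m x - F x) < ennreal \<epsilon>"
  "\<And>x. (\<And>k. f k x = 0) \<Longrightarrow> F x = 0"
proof -
 have "\<exists>N. \<forall>k. \<forall>m\<ge>N k. \<forall>l\<ge>N k. nsq M (\<lambda>x. f m x - f l x) < ennreal ((1/4) ^ k)"
  by (rule choice) (use cau in simp)
 then obtain N where N: "\<And>k m l. m \<ge> N k \<Longrightarrow> l \<ge> N k \<Longrightarrow> nsq M (\<lambda>x. f m x - f l x) < ennreal ((1/4) ^ k)" by blast
 \<comment> \<open>Running maxima make both \<open>r k\<close> and \<open>r (Suc k)\<close> at least
   \<open>N k\<close>.\<close>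
 define r where "r k = Max (N ` {..k})" for k
 have rN: "N k \<le> r k" and rm: "r k \<le> r (Suc k)" for k
  unfolding r_def by (auto intro!: Max_ge Max_mono)
 have rmono: "r k \<le> r j" if "k \<le> j" for k j using lift_Suc_mono_le[of r, OF rm that] .
 have inc: "nsq M (\<lambda>x. f (r (Suc k)) x - f (r k) x) \<le> ennreal ((1/4) ^ k)" for k
  by (intro less_imp_le N order_trans[OF rN rm] rN)
 define F where "F x = lim (\<lambda>k. f (r k) x)" for x
 have [measurable]: "F \<in> borel_measurable M" unfolding F_def by measurable
 have tail: "nsq M (\<lambda>x. F x - f (r m) x) \<le> ennreal (4 * (1/4) ^ m)" for m
 proof -
  let ?D = "\<lambda>k x. (f (r (Suc (k + m))) x - f (r (k + m)) x)^2"
  have b: "(\<integral>\<^sup>+x. ennreal (?D k x) \<partial>M) \<le> ennreal ((1/4) ^ m * (1/4) ^ k)" for k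
   using inc[of "k + m"] by (simp add: power_add mult.commute)
  have "sqrt (1/4) = 1/2" by (simp add: real_sqrt_divide)
  note S = sum_sqrt_AE[of ?D M "(1/4)^m" "1/4", OF _ _ b]
  have "nsq M (\<lambda>x. F x - f (r m) x) \<le> nsq M (\<lambda>x. \<Sum>k. sqrt (?D k x))"
  proof (rule nn_integral_mono_AE)
   have "AE x in M. summable (\<lambda>k. sqrt (?D k x))" by (rule S(1)) auto
   thus "AE x in M. ennreal ((F x - f (r m) x)^2) \<le> ennreal ((\<Sum>k. sqrt (?D k x))^2)"
   proof eventually_elim
    case (elim x)
    have *: "\<bar>f (r (Suc k + m)) x - f (r (k + m)) x\<bar> \<le> sqrt (?D k x)" for k by simp
    have 1: "convergent (\<lambda>k. f (r (k + m)) x)" "\<bar>lim (\<lambda>k. f (r (k + m)) x) - f (r (0 + m)) x\<bar> \<le> (\<Sum>k. sqrt (?D k x))"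
     using summable_increments_limit[of "\<lambda>k. f (r (k + m)) x", OF * elim] by auto
    have "lim (\<lambda>k. f (r (k + m)) x) = F x"
    proof -
     have "(\<lambda>k. f (r (k + m)) x) \<longlonglongrightarrow> lim (\<lambda>k. f (r (k + m)) x)" using 1(1) by (simp add: convergent_LIMSEQ_iff)
     hence "(\<lambda>k. f (r k) x) \<longlonglongrightarrow> lim (\<lambda>k. f (r (k + m)) x)" by (rule LIMSEQ_offset)
     thus ?thesis unfolding F_def by (simp add: limI)
    qed
    hence "\<bar>F x - f (r m) x\<bar> \<le> (\<Sum>k. sqrt (?D k x))" using 1(2) by simp
    from power_mono[OF this abs_ge_zero, of 2]
    show ?case by (intro ennreal_leI) (simp only: power2_abs)
   qed
  qed
  also have "... \<le> ennreal ((1/4)^m / (1 - sqrt (1/4))^2)" by (rule S(2)) auto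
  finally show ?thesis using \<open>sqrt (1/4) = 1/2\<close> by (simp add: power2_eq_square mult.commute)
 qed
 show ?thesis
 proof (rule that[of F])
  fix \<epsilon> :: real assume e: "\<epsilon> > 0"
  have "(\<lambda>m. 10 * (1/4::real) ^ m) \<longlonglongrightarrow> 10 * 0" by (intro tendsto_intros) (simp add: LIMSEQ_realpow_zero)
  then obtain k where k: "10 * (1/4::real) ^ k < \<epsilon>"
   using e by (metis (no_types, lifting) mult_zero_right order_tendstoD(2) eventually_sequentially le_refl)
  show "\<exists>N. \<forall>m\<ge>N. nsq M (\<lambda>x. f m x - F x) < ennreal \<epsilon>"
  proof (intro exI[of _ "r k"] allI impI)
   fix m assume m: "r k \<le> m"
   have "nsq M (\<lambda>x. f m x - F x) \<le> 2 * nsq M (\<lambda>x. f m x - f (r k) x) + 2 * nsq M (\<lambda>x. f (r k) x - F x)"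
    by (rule nn_square_diff_le) measurable
   also have "... \<le> 2 * ennreal ((1/4) ^ k) + 2 * ennreal (4 * (1/4) ^ k)"
    using tail[of k] N[of k m "r k"] m rN[of k]
    by (intro add_mono mult_left_mono) (auto simp: power2_commute[of "F _"] intro: less_imp_le)
   also have "... = ennreal (10 * (1/4) ^ k)"
    by (simp add: ennreal_mult'[symmetric] ennreal_plus[symmetric] del: ennreal_plus flip: ennreal_numeral)
   also have "... < ennreal \<epsilon>" using k e by (simp add: ennreal_lessI)
   finally show "nsq M (\<lambda>x. f m x - F x) < ennreal \<epsilon>" .
  qed
 next
  fix x assume "\<And>k. f k x = 0"
  thus "F x = 0" by (simp add: F_def lim_const)
 qed measurable
qed

lemma nn_integral_CS_set:
 assumes [measurable]: "f \<in> borel_measurable M" "S \<in> sets M"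
 shows "(\<integral>\<^sup>+x. ennreal \<bar>f x\<bar> * indicator S x \<partial>M)^2 \<le> emeasure M S * (\<integral>\<^sup>+x. ennreal ((f x)^2) * indicator S x \<partial>M)"
proof -
 have "(\<integral>\<^sup>+x. ennreal \<bar>f x\<bar> * indicator S x \<partial>M)^2 = (\<integral>\<^sup>+x. indicator S x * (ennreal \<bar>f x\<bar> * indicator S x) \<partial>M)^2"
  by (intro arg_cong[where f="\<lambda>x. x^2"] nn_integral_cong) (auto simp: indicator_def)
 also have "... \<le> (\<integral>\<^sup>+x. (indicator S x)^2 \<partial>M) * (\<integral>\<^sup>+x. (ennreal \<bar>f x\<bar> * indicator S x)^2 \<partial>M)"
  by (rule Cauchy_Schwarz_nn_integral) measurable
 also have "(\<integral>\<^sup>+x. (indicator S x)^2 \<partial>M) = emeasure M S"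
  by (subst nn_integral_cong[of _ _ "indicator S"]) (auto simp: indicator_def)
 also have "(\<integral>\<^sup>+x. (ennreal \<bar>f x\<bar> * indicator S x)^2 \<partial>M) = (\<integral>\<^sup>+x. ennreal ((f x)^2) * indicator S x \<partial>M)"
  by (intro nn_integral_cong) (auto simp: indicator_def ennreal_power)
 finally show ?thesis .
qed

lemma set_integral_square_le:
 fixes f :: "'a \<Rightarrow> real"
 assumes [measurable]: "f \<in> borel_measurable M" "S \<in> sets M"
 shows "ennreal ((\<integral>x. indicator S x * f x \<partial>M)^2) \<le> emeasure M S * (\<integral>\<^sup>+x. ennreal ((f x)^2) * indicator S x \<partial>M)"
proof -
 have "ennreal \<bar>\<integral>x. indicator S x * f x \<partial>M\<bar> \<le> (\<integral>\<^sup>+x. ennreal \<bar>f x\<bar> * indicator S x \<partial>M)"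
 proof (cases "integrable M (\<lambda>x. indicator S x * f x)")
  case True
  have "ennreal (norm (\<integral>x. indicator S x * f x \<partial>M)) \<le> (\<integral>\<^sup>+x. ennreal (norm (indicator S x * f x)) \<partial>M)"
   by (rule integral_norm_bound_ennreal[OF True])
  also have "... = (\<integral>\<^sup>+x. ennreal \<bar>f x\<bar> * indicator S x \<partial>M)"
   by (intro nn_integral_cong) (auto simp: indicator_def)
  finally show ?thesis by simp
 qed (simp add: not_integrable_integral_eq)
 hence "(ennreal \<bar>\<integral>x. indicator S x * f x \<partial>M\<bar>)^2 \<le> (\<integral>\<^sup>+x. ennreal \<bar>f x\<bar> * indicator S x \<partial>M)^2"
  by (rule power_mono) simp
 also note nn_integral_CS_set[OF assms]
 finally show ?thesis by (simp add: ennreal_power)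
qed

text \<open>The difference of two averages is the average of u(y) - u(z) over the product of
  \<open>A\<close> and \<open>B\<close>; Cauchy-Schwarz is applied first in \<open>y\<close> and
  then in \<open>z\<close>.\<close>

lemma average_diff_le:
 fixes u :: "'a::euclidean_space \<Rightarrow> real"
 assumes u: "integrable lborel u" and A[measurable]: "A \<in> sets borel" and B[measurable]: "B \<in> sets borel"
  and fA: "emeasure lborel A = ennreal a" "a > 0" and fB: "emeasure lborel B = ennreal b" "b > 0"
 shows "ennreal (((LBINT x. indicator A x * u x) / a - (LBINT x. indicator B x * u x) / b)^2)
  \<le> ennreal (1 / (a * b)) * (\<integral>\<^sup>+y. nsq_on B (\<lambda>z. u z - u y) * indicator A y \<partial>lborel)"
proof -
 have [measurable]: "u \<in> borel_measurable borel" using u by auto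
 define I where "I y = (LBINT z. indicator B z * (u y - u z))" for y
 have iB: "integrable lborel (\<lambda>x. indicator B x :: real)" and iA: "integrable lborel (\<lambda>x. indicator A x :: real)"
  using fA fB by (auto simp: less_top[symmetric])
 have mB: "measure lborel B = b" "measure lborel A = a" using fA fB by (auto simp: measure_def)
 have uB: "integrable lborel (\<lambda>x. indicator B x * u x)" "integrable lborel (\<lambda>x. indicator A x * u x)"
  using integrable_real_mult_indicator[OF _ u] by (simp_all add: mult.commute)
 have I: "I y = u y * b - (LBINT x. indicator B x * u x)" for y
 proof -
  have "I y = (LBINT z. u y * indicator B z - indicator B z * u z)"
   unfolding I_def by (intro Bochner_Integration.integral_cong) (auto simp: algebra_simps)
  also have "... = u y * b - (LBINT x. indicator B x * u x)"
   using iB uB by (simp add: mB)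
  finally show ?thesis .
 qed
 have [measurable]: "I \<in> borel_measurable borel" unfolding I by measurable
 have "(LBINT y. indicator A y * I y) = (LBINT y. b * (indicator A y * u y) - (LBINT x. indicator B x * u x) * indicator A y)"
  unfolding I by (intro Bochner_Integration.integral_cong) (auto simp: algebra_simps)
 also have "... = b * (LBINT x. indicator A x * u x) - a * (LBINT x. indicator B x * u x)"
  using iA uB by (simp add: mB mult.commute)
 finally have e: "(LBINT x. indicator A x * u x) / a - (LBINT x. indicator B x * u x) / b = (LBINT y. indicator A y * I y) / (a * b)"
  using fA fB by (simp add: field_simps)
 have "ennreal ((LBINT y. indicator A y * I y)^2) \<le> ennreal a * nsq_on A I"
  using set_integral_square_le[of I lborel A] by (simp add: fA)
 also have "... \<le> ennreal a * (\<integral>\<^sup>+y. (ennreal b * nsq_on B (\<lambda>z. u z - u y)) * indicator A y \<partial>lborel)"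
 proof (intro mult_left_mono nn_integral_mono mult_right_mono)
  fix y
  show "ennreal ((I y)^2) \<le> ennreal b * nsq_on B (\<lambda>z. u z - u y)"
   using set_integral_square_le[of "\<lambda>z. u y - u z" lborel B] by (simp add: fB I_def power2_commute)
 qed auto
 also have "... = ennreal (a * b) * (\<integral>\<^sup>+y. nsq_on B (\<lambda>z. u z - u y) * indicator A y \<partial>lborel)"
  using fA fB by (simp add: mult.assoc nn_integral_cmult ennreal_mult)
 finally have f: "ennreal ((LBINT y. indicator A y * I y)^2) \<le> ennreal (a * b) * (\<integral>\<^sup>+y. nsq_on B (\<lambda>z. u z - u y) * indicator A y \<partial>lborel)" .
 have ab: "a * b > 0" using fA fB by simp
 have "ennreal (((LBINT y. indicator A y * I y) / (a * b))^2) = ennreal (1 / (a * b)^2) * ennreal ((LBINT y. indicator A y * I y)^2)"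
  by (simp add: ennreal_mult'[symmetric] power_divide)
 also have "... \<le> ennreal (1 / (a * b)^2) * (ennreal (a * b) * (\<integral>\<^sup>+y. nsq_on B (\<lambda>z. u z - u y) * indicator A y \<partial>lborel))"
  by (intro mult_left_mono f) simp
 also have "... = ennreal (1 / (a * b)) * (\<integral>\<^sup>+y. nsq_on B (\<lambda>z. u z - u y) * indicator A y \<partial>lborel)"
 proof -
  have "ennreal (1 / (a * b)^2) * ennreal (a * b) = ennreal (1 / (a * b)^2 * (a * b))"
   using ab by (intro ennreal_mult[symmetric]) auto
  also have "1 / (a * b)^2 * (a * b) = 1 / (a * b)" using ab by (simp add: power2_eq_square)
  finally show ?thesis by (simp only: mult.assoc[symmetric])
 qed
 finally show ?thesis unfolding e .
qed

text \<open>Weak sequential compactness, reduced to integrals over Borel sets, which is all that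
  averages need. A diagonal sequence handles a countable generator stable under intersection; the
  bound \<open>J\<close>, uniform in \<open>m\<close> and small on small sets, extends convergence
  to all Borel sets.\<close>

lemma weak_subsequence:
 fixes u :: "nat \<Rightarrow> 'a::euclidean_space \<Rightarrow> real"
 assumes [measurable]: "\<And>m. u m \<in> borel_measurable borel" "\<Omega> \<in> sets borel"
  and z: "\<And>m x. x \<notin> \<Omega> \<Longrightarrow> u m x = 0" and fin: "emeasure lborel \<Omega> < \<infinity>"
  and bd: "\<And>m. nsq lborel (u m) \<le> ennreal C" and C: "C \<ge> 0"
 obtains r :: "nat \<Rightarrow> nat" where "strict_mono r"
  "\<And>S. S \<in> sets borel \<Longrightarrow> convergent (\<lambda>m. \<integral>x. indicator S x * u (r m) x \<partial>lborel)"
proof -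
 let ?J = "\<lambda>m S. \<integral>x. indicator S x * u m x \<partial>lborel"
 have J: "\<bar>?J m S\<bar> \<le> sqrt (measure lborel (\<Omega> \<inter> S) * C)" if S[measurable]: "S \<in> sets borel" for m S
 proof -
  have f: "emeasure lborel (\<Omega> \<inter> S) = ennreal (measure lborel (\<Omega> \<inter> S))"
   using fin emeasure_mono[of "\<Omega> \<inter> S" \<Omega> lborel] by (intro emeasure_eq_ennreal_measure) (auto simp: top_unique)
  have "?J m S = (LBINT x. indicator (\<Omega> \<inter> S) x * u m x)"
   by (intro Bochner_Integration.integral_cong) (use z in \<open>auto simp: indicator_def\<close>)
  hence "ennreal ((?J m S)^2) \<le> ennreal (measure lborel (\<Omega> \<inter> S)) * nsq_on (\<Omega> \<inter> S) (u m)"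
   using set_integral_square_le[of "u m" lborel "\<Omega> \<inter> S"] by (simp add: f)
  also have "... \<le> ennreal (measure lborel (\<Omega> \<inter> S)) * ennreal C"
  proof (rule mult_left_mono)
   have "nsq_on (\<Omega> \<inter> S) (u m) \<le> nsq lborel (u m)"
    by (intro nn_integral_mono) (auto simp: indicator_def)
   thus "nsq_on (\<Omega> \<inter> S) (u m) \<le> ennreal C" using bd by (rule order_trans)
  qed simp
  finally have "(?J m S)^2 \<le> measure lborel (\<Omega> \<inter> S) * C"
   using C by (simp add: ennreal_mult'[symmetric])
  thus ?thesis by (metis real_sqrt_abs real_sqrt_le_iff)
 qed
 have i: "integrable lborel (\<lambda>x. indicator S x * u m x)" if [measurable]: "S \<in> sets borel" for S m
 proof (rule Bochner_Integration.integrable_bound)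
  show "integrable lborel (\<lambda>x. indicator \<Omega> x + (u m x)^2)"
  proof (rule Bochner_Integration.integrable_add)
   show "integrable lborel (\<lambda>x. (u m x)^2)"
    using bd[of m] by (intro integrableI_bounded) (auto simp: le_less_trans)
  qed (use fin in simp)
  have "\<bar>t\<bar> \<le> 1 + t^2" for t :: real 
  proof -
   have "0 \<le> (\<bar>t\<bar> - 1 / 2)^2" by simp
   also have "... = t^2 - \<bar>t\<bar> + 1 / 4" 
    by (simp only: power2_diff power2_abs) (simp add: power2_eq_square)
   finally show ?thesis by simp
  qed
  thus "AE x in lborel. norm (indicator S x * u m x) \<le> norm (indicator \<Omega> x + (u m x)^2)"
   using z by (intro AE_I2) (auto simp: indicator_def)
 qed measurable
 obtain B :: "'a set set" where B: "countable B" "topological_basis B" using ex_countable_basis by blast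
 \<comment> \<open>Finite intersections of basis sets, the empty one included: it supplies
   \<open>UNIV\<close>, which the complement step uses.\<close>
 define G where "G = {\<Inter>F |F. finite F \<and> F \<subseteq> B}"
 have cG: "countable G"
 proof -
  have "G = Inter ` {F. finite F \<and> F \<subseteq> B}" by (auto simp: G_def)
  thus ?thesis using countable_Collect_finite_subset[OF B(1)] by simp
 qed
 have Bb: "b \<in> sets borel" if "b \<in> B" for b using topological_basis_open[OF B(2) that] by simp
 have Gb: "S \<in> sets borel" if S: "S \<in> G" for S
 proof -
  obtain F where F: "finite F" "F \<subseteq> B" "S = \<Inter>F" using S G_def by blast
  show ?thesis
  proof (cases "F = {}")
   case False
   have "(\<Inter>b\<in>F. b) \<in> sets borel"
    by (rule sets.finite_INT) (use F False Bb in auto)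
   thus ?thesis using F by simp
  qed (use F in simp)
 qed
 have GU: "UNIV \<in> G" unfolding G_def by (auto intro!: exI[of _ "{}"])
 have sig: "sigma_sets UNIV G = sets borel"
 proof
  show "sigma_sets UNIV G \<subseteq> sets borel" using Gb sets.sigma_sets_subset[of G borel] by auto
  have "B \<subseteq> G" unfolding G_def by (auto intro!: exI[of _ "{_}"])
  hence "sigma_sets UNIV B \<subseteq> sigma_sets UNIV G" by (rule sigma_sets_mono')
  moreover have "sets (borel::'a measure) = sigma_sets UNIV B"
   by (subst borel_eq_countable_basis[OF B]) (rule sets_measure_of, simp)
  ultimately show "sets borel \<subseteq> sigma_sets UNIV G" by simp
 qed
 interpret sub: subseqs "\<lambda>n s. convergent (\<lambda>m. ?J (s m) (from_nat_into G n))"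
 proof
  fix n and s :: "nat \<Rightarrow> nat" assume "strict_mono s"
  have "from_nat_into G n \<in> sets borel" using GU Gb from_nat_into[of G n] by blast
  hence "bounded (range (\<lambda>m. ?J (s m) (from_nat_into G n)))" using J by (intro boundedI) auto
  then obtain l r where "strict_mono r" "((\<lambda>m. ?J (s m) (from_nat_into G n)) \<circ> r) \<longlonglongrightarrow> l"
   using bounded_imp_convergent_subsequence by blast
  thus "\<exists>r'. strict_mono r' \<and> convergent (\<lambda>m. ?J ((s \<circ> r') m) (from_nat_into G n))"
   by (auto simp: o_def intro: convergentI)
 qed
 define r where "r = sub.diagseq"
 have rm: "strict_mono r" unfolding r_def by (rule sub.subseq_diagseq)
 have base: "convergent (\<lambda>m. ?J (r m) S)" if S: "S \<in> G" for S
 proof -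
  obtain k where k: "from_nat_into G k = S" using from_nat_into_surj[OF cG S] by blast
  have "convergent (\<lambda>m. ?J ((sub.diagseq \<circ> ((+) (Suc k))) m) (from_nat_into G k))"
  proof (rule sub.diagseq_holds)
   fix r s :: "nat \<Rightarrow> nat" and n assume "strict_mono r" "convergent (\<lambda>m. ?J (s m) (from_nat_into G n))"
   from convergent_subseq_convergent[OF this(2,1)]
   show "convergent (\<lambda>m. ?J ((s \<circ> r) m) (from_nat_into G n))" by (simp add: o_def)
  qed
  hence "convergent (\<lambda>m. ?J (r (m + Suc k)) S)" by (simp add: o_def k r_def add.commute)
  thus ?thesis using convergent_ignore_initial_segment[of "\<lambda>m. ?J (r m) S" "Suc k"] by simp
 qed
 have "convergent (\<lambda>m. ?J (r m) S)" if "S \<in> sets borel" for S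
 proof -
  have "S \<in> sigma_sets UNIV G" using that sig by simp
  moreover have "Int_stable G"
  proof (rule Int_stableI)
   fix a b assume "a \<in> G" "b \<in> G"
   then obtain F F' where "finite F" "F \<subseteq> B" "a = \<Inter>F" "finite F'" "F' \<subseteq> B" "b = \<Inter>F'" unfolding G_def by blast
   thus "a \<inter> b \<in> G" unfolding G_def by (auto intro!: exI[of _ "F \<union> F'"])
  qed
  moreover have "G \<subseteq> Pow UNIV" by simp
  ultimately show ?thesis
  proof (rule_tac sigma_sets_induct_disjoint[where G=G and \<Omega>=UNIV and A=S], goal_cases)
   case (4 A) show ?case by (rule base[OF 4(4)])
  next
   case 5 show ?case by (simp add: convergent_const)
  next
   case (6 A)
   from 6(4) have [measurable]: "A \<in> sets borel" using sig by simp
   have "?J (r m) (UNIV - A) = ?J (r m) UNIV - ?J (r m) A" for m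
    by (subst Bochner_Integration.integral_diff[symmetric]; (intro i)?)
      (auto intro!: Bochner_Integration.integral_cong simp: indicator_def)
   thus ?case using convergent_diff[OF base[OF GU] 6(5)] by simp
  next
   case (7 A)
   from 7(5) have A[measurable]: "A k \<in> sets borel" for k using sig by auto
   \<comment> \<open>The tail of the disjoint union. Its part in \<Omega> has measure tending to 0,
     so its contribution is small for all \<open>m\<close> at once, and finitely many sets decide
     convergence.\<close>
   define T where "T n = (\<Union>k. A (k + n))" for n
   have T[measurable]: "T n \<in> sets borel" for n unfolding T_def by measurable
   have split: "?J m (\<Union>k. A k) = (\<Sum>k<n. ?J m (A k)) + ?J m (T n)" for m n
   proof -
    have pt: "indicator (\<Union>k. A k) x = (\<Sum>k<n. indicator (A k) x) + (indicator (T n) x :: real)" for x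
    proof -
     have "(\<Union>k. A k) = (\<Union>k<n. A k) \<union> T n"
     proof -
      have sub: "x \<in> (\<Union>k<n. A k) \<union> T n" if "x \<in> A k" for x k
       using that by (cases "k < n") (auto simp: T_def intro: exI[of _ "k - n"])
      have "(\<Union>k. A k) \<subseteq> (\<Union>k<n. A k) \<union> T n" using sub by blast
      moreover have "(\<Union>k<n. A k) \<union> T n \<subseteq> (\<Union>k. A k)" by (auto simp: T_def)
      ultimately show ?thesis by (rule equalityI)
     qed
     moreover have "(\<Union>k<n. A k) \<inter> T n = {}"
     proof -
      have "A k \<inter> A (j + n) = {}" if "k < n" for k j
       using 7(4) that by (intro disjoint_family_onD[of A UNIV]) auto
      thus ?thesis unfolding T_def by blast
     qed
     moreover have "indicator (\<Union>k<n. A k) x = (\<Sum>k<n. indicator (A k) x :: real)"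
      by (rule indicator_UN_disjoint) (use 7(4) in \<open>auto simp: disjoint_family_on_def\<close>)
     ultimately show ?thesis by (simp add: indicator_disj_union)
    qed
    have "?J m (\<Union>k. A k) = (LBINT x. (\<Sum>k<n. indicator (A k) x * u m x) + indicator (T n) x * u m x)"
     by (simp only: pt distrib_right sum_distrib_right)
    also have "... = (\<Sum>k<n. ?J m (A k)) + ?J m (T n)"
    proof -
     have "integrable lborel (\<lambda>x. \<Sum>k<n. indicator (A k) x * u m x)"
      by (intro Bochner_Integration.integrable_sum i A)
     from Bochner_Integration.integral_add[OF this i[OF T]]
     show ?thesis by (simp only: Bochner_Integration.integral_sum[OF i[OF A]])
    qed
    finally show ?thesis .
   qed
   have Tlim: "(\<lambda>n. measure lborel (\<Omega> \<inter> T n)) \<longlonglongrightarrow> 0"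
   proof -
    have "(\<lambda>n. measure lborel (\<Omega> \<inter> T n)) \<longlonglongrightarrow> measure lborel (\<Inter>n. \<Omega> \<inter> T n)"
    proof (rule Lim_measure_decseq)
     show "decseq (\<lambda>n. \<Omega> \<inter> T n)"
     proof (rule decseq_SucI)
      fix n
      have "A (k + Suc n) \<subseteq> T n" for k unfolding T_def by (rule order_trans[OF _ UN_upper[of "Suc k"]]) auto
      thus "\<Omega> \<inter> T (Suc n) \<subseteq> \<Omega> \<inter> T n" unfolding T_def[of "Suc n"] by blast
     qed
     show "emeasure lborel (\<Omega> \<inter> T n) \<noteq> \<infinity>" for n
      using fin emeasure_mono[of "\<Omega> \<inter> T n" \<Omega> lborel] by (auto simp: top_unique)
    qed auto
    moreover have "(\<Inter>n. \<Omega> \<inter> T n) = {}"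
    proof (rule ccontr)
     assume "(\<Inter>n. \<Omega> \<inter> T n) \<noteq> {}"
     then obtain x where x: "\<And>n. x \<in> T n" by blast
     obtain k where k: "x \<in> A k" using x[of 0] by (auto simp: T_def)
     obtain j where "x \<in> A (j + Suc k)" using x[of "Suc k"] by (auto simp: T_def)
     moreover have "j + Suc k \<noteq> k" by simp
     ultimately show False using k 7(4) by (meson disjoint_family_onD disjoint_iff UNIV_I)
    qed
    ultimately show ?thesis by simp
   qed
   have "Cauchy (\<lambda>m. ?J (r m) (\<Union>k. A k))"
   proof (rule metric_CauchyI)
    fix e :: real assume e: "e > 0"
    have "(\<lambda>n. sqrt (measure lborel (\<Omega> \<inter> T n) * C)) \<longlonglongrightarrow> sqrt (0 * C)" by (intro tendsto_intros Tlim)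
    hence "\<forall>\<^sub>F n in sequentially. sqrt (measure lborel (\<Omega> \<inter> T n) * C) < e / 4"
     using e by (intro order_tendstoD(2)[of _ "sqrt (0 * C)"]) auto
    then obtain n where n: "sqrt (measure lborel (\<Omega> \<inter> T n) * C) < e / 4" by (auto simp: eventually_sequentially)
    have "convergent (\<lambda>m. \<Sum>k<n. ?J (r m) (A k))" using 7(6) by (intro convergent_sum) auto
    hence cau: "Cauchy (\<lambda>m. \<Sum>k<n. ?J (r m) (A k))" by (rule convergent_Cauchy)
    obtain N where N: "\<And>m l. m \<ge> N \<Longrightarrow> l \<ge> N \<Longrightarrow> dist (\<Sum>k<n. ?J (r m) (A k)) (\<Sum>k<n. ?J (r l) (A k)) < e / 4"
     using metric_CauchyD[OF cau, of "e / 4"] e by auto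
    have small: "\<bar>?J (r m) (T n)\<bar> < e / 4" for m using J[OF T[of n], of "r m"] n by (rule le_less_trans)
    show "\<exists>N. \<forall>m\<ge>N. \<forall>l\<ge>N. dist (?J (r m) (\<Union>k. A k)) (?J (r l) (\<Union>k. A k)) < e"
    proof (intro exI[of _ N] allI impI)
     fix m l assume "N \<le> m" "N \<le> l"
     thus "dist (?J (r m) (\<Union>k. A k)) (?J (r l) (\<Union>k. A k)) < e"
      unfolding split[of _ n] using N[of m l] small[of m] small[of l] unfolding dist_real_def by linarith
    qed
   qed
   thus ?case by (rule Cauchy_convergent)
  qed
 qed
 thus ?thesis using rm that by blast
qed

section \<open>Geometry of the cuspidal domain\<close>

lemma open_nonempty_emeasure_pos:
 fixes U :: "'a::euclidean_space set"
 assumes "open U" "U \<noteq> {}"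
 shows "emeasure lborel U > 0"
proof (rule ccontr)
 assume "\<not> ?thesis"
 hence "U \<in> null_sets lborel" using assms by (simp add: null_sets_def)
 hence "negligible U" by (simp add: negligible_iff_null_sets null_sets_completionI)
 thus False using assms open_not_negligible by blast
qed

lemma xprime_nth: "xprime e x $ i = (if i = e then 0 else x $ i)"
 by (simp add: xprime_def)

lemma xprime_linear: "xprime e (x + y) = xprime e x + xprime e y" "xprime e (x - y) = xprime e x - xprime e y"
 "xprime e (t *\<^sub>R x) = t *\<^sub>R xprime e x"
 by (simp_all add: vec_eq_iff xprime_nth)

lemma xprime_axis: "xprime e (axis e t) = 0" "xprime e (xprime e x) = xprime e x"
 by (simp_all add: vec_eq_iff xprime_nth axis_def)

lemma norm_xprime: "(norm (x :: real^'n))^2 = (norm (xprime e x))^2 + (x $ e)^2"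
proof -
 have "(norm x)^2 = (\<Sum>i\<in>UNIV. (x $ i)^2)" for x :: "real^'n"
  unfolding power2_norm_eq_inner inner_vec_def by (simp add: power2_eq_square)
 note n = this
 have "(\<Sum>i\<in>UNIV. (x $ i)^2) = (x $ e)^2 + (\<Sum>i\<in>UNIV - {e}. (x $ i)^2)" by (rule sum.remove) auto
 moreover have "(\<Sum>i\<in>UNIV. (xprime e x $ i)^2) = (xprime e x $ e)^2 + (\<Sum>i\<in>UNIV - {e}. (xprime e x $ i)^2)"
  by (rule sum.remove) auto
 moreover have "(\<Sum>i\<in>UNIV - {e}. (xprime e x $ i)^2) = (\<Sum>i\<in>UNIV - {e}. (x $ i)^2)"
  by (rule sum.cong) (auto simp: xprime_nth)
 ultimately show ?thesis by (simp add: n xprime_nth)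
qed

lemma norm_xprime_le: "norm (xprime e x) \<le> norm (x :: real^'n)"
 using norm_xprime[of x e] by (metis abs_norm_cancel abs_le_square_iff le_add_same_cancel1 zero_le_power2)

lemma continuous_xprime: "continuous_on S (xprime e)"
 unfolding xprime_def
proof (rule continuous_on_vec_lambda)
 fix i show "continuous_on S (\<lambda>x. if i = e then 0 else x $ i)"
  by (cases "i = e") (auto intro!: continuous_intros)
qed

text \<open>\<open>lip\<close> gives cones of fixed aperture and makes the scale comparable at
  neighbouring points. \<open>lt1\<close> forces a boundary point of the cusp with \<gamma>(x_n) = 1
  to have x_n = 1, which puts it on the sphere.\<close>

locale cusp =
 fixes \<gamma> :: "real \<Rightarrow> real" and e :: "'n::finite" and L :: real
 assumes n2: "CARD('n) \<ge> 2"
  and gmono: "mono_on {0..1} \<gamma>" and g0: "\<gamma> 0 = 0" and g1: "\<gamma> 1 = 1"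
  and L1: "L \<ge> 1"
  and lip: "\<And>s t. s \<in> {0..1} \<Longrightarrow> t \<in> {0..1} \<Longrightarrow> \<bar>\<gamma> s - \<gamma> t\<bar> \<le> L * \<bar>s - t\<bar>"
  and lt1: "\<And>t. 0 \<le> t \<Longrightarrow> t < 1 \<Longrightarrow> \<gamma> t < 1"
begin

definition \<Omega> :: "(real^'n) set" where "\<Omega> = cusp_domain \<gamma> e"
definition W :: "real^'n \<Rightarrow> real" where "W = cusp_weight \<gamma> e"
text \<open>Constant extension of \<gamma> beyond the unit interval, so that the scale is Lipschitz
  on the whole space and can be evaluated at points of the ball.\<close>

definition gam :: "real \<Rightarrow> real" where "gam t = \<gamma> (max 0 (min 1 t))"

lemma gam_eq: "0 \<le> t \<Longrightarrow> t \<le> 1 \<Longrightarrow> gam t = \<gamma> t" by (simp add: gam_def)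

lemma gam_mono: "s \<le> t \<Longrightarrow> gam s \<le> gam t"
 unfolding gam_def by (rule mono_onD[OF gmono]) auto

lemma gam_bounds: "0 \<le> gam t" "gam t \<le> 1"
proof -
 have "gam 0 \<le> gam (max 0 (min 1 t))" "gam (max 0 (min 1 t)) \<le> gam 1" by (intro gam_mono; simp)+
 thus "0 \<le> gam t" "gam t \<le> 1" by (simp_all add: gam_def g0 g1)
qed

lemma gam_lip: "\<bar>gam s - gam t\<bar> \<le> L * \<bar>s - t\<bar>"
proof -
 have "\<bar>gam s - gam t\<bar> \<le> L * \<bar>max 0 (min 1 s) - max 0 (min 1 t)\<bar>" unfolding gam_def by (rule lip) auto
 also have "... \<le> L * \<bar>s - t\<bar>" using L1 by (intro mult_left_mono) auto
 finally show ?thesis .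
qed

lemma gam_le: "0 \<le> t \<Longrightarrow> gam t \<le> L * t" using gam_lip[of t 0] by (simp add: gam_def g0)
lemma gam_ge1: "1 \<le> t \<Longrightarrow> gam t = 1" by (simp add: gam_def g1 min_def)
lemma gam_lt1: "t < 1 \<Longrightarrow> gam t < 1" using lt1[of "max 0 t"] by (simp add: gam_def min_def max_def split: if_splits)

lemma continuous_gam: "continuous_on S gam"
proof (rule continuous_on_subset)
 show "continuous_on UNIV gam"
  by (rule lipschitz_on_continuous_on[of L]) (use gam_lip L1 in \<open>auto simp: lipschitz_on_def dist_real_def\<close>)
qed simp

lemma gam_borel[measurable]: "gam \<in> borel_measurable borel"
 by (rule borel_measurable_continuous_onI[OF continuous_gam])

lemma norm_c: "(norm (x - axis e 2 :: real^'n))^2 = (norm (xprime e x))^2 + (x $ e - 2)^2"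
 using norm_xprime[of "x - axis e 2" e] by (simp add: xprime_linear xprime_axis)

lemma mem_ball_c: "x \<in> ball (axis e 2) (sqrt 2) \<longleftrightarrow> (norm (xprime e x))^2 + (x $ e - 2)^2 < 2"
proof -
 have "x \<in> ball (axis e 2) (sqrt 2) \<longleftrightarrow> norm (x - axis e 2) < sqrt 2" by (simp add: dist_norm norm_minus_commute)
 also have "... \<longleftrightarrow> (norm (x - axis e 2))^2 < (sqrt 2)^2"
  by (metis abs_norm_cancel abs_of_nonneg linorder_not_less power2_le_iff_abs_le norm_ge_zero real_sqrt_ge_zero zero_le_numeral)
 finally show ?thesis by (simp add: norm_c)
qed

lemma mem_cball_c: "x \<in> cball (axis e 2) (sqrt 2) \<longleftrightarrow> (norm (xprime e x))^2 + (x $ e - 2)^2 \<le> 2"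
proof -
 have "x \<in> cball (axis e 2) (sqrt 2) \<longleftrightarrow> norm (x - axis e 2) \<le> sqrt 2" by (simp add: dist_norm norm_minus_commute)
 also have "... \<longleftrightarrow> (norm (x - axis e 2))^2 \<le> (sqrt 2)^2"
  by (smt (verit) norm_ge_zero power2_le_imp_le power_mono real_sqrt_ge_zero)
 finally show ?thesis by (simp add: norm_c)
qed

lemma mem_\<Omega>: "x \<in> \<Omega> \<longleftrightarrow> (norm (xprime e x) < gam (x $ e) \<and> 0 < x $ e \<and> x $ e \<le> 1) \<or> (norm (xprime e x))^2 + (x $ e - 2)^2 < 2"
 unfolding \<Omega>_def cusp_domain_def Un_iff mem_ball_c using gam_eq[of "x $ e"] by auto

lemma ball_subset: "ball (axis e 2) (sqrt 2) \<subseteq> \<Omega>" unfolding \<Omega>_def cusp_domain_def by simp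

text \<open>With centre at height 2 the radius sqrt 2 lets the sphere pass through the rims |x'| = 1
  at heights 1 and 3; strictly between these heights the ball contains the closed unit
  cylinder.\<close>

lemma ball_cylinder: "norm (xprime e x) \<le> 1 \<Longrightarrow> 1 < x $ e \<Longrightarrow> x $ e < 3 \<Longrightarrow> (norm (xprime e x))^2 + (x $ e - 2)^2 < 2"
proof -
 assume a: "norm (xprime e x) \<le> 1" "1 < x $ e" "x $ e < 3"
 have "(norm (xprime e x))^2 \<le> 1" using a(1) by (simp add: power_le_one)
 moreover have "(x $ e - 2)^2 < 1" using a(2,3) by (simp add: abs_square_less_1)
 ultimately show ?thesis by simp
qed

text \<open>The cusp part is not open at its top x_n = 1, but there |x'| < 1 and the point lies in
  the ball.\<close>

lemma open_\<Omega>: "open \<Omega>"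
proof -
 have "\<Omega> = {x. norm (xprime e x) < gam (x $ e) \<and> 0 < x $ e \<and> x $ e < 1} \<union> ball (axis e 2) (sqrt 2)"
 proof -
  have "(norm (xprime e x))^2 + (x $ e - 2)^2 < 2" if "norm (xprime e x) < gam (x $ e)" "x $ e = 1" for x
  proof -
   have "(norm (xprime e x))^2 < 1" using that by (simp add: gam_ge1 abs_square_less_1)
   thus ?thesis using that by simp
  qed
  thus ?thesis unfolding set_eq_iff mem_\<Omega> Un_iff mem_ball_c mem_Collect_eq by (smt (verit))
 qed
 moreover have "open {x. norm (xprime e x) < gam (x $ e) \<and> 0 < x $ e \<and> x $ e < 1}"
  by (intro open_Collect_conj open_Collect_less continuous_intros continuous_xprime continuous_on_compose2[OF continuous_gam[of UNIV]]) auto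
 ultimately show ?thesis by (simp add: open_Un)
qed

lemma \<Omega>_subset: "\<Omega> \<subseteq> {x. norm (xprime e x) \<le> gam (x $ e) \<and> 0 \<le> x $ e \<and> x $ e \<le> 1} \<union> cball (axis e 2) (sqrt 2)"
proof
 fix x assume "x \<in> \<Omega>"
 thus "x \<in> {x. norm (xprime e x) \<le> gam (x $ e) \<and> 0 \<le> x $ e \<and> x $ e \<le> 1} \<union> cball (axis e 2) (sqrt 2)"
  unfolding mem_\<Omega> Un_iff mem_cball_c mem_Collect_eq by auto
qed

lemma bounded_\<Omega>: "bounded \<Omega>"
proof -
 have "norm x \<le> 2" if "norm (xprime e x) \<le> gam (x $ e)" "0 \<le> x $ e" "x $ e \<le> 1" for x
 proof -
  have "norm (xprime e x) \<le> 1" using that gam_bounds(2) order_trans by blast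
  hence "(norm (xprime e x))^2 \<le> 1" "(x $ e)^2 \<le> 1" using that by (simp_all add: power_le_one)
  hence "(norm x)^2 \<le> 2^2" using norm_xprime[of x e] by simp
  thus ?thesis by (rule power2_le_imp_le) simp
 qed
 hence "{x. norm (xprime e x) \<le> gam (x $ e) \<and> 0 \<le> x $ e \<and> x $ e \<le> 1} \<subseteq> cball 0 2" by auto
 hence "\<Omega> \<subseteq> cball 0 2 \<union> cball (axis e 2) (sqrt 2)" using \<Omega>_subset by blast
 thus ?thesis by (rule bounded_subset[rotated]) simp
qed

definition cuspcond :: "real^'n \<Rightarrow> bool" where
 "cuspcond x \<longleftrightarrow> 0 \<le> x $ e \<and> x $ e \<le> 1 \<and> norm (xprime e x) = gam (x $ e) \<and> gam (x $ e) < 1"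

definition Cus :: "(real^'n) set" where "Cus = {x \<in> frontier \<Omega>. cuspcond x}"
definition Sph :: "(real^'n) set" where "Sph = {x \<in> frontier \<Omega>. \<not> cuspcond x}"

lemma frontier_Un: "frontier \<Omega> = Cus \<union> Sph" unfolding Cus_def Sph_def by blast

lemma W_eq: "W x = (if cuspcond x then gam (x $ e) else 1)"
 unfolding W_def cusp_weight_def cuspcond_def using gam_eq[of "x $ e"] by auto

lemma W_bounds: "0 \<le> W x" "W x \<le> 1" using gam_bounds by (auto simp: W_eq)

text \<open>A frontier point in the closed cusp satisfies |x'| = \<gamma>(x_n). If it violates
  \<open>cuspcond\<close> then \<gamma>(x_n) = 1, so x_n = 1 and |x'| = 1, a point of the rim on the
  sphere. A frontier point outside the closed cusp lies in the closed ball but not in the open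
  one.\<close>

lemma Sph_sphere: "x \<in> Sph \<Longrightarrow> (norm (xprime e x))^2 + (x $ e - 2)^2 = 2"
proof -
 assume x: "x \<in> Sph"
 hence n: "x \<notin> \<Omega>" "x \<in> closure \<Omega>" using open_\<Omega> by (auto simp: Sph_def frontier_def interior_open)
 have "closed {x. norm (xprime e x) \<le> gam (x $ e) \<and> 0 \<le> x $ e \<and> x $ e \<le> 1}"
  by (intro closed_Collect_conj closed_Collect_le continuous_intros continuous_xprime continuous_on_compose2[OF continuous_gam[of UNIV]]) auto
 hence "closure \<Omega> \<subseteq> {x. norm (xprime e x) \<le> gam (x $ e) \<and> 0 \<le> x $ e \<and> x $ e \<le> 1} \<union> cball (axis e 2) (sqrt 2)"
  by (intro closure_minimal \<Omega>_subset closed_Un) auto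
 hence "(norm (xprime e x) \<le> gam (x $ e) \<and> 0 \<le> x $ e \<and> x $ e \<le> 1) \<or> (norm (xprime e x))^2 + (x $ e - 2)^2 \<le> 2"
  using n(2) unfolding mem_cball_c[symmetric] by blast
 moreover have nb: "\<not> (norm (xprime e x))^2 + (x $ e - 2)^2 < 2" "\<not> (norm (xprime e x) < gam (x $ e) \<and> 0 < x $ e \<and> x $ e \<le> 1)"
  using n(1) unfolding mem_\<Omega> by blast+
 moreover have "(norm (xprime e x))^2 + (x $ e - 2)^2 = 2" if a: "norm (xprime e x) \<le> gam (x $ e)" "0 \<le> x $ e" "x $ e \<le> 1"
 proof -
  have "gam 0 = 0" by (simp add: gam_def g0)
  hence eq: "norm (xprime e x) = gam (x $ e)" using nb(2) a by (smt (verit) norm_ge_zero)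
  hence "\<not> gam (x $ e) < 1" using x a unfolding Sph_def cuspcond_def by blast
  hence "x $ e = 1" using gam_lt1[of "x $ e"] a by linarith
  thus ?thesis using eq by (simp add: gam_ge1)
 qed
 ultimately show ?thesis by linarith
qed

text \<open>Inside the cusp the radius does not decrease upwards; above height 1 the cylinder takes
  over; and in the ball, moving up below the centre height 2 brings the point no farther from the
  centre.\<close>

lemma up_shift:
 assumes "y \<in> \<Omega>" "0 \<le> s" "y $ e + s < 2"
 shows "y + axis e s \<in> \<Omega>"
proof -
 have ye: "(y + axis e s) $ e = y $ e + s" "xprime e (y + axis e s) = xprime e y"
  by (simp_all add: xprime_linear xprime_axis)
 from assms(1) consider "norm (xprime e y) < gam (y $ e)" "0 < y $ e" "y $ e \<le> 1"
  | "(norm (xprime e y))^2 + (y $ e - 2)^2 < 2" unfolding mem_\<Omega> by blast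
 thus ?thesis
 proof cases
  case 1
  show ?thesis
  proof (cases "y $ e + s \<le> 1")
   case True
   have "gam (y $ e) \<le> gam (y $ e + s)" using assms by (intro gam_mono) simp
   thus ?thesis unfolding mem_\<Omega> ye using 1 True assms by auto
  next
   case False
   have "norm (xprime e y) \<le> 1" using 1 gam_bounds(2)[of "y $ e"] by linarith
   hence "(norm (xprime e (y + axis e s)))^2 + ((y + axis e s) $ e - 2)^2 < 2"
    by (intro ball_cylinder) (use False assms ye in auto)
   thus ?thesis unfolding mem_\<Omega> by blast
  qed
 next
  case 2
  have "(y $ e + s - 2)^2 \<le> (y $ e - 2)^2" using assms by (intro abs_le_square_iff[THEN iffD1]) auto
  thus ?thesis unfolding mem_\<Omega> ye using 2 by simp
 qed
qed

lemma shift_into_ball: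
 assumes "y \<in> \<Omega>" "y \<notin> ball (axis e 2) (sqrt 2)"
 shows "y + axis e 1 \<in> ball (axis e 2) (sqrt 2)" "y $ e \<le> 1" "0 < y $ e" "norm (xprime e y) < gam (y $ e)"
proof -
 have 1: "norm (xprime e y) < gam (y $ e)" "0 < y $ e" "y $ e \<le> 1" using assms unfolding mem_\<Omega> mem_ball_c by auto
 have "norm (xprime e y) \<le> 1" using 1 gam_bounds(2)[of "y $ e"] by linarith
 thus "y + axis e 1 \<in> ball (axis e 2) (sqrt 2)"
  unfolding mem_ball_c by (intro ball_cylinder) (use 1 in \<open>auto simp: xprime_linear xprime_axis\<close>)
 show "y $ e \<le> 1" "0 < y $ e" "norm (xprime e y) < gam (y $ e)" by fact+
qed

text \<open>\<open>cone\<close> shifts by up to \<open>MM * \<rho>\<close>. The summand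
  \<open>L\<close> pays for the variation of \<gamma> over a distance \<rho>, the 4 for the radius
  of the inner ball and for margins. \<open>c0\<close> keeps the shift within an eighth of the
  weight.\<close>

definition MM :: real where "MM = L + 4"
definition c0 :: real where "c0 = 1 / (8 * MM^2)"

lemma MM: "MM \<ge> 5" "MM = L + 4" and c0: "c0 > 0" "c0 \<le> 1" "MM * c0 \<le> 1 / 8" "MM^2 * c0 = 1 / 8"
proof -
 show M: "MM \<ge> 5" "MM = L + 4" using L1 by (auto simp: MM_def)
 thus "c0 > 0" by (simp add: c0_def)
 show "MM^2 * c0 = 1 / 8" using M by (simp add: c0_def)
 show m: "MM * c0 \<le> 1 / 8" using M 
 proof -
  have "MM * c0 = 1 / (8 * MM)" using M by (simp add: c0_def power2_eq_square)
  also have "... \<le> 1 / 8" using M by (intro divide_left_mono) auto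
  finally show ?thesis .
 qed
 have "1 * c0 \<le> MM * c0" using M \<open>c0 > 0\<close> by (intro mult_right_mono) auto
 thus "c0 \<le> 1" using m by simp
qed

text \<open>The direction of \<open>h\<close> is radial towards the axis on the side of the cusp,
  vertical on the lower part of the sphere and towards the centre on the upper part. Each choice
  keeps nearby points of the domain inside the domain, and \<open>MM\<close> makes the shift long
  enough for a whole ball of radius \<rho> to fit.\<close>

lemma cone:
 assumes x: "x \<in> frontier \<Omega>" and \<rho>: "0 < \<rho>" "\<rho> \<le> c0 * W x"
 obtains h where "norm h \<le> MM * \<rho>" "ball (x + h) \<rho> \<subseteq> \<Omega>"
  "\<And>y s. y \<in> ball x \<rho> \<Longrightarrow> y \<in> \<Omega> \<Longrightarrow> 0 \<le> s \<Longrightarrow> s \<le> 1 \<Longrightarrow> y + s *\<^sub>R h \<in> \<Omega>"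
proof -
 have "MM * \<rho> \<le> MM * (c0 * W x)" using \<rho> MM by (intro mult_left_mono) auto
 also have "... \<le> 1 / 8 * W x" using c0(3) W_bounds[of x] mult_right_mono[of "MM * c0" "1/8" "W x"] by (simp add: mult.assoc)
 finally have M1: "MM * \<rho> \<le> W x / 8" by simp
 hence M2: "MM * \<rho> \<le> 1 / 8" using W_bounds[of x] by linarith
 have "5 * \<rho> \<le> MM * \<rho>" using MM \<rho> by (intro mult_right_mono) auto
 hence r: "\<rho> \<le> 1 / 40" "\<rho> \<le> W x / 40" using M1 M2 by linarith+
 have comp: "\<bar>z $ i\<bar> \<le> norm z" for z :: "real^'n" and i by (rule component_le_norm_cart)
 show ?thesis
 proof (cases "cuspcond x")
  case True
  define q where "q = gam (x $ e)"
  have W: "W x = q" using True by (simp add: W_eq q_def)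
  have q: "q > 0" "q < 1" "norm (xprime e x) = q" "0 \<le> x $ e" "x $ e \<le> 1"
   using r \<rho> W True by (auto simp: cuspcond_def q_def)
  define th where "th = (1 / q) *\<^sub>R xprime e x"
  have th: "norm th = 1" "xprime e x = q *\<^sub>R th" "th $ e = 0" "xprime e th = th"
   using q by (auto simp: th_def xprime_linear xprime_axis xprime_nth)
  have xL: "q \<le> L * (x $ e)" using gam_le[of "x $ e"] q by (simp add: q_def)
  have Lr: "L * \<rho> \<le> (MM - 1) * \<rho>" using MM \<rho> by (intro mult_right_mono) auto
  \<comment> \<open>The height, and with it \<gamma>, stays constant along this motion, so only |y'|
    has to be watched.\<close>
  define h where "h = - (MM * \<rho>) *\<^sub>R th"
  have "ball (x + h) \<rho> \<subseteq> \<Omega>"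
  proof
   fix z assume "z \<in> ball (x + h) \<rho>"
   define w where "w = z - (x + h)"
   have w: "norm w < \<rho>" using \<open>z \<in> ball (x + h) \<rho>\<close> by (simp add: w_def dist_norm norm_minus_commute)
   have z: "z = x + h + w" by (simp add: w_def)
   have "xprime e z = (q - MM * \<rho>) *\<^sub>R th + xprime e w"
    by (simp add: z h_def xprime_linear th algebra_simps)
   hence "norm (xprime e z) \<le> norm ((q - MM * \<rho>) *\<^sub>R th) + norm (xprime e w)" by (simp only: norm_triangle_ineq)
   also have "norm ((q - MM * \<rho>) *\<^sub>R th) = q - MM * \<rho>" using M1 W q th by simp
   finally have zp: "norm (xprime e z) < q - MM * \<rho> + \<rho>" using norm_xprime_le[of e w] w by linarith
   have ze: "\<bar>z $ e - x $ e\<bar> < \<rho>" using comp[of w e] w by (simp add: z h_def th)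
   have "L * \<rho> < L * (x $ e)"
   proof -
    have "L * \<rho> < MM * \<rho>" using MM \<rho> by (intro mult_strict_right_mono) auto
    thus ?thesis using M1 W xL q by linarith
   qed
   hence pos: "\<rho> < x $ e" using L1 by simp
   show "z \<in> \<Omega>"
   proof (cases "z $ e \<le> 1")
    case True
    have "\<bar>gam (z $ e) - gam (x $ e)\<bar> \<le> L * \<bar>z $ e - x $ e\<bar>" by (rule gam_lip)
    also have "... \<le> L * \<rho>" using ze L1 by (intro mult_left_mono) auto
    finally have "gam (z $ e) \<ge> q - L * \<rho>" by (simp add: q_def)
    hence "norm (xprime e z) < gam (z $ e)" using zp Lr by (simp add: algebra_simps)
    thus ?thesis unfolding mem_\<Omega> using True ze pos by auto
   next
    case False
    have "norm (xprime e z) \<le> 1" using zp q \<open>5 * \<rho> \<le> MM * \<rho>\<close> \<rho> by linarith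
    hence "(norm (xprime e z))^2 + (z $ e - 2)^2 < 2"
     by (intro ball_cylinder) (use False ze q r in auto)
    thus ?thesis unfolding mem_\<Omega> by blast
   qed
  qed
  moreover have "y + s *\<^sub>R h \<in> \<Omega>" if y: "y \<in> ball x \<rho>" "y \<in> \<Omega>" and s: "0 \<le> s" "s \<le> 1" for y s
  proof -
   define t where "t = s * (MM * \<rho>)"
   have t: "0 \<le> t" "t \<le> MM * \<rho>" using s MM \<rho> by (auto simp: t_def mult_left_le_one_le)
   have yh: "y + s *\<^sub>R h = y - t *\<^sub>R th" by (simp add: h_def t_def)
   have "xprime e y \<bullet> th = xprime e x \<bullet> th + xprime e (y - x) \<bullet> th" by (simp add: xprime_linear inner_diff_left)
   moreover have "xprime e x \<bullet> th = q" using th by (simp add: dot_square_norm)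
   moreover have "\<bar>xprime e (y - x) \<bullet> th\<bar> \<le> norm (xprime e (y - x))"
    using Cauchy_Schwarz_ineq2[of "xprime e (y - x)" th] th(1) by simp
   moreover have "norm (xprime e (y - x)) < \<rho>" using y norm_xprime_le[of e "y - x"] by (simp add: dist_norm norm_minus_commute)
   ultimately have "xprime e y \<bullet> th \<ge> q - \<rho>" by linarith
   hence tq: "t \<le> 2 * (xprime e y \<bullet> th)" using t M1 W r q by linarith
   \<comment> \<open>Expanding the square: |y'| does not increase as long as \<open>t\<close> is at
     most twice the component of y' along \<open>th\<close>, which is at least
     \<open>q - \<rho>\<close>.\<close>
   have "(norm (xprime e y - t *\<^sub>R th))^2 = (norm (xprime e y))^2 - t * (2 * (xprime e y \<bullet> th) - t)"
    using th by (simp add: power2_norm_eq_inner inner_diff_left inner_diff_right inner_commute algebra_simps)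
     (simp add: dot_square_norm)
   also have "... \<le> (norm (xprime e y))^2" using t tq by simp
   finally have sq: "(norm (xprime e y - t *\<^sub>R th))^2 \<le> (norm (xprime e y))^2" .
   hence le: "norm (xprime e y - t *\<^sub>R th) \<le> norm (xprime e y)" by (rule power2_le_imp_le) simp
   have eqs: "xprime e (y - t *\<^sub>R th) = xprime e y - t *\<^sub>R th" "(y - t *\<^sub>R th) $ e = y $ e"
    using th by (simp_all add: xprime_linear)
   from y(2) show ?thesis unfolding yh mem_\<Omega> eqs using le sq by linarith
  qed
  moreover have "norm h \<le> MM * \<rho>" using th MM \<rho> by (simp add: h_def)
  ultimately show ?thesis using that by blast
 next
  case False
  hence "x \<in> Sph" using x by (simp add: Sph_def)
  hence sp: "(norm (xprime e x))^2 + (x $ e - 2)^2 = 2" by (rule Sph_sphere)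
  have s2: "sqrt 2 \<le> 3 / 2" "sqrt 2 \<ge> 1" by (rule real_le_lsqrt; simp add: power2_eq_square) simp
  show ?thesis
  proof (cases "x $ e < 3 / 2")
   case True
   \<comment> \<open>Near the rim the ball around \<open>x\<close> may also contain points of the
     cusp, for which a motion towards the centre need not stay inside; going up is safe for both
     parts.\<close>
   define h where "h = (axis e (MM * \<rho>) :: real^'n)"
   have hs: "s *\<^sub>R h = axis e (s * (MM * \<rho>))" for s by (simp add: h_def axis_def vec_eq_iff)
   have "(norm (x + h - axis e 2))^2 = 2 - 2 * (MM * \<rho>) * (2 - x $ e) + (MM * \<rho>)^2"
    using sp unfolding norm_c by (simp add: h_def xprime_linear xprime_axis power2_eq_square algebra_simps)
   also have "... \<le> 2 - MM * \<rho> + (MM * \<rho>)^2"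
   proof -
    have "(MM * \<rho>) * 1 \<le> (MM * \<rho>) * (2 * (2 - x $ e))" using True MM \<rho> by (intro mult_left_mono) auto
    thus ?thesis by (simp add: algebra_simps)
   qed
   also have "... \<le> (sqrt 2 - \<rho>)^2"
   proof -
    have "(MM * \<rho>) * (MM * \<rho>) \<le> (1 / 8) * (MM * \<rho>)" using M2 MM \<rho> by (intro mult_right_mono) auto
    moreover have "2 * sqrt 2 * \<rho> \<le> 3 * \<rho>" using s2 \<rho> by (intro mult_right_mono) auto
    moreover have "(sqrt 2 - \<rho>)^2 = 2 - 2 * sqrt 2 * \<rho> + \<rho>^2" by (simp add: power2_diff)
    moreover have "\<rho>^2 \<ge> 0" by simp
    ultimately show ?thesis using \<open>5 * \<rho> \<le> MM * \<rho>\<close> \<rho> by (simp only: power2_eq_square[of "MM * \<rho>"])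
   qed
   finally have "norm (x + h - axis e 2) \<le> sqrt 2 - \<rho>" by (rule power2_le_imp_le) (use s2 r in linarith)
   hence "ball (x + h) \<rho> \<subseteq> ball (axis e 2) (sqrt 2)"
    by (subst ball_subset_ball_iff) (simp add: dist_norm)
   moreover have "y + s *\<^sub>R h \<in> \<Omega>" if y: "y \<in> ball x \<rho>" "y \<in> \<Omega>" and s: "0 \<le> s" "s \<le> 1" for y s
    unfolding hs
   proof (rule up_shift[OF y(2)])
    show "0 \<le> s * (MM * \<rho>)" using s MM \<rho> by simp
    have "s * (MM * \<rho>) \<le> MM * \<rho>" using s MM \<rho> by (simp add: mult_left_le_one_le)
    moreover have "\<bar>y $ e - x $ e\<bar> < \<rho>" using comp[of "y - x" e] y by (simp add: dist_norm norm_minus_commute)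
    ultimately show "y $ e + s * (MM * \<rho>) < 2" using True M2 r by linarith
   qed
   moreover have "norm h \<le> MM * \<rho>" using MM \<rho> hs[of 1] norm_axis_1[of e] by (simp add: h_def norm_eq_sqrt_inner inner_axis_axis)
   ultimately show ?thesis using that ball_subset by blast
  next
   case False
   have nx: "norm (x - axis e 2) = sqrt 2"
    using sp norm_c[of x] by (metis norm_ge_zero real_sqrt_unique)
   define h where "h = (MM * \<rho> / sqrt 2) *\<^sub>R (axis e 2 - x)"
   have nh: "norm h = MM * \<rho>" using nx MM \<rho> by (simp add: h_def norm_minus_commute[of _ x])
   have "x + h - axis e 2 = (1 - MM * \<rho> / sqrt 2) *\<^sub>R (x - axis e 2)" by (simp add: h_def algebra_simps)
   moreover have le1: "MM * \<rho> / sqrt 2 \<le> 1"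
   proof -
    have "MM * \<rho> \<le> sqrt 2" using M2 s2(2) by linarith
    thus ?thesis by simp
   qed
   ultimately have "norm (x + h - axis e 2) = (1 - MM * \<rho> / sqrt 2) * sqrt 2" using nx by simp
   hence "norm (x + h - axis e 2) = sqrt 2 - MM * \<rho>" by (simp add: left_diff_distrib)
   hence "ball (x + h) \<rho> \<subseteq> ball (axis e 2) (sqrt 2)"
    using \<open>5 * \<rho> \<le> MM * \<rho>\<close> \<rho> by (subst ball_subset_ball_iff) (simp add: dist_norm)
   moreover have "y + s *\<^sub>R h \<in> \<Omega>" if y: "y \<in> ball x \<rho>" "y \<in> \<Omega>" and s: "0 \<le> s" "s \<le> 1" for y s
   proof -
    have "\<bar>y $ e - x $ e\<bar> < \<rho>" using comp[of "y - x" e] y by (simp add: dist_norm norm_minus_commute)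
    hence "y $ e > 1" using False r by linarith
    hence yb: "y \<in> ball (axis e 2) (sqrt 2)" using y(2) unfolding mem_\<Omega> mem_ball_c by linarith
    have "dist (axis e 2) (y + axis e 2 - x) = dist x y" by (simp add: dist_norm)
    also have "... < \<rho>" using y(1) by simp
    also have "\<rho> < sqrt 2" using r s2(2) by linarith
    finally have "dist (axis e 2) (y + axis e 2 - x) < sqrt 2" .
    \<comment> \<open>The full translation by the vector from \<open>x\<close> to the centre takes
      \<open>y\<close> to within |y - x| of the centre. The point \<open>y + s h\<close> lies on the
      segment from \<open>y\<close> to its image, and the ball is convex.\<close>
    hence y2: "y + axis e 2 - x \<in> ball (axis e 2) (sqrt 2)" by simp
    define \<tau> where "\<tau> = s * (MM * \<rho> / sqrt 2)"
    have p: "0 \<le> MM * \<rho> / sqrt 2" using MM \<rho> by (intro divide_nonneg_nonneg mult_nonneg_nonneg) auto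
    have \<tau>: "0 \<le> \<tau>" "\<tau> \<le> 1" unfolding \<tau>_def
     by (rule mult_nonneg_nonneg[OF s(1) p]) (rule mult_le_one[OF s(2) p le1])
    have "(1 - \<tau>) *\<^sub>R y + \<tau> *\<^sub>R (y + axis e 2 - x) \<in> ball (axis e 2) (sqrt 2)"
     using convex_ball[of "axis e 2 :: real^'n" "sqrt 2"] yb y2 \<tau> unfolding convex_alt by blast
    moreover have "(1 - \<tau>) *\<^sub>R y + \<tau> *\<^sub>R (y + axis e 2 - x) = y + s *\<^sub>R h"
     by (simp add: h_def \<tau>_def algebra_simps)
    ultimately show ?thesis using ball_subset by auto
   qed
   ultimately show ?thesis using that nh ball_subset by (metis order_refl subset_trans)
  qed
 qed
qed

end

section \<open>Surface bounds for spheres and surfaces of revolution\<close>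

lemma hausdorff_outer_finite_UN:
 assumes "finite I"
 shows "hausdorff_outer s (\<Union>t\<in>I. C t) \<le> (\<Sum>t\<in>I. hausdorff_outer s (C t))"
 using assms
proof (induction I rule: finite_induct)
 case (insert t I)
 have "hausdorff_outer s (\<Union>t\<in>insert t I. C t) \<le> hausdorff_outer s (C t) + hausdorff_outer s (\<Union>t\<in>I. C t)"
  using hausdorff_outer_Un[of s "C t"] by simp
 also have "... \<le> hausdorff_outer s (C t) + (\<Sum>t\<in>I. hausdorff_outer s (C t))" by (intro add_left_mono insert.IH)
 finally show ?case using insert by simp
qed (simp add: hausdorff_outer_empty)

text \<open>On a piece of a sphere-like surface where the i-th coordinate is comparable to the radius,
 that coordinate is a Lipschitz function of the others, uniformly as the radius tends to 0.\<close>

lemma sphere_graph_lipschitz: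
 fixes x z c :: "real^'n"
 assumes x: "(\<Sum>j\<in>J. (x $ j - c $ j)^2) = a^2" and z: "(\<Sum>j\<in>J. (z $ j - c $ j)^2) = b^2"
  and ab: "a \<ge> 0" "b \<ge> 0" and iJ: "i \<in> J" and s: "s = 1 \<or> s = - 1"
  and xi: "s * (x $ i - c $ i) \<ge> a / k" and zi: "s * (z $ i - c $ i) \<ge> b / k" and k: "k > 0"
  and lip: "\<bar>a - b\<bar> \<le> L * d" and d: "\<And>j. j \<noteq> i \<Longrightarrow> \<bar>x $ j - z $ j\<bar> \<le> d" and d0: "d \<ge> 0"
 shows "\<bar>x $ i - z $ i\<bar> \<le> k * (L + real CARD('n)) * d"
proof -
 have comp: "\<bar>y $ j - c $ j\<bar> \<le> r" if "(\<Sum>j\<in>J. (y $ j - c $ j)^2) = r^2" "r \<ge> 0" "j \<in> J" for y :: "real^'n" and r j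
 proof -
  have "(y $ j - c $ j)^2 \<le> (\<Sum>j\<in>J. (y $ j - c $ j)^2)" using that by (intro member_le_sum) auto
  thus ?thesis using that by (metis abs_le_square_iff abs_of_nonneg)
 qed
 define X where "X j = x $ j - c $ j" for j
 define Z where "Z j = z $ j - c $ j" for j
 have Xa: "\<bar>X j\<bar> \<le> a" and Zb: "\<bar>Z j\<bar> \<le> b" if "j \<in> J" for j using comp[OF x ab(1) that] comp[OF z ab(2) that] by (auto simp: X_def Z_def)
 have XZ: "X j - Z j = x $ j - z $ j" for j by (simp add: X_def Z_def)
 show ?thesis
 proof (cases "a + b = 0")
  case True
  hence "X i = 0" "Z i = 0" using Xa[OF iJ] Zb[OF iJ] ab by auto
  hence "x $ i - z $ i = 0" using XZ[of i] by simp
  moreover have "0 \<le> \<bar>a - b\<bar>" by simp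
  hence "0 \<le> L * d" using lip by linarith
  hence "0 \<le> (L + real CARD('n)) * d" using d0 by (simp add: distrib_right)
  hence "0 \<le> k * ((L + real CARD('n)) * d)" using k by simp
  ultimately show ?thesis by (simp add: mult.assoc)
 next
  case False
  hence abp: "a + b > 0" using ab by linarith
  have sx: "(\<Sum>j\<in>J. (X j)^2) = a^2" and sz: "(\<Sum>j\<in>J. (Z j)^2) = b^2" using x z by (simp_all add: X_def Z_def)
  have rx: "(\<Sum>j\<in>J. (X j)^2) = (X i)^2 + (\<Sum>j\<in>J - {i}. (X j)^2)"
   and rz: "(\<Sum>j\<in>J. (Z j)^2) = (Z i)^2 + (\<Sum>j\<in>J - {i}. (Z j)^2)" by (rule sum.remove; use iJ in simp)+
  \<comment> \<open>The upper estimate of this difference and the lower estimate of |X i + Z i| both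
    carry the factor \<open>a + b\<close>. It cancels, so the Lipschitz constant does not see the
    radii.\<close>
  have "(X i)^2 - (Z i)^2 = (a^2 - b^2) - (\<Sum>j\<in>J - {i}. (X j)^2 - (Z j)^2)"
   using sx sz rx rz by (simp add: sum_subtractf)
  hence "\<bar>(X i)^2 - (Z i)^2\<bar> \<le> \<bar>a^2 - b^2\<bar> + \<bar>\<Sum>j\<in>J - {i}. (X j)^2 - (Z j)^2\<bar>" by linarith
  also have "\<bar>a^2 - b^2\<bar> \<le> (a + b) * (L * d)"
  proof -
   have "a^2 - b^2 = (a + b) * (a - b)" by (simp add: power2_eq_square algebra_simps)
   thus ?thesis using lip abp by (simp add: abs_mult mult_left_mono)
  qed
  also have "\<bar>\<Sum>j\<in>J - {i}. (X j)^2 - (Z j)^2\<bar> \<le> (\<Sum>j\<in>J - {i}. (a + b) * d)"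
  proof (rule order_trans[OF sum_abs], rule sum_mono)
   fix j assume j: "j \<in> J - {i}"
   have "(X j)^2 - (Z j)^2 = (X j + Z j) * (X j - Z j)" by (simp add: power2_eq_square algebra_simps)
   hence "\<bar>(X j)^2 - (Z j)^2\<bar> = \<bar>X j + Z j\<bar> * \<bar>X j - Z j\<bar>" by (simp add: abs_mult)
   also have "... \<le> (a + b) * d"
    using Xa[of j] Zb[of j] d[of j] j abp XZ by (intro mult_mono) auto
   finally show "\<bar>(X j)^2 - (Z j)^2\<bar> \<le> (a + b) * d" .
  qed
  also have "(\<Sum>j\<in>J - {i}. (a + b) * d) \<le> real CARD('n) * ((a + b) * d)"
   using abp d0 by (simp add: mult_right_mono card_mono)
  finally have 1: "\<bar>(X i)^2 - (Z i)^2\<bar> \<le> (a + b) * ((L + real CARD('n)) * d)" by (simp add: algebra_simps)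
  have "(a + b) / k \<le> s * (X i + Z i)" using xi zi by (simp add: X_def Z_def add_divide_distrib algebra_simps)
  also have "... \<le> \<bar>X i + Z i\<bar>" using s by auto
  finally have 2: "(a + b) / k \<le> \<bar>X i + Z i\<bar>" .
  have "((a + b) / k) * \<bar>X i - Z i\<bar> \<le> \<bar>X i + Z i\<bar> * \<bar>X i - Z i\<bar>" using 2 by (rule mult_right_mono) simp
  also have "... = \<bar>(X i)^2 - (Z i)^2\<bar>" by (simp add: abs_mult[symmetric] power2_eq_square algebra_simps)
  also note 1
  finally have "(a + b) * (\<bar>X i - Z i\<bar> / k) \<le> (a + b) * ((L + real CARD('n)) * d)" by simp
  hence "\<bar>X i - Z i\<bar> / k \<le> (L + real CARD('n)) * d" using abp by (simp only: mult_le_cancel_left_pos)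
  thus ?thesis using k by (simp add: XZ divide_le_eq mult_ac)
 qed
qed

text \<open>2n counts the charts, one for each coordinate and sign; the rest is the bound of
  \<open>hausdorff_upper\<close> with Lipschitz constant n(L + n), without the power of the
  radius.\<close>

definition sphere_const :: "'n itself \<Rightarrow> real \<Rightarrow> real" where
 "sphere_const t L = 2 * real CARD('n) *
   (hausdorff_const (real CARD('n) - 1) * (real CARD('n) * (real CARD('n) * (L + real CARD('n)))) ^ (CARD('n) - 1))"

text \<open>The radius \<open>R\<close> is constant for the sphere and \<gamma>(x_n) for the side of
  the cusp, where \<open>J\<close> leaves out the axis. Some coordinate in \<open>J\<close> has size
  at least R/n, for otherwise the squares could not add up to R^2; together with its sign it selects
  the chart.\<close>

lemma sphere_like_upper:
 fixes P :: "(real^'n) set"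
 assumes n: "CARD('n) \<ge> 2" and L: "L \<ge> 0"
  and P: "\<And>x. x \<in> P \<Longrightarrow> (\<Sum>j\<in>J. (x $ j - c $ j)^2) = (R x)^2" "\<And>x. x \<in> P \<Longrightarrow> R x \<ge> 0"
  and lip: "\<And>x z d i. x \<in> P \<Longrightarrow> z \<in> P \<Longrightarrow> i \<in> J \<Longrightarrow> (\<And>j. j \<noteq> i \<Longrightarrow> \<bar>x $ j - z $ j\<bar> \<le> d) \<Longrightarrow> \<bar>R x - R z\<bar> \<le> L * d"
  and ne: "J \<noteq> {}" and r: "r > 0"
 shows "surface_outer (P \<inter> ball y r) \<le> ennreal (sphere_const TYPE('n) L * r ^ (CARD('n) - 1))"
proof -
 define k where "k = real CARD('n)"
 have k: "k \<ge> 2" using n by (simp add: k_def)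
 define Q where "Q i s = {x\<in>P. s * (x $ i - c $ i) \<ge> R x / k}" for i s
 define Lk where "Lk = k * (L + k)"
 have "1 * 1 \<le> k * (L + k)" using k L by (intro mult_mono) auto
 hence Lk: "Lk \<ge> 1" by (simp add: Lk_def)
 let ?b = "hausdorff_const (real CARD('n) - 1) * (real CARD('n) * Lk * r) ^ (CARD('n) - 1)"
 have hc: "hausdorff_const (real CARD('n) - 1) > 0" by (rule hausdorff_const_pos) (use n in simp)
 have b0: "0 \<le> ?b" using hc Lk r by (intro mult_nonneg_nonneg zero_le_power) auto
 have one: "surface_outer {x\<in>Q i s. \<forall>j. j \<noteq> i \<longrightarrow> \<bar>x $ j - y $ j\<bar> \<le> r} \<le> ennreal ?b"
  if i: "i \<in> J" and s: "s \<in> {1, - 1}" for i and s :: real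
 proof (rule hausdorff_upper[OF n Lk r])
  fix x z d assume x: "x \<in> Q i s" and z: "z \<in> Q i s" and d: "\<And>j. j \<noteq> i \<Longrightarrow> \<bar>x $ j - z $ j\<bar> \<le> d"
  have "\<exists>j. j \<noteq> i"
  proof (rule ccontr)
   assume "\<nexists>j. j \<noteq> i"
   hence "UNIV = {i}" by auto
   hence "CARD('n) = 1" by (metis card_1_singleton_iff One_nat_def)
   thus False using n by simp
  qed
  then obtain j where "j \<noteq> i" by blast
  hence d0: "d \<ge> 0" using d[of j] by linarith
  show "\<bar>x $ i - z $ i\<bar> \<le> Lk * d" unfolding Lk_def k_def
  proof (rule sphere_graph_lipschitz[where x=x and z=z and s=s and c=c and J=J and a="R x" and b="R z"])
   have xz: "x \<in> P" "z \<in> P" using x z by (auto simp: Q_def)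
   show "\<bar>R x - R z\<bar> \<le> L * d" by (rule lip[OF xz i d])
  qed (use x z s i d d0 k P in \<open>auto simp: Q_def k_def\<close>)
 qed
 have "P \<inter> ball y r \<subseteq> (\<Union>(i, s)\<in>J \<times> {1, - 1}. {x\<in>Q i s. \<forall>j. j \<noteq> i \<longrightarrow> \<bar>x $ j - y $ j\<bar> \<le> r})"
 proof
  fix x assume x: "x \<in> P \<inter> ball y r"
  have cl: "\<bar>x $ j - y $ j\<bar> \<le> r" for j
   using component_le_norm_cart[of "x - y" j] x by (simp add: dist_norm norm_minus_commute)
  have "\<exists>i\<in>J. (R x / k)^2 \<le> (x $ i - c $ i)^2"
  proof (rule ccontr)
   assume "\<not> ?thesis"
   hence "(\<Sum>j\<in>J. (x $ j - c $ j)^2) < (\<Sum>j\<in>J. (R x / k)^2)"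
    using ne by (intro sum_strict_mono) auto
   also have "... \<le> k * (R x / k)^2" by (simp add: k_def card_mono mult_right_mono)
   also have "... = (R x)^2 / k" using k by (simp add: power2_eq_square)
   also have "... \<le> (R x)^2" using k by (simp add: divide_le_eq mult_le_cancel_left1)
   finally show False using P(1)[of x] x by simp
  qed
  then obtain i where i: "i \<in> J" "(R x / k)^2 \<le> (x $ i - c $ i)^2" by blast
  have "R x / k \<le> \<bar>x $ i - c $ i\<bar>" using i(2) P(2)[of x] x k by (metis IntD1 abs_le_square_iff abs_of_nonneg divide_nonneg_nonneg order_trans zero_le_numeral)
  hence "x \<in> Q i 1 \<or> x \<in> Q i (- 1)" using x by (auto simp: Q_def)
  thus "x \<in> (\<Union>(i, s)\<in>J \<times> {1, - 1}. {x\<in>Q i s. \<forall>j. j \<noteq> i \<longrightarrow> \<bar>x $ j - y $ j\<bar> \<le> r})"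
   using i(1) cl by blast
 qed
 hence "surface_outer (P \<inter> ball y r)
   \<le> surface_outer (\<Union>t\<in>J \<times> {1, - 1}. case t of (i, s) \<Rightarrow> {x\<in>Q i s. \<forall>j. j \<noteq> i \<longrightarrow> \<bar>x $ j - y $ j\<bar> \<le> r})"
  by (rule hausdorff_outer_mono)
 also have "... \<le> (\<Sum>t\<in>J \<times> {1, - 1}. surface_outer (case t of (i, s) \<Rightarrow> {x\<in>Q i s. \<forall>j. j \<noteq> i \<longrightarrow> \<bar>x $ j - y $ j\<bar> \<le> r}))"
  by (rule hausdorff_outer_finite_UN) simp
 also have "... \<le> (\<Sum>t\<in>J \<times> {1, - 1::real}. ennreal ?b)"
 proof (rule sum_mono)
  fix t :: "'n \<times> real" assume "t \<in> J \<times> {1, - 1}"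
  thus "surface_outer (case t of (i, s) \<Rightarrow> {x\<in>Q i s. \<forall>j. j \<noteq> i \<longrightarrow> \<bar>x $ j - y $ j\<bar> \<le> r}) \<le> ennreal ?b"
   using one[of "fst t" "snd t"] by (simp add: mem_Times_iff split_beta)
 qed
 also have "... = ennreal (real (card J * 2) * ?b)"
 proof -
  have "card (J \<times> {1, - 1::real}) = card J * 2" by (simp add: card_cartesian_product)
  hence "(\<Sum>t\<in>J \<times> {1, - 1::real}. ennreal ?b) = of_nat (card J * 2) * ennreal ?b" by (simp only: sum_constant)
  thus ?thesis using b0 by (subst ennreal_mult) (auto simp: ennreal_of_nat_eq_real_of_nat)
 qed
 also have "... \<le> ennreal (2 * real CARD('n) * ?b)"
  using b0 by (intro ennreal_leI mult_right_mono) (auto simp: card_mono)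
 also have "2 * real CARD('n) * ?b = sphere_const TYPE('n) L * r ^ (CARD('n) - 1)"
  by (simp add: sphere_const_def Lk_def k_def power_mult_distrib mult_ac)
 finally show ?thesis .
qed

section \<open>The weighted boundary measure and its kernel estimates\<close>

context cusp
begin

definition CA :: real where "CA = sphere_const TYPE('n) L"
text \<open>The Hausdorff measure lives on the frontier with its Caratheodory sets. Transported to
  the Borel sets of the whole space it can be paired with \<open>lborel\<close> in Tonelli's
  theorem.\<close>

definition HB :: "(real^'n) measure" where
 "HB = distr (hausdorff_measure_on (real CARD('n) - 1) (frontier \<Omega>)) borel (\<lambda>x. x)"

lemma CA_nonneg: "CA \<ge> 0"
proof -
 have "hausdorff_const (real CARD('n) - 1) > 0" by (rule hausdorff_const_pos) (use n2 in simp)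
 thus ?thesis unfolding CA_def sphere_const_def using L1 by (intro mult_nonneg_nonneg zero_le_power) auto
qed

lemma xprime_borel[measurable]: "xprime e \<in> borel_measurable borel"
 by (rule borel_measurable_continuous_onI[OF continuous_xprime])

lemma coord_borel[measurable]: "(\<lambda>x::real^'n. x $ i) \<in> borel_measurable borel"
 by (intro borel_measurable_continuous_onI continuous_intros)

lemma ball_borel[measurable]: "ball (x::real^'n) r \<in> sets borel" by simp

lemma \<Omega>_borel[measurable]: "\<Omega> \<in> sets borel" using open_\<Omega> by simp

lemma Cus_borel[measurable]: "Cus \<in> sets borel" and Sph_borel[measurable]: "Sph \<in> sets borel"
 and frontier_borel[measurable]: "frontier \<Omega> \<in> sets borel" and W_borel[measurable]: "W \<in> borel_measurable borel"
proof -
 show f: "frontier \<Omega> \<in> sets borel" by (simp add: borel_closed)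
 have c: "{x. cuspcond x} \<in> sets borel" unfolding cuspcond_def by measurable
 have "Cus = frontier \<Omega> \<inter> {x. cuspcond x}" "Sph = frontier \<Omega> - {x. cuspcond x}" by (auto simp: Cus_def Sph_def)
 thus "Cus \<in> sets borel" "Sph \<in> sets borel" using f c by auto
 have [measurable]: "Measurable.pred borel cuspcond" unfolding cuspcond_def[abs_def] by measurable
 have "W = (\<lambda>x. if cuspcond x then gam (x $ e) else 1)" by (auto simp: W_eq)
 also have "... \<in> borel_measurable borel" by measurable
 finally show "W \<in> borel_measurable borel" .
qed

lemma sets_HB[measurable_cong]: "sets HB = sets borel" and space_HB: "space HB = UNIV"
 by (simp_all add: HB_def)

lemma emeasure_HB: "A \<in> sets borel \<Longrightarrow> emeasure HB A = surface_outer (frontier \<Omega> \<inter> A)"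
proof -
 let ?H = "hausdorff_measure_on (real CARD('n) - 1) (frontier \<Omega>)"
 assume A: "A \<in> sets borel"
 hence "emeasure HB A = emeasure ?H ((\<lambda>x. x) -` A \<inter> space ?H)"
  unfolding HB_def by (rule emeasure_distr[OF id_measurable_hausdorff])
 also have "(\<lambda>x. x) -` A \<inter> space ?H = frontier \<Omega> \<inter> A" by (auto simp: space_hausdorff)
 finally show ?thesis using emeasure_hausdorff[OF borel_in_hausdorff_sets[OF A]] by simp
qed

lemma Sph_upper: "r > 0 \<Longrightarrow> surface_outer (Sph \<inter> ball y r) \<le> ennreal (CA * r ^ (CARD('n) - 1))"
 unfolding CA_def
proof (rule sphere_like_upper[where J=UNIV and c="axis e 2" and R="\<lambda>_. sqrt 2"])
 fix x assume "x \<in> Sph"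
 hence "(norm (x - axis e 2))^2 = 2" using Sph_sphere norm_c by simp
 thus "(\<Sum>j\<in>UNIV. (x $ j - axis e 2 $ j)^2) = (sqrt 2)^2"
  unfolding power2_norm_eq_inner inner_vec_def by (simp add: power2_eq_square)
next
 fix x z :: "real^'n" and d :: real and i :: 'n
 assume "\<And>j. j \<noteq> i \<Longrightarrow> \<bar>x $ j - z $ j\<bar> \<le> d"
 moreover obtain j where "j \<noteq> i" using n2 by (metis card_2_iff' card_le_Suc0_iff_eq finite_code not_less_eq_eq numeral_2_eq_2 UNIV_I)
 ultimately have "d \<ge> 0" by (meson abs_ge_zero order_trans)
 thus "\<bar>sqrt 2 - sqrt 2\<bar> \<le> L * d" using L1 by simp
qed (use n2 L1 in auto)

lemma Cus_upper: "r > 0 \<Longrightarrow> surface_outer (Cus \<inter> ball y r) \<le> ennreal (CA * r ^ (CARD('n) - 1))"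
 unfolding CA_def
proof (rule sphere_like_upper[where J="UNIV - {e}" and c=0 and R="\<lambda>x. gam (x $ e)"])
 fix x assume "x \<in> Cus"
 hence "(norm (xprime e x))^2 = (gam (x $ e))^2" by (simp add: Cus_def cuspcond_def)
 moreover have "(norm (xprime e x))^2 = (\<Sum>j\<in>UNIV. (xprime e x $ j)^2)"
  unfolding power2_norm_eq_inner inner_vec_def by (simp add: power2_eq_square)
 moreover have "... = (xprime e x $ e)^2 + (\<Sum>j\<in>UNIV - {e}. (xprime e x $ j)^2)" by (rule sum.remove) auto
 moreover have "(\<Sum>j\<in>UNIV - {e}. (xprime e x $ j)^2) = (\<Sum>j\<in>UNIV - {e}. (x $ j - 0 $ j)^2)"
  by (rule sum.cong) (auto simp: xprime_nth)
 ultimately show "(\<Sum>j\<in>UNIV - {e}. (x $ j - 0 $ j)^2) = (gam (x $ e))^2" by (simp add: xprime_nth)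
next
 fix x z :: "real^'n" and d :: real and i :: 'n
 assume "\<And>j. j \<noteq> i \<Longrightarrow> \<bar>x $ j - z $ j\<bar> \<le> d" and "i \<in> UNIV - {e}"
 hence "\<bar>x $ e - z $ e\<bar> \<le> d" by auto
 hence "L * \<bar>x $ e - z $ e\<bar> \<le> L * d" using L1 by (intro mult_left_mono) auto
 thus "\<bar>gam (x $ e) - gam (z $ e)\<bar> \<le> L * d" using gam_lip[of "x $ e" "z $ e"] by linarith
next
 obtain j where "j \<noteq> e" using n2 by (metis card_2_iff' card_le_Suc0_iff_eq finite_code not_less_eq_eq numeral_2_eq_2 UNIV_I)
 thus "UNIV - {e} \<noteq> {}" by auto
qed (use n2 L1 gam_bounds in auto)

text \<open>The scale \<sigma> agrees with the weight on \<open>P\<close> but is Lipschitz on the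
  whole space: after Tonelli it is evaluated at interior points \<open>y\<close> instead of the
  boundary points \<open>x\<close>.\<close>

definition piece :: "(real^'n) set \<Rightarrow> (real^'n \<Rightarrow> real) \<Rightarrow> bool" where
 "piece P \<sigma> \<longleftrightarrow> P \<in> sets borel \<and> P \<subseteq> frontier \<Omega> \<and> (\<forall>x\<in>P. W x = \<sigma> x) \<and> (\<forall>x. 0 \<le> \<sigma> x \<and> \<sigma> x \<le> 1) \<and>
   (\<forall>x z. \<bar>\<sigma> x - \<sigma> z\<bar> \<le> L * norm (x - z)) \<and>
   (\<forall>y. \<forall>r>0. surface_outer (P \<inter> ball y r) \<le> ennreal (CA * r ^ (CARD('n) - 1)))"

lemma piece_Sph: "piece Sph (\<lambda>_. 1)"
proof -
 have "Sph \<subseteq> frontier \<Omega>" "\<forall>x\<in>Sph. W x = 1" by (auto simp: Sph_def W_eq)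
 thus ?thesis unfolding piece_def using Sph_upper L1 Sph_borel by simp
qed

lemma piece_Cus: "piece Cus (\<lambda>x. gam (x $ e))"
proof -
 have "\<bar>gam (x $ e) - gam (z $ e)\<bar> \<le> L * norm (x - z)" for x z :: "real^'n"
 proof -
  have "L * \<bar>x $ e - z $ e\<bar> \<le> L * norm (x - z)" using component_le_norm_cart[of "x - z" e] L1 by (intro mult_left_mono) auto
  thus ?thesis using gam_lip[of "x $ e" "z $ e"] by linarith
 qed
 moreover have "Cus \<subseteq> frontier \<Omega>" "\<forall>x\<in>Cus. W x = gam (x $ e)" by (auto simp: Cus_def W_eq)
 ultimately show ?thesis unfolding piece_def using Cus_upper gam_bounds Cus_borel by simp
qed

lemma piece_subset: "piece P \<sigma> \<Longrightarrow> Q \<subseteq> P \<Longrightarrow> Q \<in> sets borel \<Longrightarrow> piece Q \<sigma>"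
 unfolding piece_def by (meson Int_mono hausdorff_outer_mono order_refl order_trans subsetD)

definition bm :: "(real^'n) set \<Rightarrow> (real^'n) measure" where
 "bm P = density HB (\<lambda>x. ennreal (W x) * indicator P x)"

lemma sets_bm[measurable_cong]: "sets (bm P) = sets borel" and space_bm: "space (bm P) = UNIV"
 by (simp_all add: bm_def sets_HB space_HB)

lemma HB_finite: "emeasure HB UNIV < \<infinity>"
proof -
 obtain R where R: "R > 0" "frontier \<Omega> \<subseteq> ball 0 R"
   proof -
  have "bounded (frontier \<Omega>)" by (rule bounded_subset[OF bounded_closure[OF bounded_\<Omega>]]) (simp add: frontier_def)
  from bounded_subset_ballD[OF this, of 0] show ?thesis using that by blast
 qed
 have "emeasure HB UNIV = surface_outer ((Cus \<inter> ball 0 R) \<union> (Sph \<inter> ball 0 R))"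
  using R by (subst emeasure_HB) (auto simp: frontier_Un Un_absorb2 Int_absorb2 Int_Un_distrib2[symmetric])
 also have "... \<le> surface_outer (Cus \<inter> ball 0 R) + surface_outer (Sph \<inter> ball 0 R)"
  by (rule hausdorff_outer_Un)
 also have "... \<le> ennreal (CA * R ^ (CARD('n) - 1)) + ennreal (CA * R ^ (CARD('n) - 1))"
  by (intro add_mono Cus_upper Sph_upper R)
 also have "... < \<infinity>" by simp
 finally show ?thesis .
qed

lemma nn_integral_bm:
 assumes [measurable]: "f \<in> borel_measurable borel" "P \<in> sets borel"
 shows "(\<integral>\<^sup>+x. f x \<partial>bm P) = (\<integral>\<^sup>+x. ennreal (W x) * indicator P x * f x \<partial>HB)"
 unfolding bm_def by (rule nn_integral_density) measurable

lemma bm_finite: assumes [measurable]: "P \<in> sets borel" shows "emeasure (bm P) UNIV < \<infinity>"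
proof -
 have "emeasure (bm P) UNIV = (\<integral>\<^sup>+x. ennreal (W x) * indicator P x * indicator UNIV x \<partial>HB)"
  unfolding bm_def by (subst emeasure_density) (auto simp: sets_HB)
 also have "... \<le> (\<integral>\<^sup>+x. 1 \<partial>HB)"
  by (intro nn_integral_mono) (use W_bounds in \<open>auto simp: indicator_def ennreal_le_1\<close>)
 also have "... < \<infinity>" using HB_finite by (simp add: space_HB)
 finally show ?thesis .
qed

lemma finite_measure_bm: "P \<in> sets borel \<Longrightarrow> finite_measure (bm P)"
 using bm_finite by (intro finite_measureI) (auto simp: space_bm less_top[symmetric])

lemma AE_bm: assumes "P \<in> sets borel" shows "AE x in bm P. x \<in> P \<and> W x > 0"
 unfolding bm_def using assms
 by (subst AE_density) (auto simp: indicator_def intro!: AE_I2 split: if_splits)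

text \<open>\<open>KK\<close> adds the radius of the inner ball to the shift \<open>MM\<close>, so
  that everything used at \<open>x\<close> with radius \<rho> lies in
  \<open>ball x (KK * \<rho>)\<close>. The choice of \<open>\<kappa>\<close> makes
  \<open>L * KK * \<kappa>\<close> at most 1/2, whence the scales at two points that see each other
  differ by at most a factor 2.\<close>

definition KK :: real where "KK = MM + 1"
definition \<kappa> :: real where "\<kappa> = c0 / L"

lemma KK: "KK \<ge> 6" and kappa: "\<kappa> > 0" "\<kappa> \<le> c0" "\<kappa> \<le> 1" "L * KK * \<kappa> \<le> 1 / 2"
proof -
 show K: "KK \<ge> 6" using MM by (simp add: KK_def)
 show p: "\<kappa> > 0" using c0 L1 by (simp add: \<kappa>_def)
 show k: "\<kappa> \<le> c0" using c0 L1 by (simp add: \<kappa>_def divide_le_eq mult_le_cancel_left1)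
 thus "\<kappa> \<le> 1" using c0 by linarith
 have "L * KK * \<kappa> = (MM + 1) * c0" using L1 by (simp add: \<kappa>_def KK_def)
 also have "... \<le> 2 * (MM * c0)" using MM c0 by (simp add: distrib_right)
 also have "... \<le> 1 / 2" using c0 by simp
 finally show "L * KK * \<kappa> \<le> 1 / 2" .
qed

text \<open>The scale does not vary much between a boundary point and the points it sees,
 so the kernel is integrated over a ball of radius comparable to the scale at y.\<close>

lemma kernel_bound:
 assumes P: "piece P \<sigma>" and r: "0 < r" "r \<le> \<kappa>"
 shows "(\<integral>\<^sup>+x. ennreal (1 / (r * \<sigma> x) ^ j) * indicator {x. dist x y < KK * (r * \<sigma> x)} x \<partial>bm P)
  \<le> ennreal (2 * \<sigma> y * (2 / (r * \<sigma> y)) ^ j * (CA * (2 * KK * r * \<sigma> y) ^ (CARD('n) - 1)))"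
proof -
 have [measurable]: "P \<in> sets borel" and sub: "P \<subseteq> frontier \<Omega>" and W: "\<And>x. x \<in> P \<Longrightarrow> W x = \<sigma> x"
  and s: "\<And>x. 0 \<le> \<sigma> x" "\<And>x. \<sigma> x \<le> 1" and lp: "\<And>x z. \<bar>\<sigma> x - \<sigma> z\<bar> \<le> L * norm (x - z)"
  and up: "\<And>y r. r > 0 \<Longrightarrow> surface_outer (P \<inter> ball y r) \<le> ennreal (CA * r ^ (CARD('n) - 1))"
  using P unfolding piece_def by auto
 have "continuous_on UNIV \<sigma>"
  by (rule lipschitz_on_continuous_on[of L]) (use lp L1 in \<open>auto simp: lipschitz_on_def dist_norm\<close>)
 hence [measurable]: "\<sigma> \<in> borel_measurable borel" by (rule borel_measurable_continuous_onI)
 have cmp: "\<sigma> x \<le> 2 * \<sigma> y \<and> \<sigma> y \<le> 2 * \<sigma> x" if "dist x y < KK * (r * \<sigma> x)" for x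
 proof -
  have "\<bar>\<sigma> x - \<sigma> y\<bar> \<le> L * dist x y" using lp[of x y] by (simp add: dist_norm)
  also have "... \<le> L * (KK * (r * \<sigma> x))" using that L1 by (intro mult_left_mono) auto
  also have "... \<le> L * (KK * (\<kappa> * \<sigma> x))" using L1 KK r s by (intro mult_left_mono mult_right_mono) auto
  also have "... \<le> (1 / 2) * \<sigma> x" using mult_right_mono[OF kappa(4) s(1)[of x]] by (simp add: mult_ac)
  finally show ?thesis using s[of x] s[of y] by linarith
 qed
 show ?thesis
 proof (cases "\<sigma> y = 0")
  \<comment> \<open>At scale 0 nothing sees \<open>y\<close>: comparability gives
    \<open>\<sigma> x = 0\<close>, against the strict inequality.\<close>
  case True
  have "\<not> dist x y < KK * (r * \<sigma> x)" for x
  proof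
   assume d: "dist x y < KK * (r * \<sigma> x)"
   hence "\<sigma> x = 0" using cmp[OF d] True s(1)[of x] by simp
   thus False using d by (simp add: zero_le_dist not_less[symmetric])
  qed
  thus ?thesis by simp
 next
  case False
  hence sy: "\<sigma> y > 0" using s(1)[of y] by simp
  define \<rho> where "\<rho> = 2 * KK * r * \<sigma> y"
  have \<rho>: "\<rho> > 0" using KK r sy by (simp add: \<rho>_def)
  have "(\<integral>\<^sup>+x. ennreal (1 / (r * \<sigma> x) ^ j) * indicator {x. dist x y < KK * (r * \<sigma> x)} x \<partial>bm P)
   = (\<integral>\<^sup>+x. ennreal (W x) * indicator P x * (ennreal (1 / (r * \<sigma> x) ^ j) * indicator {x. dist x y < KK * (r * \<sigma> x)} x) \<partial>HB)"
   by (rule nn_integral_bm) measurable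
  also have "... \<le> (\<integral>\<^sup>+x. ennreal (2 * \<sigma> y * (2 / (r * \<sigma> y)) ^ j) * indicator (P \<inter> ball y \<rho>) x \<partial>HB)"
  proof (rule nn_integral_mono)
   fix x
   show "ennreal (W x) * indicator P x * (ennreal (1 / (r * \<sigma> x) ^ j) * indicator {x. dist x y < KK * (r * \<sigma> x)} x)
    \<le> ennreal (2 * \<sigma> y * (2 / (r * \<sigma> y)) ^ j) * indicator (P \<inter> ball y \<rho>) x"
   proof (cases "x \<in> P \<and> dist x y < KK * (r * \<sigma> x)")
    case True
    note c = cmp[OF conjunct2[OF True]]
    have sx: "\<sigma> x > 0" using c sy by linarith
    have "KK * (r * \<sigma> x) \<le> KK * (r * (2 * \<sigma> y))" using KK r c by (intro mult_left_mono) auto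
    hence "x \<in> ball y \<rho>" using True by (simp add: \<rho>_def dist_commute mult_ac)
    moreover have "W x * (1 / (r * \<sigma> x) ^ j) \<le> 2 * \<sigma> y * (2 / (r * \<sigma> y)) ^ j"
    proof (rule mult_mono)
     have "1 / (r * \<sigma> x) \<le> 2 / (r * \<sigma> y)" using c sx sy r by (simp add: field_simps)
     hence "(1 / (r * \<sigma> x)) ^ j \<le> (2 / (r * \<sigma> y)) ^ j" using r sx by (intro power_mono) auto
     thus "1 / (r * \<sigma> x) ^ j \<le> (2 / (r * \<sigma> y)) ^ j" by (simp add: power_divide)
    qed (use c W True sy sx r in auto)
    hence "ennreal (W x) * ennreal (1 / (r * \<sigma> x) ^ j) \<le> ennreal (2 * \<sigma> y * (2 / (r * \<sigma> y)) ^ j)"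
     using W_bounds[of x] sx r by (subst ennreal_mult[symmetric]) (auto intro: ennreal_leI)
    ultimately show ?thesis using True by simp
   qed auto
  qed
  also have "... = ennreal (2 * \<sigma> y * (2 / (r * \<sigma> y)) ^ j) * emeasure HB (P \<inter> ball y \<rho>)"
   by (rule nn_integral_cmult_indicator) (simp add: sets_HB)
  also have "emeasure HB (P \<inter> ball y \<rho>) = surface_outer (P \<inter> ball y \<rho>)"
   using sub by (subst emeasure_HB) (auto simp: Int_absorb1 Int_assoc[symmetric] Int_absorb2)
  also have "... \<le> ennreal (CA * \<rho> ^ (CARD('n) - 1))" by (rule up[OF \<rho>])
  finally have "(\<integral>\<^sup>+x. ennreal (1 / (r * \<sigma> x) ^ j) * indicator {x. dist x y < KK * (r * \<sigma> x)} x \<partial>bm P)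
   \<le> ennreal (2 * \<sigma> y * (2 / (r * \<sigma> y)) ^ j) * ennreal (CA * \<rho> ^ (CARD('n) - 1))" by (simp add: mult_left_mono)
  also have "... = ennreal (2 * \<sigma> y * (2 / (r * \<sigma> y)) ^ j * (CA * \<rho> ^ (CARD('n) - 1)))"
   using sy r CA_nonneg \<rho> by (intro ennreal_mult[symmetric]) auto
  finally show ?thesis unfolding \<rho>_def .
 qed
qed

text \<open>Exchanging the order of integration turns local integrals around boundary points into
  one integral over the region \<open>Y\<close> seen from \<open>P\<close>. The exponent
  \<open>j\<close> is n - 2 for the energy and n for the square of the function.\<close>

lemma kernel_tonelli:
 assumes P: "piece P \<sigma>" and r: "0 < r" "r \<le> \<kappa>" and [measurable]: "F \<in> borel_measurable borel" "Y \<in> sets borel"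
  and Y: "\<And>x y. x \<in> P \<Longrightarrow> y \<in> \<Omega> \<Longrightarrow> dist x y < KK * (r * \<sigma> x) \<Longrightarrow> y \<in> Y"
  and B: "\<And>y. y \<in> Y \<Longrightarrow> 2 * \<sigma> y * (2 / (r * \<sigma> y)) ^ j * (CA * (2 * KK * r * \<sigma> y) ^ (CARD('n) - 1)) \<le> B"
 shows "(\<integral>\<^sup>+x. ennreal (1 / (r * \<sigma> x) ^ j) * (\<integral>\<^sup>+y. F y * indicator (\<Omega> \<inter> ball x (KK * (r * \<sigma> x))) y \<partial>lborel) \<partial>bm P)
  \<le> ennreal B * (\<integral>\<^sup>+y. F y * indicator Y y \<partial>lborel)"
proof -
 have Pb[measurable]: "P \<in> sets borel" and lp: "\<And>x z. \<bar>\<sigma> x - \<sigma> z\<bar> \<le> L * norm (x - z)"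
  using P unfolding piece_def by auto
 have "continuous_on UNIV \<sigma>"
  by (rule lipschitz_on_continuous_on[of L]) (use lp L1 in \<open>auto simp: lipschitz_on_def dist_norm\<close>)
 hence [measurable]: "\<sigma> \<in> borel_measurable borel" by (rule borel_measurable_continuous_onI)
 interpret finite_measure "bm P" by (rule finite_measure_bm) measurable
 interpret pair_sigma_finite "bm P" "lborel :: (real^'n) measure" ..
 let ?k = "\<lambda>x y. ennreal (1 / (r * \<sigma> x) ^ j) * indicator {x. dist x y < KK * (r * \<sigma> x)} x"
 have "(\<integral>\<^sup>+x. ennreal (1 / (r * \<sigma> x) ^ j) * (\<integral>\<^sup>+y. F y * indicator (\<Omega> \<inter> ball x (KK * (r * \<sigma> x))) y \<partial>lborel) \<partial>bm P)
  = (\<integral>\<^sup>+x. (\<integral>\<^sup>+y. F y * indicator \<Omega> y * ?k x y \<partial>lborel) \<partial>bm P)"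
 proof (rule nn_integral_cong)
  fix x
  have "ennreal (1 / (r * \<sigma> x) ^ j) * (\<integral>\<^sup>+y. F y * indicator (\<Omega> \<inter> ball x (KK * (r * \<sigma> x))) y \<partial>lborel)
   = (\<integral>\<^sup>+y. ennreal (1 / (r * \<sigma> x) ^ j) * (F y * indicator (\<Omega> \<inter> ball x (KK * (r * \<sigma> x))) y) \<partial>lborel)"
   by (rule nn_integral_cmult[symmetric]) measurable
  also have "... = (\<integral>\<^sup>+y. F y * indicator \<Omega> y * ?k x y \<partial>lborel)"
   by (rule nn_integral_cong) (auto simp: indicator_def mult.commute)
  finally show "ennreal (1 / (r * \<sigma> x) ^ j) * (\<integral>\<^sup>+y. F y * indicator (\<Omega> \<inter> ball x (KK * (r * \<sigma> x))) y \<partial>lborel)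
   = (\<integral>\<^sup>+y. F y * indicator \<Omega> y * ?k x y \<partial>lborel)" .
 qed
 also have "... = (\<integral>\<^sup>+y. (\<integral>\<^sup>+x. F y * indicator \<Omega> y * ?k x y \<partial>bm P) \<partial>lborel)"
 proof (rule Fubini'[symmetric])
  have "{p :: (real^'n) \<times> (real^'n). dist (fst p) (snd p) < KK * (r * \<sigma> (fst p))} \<in> sets (bm P \<Otimes>\<^sub>M lborel)"
  proof -
   have "{p \<in> space (bm P \<Otimes>\<^sub>M lborel). dist (fst p) (snd p) < KK * (r * \<sigma> (fst p))} \<in> sets (bm P \<Otimes>\<^sub>M lborel)"
    by measurable
   thus ?thesis by (simp add: space_pair_measure space_bm)
  qed
  hence "(\<lambda>p. F (snd p) * indicator \<Omega> (snd p) * (ennreal (1 / (r * \<sigma> (fst p)) ^ j) *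
    indicator {p :: (real^'n) \<times> (real^'n). dist (fst p) (snd p) < KK * (r * \<sigma> (fst p))} p)) \<in> borel_measurable (bm P \<Otimes>\<^sub>M lborel)"
   by measurable
  moreover have "(\<lambda>p. F (snd p) * indicator \<Omega> (snd p) * (ennreal (1 / (r * \<sigma> (fst p)) ^ j) *
    indicator {p :: (real^'n) \<times> (real^'n). dist (fst p) (snd p) < KK * (r * \<sigma> (fst p))} p)) =
   (\<lambda>(x, y). F y * indicator \<Omega> y * ?k x y)" by (auto simp: indicator_def fun_eq_iff)
  ultimately show "(\<lambda>(x, y). F y * indicator \<Omega> y * ?k x y) \<in> borel_measurable (bm P \<Otimes>\<^sub>M lborel)" by simp
 qed
 also have "... \<le> (\<integral>\<^sup>+y. ennreal B * (F y * indicator Y y) \<partial>lborel)"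
 proof (rule nn_integral_mono)
  fix y
  show "(\<integral>\<^sup>+x. F y * indicator \<Omega> y * ?k x y \<partial>bm P) \<le> ennreal B * (F y * indicator Y y)"
  proof (cases "y \<in> Y")
   case True
   have "(\<integral>\<^sup>+x. F y * indicator \<Omega> y * ?k x y \<partial>bm P) = F y * indicator \<Omega> y * (\<integral>\<^sup>+x. ?k x y \<partial>bm P)"
    by (rule nn_integral_cmult) measurable
   also have "... \<le> F y * 1 * ennreal B"
    using order_trans[OF kernel_bound[OF P r] ennreal_leI[OF B[OF True]]]
    by (intro mult_mono) (auto simp: indicator_def)
   finally show ?thesis using True by (simp add: mult.commute)
  next
   case False
   have "AE x in bm P. F y * indicator \<Omega> y * ?k x y = 0"
    using AE_bm[OF Pb] by eventually_elim (use Y False in \<open>auto simp: indicator_def\<close>)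
   hence "(\<integral>\<^sup>+x. F y * indicator \<Omega> y * ?k x y \<partial>bm P) = (\<integral>\<^sup>+x. 0 \<partial>bm P)" by (rule nn_integral_cong_AE)
   thus ?thesis by simp
  qed
 qed
 also have "... = ennreal B * (\<integral>\<^sup>+y. F y * indicator Y y \<partial>lborel)"
  by (rule nn_integral_cmult) measurable
 finally show ?thesis .
qed

end

section \<open>Traces\<close>

lemma dist_set_measurable:
 assumes [measurable]: "f \<in> borel_measurable borel"
 shows "{p :: ('a::euclidean_space) \<times> 'a. dist (fst p) (snd p) < f (fst p)} \<in> sets (borel \<Otimes>\<^sub>M lborel)"
proof -
 have "{p \<in> space (borel \<Otimes>\<^sub>M lborel). dist (fst p) (snd p) < f (fst p)} \<in> sets (borel \<Otimes>\<^sub>M (lborel :: 'a measure))"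
  by measurable
 thus ?thesis by (simp add: space_pair_measure)
qed

lemma ball_nn_integral_measurable:
 fixes F :: "'a::euclidean_space \<Rightarrow> ennreal"
 assumes [measurable]: "f \<in> borel_measurable borel" "F \<in> borel_measurable borel" "S \<in> sets borel"
 shows "(\<lambda>x. \<integral>\<^sup>+y. F y * indicator (S \<inter> ball x (f x)) y \<partial>lborel) \<in> borel_measurable borel"
proof -
 note [measurable] = dist_set_measurable[OF assms(1)]
 have "(\<lambda>x. \<integral>\<^sup>+y. F y * indicator S y * indicator {p :: 'a \<times> 'a. dist (fst p) (snd p) < f (fst p)} (x, y) \<partial>lborel) \<in> borel_measurable borel"
  by measurable
 moreover have "F y * indicator S y * indicator {p :: 'a \<times> 'a. dist (fst p) (snd p) < f (fst p)} (x, y) = F y * indicator (S \<inter> ball x (f x)) y" for x y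
  by (auto simp: indicator_def)
 ultimately show ?thesis by simp
qed

lemma ball_integral_measurable:
 fixes F :: "'a::euclidean_space \<Rightarrow> real"
 assumes [measurable]: "f \<in> borel_measurable borel" "F \<in> borel_measurable borel" "S \<in> sets borel"
 shows "(\<lambda>x. \<integral>y. indicator (S \<inter> ball x (f x)) y * F y \<partial>lborel) \<in> borel_measurable borel"
proof -
 note [measurable] = dist_set_measurable[OF assms(1)]
 have "(\<lambda>x. \<integral>y. F y * indicator S y * indicator {p :: 'a \<times> 'a. dist (fst p) (snd p) < f (fst p)} (x, y) \<partial>lborel) \<in> borel_measurable borel"
  by measurable
 moreover have "F y * indicator S y * indicator {p :: 'a \<times> 'a. dist (fst p) (snd p) < f (fst p)} (x, y) = indicator (S \<inter> ball x (f x)) y * F y" for x y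
  by (auto simp: indicator_def)
 ultimately show ?thesis by simp
qed

lemma energy_mono: "S \<subseteq> T \<Longrightarrow> energy q S \<le> energy q T"
 unfolding energy_def by (intro nn_integral_mono mult_left_mono) (auto simp: indicator_def)

context cusp
begin

definition avg :: "(real^'n \<Rightarrow> real) \<Rightarrow> real^'n \<Rightarrow> real \<Rightarrow> real" where
 "avg u x r = (LBINT y. indicator (\<Omega> \<inter> ball x r) y * u y) / measure lborel (\<Omega> \<inter> ball x r)"

definition V :: real where "V = unit_ball_vol (real CARD('n))"

lemma V_pos: "V > 0" by (simp add: V_def)

lemma emeasure_ball_V: "r \<ge> 0 \<Longrightarrow> emeasure lborel (ball (x::real^'n) r) = ennreal (V * r ^ CARD('n))"
 using emeasure_ball[of r x] by (simp add: V_def)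

lemma emeasure_\<Omega>_finite: "emeasure lborel \<Omega> < \<infinity>"
 by (rule emeasure_bounded_finite[OF bounded_\<Omega>])

lemma emeasure_sub: assumes "S \<in> sets borel" "S \<subseteq> \<Omega>" shows "emeasure lborel S = ennreal (measure lborel S)"
 using emeasure_mono[of S \<Omega> lborel] assms emeasure_\<Omega>_finite
 by (intro emeasure_eq_ennreal_measure) (auto simp: top_unique)

text \<open>The inner ball of \<open>cone\<close> at radius \<open>r / KK\<close> lies in the ball
  of radius \<open>r\<close>, since \<open>KK\<close> allows for the shift.\<close>

lemma vol_lower:
 assumes x: "x \<in> frontier \<Omega>" and r: "0 < r" "r \<le> c0 * W x"
 shows "measure lborel (\<Omega> \<inter> ball x r) \<ge> V * (r / KK) ^ CARD('n)"
proof -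
 define \<rho> where "\<rho> = r / KK"
 have \<rho>: "0 < \<rho>" "\<rho> \<le> r" "r = KK * \<rho>" using r KK by (auto simp: \<rho>_def divide_le_eq mult_le_cancel_left1)
 have \<rho>W: "\<rho> \<le> c0 * W x" using \<rho>(2) r(2) by linarith
 obtain h where h: "norm h \<le> MM * \<rho>" "ball (x + h) \<rho> \<subseteq> \<Omega>"
  by (rule cone[OF x \<rho>(1) \<rho>W])
 have "ball (x + h) \<rho> \<subseteq> ball x r"
  using h(1) \<rho> by (subst ball_subset_ball_iff) (auto simp: dist_norm KK_def algebra_simps)
 hence "ball (x + h) \<rho> \<subseteq> \<Omega> \<inter> ball x r" using h(2) by blast
 hence "emeasure lborel (ball (x + h) \<rho>) \<le> emeasure lborel (\<Omega> \<inter> ball x r)" by (rule emeasure_mono) simp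
 hence "ennreal (V * \<rho> ^ CARD('n)) \<le> ennreal (measure lborel (\<Omega> \<inter> ball x r))"
  using \<rho> by (subst (asm) emeasure_ball_V) (auto simp: emeasure_sub)
 thus ?thesis by (simp add: \<rho>_def)
qed

definition C1 :: real where "C1 = (2 * KK) ^ CARD('n) * (2 * MM^2 + 8 * 2 ^ CARD('n)) / V"

lemma C1_nonneg: "C1 \<ge> 0"
 unfolding C1_def using KK MM V_pos by (intro divide_nonneg_nonneg mult_nonneg_nonneg add_nonneg_nonneg) auto

text \<open>\<open>a\<close> is the average over the inner ball of \<open>cone\<close> and does not
  depend on \<open>r\<close>. The part of the domain near \<open>x\<close> is shifted into that
  ball, where Poincare's inequality holds. The power of \<rho> is what scaling leaves: \<rho>^2 from
  the squared lengths, divided by a volume of order \<rho>^n.\<close>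

lemma avg_ball_compare:
 assumes sp: "sob_pair \<Omega> u q" and x: "x \<in> frontier \<Omega>" and \<rho>: "0 < \<rho>" "\<rho> \<le> c0 * W x"
 obtains a where "\<And>r. \<rho> / 2 \<le> r \<Longrightarrow> r \<le> \<rho> \<Longrightarrow>
   ennreal ((avg u x r - a)^2) \<le> ennreal (C1 / \<rho> ^ (CARD('n) - 2)) * energy q (\<Omega> \<inter> ball x (KK * \<rho>))"
proof -
 note [measurable] = sob_meas[OF open_\<Omega> bounded_\<Omega> sp]
 have K: "KK > 0" using KK by simp
 obtain h where h: "norm h \<le> MM * \<rho>" "ball (x + h) \<rho> \<subseteq> \<Omega>"
  "\<And>y s. y \<in> ball x \<rho> \<Longrightarrow> y \<in> \<Omega> \<Longrightarrow> 0 \<le> s \<Longrightarrow> s \<le> 1 \<Longrightarrow> y + s *\<^sub>R h \<in> \<Omega>"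
 proof (rule cone[OF x \<rho>])
  fix h assume a: "norm h \<le> MM * \<rho>" "ball (x + h) \<rho> \<subseteq> \<Omega>"
   "\<And>y s. y \<in> ball x \<rho> \<Longrightarrow> y \<in> \<Omega> \<Longrightarrow> 0 \<le> s \<Longrightarrow> s \<le> 1 \<Longrightarrow> y + s *\<^sub>R h \<in> \<Omega>"
  show thesis by (rule that[OF a(1,2)]) (rule a(3))
 qed
 let ?B = "ball (x + h) \<rho>" and ?S = "\<Omega> \<inter> ball x (KK * \<rho>)" and ?E = "ball x \<rho> \<inter> \<Omega>"
 let ?n = "CARD('n)"
 have BS: "?B \<subseteq> ?S"
 proof -
  have "ball (x + h) \<rho> \<subseteq> ball x (KK * \<rho>)"
   using h(1) \<rho> by (subst ball_subset_ball_iff) (auto simp: dist_norm KK_def algebra_simps)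
  thus ?thesis using h(2) by blast
 qed
 have shift: "y + s *\<^sub>R h \<in> \<Omega> \<inter> ?S" if "y \<in> ?E" "0 \<le> s" "s \<le> 1" for y s
 proof -
  have "norm (s *\<^sub>R h) \<le> MM * \<rho>"
  proof -
   have "s * norm h \<le> 1 * (MM * \<rho>)" using that h(1) by (intro mult_mono) auto
   thus ?thesis using that by simp
  qed
  moreover have "dist x (y + s *\<^sub>R h) \<le> dist x y + norm (s *\<^sub>R h)"
   using norm_triangle_ineq4[of "x - y" "s *\<^sub>R h"] by (simp add: dist_norm algebra_simps)
  ultimately have "dist x (y + s *\<^sub>R h) < KK * \<rho>" using that by (simp add: KK_def algebra_simps)
  thus ?thesis using h(3)[of y s] that by auto
 qed
 have T1: "nsq_on ?E (\<lambda>y. u (y + h) - u y) \<le> ennreal ((MM * \<rho>)^2) * energy q ?S"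
 proof -
  have "nsq_on ?E (\<lambda>y. u (y + h) - u y) \<le> ennreal ((norm h)^2) * energy q ?S"
   by (rule sob_translation[OF open_\<Omega> bounded_\<Omega> sp]) (use open_\<Omega> shift in auto)
  also have "... \<le> ennreal ((MM * \<rho>)^2) * energy q ?S"
   using h(1) by (intro mult_right_mono ennreal_leI power_mono) auto
  finally show ?thesis .
 qed
 have T2: "(\<integral>\<^sup>+y. nsq_on ?B (\<lambda>z. u z - u y) * indicator ?B y \<partial>lborel)
   \<le> ennreal ((2 * \<rho>)^2 * (V * (2 * \<rho>) ^ ?n)) * energy q ?S"
 proof -
  have "(\<integral>\<^sup>+y. nsq_on ?B (\<lambda>z. u z - u y) * indicator ?B y \<partial>lborel)
   \<le> ennreal ((2 * \<rho>)^2) * emeasure lborel (ball (0::real^'n) (2 * \<rho>)) * energy q ?B"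
  proof (rule sob_poincare[OF open_\<Omega> bounded_\<Omega> sp])
   fix y z assume "y \<in> ?B" "z \<in> ?B"
   hence "dist y z < \<rho> + \<rho>" by (intro dist_triangle_less_add[of _ "x + h"]) (auto simp: dist_commute)
   thus "norm (z - y) < 2 * \<rho>" by (simp add: dist_norm norm_minus_commute)
  qed (use h(2) in auto)
  also have "... \<le> ennreal ((2 * \<rho>)^2) * ennreal (V * (2 * \<rho>) ^ ?n) * energy q ?S"
   using \<rho> BS by (subst emeasure_ball_V) (auto intro!: mult_left_mono energy_mono)
  also have "ennreal ((2 * \<rho>)^2) * ennreal (V * (2 * \<rho>) ^ ?n) = ennreal ((2 * \<rho>)^2 * (V * (2 * \<rho>) ^ ?n))"
   using V_pos \<rho> by (intro ennreal_mult[symmetric]) auto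
  finally show ?thesis .
 qed
 define \<Phi> where "\<Phi> y = nsq_on ?B (\<lambda>z. u z - u y)" for y
 have [measurable]: "\<Phi> \<in> borel_measurable borel" unfolding \<Phi>_def by measurable
 let ?bv = "ennreal (V * \<rho> ^ ?n)"
 have bv: "emeasure lborel ?B = ?bv" using \<rho> by (simp add: emeasure_ball_V)
 \<comment> \<open>The difference u(z) - u(y) is routed through u(y + h): one leg is the translation
   error, the other takes place inside the inner ball.\<close>
 have pt: "\<Phi> y \<le> 2 * (ennreal ((u (y + h) - u y)^2) * ?bv) + 2 * \<Phi> (y + h)" for y
 proof -
  have "\<Phi> y \<le> (\<integral>\<^sup>+z. (2 * ennreal ((u (y + h) - u y)^2)) * indicator ?B z + 2 * (ennreal ((u z - u (y + h))^2) * indicator ?B z) \<partial>lborel)"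
   unfolding \<Phi>_def
  proof (rule nn_integral_mono)
   fix z
   have "ennreal ((u z - u y)^2) \<le> ennreal (2 * (u (y + h) - u y)^2 + 2 * (u z - u (y + h))^2)"
    using square_diff_le[of "u z" "u y" "u (y + h)"] by (intro ennreal_leI) simp
   also have "... = 2 * ennreal ((u (y + h) - u y)^2) + 2 * ennreal ((u z - u (y + h))^2)"
    by (simp add: ennreal_plus ennreal_mult')
   finally show "ennreal ((u z - u y)^2) * indicator ?B z \<le>
     (2 * ennreal ((u (y + h) - u y)^2)) * indicator ?B z + 2 * (ennreal ((u z - u (y + h))^2) * indicator ?B z)"
    by (auto simp: indicator_def)
  qed
  also have "... = (2 * ennreal ((u (y + h) - u y)^2)) * ?bv + 2 * \<Phi> (y + h)"
   unfolding \<Phi>_def by (subst nn_integral_add) (auto simp: nn_integral_cmult nn_integral_cmult_indicator bv)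
  finally show ?thesis by (simp add: mult.assoc)
 qed
 have "(\<integral>\<^sup>+y. \<Phi> y * indicator ?E y \<partial>lborel) \<le>
   (\<integral>\<^sup>+y. (2 * ?bv) * (ennreal ((u (y + h) - u y)^2) * indicator ?E y) + 2 * (\<Phi> (y + h) * indicator ?B (y + h)) \<partial>lborel)"
 proof (rule nn_integral_mono)
  fix y
  have "y + h \<in> ?B" if "y \<in> ?E" using that by (simp add: dist_norm)
  thus "\<Phi> y * indicator ?E y \<le> (2 * ?bv) * (ennreal ((u (y + h) - u y)^2) * indicator ?E y) + 2 * (\<Phi> (y + h) * indicator ?B (y + h))"
   using pt[of y] by (auto simp: indicator_def mult_ac)
 qed
 also have "... = (2 * ?bv) * nsq_on ?E (\<lambda>y. u (y + h) - u y) + 2 * (\<integral>\<^sup>+y. \<Phi> (y + h) * indicator ?B (y + h) \<partial>lborel)"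
  by (subst nn_integral_add) (auto simp: nn_integral_cmult)
 also have "(\<integral>\<^sup>+y. \<Phi> (y + h) * indicator ?B (y + h) \<partial>lborel) = (\<integral>\<^sup>+y. \<Phi> y * indicator ?B y \<partial>lborel)"
  by (rule nn_integral_translate) measurable
 also have "(2 * ?bv) * nsq_on ?E (\<lambda>y. u (y + h) - u y) + 2 * (\<integral>\<^sup>+y. \<Phi> y * indicator ?B y \<partial>lborel)
   \<le> (2 * ?bv) * (ennreal ((MM * \<rho>)^2) * energy q ?S) + 2 * (ennreal ((2 * \<rho>)^2 * (V * (2 * \<rho>) ^ ?n)) * energy q ?S)"
  using T1 T2 unfolding \<Phi>_def by (intro add_mono mult_left_mono) auto
 also have "... = ennreal (V * \<rho> ^ ?n * \<rho>^2 * (2 * MM^2 + 8 * 2 ^ ?n)) * energy q ?S"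
 proof -
  have two: "2 * ennreal t = ennreal (2 * t)" for t
   by (subst ennreal_mult') auto
  have "(2 * ?bv) * ennreal ((MM * \<rho>)^2) = ennreal (2 * (V * \<rho> ^ ?n) * (MM * \<rho>)^2)"
   unfolding two using V_pos \<rho> by (intro ennreal_mult[symmetric]) auto
  moreover have "2 * ennreal ((2 * \<rho>)^2 * (V * (2 * \<rho>) ^ ?n)) = ennreal (2 * ((2 * \<rho>)^2 * (V * (2 * \<rho>) ^ ?n)))"
   by (rule two)
  moreover have "ennreal (2 * (V * \<rho> ^ ?n) * (MM * \<rho>)^2) + ennreal (2 * ((2 * \<rho>)^2 * (V * (2 * \<rho>) ^ ?n)))
    = ennreal (2 * (V * \<rho> ^ ?n) * (MM * \<rho>)^2 + 2 * ((2 * \<rho>)^2 * (V * (2 * \<rho>) ^ ?n)))"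
   using V_pos \<rho> by (intro ennreal_plus[symmetric]) auto
  moreover have "2 * (V * \<rho> ^ ?n) * (MM * \<rho>)^2 + 2 * ((2 * \<rho>)^2 * (V * (2 * \<rho>) ^ ?n)) = V * \<rho> ^ ?n * \<rho>^2 * (2 * MM^2 + 8 * 2 ^ ?n)"
   by (simp add: power_mult_distrib algebra_simps)
  ultimately show ?thesis by (simp only: mult.assoc[symmetric] distrib_right[symmetric])
 qed
 finally have E: "(\<integral>\<^sup>+y. \<Phi> y * indicator ?E y \<partial>lborel) \<le> ennreal (V * \<rho> ^ ?n * \<rho>^2 * (2 * MM^2 + 8 * 2 ^ ?n)) * energy q ?S" .
 define a where "a = (LBINT y. indicator ?B y * u y) / (V * \<rho> ^ ?n)"
 show ?thesis
 proof (rule that[of a])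
  fix r assume r: "\<rho> / 2 \<le> r" "r \<le> \<rho>"
  hence r0: "r > 0" using \<rho> by linarith
  let ?A = "\<Omega> \<inter> ball x r"
  let ?m = "measure lborel ?A"
  have m: "?m \<ge> V * (\<rho> / (2 * KK)) ^ ?n"
  proof -
   have "V * (\<rho> / (2 * KK)) ^ ?n \<le> V * (r / KK) ^ ?n"
    using V_pos r \<rho> K by (intro mult_left_mono power_mono) (auto simp: field_simps)
   also have "... \<le> ?m" using r r0 \<rho> by (intro vol_lower[OF x]) auto
   finally show ?thesis .
  qed
  have m0: "V * (\<rho> / (2 * KK)) ^ ?n > 0" using V_pos \<rho> K by simp
  have mp: "?m > 0" using m m0 by linarith
  have vp: "V * \<rho> ^ ?n > 0" using V_pos \<rho> by simp
  have "ennreal ((avg u x r - a)^2) \<le> ennreal (1 / (?m * (V * \<rho> ^ ?n))) * (\<integral>\<^sup>+y. \<Phi> y * indicator ?A y \<partial>lborel)"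
   unfolding avg_def a_def \<Phi>_def
   by (rule average_diff_le[OF sob_integrable(1)[OF open_\<Omega> bounded_\<Omega> sp] _ _ emeasure_sub mp bv vp]) auto
  also have "... \<le> ennreal (1 / (?m * (V * \<rho> ^ ?n))) * (\<integral>\<^sup>+y. \<Phi> y * indicator ?E y \<partial>lborel)"
   using r by (intro mult_left_mono nn_integral_mono) (auto simp: indicator_def)
  also have "... \<le> ennreal (1 / (?m * (V * \<rho> ^ ?n))) * (ennreal (V * \<rho> ^ ?n * \<rho>^2 * (2 * MM^2 + 8 * 2 ^ ?n)) * energy q ?S)"
   by (intro mult_left_mono E) simp
  also have "... = ennreal (1 / (?m * (V * \<rho> ^ ?n)) * (V * \<rho> ^ ?n * \<rho>^2 * (2 * MM^2 + 8 * 2 ^ ?n))) * energy q ?S"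
   using mp vp V_pos \<rho> by (subst ennreal_mult) (auto simp: mult.assoc)
  also have "... \<le> ennreal (C1 / \<rho> ^ (?n - 2)) * energy q ?S"
  proof (intro mult_right_mono ennreal_leI)
   have "1 / (?m * (V * \<rho> ^ ?n)) * (V * \<rho> ^ ?n * \<rho>^2 * (2 * MM^2 + 8 * 2 ^ ?n)) = \<rho>^2 * (2 * MM^2 + 8 * 2 ^ ?n) / ?m"
   proof -
    have "1 / (m * b) * (b * r * s) = r * s / m" if "b \<noteq> 0" for m b r s :: real using that by simp
    from this[of "V * \<rho> ^ ?n"] show ?thesis using vp V_pos \<rho> by simp
   qed
   also have "... \<le> \<rho>^2 * (2 * MM^2 + 8 * 2 ^ ?n) / (V * (\<rho> / (2 * KK)) ^ ?n)"
    using m m0 mp by (intro divide_left_mono mult_nonneg_nonneg add_nonneg_nonneg) auto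
   also have "... = C1 * (\<rho>^2 / \<rho> ^ ?n)"
   proof -
    have "r * t / (v * (p / k)) = k * t / v * (r / p)" for r t v p k :: real by simp
    thus ?thesis unfolding C1_def power_divide by simp
   qed
   also have "\<rho>^2 / \<rho> ^ ?n = 1 / \<rho> ^ (?n - 2)"
   proof -
    have "?n = 2 + (?n - 2)" using n2 by simp
    hence "\<rho> ^ ?n = \<rho>^2 * \<rho> ^ (?n - 2)" by (metis power_add)
    thus ?thesis using \<rho> by simp
   qed
   finally show "1 / (?m * (V * \<rho> ^ ?n)) * (V * \<rho> ^ ?n * \<rho>^2 * (2 * MM^2 + 8 * 2 ^ ?n)) \<le> C1 / \<rho> ^ (?n - 2)" by simp
  qed simp
  finally show "ennreal ((avg u x r - a)^2) \<le> ennreal (C1 / \<rho> ^ (?n - 2)) * energy q ?S" .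
 qed
qed

text \<open>The factor 4 comes from comparing two averages through the common value \<open>a\<close>
  of \<open>avg_ball_compare\<close>. The bound is real rather than \<open>ennreal\<close> so that
  its square roots can be summed.\<close>

definition dev :: "(real^'n \<Rightarrow> real^'n) \<Rightarrow> real^'n \<Rightarrow> real \<Rightarrow> real" where
 "dev q x \<rho> = 4 * (C1 / \<rho> ^ (CARD('n) - 2)) * enn2real (energy q (\<Omega> \<inter> ball x (KK * \<rho>)))"

lemma energy_finite: "sob_pair \<Omega> u q \<Longrightarrow> energy q S < \<infinity>"
proof -
 assume sp: "sob_pair \<Omega> u q"
 have "energy q S \<le> nsq lborel (\<lambda>x. norm (q x))"
  unfolding energy_def by (intro nn_integral_mono) (auto simp: indicator_def)
 also have "... < \<infinity>" using sob_pairD(4)[OF sp] unfolding integrable_iff_bounded by simp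
 finally show ?thesis .
qed

lemma avg_compare:
 assumes sp: "sob_pair \<Omega> u q" and x: "x \<in> frontier \<Omega>" and \<rho>: "0 < \<rho>" "\<rho> \<le> c0 * W x"
  and r: "\<rho> / 2 \<le> r" "r \<le> \<rho>" and r': "\<rho> / 2 \<le> r'" "r' \<le> \<rho>"
 shows "(avg u x r - avg u x r')^2 \<le> dev q x \<rho>"
proof -
 let ?e = "energy q (\<Omega> \<inter> ball x (KK * \<rho>))"
 have e: "?e = ennreal (enn2real ?e)" using energy_finite[OF sp, of "\<Omega> \<inter> ball x (KK * \<rho>)"] by simp
 have c: "C1 / \<rho> ^ (CARD('n) - 2) \<ge> 0" using C1_nonneg \<rho> by simp
 obtain a where a: "\<And>r. \<rho> / 2 \<le> r \<Longrightarrow> r \<le> \<rho> \<Longrightarrow> ennreal ((avg u x r - a)^2) \<le> ennreal (C1 / \<rho> ^ (CARD('n) - 2)) * ?e"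
  using avg_ball_compare[OF sp x \<rho>] by blast
 have b: "(avg u x r - a)^2 \<le> C1 / \<rho> ^ (CARD('n) - 2) * enn2real ?e" if "\<rho> / 2 \<le> r" "r \<le> \<rho>" for r
 proof -
  have "ennreal ((avg u x r - a)^2) \<le> ennreal (C1 / \<rho> ^ (CARD('n) - 2) * enn2real ?e)"
  proof -
   have "ennreal ((avg u x r - a)^2) \<le> ennreal (C1 / \<rho> ^ (CARD('n) - 2)) * ?e" by (rule a[OF that])
   also have "... = ennreal (C1 / \<rho> ^ (CARD('n) - 2)) * ennreal (enn2real ?e)" using e by (rule arg_cong)
   also have "... = ennreal (C1 / \<rho> ^ (CARD('n) - 2) * enn2real ?e)" by (rule ennreal_mult[symmetric]) (use c in auto)
   finally show ?thesis .
  qed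
  moreover have "0 \<le> C1 / \<rho> ^ (CARD('n) - 2) * enn2real ?e" using c by (rule mult_nonneg_nonneg) simp
  ultimately show ?thesis using ennreal_le_iff by blast
 qed
 have "(avg u x r - avg u x r')^2 \<le> 2 * (avg u x r - a)^2 + 2 * (avg u x r' - a)^2"
  using square_diff_le[of "avg u x r" "avg u x r'" a] by (simp add: power2_commute)
 also have "... \<le> 4 * (C1 / \<rho> ^ (CARD('n) - 2) * enn2real ?e)" using b[OF r] b[OF r'] by linarith
 also have "... = dev q x \<rho>" by (simp add: dev_def)
 finally show ?thesis .
qed


lemma measure_ball_measurable:
 assumes [measurable]: "f \<in> borel_measurable borel"
 shows "(\<lambda>x. measure lborel (\<Omega> \<inter> ball x (f x))) \<in> borel_measurable borel"
proof -
 have "(\<lambda>x. \<integral>\<^sup>+y. 1 * indicator (\<Omega> \<inter> ball x (f x)) y \<partial>lborel) \<in> borel_measurable borel"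
  by (rule ball_nn_integral_measurable) auto
 hence "(\<lambda>x. enn2real (\<integral>\<^sup>+y. 1 * indicator (\<Omega> \<inter> ball x (f x)) y \<partial>lborel)) \<in> borel_measurable borel" by measurable
 thus ?thesis by (simp add: measure_def)
qed

lemma avg_measurable:
 assumes [measurable]: "f \<in> borel_measurable borel" "u \<in> borel_measurable borel"
 shows "(\<lambda>x. avg u x (f x)) \<in> borel_measurable borel"
 unfolding avg_def
 by (intro borel_measurable_divide ball_integral_measurable measure_ball_measurable) auto

lemma avg_square_le:
 assumes [measurable]: "u \<in> borel_measurable borel" and x: "x \<in> frontier \<Omega>" and \<rho>: "0 < \<rho>" "\<rho> \<le> c0 * W x"
 shows "ennreal ((avg u x \<rho>)^2) \<le> ennreal (KK ^ CARD('n) / V * (1 / \<rho> ^ CARD('n))) *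
  nsq_on (\<Omega> \<inter> ball x \<rho>) u"
proof -
 let ?A = "\<Omega> \<inter> ball x \<rho>"
 let ?m = "measure lborel ?A" and ?I = "\<integral>y. indicator ?A y * u y \<partial>lborel"
 have m: "?m \<ge> V * (\<rho> / KK) ^ CARD('n)" by (rule vol_lower[OF x \<rho>])
 have p: "V * (\<rho> / KK) ^ CARD('n) > 0" using V_pos \<rho> KK by simp
 have mp: "?m > 0" using m p by linarith
 have "ennreal ((avg u x \<rho>)^2) = ennreal (1 / ?m^2) * ennreal (?I^2)"
  unfolding avg_def by (simp add: ennreal_mult'[symmetric] power_divide)
 also have "... \<le> ennreal (1 / ?m^2) * (ennreal ?m * nsq_on ?A u)"
  using set_integral_square_le[of u lborel ?A] by (intro mult_left_mono) (auto simp: emeasure_sub)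
 also have "... = ennreal (1 / ?m) * nsq_on ?A u"
 proof -
  have "ennreal (1 / ?m^2) * ennreal ?m = ennreal (1 / ?m^2 * ?m)" using mp by (intro ennreal_mult[symmetric]) auto
  also have "1 / ?m^2 * ?m = 1 / ?m" using mp by (simp add: power2_eq_square)
  finally show ?thesis by (simp only: mult.assoc[symmetric])
 qed
 also have "... \<le> ennreal (KK ^ CARD('n) / V * (1 / \<rho> ^ CARD('n))) * nsq_on ?A u"
 proof (intro mult_right_mono ennreal_leI)
  have "1 / ?m \<le> 1 / (V * (\<rho> / KK) ^ CARD('n))" using m p mp by (intro divide_left_mono) auto
  also have "... = KK ^ CARD('n) / V * (1 / \<rho> ^ CARD('n))" by (simp add: power_divide)
  finally show "1 / ?m \<le> KK ^ CARD('n) / V * (1 / \<rho> ^ CARD('n))" .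
 qed simp
 finally show ?thesis .
qed

definition rk :: "nat \<Rightarrow> real" where "rk k = \<kappa> * (1 / 2) ^ k"

lemma rk: "rk k > 0" "rk k \<le> \<kappa>" "rk (Suc k) = rk k / 2"
 using kappa by (auto simp: rk_def power_le_one mult_le_cancel_left1)

text \<open>\<open>C3\<close> is the kernel bound for the exponent n - 2 with the powers of scale
  and weight taken out. \<open>C4\<close> results from summing dyadic errors of ratio 1/2 by
  \<open>sum_sqrt_AE\<close>. \<open>C5\<close> is the kernel bound for the exponent n times the
  constant of \<open>avg_square_le\<close>; no power of the weight is left in it.\<close>

definition C3 :: real where "C3 = 2 * 2 ^ (CARD('n) - 2) * CA * (2 * KK) ^ (CARD('n) - 1)"
definition C4 :: real where "C4 = 4 * C1 * C3 * \<kappa> / (1 - sqrt (1 / 2))^2"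
definition C5 :: real where "C5 = KK ^ CARD('n) / V * (2 * 2 ^ CARD('n) * CA * (2 * KK) ^ (CARD('n) - 1) / \<kappa>)"

lemma C345: "C3 \<ge> 0" "C4 \<ge> 0" "C5 \<ge> 0"
 unfolding C3_def C4_def C5_def using CA_nonneg KK kappa C1_nonneg V_pos
 by (auto intro!: mult_nonneg_nonneg divide_nonneg_nonneg)

text \<open>A limit along countably many radii is Borel; that all radii give the same limit almost
  everywhere is part of \<open>trace_piece\<close>.\<close>

definition tr :: "(real^'n \<Rightarrow> real) \<Rightarrow> (real^'n \<Rightarrow> real) \<Rightarrow> real^'n \<Rightarrow> real" where
 "tr \<sigma> u x = lim (\<lambda>k. avg u x (rk k * \<sigma> x))"

lemma piece_measurable: "piece P \<sigma> \<Longrightarrow> P \<in> sets borel" "piece P \<sigma> \<Longrightarrow> \<sigma> \<in> borel_measurable borel"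
proof -
 assume P: "piece P \<sigma>"
 thus "P \<in> sets borel" by (simp add: piece_def)
 have "continuous_on UNIV \<sigma>"
  by (rule lipschitz_on_continuous_on[of L]) (use P L1 in \<open>auto simp: lipschitz_on_def dist_norm piece_def\<close>)
 thus "\<sigma> \<in> borel_measurable borel" by (rule borel_measurable_continuous_onI)
qed

lemma tr_measurable: "\<sigma> \<in> borel_measurable borel \<Longrightarrow> u \<in> borel_measurable borel \<Longrightarrow> tr \<sigma> u \<in> borel_measurable borel"
 unfolding tr_def by (intro borel_measurable_lim_metric avg_measurable) auto

text \<open>The powers combine: (r \<sigma>)^(-(n-2)) from the deviation, (r \<sigma>)^(n-1) from
  the surface in a ball and \<sigma> from the weight leave r \<sigma>^2. The factor
  \<open>rk k\<close> is the geometric decay that makes the averages converge.\<close>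

lemma dev_nn_integral:
 assumes sp: "sob_pair \<Omega> u q" and P: "piece P \<sigma>" and [measurable]: "Y \<in> sets borel"
  and Y: "\<And>x y. x \<in> P \<Longrightarrow> y \<in> \<Omega> \<Longrightarrow> dist x y < KK * (\<kappa> * \<sigma> x) \<Longrightarrow> y \<in> Y"
  and s: "\<And>y. y \<in> Y \<Longrightarrow> \<sigma> y \<le> s"
 shows "(\<integral>\<^sup>+x. ennreal (dev q x (rk k * \<sigma> x)) \<partial>bm P) \<le> ennreal (4 * C1 * C3 * s^2 * rk k * enn2real (energy q Y))"
proof -
 note [measurable] = sob_meas[OF open_\<Omega> bounded_\<Omega> sp]
 let ?j = "CARD('n) - 2"
 have s0: "\<And>x. 0 \<le> \<sigma> x" using P by (simp add: piece_def)
 have d: "ennreal (dev q x (rk k * \<sigma> x)) = ennreal (4 * C1) * (ennreal (1 / (rk k * \<sigma> x) ^ ?j) *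
   nsq_on (\<Omega> \<inter> ball x (KK * (rk k * \<sigma> x))) (\<lambda>y. norm (q y)))" for x
 proof -
  let ?e = "energy q (\<Omega> \<inter> ball x (KK * (rk k * \<sigma> x)))"
  have e: "ennreal (enn2real ?e) = ?e" using energy_finite[OF sp, of "\<Omega> \<inter> ball x (KK * (rk k * \<sigma> x))"] by simp
  have "ennreal (dev q x (rk k * \<sigma> x)) = ennreal (4 * C1 * (1 / (rk k * \<sigma> x) ^ ?j * enn2real ?e))"
   by (simp add: dev_def)
  also have "... = ennreal (4 * C1) * (ennreal (1 / (rk k * \<sigma> x) ^ ?j) * ennreal (enn2real ?e))"
   using C1_nonneg rk(1)[of k] s0[of x] by (subst ennreal_mult, simp, simp, subst ennreal_mult) auto
  finally show ?thesis unfolding e by (simp only: energy_def)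
 qed
 have "(\<integral>\<^sup>+x. ennreal (dev q x (rk k * \<sigma> x)) \<partial>bm P) = ennreal (4 * C1) * (\<integral>\<^sup>+x. ennreal (1 / (rk k * \<sigma> x) ^ ?j) *
   nsq_on (\<Omega> \<inter> ball x (KK * (rk k * \<sigma> x))) (\<lambda>y. norm (q y)) \<partial>bm P)"
  unfolding d
 proof (rule nn_integral_cmult)
  note [measurable] = piece_measurable(2)[OF P]
  note [measurable] = ball_nn_integral_measurable[of "\<lambda>x. KK * (rk k * \<sigma> x)" "\<lambda>y. ennreal ((norm (q y))^2)" \<Omega>]
  show "(\<lambda>x. ennreal (1 / (rk k * \<sigma> x) ^ ?j) * nsq_on (\<Omega> \<inter> ball x (KK * (rk k * \<sigma> x))) (\<lambda>y. norm (q y))) \<in> borel_measurable (bm P)"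
   by measurable
 qed
 also have "... \<le> ennreal (4 * C1) * (ennreal (C3 * s^2 * rk k) * nsq_on Y (\<lambda>y. norm (q y)))"
 proof (intro mult_left_mono kernel_tonelli[OF P rk(1,2)])
  fix x y assume "x \<in> P" "y \<in> \<Omega>" "dist x y < KK * (rk k * \<sigma> x)"
  moreover have "KK * (rk k * \<sigma> x) \<le> KK * (\<kappa> * \<sigma> x)" using KK rk s0 by (intro mult_left_mono mult_right_mono) auto
  ultimately show "y \<in> Y" using Y by force
 next
  fix y assume y: "y \<in> Y"
  show "2 * \<sigma> y * (2 / (rk k * \<sigma> y)) ^ ?j * (CA * (2 * KK * rk k * \<sigma> y) ^ (CARD('n) - 1)) \<le> C3 * s^2 * rk k"
  proof (cases "\<sigma> y = 0")
   case True thus ?thesis using C345 rk(1)[of k] by simp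
  next
   case False
   define t where "t = rk k * \<sigma> y"
   have t: "t > 0" using False s0[of y] rk(1)[of k] by (simp add: t_def)
   have "CARD('n) - 1 = Suc ?j" using n2 by simp
   hence "(2 / t) ^ ?j * (2 * KK * t) ^ (CARD('n) - 1) = 2 ^ ?j * (2 * KK) ^ (CARD('n) - 1) * t"
    using t by (simp add: power_divide power_mult_distrib)
   hence "2 * \<sigma> y * (2 / t) ^ ?j * (CA * (2 * KK * t) ^ (CARD('n) - 1)) = C3 * (\<sigma> y * t)"
    by (simp add: C3_def mult_ac)
   also have "... = C3 * (\<sigma> y)^2 * rk k" by (simp add: t_def power2_eq_square)
   also have "... \<le> C3 * s^2 * rk k"
    using C345 rk(1)[of k] s[OF y] s0[of y] by (intro mult_right_mono mult_left_mono power_mono) auto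
   finally show ?thesis by (simp add: t_def mult.assoc)
  qed
 qed auto
 also have "... = ennreal (4 * C1) * (ennreal (C3 * s^2 * rk k) * ennreal (enn2real (energy q Y)))"
  using energy_finite[OF sp, of Y] by (simp add: energy_def)
 also have "... = ennreal (4 * C1 * (C3 * s^2 * rk k * enn2real (energy q Y)))"
  using C1_nonneg C345 rk(1)[of k] by (subst ennreal_mult, simp, simp, subst ennreal_mult) auto
 finally show ?thesis by (simp add: mult.assoc)
qed

text \<open>Dyadic increments have squared norms decaying like 2^(-k) by
  \<open>dev_nn_integral\<close>, so \<open>sum_sqrt_AE\<close> sums them, and
  \<open>avg_compare\<close> fills in the radii between. \<open>Y\<close> and \<open>s\<close> stay
  free so that near the tip only a thin strip enters, with a small factor at the energy.\<close>

lemma trace_piece: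
 assumes sp: "sob_pair \<Omega> u q" and P: "piece P \<sigma>" and Yb[measurable]: "Y \<in> sets borel"
  and Y: "\<And>x y. x \<in> P \<Longrightarrow> y \<in> \<Omega> \<Longrightarrow> dist x y < KK * (\<kappa> * \<sigma> x) \<Longrightarrow> y \<in> Y"
  and s: "\<And>y. y \<in> Y \<Longrightarrow> \<sigma> y \<le> s"
 shows trace_limit: "AE x in bm P. (avg u x \<longlongrightarrow> tr \<sigma> u x) (at_right 0)"
  and trace_approx: "nsq (bm P) (\<lambda>x. tr \<sigma> u x - avg u x (rk m * \<sigma> x))
    \<le> ennreal (C4 * s^2 * (1 / 2) ^ m * enn2real (energy q Y))"
  and trace_start: "nsq (bm P) (\<lambda>x. avg u x (rk 0 * \<sigma> x))
    \<le> ennreal C5 * nsq_on Y u"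
proof -
 note [measurable] = sob_meas[OF open_\<Omega> bounded_\<Omega> sp] piece_measurable[OF P]
 have s0: "\<And>x. 0 \<le> \<sigma> x" "\<And>x. x \<in> P \<Longrightarrow> x \<in> frontier \<Omega>" "\<And>x. x \<in> P \<Longrightarrow> W x = \<sigma> x"
  using P by (auto simp: piece_def)
 define D where "D k x = dev q x (rk k * \<sigma> x)" for k x
 have Dpos: "D k x \<ge> 0" for k x
  unfolding D_def dev_def using C1_nonneg rk(1)[of k] s0(1)[of x] by (intro mult_nonneg_nonneg divide_nonneg_nonneg) auto
 have Dm[measurable]: "D k \<in> borel_measurable borel" for k
 proof -
  note [measurable] = ball_nn_integral_measurable[of "\<lambda>x. KK * (rk k * \<sigma> x)" "\<lambda>y. ennreal ((norm (q y))^2)" \<Omega>]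
  show ?thesis unfolding D_def dev_def energy_def by measurable
 qed
 have scale: "0 < rk k * \<sigma> x" "rk k * \<sigma> x \<le> c0 * W x" if "x \<in> P" "W x > 0" for k x
 proof -
  have "\<sigma> x > 0" using that s0 by simp
  thus "0 < rk k * \<sigma> x" using rk(1)[of k] by simp
  have "rk k \<le> c0" using rk(2)[of k] kappa(2) by linarith
  thus "rk k * \<sigma> x \<le> c0 * W x" using s0 that by (simp add: mult_right_mono)
 qed
 have half_eq: "rk (Suc k) * \<sigma> x = rk k * \<sigma> x / 2" for k x by (simp add: rk(3))
 have cmp: "\<bar>avg u x r - avg u x (rk k * \<sigma> x)\<bar> \<le> sqrt (D k x)"
  if x: "x \<in> P" "W x > 0" and r: "rk (Suc k) * \<sigma> x \<le> r" "r \<le> rk k * \<sigma> x" for x r k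
 proof -
  have "(avg u x r - avg u x (rk k * \<sigma> x))^2 \<le> D k x"
   unfolding D_def
   by (rule avg_compare[OF sp s0(2)[OF x(1)] scale[OF x]]; use r[unfolded half_eq] scale(1)[OF x, of k] in linarith)
  thus ?thesis by (simp add: real_le_rsqrt)
 qed
 have inc: "\<bar>avg u x (rk (Suc k) * \<sigma> x) - avg u x (rk k * \<sigma> x)\<bar> \<le> sqrt (D k x)" if "x \<in> P" "W x > 0" for x k
  by (rule cmp[OF that]; use half_eq[of k x] scale(1)[OF that, of k] in linarith)
 define c where "c = 4 * C1 * C3 * s^2 * \<kappa> * enn2real (energy q Y)"
 have c0': "c \<ge> 0" unfolding c_def using C1_nonneg C345 kappa by (intro mult_nonneg_nonneg) auto
 have Db: "(\<integral>\<^sup>+x. ennreal (D (k + m) x) \<partial>bm P) \<le> ennreal (c * (1/2) ^ m * (1/2) ^ k)" for k m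
  using dev_nn_integral[OF sp P Yb Y s, where k="k + m"]
  by (simp add: D_def c_def rk_def power_add mult_ac)
 have half: "(0::real) < 1 / 2" "(1 / 2 :: real) < 1" by auto
 have S: "AE x in bm P. summable (\<lambda>k. sqrt (D (k + m) x))"
   "nsq (bm P) (\<lambda>x. \<Sum>k. sqrt (D (k + m) x)) \<le> ennreal (c * (1/2) ^ m / (1 - sqrt (1/2))^2)" for m
  using sum_sqrt_AE[of "\<lambda>k. D (k + m)" "bm P", OF _ Dpos Db _ half] c0' by auto
 note A = AE_bm[OF piece_measurable(1)[OF P]]
 show "AE x in bm P. (avg u x \<longlongrightarrow> tr \<sigma> u x) (at_right 0)"
  using A S(1)[of 0]
 proof eventually_elim
  case (elim x)
  hence x: "x \<in> P" "W x > 0" and sm: "summable (\<lambda>k. sqrt (D k x))" by auto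
  define A where "A k = avg u x (rk k * \<sigma> x)" for k
  have "convergent A" unfolding A_def by (rule summable_increments_limit(1)[OF inc[OF x] sm])
  hence lim: "A \<longlonglongrightarrow> tr \<sigma> u x" unfolding tr_def A_def[symmetric] by (simp add: convergent_LIMSEQ_iff)
  have sx: "\<sigma> x > 0" using x s0 by simp
  show ?case
  proof (rule tendstoI)
   fix \<epsilon> :: real assume \<epsilon>: "\<epsilon> > 0"
   have "\<forall>\<^sub>F k in sequentially. sqrt (D k x) < \<epsilon> / 2" using summable_LIMSEQ_zero[OF sm] \<epsilon> by (intro order_tendstoD(2)) auto
   moreover have "\<forall>\<^sub>F k in sequentially. dist (A k) (tr \<sigma> u x) < \<epsilon> / 2" using lim \<epsilon> by (intro tendstoD) auto
   ultimately have "\<forall>\<^sub>F k in sequentially. sqrt (D k x) < \<epsilon> / 2 \<and> dist (A k) (tr \<sigma> u x) < \<epsilon> / 2" by (rule eventually_conj)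
   then obtain N where N: "\<And>k. k \<ge> N \<Longrightarrow> sqrt (D k x) < \<epsilon> / 2 \<and> dist (A k) (tr \<sigma> u x) < \<epsilon> / 2"
    unfolding eventually_sequentially by blast
   have "dist (avg u x r) (tr \<sigma> u x) < \<epsilon>" if r: "0 < r" "r < rk N * \<sigma> x" for r
   proof -
    have "(\<lambda>k. rk k * \<sigma> x) \<longlonglongrightarrow> \<kappa> * 0 * \<sigma> x" unfolding rk_def by (intro tendsto_intros LIMSEQ_realpow_zero) auto
    hence "\<forall>\<^sub>F k in sequentially. rk k * \<sigma> x < r" using r by (intro order_tendstoD(2)) auto
    then obtain j where j: "rk j * \<sigma> x < r" by (auto simp: eventually_sequentially)
    \<comment> \<open>The first dyadic radius below \<open>r\<close>; its predecessor is at least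
      \<open>r\<close>, so \<open>r\<close> lies between two consecutive dyadic radii with indices
      from \<open>N\<close> on.\<close>
    define m where "m = (LEAST j. rk j * \<sigma> x < r)"
    have m: "rk m * \<sigma> x < r" unfolding m_def by (rule LeastI[of _ j]) fact
    have anti: "rk a * \<sigma> x \<le> rk b * \<sigma> x" if "b \<le> a" for a b
     using kappa sx that by (intro mult_right_mono) (auto simp: rk_def power_decreasing intro!: mult_left_mono)
    have "N < m" using m r anti[of m N] by (meson leI less_le_not_le order_trans less_asym le_less_trans)
    then obtain k where k: "m = Suc k" "N \<le> k" by (metis less_eq_Suc_le Suc_le_D Suc_le_mono)
    have "\<not> rk k * \<sigma> x < r" using not_less_Least[of k "\<lambda>j. rk j * \<sigma> x < r"] k by (simp add: m_def)
    hence "\<bar>avg u x r - A k\<bar> \<le> sqrt (D k x)" unfolding A_def using m k by (intro cmp[OF x]) auto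
    thus ?thesis using N[OF k(2)] unfolding dist_real_def by linarith
   qed
   thus "\<forall>\<^sub>F r in at_right 0. dist (avg u x r) (tr \<sigma> u x) < \<epsilon>"
    unfolding eventually_at_right_field using rk(1)[of N] sx by (intro exI[of _ "rk N * \<sigma> x"]) auto
  qed
 qed
 show "nsq (bm P) (\<lambda>x. tr \<sigma> u x - avg u x (rk m * \<sigma> x))
    \<le> ennreal (C4 * s^2 * (1 / 2) ^ m * enn2real (energy q Y))"
 proof -
  have "nsq (bm P) (\<lambda>x. tr \<sigma> u x - avg u x (rk m * \<sigma> x)) \<le> nsq (bm P) (\<lambda>x. \<Sum>k. sqrt (D (k + m) x))"
  proof (rule nn_integral_mono_AE)
   show "AE x in bm P. ennreal ((tr \<sigma> u x - avg u x (rk m * \<sigma> x))^2) \<le> ennreal ((\<Sum>k. sqrt (D (k + m) x))^2)"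
    using A S(1)[of m]
   proof eventually_elim
    case (elim x)
    hence x: "x \<in> P" "W x > 0" and sm: "summable (\<lambda>k. sqrt (D (k + m) x))" by auto
    let ?f = "\<lambda>k. avg u x (rk (k + m) * \<sigma> x)"
    have i: "\<bar>?f (Suc k) - ?f k\<bar> \<le> sqrt (D (k + m) x)" for k using inc[OF x, of "k + m"] by simp
    note l = summable_increments_limit[of ?f, OF i sm]
    have "?f \<longlonglongrightarrow> lim ?f" using l(1) by (simp add: convergent_LIMSEQ_iff)
    hence "(\<lambda>k. avg u x (rk k * \<sigma> x)) \<longlonglongrightarrow> lim ?f" by (rule LIMSEQ_offset)
    hence "tr \<sigma> u x = lim ?f" unfolding tr_def by (rule limI)
    hence "\<bar>tr \<sigma> u x - avg u x (rk m * \<sigma> x)\<bar> \<le> (\<Sum>k. sqrt (D (k + m) x))" using l(2) by simp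
    from power_mono[OF this abs_ge_zero, of 2]
    show ?case by (intro ennreal_leI) (simp only: power2_abs)
   qed
  qed
  also note S(2)[of m]
  also have "c * (1/2) ^ m / (1 - sqrt (1/2))^2 = C4 * s^2 * (1 / 2) ^ m * enn2real (energy q Y)"
   unfolding c_def C4_def by (simp add: mult_ac)
  finally show ?thesis .
 qed
 show "nsq (bm P) (\<lambda>x. avg u x (rk 0 * \<sigma> x))
    \<le> ennreal C5 * nsq_on Y u"
 proof -
  let ?n = "CARD('n)"
  let ?c = "KK ^ ?n / V"
  let ?F = "\<lambda>x. \<integral>\<^sup>+y. ennreal ((u y)^2) * indicator (\<Omega> \<inter> ball x (KK * (\<kappa> * \<sigma> x))) y \<partial>lborel"
  have "nsq (bm P) (\<lambda>x. avg u x (rk 0 * \<sigma> x)) \<le> (\<integral>\<^sup>+x. ennreal ?c * (ennreal (1 / (\<kappa> * \<sigma> x) ^ ?n) * ?F x) \<partial>bm P)"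
  proof (rule nn_integral_mono_AE)
   show "AE x in bm P. ennreal ((avg u x (rk 0 * \<sigma> x))^2) \<le> ennreal ?c * (ennreal (1 / (\<kappa> * \<sigma> x) ^ ?n) * ?F x)"
    using A
   proof eventually_elim
    case (elim x)
    hence x: "x \<in> P" "W x > 0" by auto
    have r0: "rk 0 * \<sigma> x = \<kappa> * \<sigma> x" by (simp add: rk_def)
    have p: "0 < \<kappa> * \<sigma> x" "\<kappa> * \<sigma> x \<le> c0 * W x" using scale[OF x, of 0] by (simp_all add: r0)
    have "1 * (\<kappa> * \<sigma> x) \<le> KK * (\<kappa> * \<sigma> x)" using KK p by (intro mult_right_mono) auto
    hence sub: "ball x (\<kappa> * \<sigma> x) \<subseteq> ball x (KK * (\<kappa> * \<sigma> x))" by (intro subset_ball) simp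
    have "ennreal ((avg u x (\<kappa> * \<sigma> x))^2) \<le> ennreal (?c * (1 / (\<kappa> * \<sigma> x) ^ ?n)) *
      nsq_on (\<Omega> \<inter> ball x (\<kappa> * \<sigma> x)) u"
     by (rule avg_square_le[OF _ s0(2)[OF x(1)] p]) measurable
    also have "... \<le> ennreal (?c * (1 / (\<kappa> * \<sigma> x) ^ ?n)) * ?F x"
     using sub by (intro mult_left_mono nn_integral_mono) (auto simp: indicator_def)
    also have "ennreal (?c * (1 / (\<kappa> * \<sigma> x) ^ ?n)) = ennreal ?c * ennreal (1 / (\<kappa> * \<sigma> x) ^ ?n)"
     using KK V_pos p by (intro ennreal_mult) auto
    finally show ?case by (simp add: r0 mult.assoc)
   qed
  qed
  also have "... = ennreal ?c * (\<integral>\<^sup>+x. ennreal (1 / (\<kappa> * \<sigma> x) ^ ?n) * ?F x \<partial>bm P)"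
  proof (rule nn_integral_cmult)
   note [measurable] = ball_nn_integral_measurable[of "\<lambda>x. KK * (\<kappa> * \<sigma> x)" "\<lambda>y. ennreal ((u y)^2)" \<Omega>]
   show "(\<lambda>x. ennreal (1 / (\<kappa> * \<sigma> x) ^ ?n) * ?F x) \<in> borel_measurable (bm P)" by measurable
  qed
  also have "... \<le> ennreal ?c * (ennreal (2 * 2 ^ ?n * CA * (2 * KK) ^ (?n - 1) / \<kappa>) * nsq_on Y u)"
  proof (intro mult_left_mono kernel_tonelli[OF P kappa(1) order_refl])
   fix y assume y: "y \<in> Y"
   show "2 * \<sigma> y * (2 / (\<kappa> * \<sigma> y)) ^ ?n * (CA * (2 * KK * \<kappa> * \<sigma> y) ^ (?n - 1)) \<le> 2 * 2 ^ ?n * CA * (2 * KK) ^ (?n - 1) / \<kappa>"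
   proof (cases "\<sigma> y = 0")
    case True thus ?thesis using CA_nonneg KK kappa by simp
   next
    case False
    define t where "t = \<kappa> * \<sigma> y"
    have t: "t > 0" using False s0(1)[of y] kappa(1) by (simp add: t_def)
    have "?n = Suc (?n - 1)" using n2 by simp
    hence tn: "t ^ ?n = t * t ^ (?n - 1)" by (metis power_Suc)
    have "(2 / t) ^ ?n * (2 * KK * t) ^ (?n - 1) = 2 ^ ?n * (2 * KK) ^ (?n - 1) / t"
     using t by (simp add: power_divide power_mult_distrib tn)
    hence "2 * \<sigma> y * (2 / t) ^ ?n * (CA * (2 * KK * t) ^ (?n - 1)) = 2 * 2 ^ ?n * CA * (2 * KK) ^ (?n - 1) * (\<sigma> y / t)"
     by (simp add: mult_ac)
    also have "\<sigma> y / t = 1 / \<kappa>" using False kappa by (simp add: t_def)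
    finally show ?thesis by (simp add: t_def mult.assoc)
   qed
  qed (use Y in auto)
  also have "... = ennreal C5 * nsq_on Y u"
  proof -
   have "ennreal ?c * ennreal (2 * 2 ^ ?n * CA * (2 * KK) ^ (?n - 1) / \<kappa>) = ennreal C5"
    unfolding C5_def using KK V_pos CA_nonneg kappa by (intro ennreal_mult[symmetric]) auto
   thus ?thesis by (simp only: mult.assoc[symmetric])
  qed
  finally show ?thesis .
 qed
qed

end

section \<open>Borel representatives of Sobolev functions\<close>

lemma lebesgue_on_transfer:
 fixes f g :: "real^'n \<Rightarrow> real"
 assumes \<Omega>: "\<Omega> \<in> sets borel" and f: "f \<in> borel_measurable (lebesgue_on \<Omega>)" and g: "g \<in> borel_measurable borel"
  and ae: "AE x in lborel. x \<in> \<Omega> \<longrightarrow> f x = g x" and S: "S \<in> sets borel" "S \<subseteq> \<Omega>"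
 shows "integral\<^sup>L (lebesgue_on S) f = (LBINT x. indicator S x * g x)"
  and "integrable (lebesgue_on S) f \<longleftrightarrow> integrable lborel (\<lambda>x. indicator S x * g x)"
proof -
 have "(\<lambda>x. indicator \<Omega> x *\<^sub>R f x) \<in> borel_measurable lebesgue"
  using f \<Omega> by (subst (asm) borel_measurable_restrict_space_iff) auto
 hence "(\<lambda>x. indicator S x * (indicator \<Omega> x *\<^sub>R f x)) \<in> borel_measurable lebesgue"
  using S sets_completionI_sets[of S lborel] by (intro borel_measurable_times borel_measurable_indicator) auto
 moreover have "indicator S x * (indicator \<Omega> x *\<^sub>R f x) = indicator S x * f x" for x using S by (auto simp: indicator_def)
 ultimately have m: "(\<lambda>x. indicator S x * f x) \<in> borel_measurable lebesgue" by (simp only:)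
 have g': "(\<lambda>x. indicator S x * g x) \<in> borel_measurable borel" using g S by measurable
 hence m': "(\<lambda>x. indicator S x * g x) \<in> borel_measurable lebesgue" by (simp add: measurable_completion)
 have "AE x in lebesgue. x \<in> \<Omega> \<longrightarrow> f x = g x" using ae by (simp only: AE_completion_iff)
 hence e: "AE x in lebesgue. indicator S x * f x = indicator S x * g x"
  by eventually_elim (use S in \<open>auto simp: indicator_def\<close>)
 have "integral\<^sup>L (lebesgue_on S) f = (\<integral>x. indicator S x * f x \<partial>lebesgue)" using S by (subst integral_restrict_space) auto
 also have "... = (\<integral>x. indicator S x * g x \<partial>lebesgue)" by (rule integral_cong_AE[OF m m' e])
 also have "... = (LBINT x. indicator S x * g x)" using g' by (intro integral_completion) simp
 finally show "integral\<^sup>L (lebesgue_on S) f = (LBINT x. indicator S x * g x)" .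
 have "integrable (lebesgue_on S) f \<longleftrightarrow> integrable lebesgue (\<lambda>x. indicator S x * f x)" using S by (subst integrable_restrict_space) auto
 also have "... \<longleftrightarrow> integrable lebesgue (\<lambda>x. indicator S x * g x)" by (rule integrable_cong_AE[OF m m' e])
 also have "... \<longleftrightarrow> integrable lborel (\<lambda>x. indicator S x * g x)" using g' by (intro integrable_completion) simp
 finally show "integrable (lebesgue_on S) f \<longleftrightarrow> integrable lborel (\<lambda>x. indicator S x * g x)" .
qed

lemma lebesgue_on_borel_rep:
 fixes f :: "real^'n \<Rightarrow> real"
 assumes "\<Omega> \<in> sets borel" "f \<in> borel_measurable (lebesgue_on \<Omega>)"
 shows "\<exists>g. g \<in> borel_measurable borel \<and> (\<forall>x. x \<notin> \<Omega> \<longrightarrow> g x = 0) \<and> (AE x in lborel. x \<in> \<Omega> \<longrightarrow> f x = g x)"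
proof -
 have "(\<lambda>x. indicator \<Omega> x *\<^sub>R f x) \<in> borel_measurable lebesgue"
  using assms by (subst (asm) borel_measurable_restrict_space_iff) auto
 then obtain g where g: "g \<in> borel_measurable lborel" "AE x in lborel. indicator \<Omega> x *\<^sub>R f x = g x"
  using completion_ex_borel_measurable_real by blast
 show ?thesis
 proof (intro exI[of _ "\<lambda>x. indicator \<Omega> x * g x"] conjI)
  show "AE x in lborel. x \<in> \<Omega> \<longrightarrow> f x = indicator \<Omega> x * g x" using g(2) by eventually_elim auto
 qed (use g assms in auto)
qed

lemma lebesgue_on_measurableI:
 fixes f g :: "real^'n \<Rightarrow> real"
 assumes "\<Omega> \<in> sets borel" "g \<in> borel_measurable borel" "AE x in lborel. x \<in> \<Omega> \<longrightarrow> f x = g x"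
 shows "f \<in> borel_measurable (lebesgue_on \<Omega>)"
proof -
 have "(\<lambda>x. indicator \<Omega> x *\<^sub>R f x) \<in> borel_measurable lebesgue"
 proof (rule borel_measurable_AE)
  show "(\<lambda>x. indicator \<Omega> x *\<^sub>R g x) \<in> borel_measurable lebesgue"
   using assms(1,2) by (intro measurable_completion) simp
  have "AE x in lebesgue. x \<in> \<Omega> \<longrightarrow> f x = g x" using assms(3) by (simp only: AE_completion_iff)
  thus "AE x in lebesgue. indicator \<Omega> x *\<^sub>R g x = indicator \<Omega> x *\<^sub>R f x" by eventually_elim (auto simp: indicator_def)
 qed
 thus ?thesis using assms(1) by (subst borel_measurable_restrict_space_iff) auto
qed

context cusp
begin

text \<open>A member v of the Sobolev space is only Lebesgue measurable on the domain; it is handled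
 through a Borel pair (u, q) on the whole space that represents v and its weak gradient.\<close>

definition Rep :: "(real^'n \<Rightarrow> real) \<Rightarrow> (real^'n \<Rightarrow> real) \<Rightarrow> (real^'n \<Rightarrow> real^'n) \<Rightarrow> bool" where
 "Rep v u q \<longleftrightarrow> sob_pair \<Omega> u q \<and> (AE x in lborel. x \<in> \<Omega> \<longrightarrow> v x = u x)"

lemma test_ext_measurable:
 assumes "\<phi> \<in> test_functions \<Omega>"
 shows "\<phi> \<in> borel_measurable borel" "partial_deriv i \<phi> \<in> borel_measurable borel"
 using C_infinity_derivative(2,3)[OF test_functionsD(1)[OF assms]] by (auto intro: borel_measurable_continuous_onI)

lemma off_\<Omega>: "(\<And>x. x \<notin> \<Omega> \<Longrightarrow> f x = 0) \<Longrightarrow> indicator \<Omega> x * (f x :: real) = f x"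
 by (cases "x \<in> \<Omega>") auto

lemma gradient_integrals:
 fixes u v h :: "real^'n \<Rightarrow> real"
 assumes u: "u \<in> borel_measurable borel" "\<And>x. x \<notin> \<Omega> \<Longrightarrow> u x = 0" "AE x in lborel. x \<in> \<Omega> \<longrightarrow> v x = u x"
  and h: "h \<in> borel_measurable borel"
 shows "integral\<^sup>L (lebesgue_on \<Omega>) (\<lambda>x. v x * h x) = (LBINT x. u x * h x)"
proof -
 have ae: "AE x in lborel. x \<in> \<Omega> \<longrightarrow> v x * h x = u x * h x" using u(3) by eventually_elim auto
 have m: "(\<lambda>x. u x * h x) \<in> borel_measurable borel" by (intro borel_measurable_times u(1) h)
 have "integral\<^sup>L (lebesgue_on \<Omega>) (\<lambda>x. v x * h x) = (LBINT x. indicator \<Omega> x * (u x * h x))"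
  by (rule lebesgue_on_transfer(1)[OF \<Omega>_borel lebesgue_on_measurableI[OF \<Omega>_borel m ae] m ae \<Omega>_borel order_refl])
 thus ?thesis using off_\<Omega>[of "\<lambda>x. u x * h x"] u(2) by simp
qed

lemma square_integrable_rep:
 fixes u v :: "real^'n \<Rightarrow> real"
 assumes u: "u \<in> borel_measurable borel" "\<And>x. x \<notin> \<Omega> \<Longrightarrow> u x = 0" "AE x in lborel. x \<in> \<Omega> \<longrightarrow> v x = u x"
 shows "square_integrable_on \<Omega> v \<longleftrightarrow> integrable lborel (\<lambda>x. (u x)^2)"
proof -
 have ae: "AE x in lborel. x \<in> \<Omega> \<longrightarrow> (v x)^2 = (u x)^2" using u(3) by eventually_elim auto
 have m: "(\<lambda>x. (u x)^2) \<in> borel_measurable borel" using u by measurable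
 have "v \<in> borel_measurable (lebesgue_on \<Omega>)" by (rule lebesgue_on_measurableI[OF \<Omega>_borel u(1,3)])
 moreover have "integrable (lebesgue_on \<Omega>) (\<lambda>x. (v x)^2) \<longleftrightarrow> integrable lborel (\<lambda>x. indicator \<Omega> x * (u x)^2)"
  by (rule lebesgue_on_transfer(2)[OF \<Omega>_borel lebesgue_on_measurableI[OF \<Omega>_borel m ae] m ae \<Omega>_borel order_refl])
 ultimately show ?thesis using off_\<Omega>[of "\<lambda>x. (u x)^2"] u(2) by (simp add: square_integrable_on_def)
qed

lemma norm_square_sum: "(norm (x :: real^'n))^2 = (\<Sum>i\<in>UNIV. (x $ i)^2)"
 unfolding power2_norm_eq_inner inner_vec_def by (simp add: power2_eq_square)

lemma Rep_W12: assumes "Rep v u q" shows "v \<in> sobolev_W12 \<Omega>" "has_weak_gradient \<Omega> v q" "\<And>i. square_integrable_on \<Omega> (\<lambda>x. q x $ i)"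
proof -
 have sp: "sob_pair \<Omega> u q" and ae: "AE x in lborel. x \<in> \<Omega> \<longrightarrow> v x = u x" using assms Rep_def by auto
 note p = sob_pairD[OF sp]
 note [measurable] = p(1,2)
 show h: "has_weak_gradient \<Omega> v q" unfolding has_weak_gradient_def
 proof (intro ballI allI)
  fix \<phi> i assume \<phi>: "\<phi> \<in> test_functions \<Omega>"
  note [measurable] = test_ext_measurable[OF \<phi>]
  have "integral\<^sup>L (lebesgue_on \<Omega>) (\<lambda>x. v x * partial_deriv i \<phi> x) = (LBINT x. u x * partial_deriv i \<phi> x)"
   by (rule gradient_integrals[OF p(1,5) ae]) (auto intro: test_ext_measurable[OF \<phi>])
  also have "... = - (LBINT x. q x $ i * \<phi> x)" by (rule p(7)[OF \<phi>])
  also have "(LBINT x. q x $ i * \<phi> x) = integral\<^sup>L (lebesgue_on \<Omega>) (\<lambda>x. q x $ i * \<phi> x)"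
   by (rule gradient_integrals[symmetric]) (auto simp: p(6))
  finally show "integral\<^sup>L (lebesgue_on \<Omega>) (\<lambda>x. v x * partial_deriv i \<phi> x) = - integral\<^sup>L (lebesgue_on \<Omega>) (\<lambda>x. q x $ i * \<phi> x)" .
 qed
 show s: "square_integrable_on \<Omega> (\<lambda>x. q x $ i)" for i
 proof (subst square_integrable_rep[where u="\<lambda>x. q x $ i"])
  show "integrable lborel (\<lambda>x. (q x $ i)^2)"
  proof (rule Bochner_Integration.integrable_bound[OF p(4)])
   have "(q x $ i)^2 \<le> (norm (q x))^2" for x using component_le_norm_cart[of "q x" i] by (metis abs_le_square_iff abs_norm_cancel)
   thus "AE x in lborel. norm ((q x $ i)^2) \<le> norm ((norm (q x))^2)" by simp
  qed measurable
 qed (auto simp: p(6))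
 have "square_integrable_on \<Omega> v" using p(3) square_integrable_rep[OF p(1,5) ae] by simp
 thus "v \<in> sobolev_W12 \<Omega>" using h s unfolding sobolev_W12_def by blast
qed

lemma gradient_unique:
 assumes "Rep v u q" "Rep v u' q'" shows "AE x in lborel. q x = q' x"
proof -
 have sp: "sob_pair \<Omega> u q" "sob_pair \<Omega> u' q'" and ae: "AE x in lborel. x \<in> \<Omega> \<longrightarrow> v x = u x" "AE x in lborel. x \<in> \<Omega> \<longrightarrow> v x = u' x"
  using assms Rep_def by auto
 note p = sob_pairD[OF sp(1)] and p' = sob_pairD[OF sp(2)]
 note [measurable] = p(1,2) p'(1,2)
 have uu: "AE x in lborel. u x = u' x" using ae by eventually_elim (use p(5) p'(5) in metis)
 have i: "integrable lborel (\<lambda>x. q x $ i)" "integrable lborel (\<lambda>x. q' x $ i)" for i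
  using integrable_inner_left[OF sob_integrable(2)[OF open_\<Omega> bounded_\<Omega> sp(1)], of "axis i 1"]
   integrable_inner_left[OF sob_integrable(2)[OF open_\<Omega> bounded_\<Omega> sp(2)], of "axis i 1"] by (simp_all add: inner_axis)
 have "AE x in lborel. q x $ i = q' x $ i" for i
 proof -
  have "AE x in lborel. x \<in> \<Omega> \<longrightarrow> q x $ i - q' x $ i = 0"
  proof (rule AE_zero_of_test_integrals[OF open_\<Omega>])
   show "integrable lborel (\<lambda>x. q x $ i - q' x $ i)" using i by simp
   fix \<phi> assume \<phi>: "\<phi> \<in> test_functions \<Omega>"
   note [measurable] = test_ext_measurable[OF \<phi>]
   obtain K where K: "\<And>x. \<bar>\<phi> x\<bar> \<le> K" using test_functions_bounded[OF \<phi>] by metis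
   have b: "integrable lborel (\<lambda>x. f x * \<phi> x)" if "integrable lborel f" for f :: "real^'n \<Rightarrow> real"
   proof (rule Bochner_Integration.integrable_bound)
    show "integrable lborel (\<lambda>x. f x * K)" using that by simp
    show "AE x in lborel. norm (f x * \<phi> x) \<le> norm (f x * K)"
     using K by (intro AE_I2) (simp add: abs_mult mult_left_mono order_trans[OF _ abs_ge_self])
   qed (use that in measurable)
   have "(LBINT x. u x * partial_deriv i \<phi> x) = (LBINT x. u' x * partial_deriv i \<phi> x)"
    by (rule integral_cong_AE) (use uu in auto)
   hence "(LBINT x. q x $ i * \<phi> x) = (LBINT x. q' x $ i * \<phi> x)" using p(7)[OF \<phi>, of i] p'(7)[OF \<phi>, of i] by simp
   thus "(LBINT x. (q x $ i - q' x $ i) * \<phi> x) = 0"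
    using Bochner_Integration.integral_diff[OF b[OF i(1)] b[OF i(2)]] by (simp add: left_diff_distrib)
  qed
  thus ?thesis by eventually_elim (use p(6) p'(6) in force)
 qed
 hence "AE x in lborel. \<forall>i. q x $ i = q' x $ i" by (simp add: AE_all_countable)
 thus ?thesis by eventually_elim (simp add: vec_eq_iff)
qed

lemma Rep_ex:
 assumes "v \<in> sobolev_W12 \<Omega>"
 obtains u q where "Rep v u q" "AE x in lborel. x \<in> \<Omega> \<longrightarrow> weak_gradient \<Omega> v x = q x"
proof -
 let ?g = "weak_gradient \<Omega> v"
 have sv: "square_integrable_on \<Omega> v" and "\<exists>g. has_weak_gradient \<Omega> v g \<and> (\<forall>i. square_integrable_on \<Omega> (\<lambda>x. g x $ i))"
  using assms unfolding sobolev_W12_def by auto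
 from someI_ex[OF this(2)] have g: "has_weak_gradient \<Omega> v ?g" "\<And>i. square_integrable_on \<Omega> (\<lambda>x. ?g x $ i)"
  unfolding weak_gradient_def by auto
 obtain u where u: "u \<in> borel_measurable borel" "\<And>x. x \<notin> \<Omega> \<Longrightarrow> u x = 0" "AE x in lborel. x \<in> \<Omega> \<longrightarrow> v x = u x"
  using lebesgue_on_borel_rep[OF \<Omega>_borel, of v] sv unfolding square_integrable_on_def by blast
 have "\<forall>i. \<exists>h. h \<in> borel_measurable borel \<and> (\<forall>x. x \<notin> \<Omega> \<longrightarrow> h x = 0) \<and> (AE x in lborel. x \<in> \<Omega> \<longrightarrow> ?g x $ i = h x)"
 proof
  fix i
  have "(\<lambda>x. ?g x $ i) \<in> borel_measurable (lebesgue_on \<Omega>)" using g(2)[of i] by (simp add: square_integrable_on_def)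
  from lebesgue_on_borel_rep[OF \<Omega>_borel this]
  show "\<exists>h. h \<in> borel_measurable borel \<and> (\<forall>x. x \<notin> \<Omega> \<longrightarrow> h x = 0) \<and> (AE x in lborel. x \<in> \<Omega> \<longrightarrow> ?g x $ i = h x)" .
 qed
 from choice[OF this] obtain h where hh: "\<forall>i. h i \<in> borel_measurable borel \<and> (\<forall>x. x \<notin> \<Omega> \<longrightarrow> h i x = 0) \<and>
   (AE x in lborel. x \<in> \<Omega> \<longrightarrow> ?g x $ i = h i x)" by blast
 have h[measurable]: "h i \<in> borel_measurable borel" and h0: "x \<notin> \<Omega> \<Longrightarrow> h i x = 0"
  and hg: "AE x in lborel. x \<in> \<Omega> \<longrightarrow> ?g x $ i = h i x" for i x using hh by auto
 define q where "q x = (\<chi> i. h i x)" for x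
 have q: "q x $ i = h i x" for x i by (simp add: q_def)
 have "sob_pair \<Omega> u q" unfolding sob_pair_def
 proof (intro conjI ballI allI impI)
  show "u \<in> borel_measurable borel" by fact
  show "q \<in> borel_measurable borel"
   by (subst borel_measurable_euclidean_space) (auto simp: Basis_vec_def inner_axis q)
  show "integrable lborel (\<lambda>x. (u x)^2)" using sv square_integrable_rep[OF u] by simp
  have "integrable lborel (\<lambda>x. (h i x)^2)" for i
   using g(2)[of i] square_integrable_rep[OF h h0 hg] by simp
  thus "integrable lborel (\<lambda>x. (norm (q x))^2)" by (simp add: norm_square_sum q)
  fix x assume "x \<notin> \<Omega>" thus "u x = 0" "q x = 0" using u(2) h0 by (auto simp: vec_eq_iff q)
 next
  fix \<phi> i assume \<phi>: "\<phi> \<in> test_functions \<Omega>"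
  have "(LBINT x. u x * partial_deriv i \<phi> x) = integral\<^sup>L (lebesgue_on \<Omega>) (\<lambda>x. v x * partial_deriv i \<phi> x)"
   by (rule gradient_integrals[OF u test_ext_measurable(2)[OF \<phi>], symmetric])
  also have "... = - integral\<^sup>L (lebesgue_on \<Omega>) (\<lambda>x. ?g x $ i * \<phi> x)" using g(1) \<phi> unfolding has_weak_gradient_def by blast
  also have "integral\<^sup>L (lebesgue_on \<Omega>) (\<lambda>x. ?g x $ i * \<phi> x) = (LBINT x. h i x * \<phi> x)"
   by (rule gradient_integrals[OF h h0 hg test_ext_measurable(1)[OF \<phi>]])
  finally show "(LBINT x. u x * partial_deriv i \<phi> x) = - (LBINT x. q x $ i * \<phi> x)" by (simp add: q)
 qed
 hence "Rep v u q" using u(3) by (simp add: Rep_def)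
 moreover have "AE x in lborel. \<forall>i. x \<in> \<Omega> \<longrightarrow> ?g x $ i = h i x" by (subst AE_all_countable) (use hg in blast)
 hence "AE x in lborel. x \<in> \<Omega> \<longrightarrow> ?g x = q x" by eventually_elim (auto simp: vec_eq_iff q)
 ultimately show ?thesis by (rule that)
qed

text \<open>\<open>weak_gradient\<close> picks some gradient; uniqueness almost everywhere lets any
  representing pair compute it.\<close>

lemma Rep_gradient:
 assumes "Rep v u q" shows "AE x in lborel. x \<in> \<Omega> \<longrightarrow> weak_gradient \<Omega> v x = q x"
proof -
 obtain u' q' where r: "Rep v u' q'" "AE x in lborel. x \<in> \<Omega> \<longrightarrow> weak_gradient \<Omega> v x = q' x"
  using Rep_ex[OF Rep_W12(1)[OF assms]] by blast
 show ?thesis using r(2) gradient_unique[OF r(1) assms] by eventually_elim auto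
qed

lemma inner_integrable:
 assumes "sob_pair \<Omega> u q" "sob_pair \<Omega> u' q'" shows "integrable lborel (\<lambda>x. q x \<bullet> q' x)"
proof (rule Bochner_Integration.integrable_bound)
 note [measurable] = sob_pairD(1,2)[OF assms(1)] sob_pairD(1,2)[OF assms(2)]
 show "integrable lborel (\<lambda>x. (norm (q x))^2 + (norm (q' x))^2)" using assms by (auto simp: sob_pair_def)
 have "\<bar>a \<bullet> b\<bar> \<le> (norm a)^2 + (norm b)^2" for a b :: "real^'n"
 proof -
  have "\<bar>a \<bullet> b\<bar> \<le> norm a * norm b" by (rule Cauchy_Schwarz_ineq2)
  moreover have "0 \<le> (norm a - norm b)^2" by simp
  hence "2 * (norm a * norm b) \<le> (norm a)^2 + (norm b)^2" by (simp add: power2_diff)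
  moreover have "0 \<le> norm a * norm b" by simp
  ultimately show ?thesis by linarith
 qed
 thus "AE x in lborel. norm (q x \<bullet> q' x) \<le> norm ((norm (q x))^2 + (norm (q' x))^2)" by simp
 show "(\<lambda>x. q x \<bullet> q' x) \<in> borel_measurable lborel" by measurable
qed

lemma product_integrable:
 fixes f g :: "'b \<Rightarrow> real"
 assumes [measurable]: "f \<in> borel_measurable M" "g \<in> borel_measurable M"
  and i: "integrable M (\<lambda>x. (f x)^2)" "integrable M (\<lambda>x. (g x)^2)"
 shows "integrable M (\<lambda>x. f x * g x)"
proof (rule Bochner_Integration.integrable_bound)
 show "integrable M (\<lambda>x. (f x)^2 + (g x)^2)" using i by simp
 have "\<bar>a * b\<bar> \<le> a^2 + b^2" for a b :: real
 proof -
  have "0 \<le> (\<bar>a\<bar> - \<bar>b\<bar>)^2" by simp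
  hence "2 * (\<bar>a\<bar> * \<bar>b\<bar>) \<le> a^2 + b^2" by (simp add: power2_diff)
  moreover have "0 \<le> \<bar>a\<bar> * \<bar>b\<bar>" by simp
  ultimately show ?thesis unfolding abs_mult by linarith
 qed
 thus "AE x in M. norm (f x * g x) \<le> norm ((f x)^2 + (g x)^2)" by simp
qed measurable

lemma sob_pair_lin:
 assumes "sob_pair \<Omega> u q" "sob_pair \<Omega> u' q'"
 shows "sob_pair \<Omega> (\<lambda>x. c * u x + d * u' x) (\<lambda>x. c *\<^sub>R q x + d *\<^sub>R q' x)"
proof -
 note p = sob_pairD[OF assms(1)] and p' = sob_pairD[OF assms(2)]
 note [measurable] = p(1,2) p'(1,2)
 note i = inner_integrable[OF assms] product_integrable[of u lborel u', OF _ _ p(3) p'(3)]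
 show ?thesis unfolding sob_pair_def
 proof (intro conjI ballI allI impI)
  have "(\<lambda>x. (c * u x + d * u' x)^2) = (\<lambda>x. c^2 * (u x)^2 + 2 * c * d * (u x * u' x) + d^2 * (u' x)^2)"
   by (auto simp: power2_eq_square algebra_simps)
  thus "integrable lborel (\<lambda>x. (c * u x + d * u' x)^2)" using p(3) p'(3) i by simp
  have "(\<lambda>x. (norm (c *\<^sub>R q x + d *\<^sub>R q' x))^2) = (\<lambda>x. c^2 * (norm (q x))^2 + 2 * c * d * (q x \<bullet> q' x) + d^2 * (norm (q' x))^2)"
  proof
   fix x show "(norm (c *\<^sub>R q x + d *\<^sub>R q' x))^2 = c^2 * (norm (q x))^2 + 2 * c * d * (q x \<bullet> q' x) + d^2 * (norm (q' x))^2"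
    unfolding power2_norm_eq_inner inner_add_left inner_add_right inner_scaleR_left inner_scaleR_right inner_commute[of "q' x" "q x"]
    by (simp only: power2_eq_square algebra_simps)
  qed
  thus "integrable lborel (\<lambda>x. (norm (c *\<^sub>R q x + d *\<^sub>R q' x))^2)" using p(4) p'(4) i by simp
  fix x assume "x \<notin> \<Omega>" thus "c * u x + d * u' x = 0" "c *\<^sub>R q x + d *\<^sub>R q' x = 0" using p(5,6) p'(5,6) by auto
 next
  fix \<phi> j assume \<phi>: "\<phi> \<in> test_functions \<Omega>"
  note [measurable] = test_ext_measurable[OF \<phi>]
  obtain K where K: "\<And>x. \<bar>\<phi> x\<bar> \<le> K" "\<And>i x. \<bar>partial_deriv i \<phi> x\<bar> \<le> K" using test_functions_bounded[OF \<phi>] by metis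
  have b: "integrable lborel (\<lambda>x. f x * \<psi> x)" if "integrable lborel f" "\<psi> \<in> borel_measurable borel" "\<And>x. \<bar>\<psi> x\<bar> \<le> K" for f \<psi> :: "real^'n \<Rightarrow> real"
  proof (rule Bochner_Integration.integrable_bound)
   show "integrable lborel (\<lambda>x. f x * K)" using that by simp
   show "AE x in lborel. norm (f x * \<psi> x) \<le> norm (f x * K)"
    using that(3) by (intro AE_I2) (simp add: abs_mult mult_left_mono order_trans[OF _ abs_ge_self])
  qed (use that in measurable)
  have s: "integrable lborel u" "integrable lborel u'" "integrable lborel (\<lambda>x. q x $ j)" "integrable lborel (\<lambda>x. q' x $ j)"
   using sob_integrable[OF open_\<Omega> bounded_\<Omega> assms(1)] sob_integrable[OF open_\<Omega> bounded_\<Omega> assms(2)]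
    integrable_inner_left[OF sob_integrable(2)[OF open_\<Omega> bounded_\<Omega> assms(1)], of "axis j 1"]
    integrable_inner_left[OF sob_integrable(2)[OF open_\<Omega> bounded_\<Omega> assms(2)], of "axis j 1"] by (simp_all add: inner_axis)
  have l: "(LBINT x. (c * f x + d * g x) * \<psi> x) = c * (LBINT x. f x * \<psi> x) + d * (LBINT x. g x * \<psi> x)"
   if "integrable lborel (\<lambda>x. f x * \<psi> x)" "integrable lborel (\<lambda>x. g x * \<psi> x)" for f g \<psi> :: "real^'n \<Rightarrow> real"
   using that by (simp add: distrib_right mult.assoc)
  show "(LBINT x. (c * u x + d * u' x) * partial_deriv j \<phi> x) = - (LBINT x. (c *\<^sub>R q x + d *\<^sub>R q' x) $ j * \<phi> x)"
   using l[OF b[OF s(1), of "partial_deriv j \<phi>"] b[OF s(2), of "partial_deriv j \<phi>"]] l[OF b[OF s(3), of \<phi>] b[OF s(4), of \<phi>]]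
    p(7)[OF \<phi>, of j] p'(7)[OF \<phi>, of j] K by simp
 qed measurable
qed

lemma Rep_lin:
 assumes "Rep v u q" "Rep v' u' q'"
 shows "Rep (\<lambda>x. c * v x + d * v' x) (\<lambda>x. c * u x + d * u' x) (\<lambda>x. c *\<^sub>R q x + d *\<^sub>R q' x)"
proof -
 have "AE x in lborel. x \<in> \<Omega> \<longrightarrow> c * v x + d * v' x = c * u x + d * u' x"
  using assms[unfolded Rep_def, THEN conjunct2] by eventually_elim auto
 thus ?thesis using assms sob_pair_lin unfolding Rep_def by blast
qed

lemma form_a:
 assumes "Rep v u q" "Rep v' u' q'"
 shows "integral\<^sup>L (lebesgue_on \<Omega>) (\<lambda>x. weak_gradient \<Omega> v x \<bullet> weak_gradient \<Omega> v' x) = (LBINT x. q x \<bullet> q' x)"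
proof -
 have sp: "sob_pair \<Omega> u q" "sob_pair \<Omega> u' q'" using assms Rep_def by auto
 note [measurable] = sob_pairD(1,2)[OF sp(1)] sob_pairD(1,2)[OF sp(2)]
 have ae: "AE x in lborel. x \<in> \<Omega> \<longrightarrow> weak_gradient \<Omega> v x \<bullet> weak_gradient \<Omega> v' x = q x \<bullet> q' x"
  using Rep_gradient[OF assms(1)] Rep_gradient[OF assms(2)] by eventually_elim auto
 have m: "(\<lambda>x. q x \<bullet> q' x) \<in> borel_measurable borel" by measurable
 have "integral\<^sup>L (lebesgue_on \<Omega>) (\<lambda>x. weak_gradient \<Omega> v x \<bullet> weak_gradient \<Omega> v' x) = (LBINT x. indicator \<Omega> x * (q x \<bullet> q' x))"
  by (rule lebesgue_on_transfer(1)[OF \<Omega>_borel lebesgue_on_measurableI[OF \<Omega>_borel m ae] m ae \<Omega>_borel order_refl])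
 thus ?thesis using off_\<Omega>[of "\<lambda>x. q x \<bullet> q' x"] sob_pairD(6)[OF sp(1)] by simp
qed

section \<open>The trace on the whole boundary and the boundary form\<close>

lemma boundary_trace_avg:
 assumes "Rep v u q" shows "boundary_trace \<Omega> v x = Lim (at_right 0) (avg u x)"
proof -
 have sp: "sob_pair \<Omega> u q" and ae: "AE x in lborel. x \<in> \<Omega> \<longrightarrow> v x = u x" using assms Rep_def by auto
 note p = sob_pairD[OF sp]
 have "integral\<^sup>L (lebesgue_on (ball x r \<inter> \<Omega>)) v / measure lebesgue (ball x r \<inter> \<Omega>) = avg u x r" for r
 proof -
  have "integral\<^sup>L (lebesgue_on (ball x r \<inter> \<Omega>)) v = (LBINT y. indicator (ball x r \<inter> \<Omega>) y * u y)"
   by (rule lebesgue_on_transfer(1)[OF \<Omega>_borel lebesgue_on_measurableI[OF \<Omega>_borel p(1) ae] p(1) ae]) auto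
  thus ?thesis unfolding avg_def by (simp add: Int_commute)
 qed
 thus ?thesis unfolding boundary_trace_def by simp
qed

definition Tb :: "(real^'n \<Rightarrow> real) \<Rightarrow> real^'n \<Rightarrow> real" where
 "Tb u x = (if x \<in> Cus then tr (\<lambda>x. gam (x $ e)) u x else tr (\<lambda>_. 1) u x)"

definition bX :: "(real^'n) measure" where "bX = bm (frontier \<Omega>)"

lemma sets_bX[measurable_cong]: "sets bX = sets borel" and space_bX: "space bX = UNIV"
 by (simp_all add: bX_def sets_bm space_bm)

lemma gam_e_borel[measurable]: "(\<lambda>x::real^'n. gam (x $ e)) \<in> borel_measurable borel" by measurable

lemma Tb_measurable: "u \<in> borel_measurable borel \<Longrightarrow> Tb u \<in> borel_measurable borel"
 unfolding Tb_def using tr_measurable[of "\<lambda>x. gam (x $ e)" u] tr_measurable[of "\<lambda>_. 1" u] Cus_borel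
 by (intro measurable_If_set) auto

lemma AE_bX: assumes "AE x in bm Cus. P x" "AE x in bm Sph. P x" shows "AE x in bX. P x"
proof -
 have "AE x in HB. 0 < ennreal (W x) * indicator S x \<longrightarrow> P x" if "AE x in bm S. P x" "S \<in> sets borel" for S
  using that unfolding bm_def by (subst (asm) AE_density) auto
 hence "AE x in HB. 0 < ennreal (W x) * indicator Cus x \<longrightarrow> P x" "AE x in HB. 0 < ennreal (W x) * indicator Sph x \<longrightarrow> P x"
  using assms by auto
 hence "AE x in HB. 0 < ennreal (W x) * indicator (frontier \<Omega>) x \<longrightarrow> P x"
  by eventually_elim (auto simp: frontier_Un indicator_def split: if_splits)
 thus ?thesis unfolding bX_def bm_def by (subst AE_density) auto
qed

lemma nn_integral_bm_split:
 assumes [measurable]: "f \<in> borel_measurable borel" "P \<in> sets borel" "Q \<in> sets borel" and d: "P \<inter> Q = {}"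
 shows "(\<integral>\<^sup>+x. f x \<partial>bm (P \<union> Q)) = (\<integral>\<^sup>+x. f x \<partial>bm P) + (\<integral>\<^sup>+x. f x \<partial>bm Q)"
proof -
 have "indicator (P \<union> Q) x = (indicator P x + indicator Q x :: ennreal)" for x using d by (auto simp: indicator_def)
 hence "(\<integral>\<^sup>+x. f x \<partial>bm (P \<union> Q)) = (\<integral>\<^sup>+x. ennreal (W x) * indicator P x * f x + ennreal (W x) * indicator Q x * f x \<partial>HB)"
  by (subst nn_integral_bm) (auto simp: distrib_left distrib_right)
 thus ?thesis by (simp add: nn_integral_add nn_integral_bm)
qed

lemma nn_integral_bX:
 assumes "f \<in> borel_measurable borel"
 shows "(\<integral>\<^sup>+x. f x \<partial>bX) = (\<integral>\<^sup>+x. f x \<partial>bm Cus) + (\<integral>\<^sup>+x. f x \<partial>bm Sph)"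
 unfolding bX_def frontier_Un by (rule nn_integral_bm_split[OF assms Cus_borel Sph_borel]) (auto simp: Cus_def Sph_def)

lemma Tb_limit:
 assumes sp: "sob_pair \<Omega> u q" shows "AE x in bX. (avg u x \<longlongrightarrow> Tb u x) (at_right 0)"
proof (rule AE_bX)
 have "AE x in bm Cus. (avg u x \<longlongrightarrow> tr (\<lambda>x. gam (x $ e)) u x) (at_right 0)"
  by (rule trace_limit[OF sp piece_Cus \<Omega>_borel, of 1]) (use gam_bounds in auto)
 thus "AE x in bm Cus. (avg u x \<longlongrightarrow> Tb u x) (at_right 0)"
  using AE_bm[OF Cus_borel] by eventually_elim (simp add: Tb_def)
 have "AE x in bm Sph. (avg u x \<longlongrightarrow> tr (\<lambda>_. 1) u x) (at_right 0)"
  by (rule trace_limit[OF sp piece_Sph \<Omega>_borel, of 1]) auto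
 thus "AE x in bm Sph. (avg u x \<longlongrightarrow> Tb u x) (at_right 0)"
  using AE_bm[OF Sph_borel] by eventually_elim (auto simp: Tb_def Cus_def Sph_def)
qed

lemma avg_lin:
 assumes "integrable lborel u" "integrable lborel u'"
 shows "avg (\<lambda>x. c * u x + d * u' x) x r = c * avg u x r + d * avg u' x r"
proof -
 have i: "integrable lborel (\<lambda>y. indicator (\<Omega> \<inter> ball x r) y * f y)" if "integrable lborel f" for f :: "real^'n \<Rightarrow> real"
  using integrable_real_mult_indicator[OF _ that, of "\<Omega> \<inter> ball x r"] by (simp add: mult.commute)
 have "(LBINT y. indicator (\<Omega> \<inter> ball x r) y * (c * u y + d * u' y))
  = (LBINT y. c * (indicator (\<Omega> \<inter> ball x r) y * u y) + d * (indicator (\<Omega> \<inter> ball x r) y * u' y))"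
  by (simp add: algebra_simps)
 also have "... = c * (LBINT y. indicator (\<Omega> \<inter> ball x r) y * u y) + d * (LBINT y. indicator (\<Omega> \<inter> ball x r) y * u' y)"
  using i[OF assms(1)] i[OF assms(2)] by simp
 finally show ?thesis by (simp add: avg_def add_divide_distrib)
qed

text \<open>Averages are linear in \<open>u\<close>, but \<open>lim\<close> only where the limits
  exist; hence the restriction to almost every point.\<close>

lemma Tb_lin:
 assumes "sob_pair \<Omega> u q" "sob_pair \<Omega> u' q'"
 shows "AE x in bX. Tb (\<lambda>x. c * u x + d * u' x) x = c * Tb u x + d * Tb u' x"
 using Tb_limit[OF assms(1)] Tb_limit[OF assms(2)] Tb_limit[OF sob_pair_lin[OF assms, of c d]]
proof eventually_elim
 case (elim x)
 have "((\<lambda>r. c * avg u x r + d * avg u' x r) \<longlongrightarrow> c * Tb u x + d * Tb u' x) (at_right 0)"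
  by (intro tendsto_intros elim)
 moreover have "avg (\<lambda>x. c * u x + d * u' x) x = (\<lambda>r. c * avg u x r + d * avg u' x r)"
  using sob_integrable(1)[OF open_\<Omega> bounded_\<Omega>] assms by (intro ext avg_lin) auto
 ultimately show ?case using elim(3) by (intro tendsto_unique[OF trivial_limit_at_right_real]) auto
qed

text \<open>Where the weight vanishes nothing is known about \<open>boundary_trace\<close>, but the
  factor \<open>W\<close> removes these points; at almost every other boundary point the trace is
  \<open>Tb\<close>.\<close>

lemma form_b:
 assumes "Rep v u q" "Rep v' u' q'"
 shows "integral\<^sup>L (hausdorff_measure_on (real CARD('n) - 1) (frontier \<Omega>)) (\<lambda>x. boundary_trace \<Omega> v x * boundary_trace \<Omega> v' x * W x)
  = (\<integral>x. Tb u x * Tb u' x \<partial>bX)"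
proof -
 let ?H = "hausdorff_measure_on (real CARD('n) - 1) (frontier \<Omega>)"
 have sp: "sob_pair \<Omega> u q" "sob_pair \<Omega> u' q'" using assms Rep_def by auto
 note [measurable] = Tb_measurable[OF sob_pairD(1)[OF sp(1)]] Tb_measurable[OF sob_pairD(1)[OF sp(2)]]
 define f where "f x = boundary_trace \<Omega> v x * boundary_trace \<Omega> v' x * W x" for x
 define g where "g x = W x * (Tb u x * Tb u' x)" for x
 have [measurable]: "g \<in> borel_measurable borel" unfolding g_def by measurable
 have "AE x in bX. boundary_trace \<Omega> v x = Tb u x \<and> boundary_trace \<Omega> v' x = Tb u' x"
  using Tb_limit[OF sp(1)] Tb_limit[OF sp(2)]
 proof eventually_elim
  case (elim x) thus ?case
   using boundary_trace_avg[OF assms(1)] boundary_trace_avg[OF assms(2)] tendsto_Lim[OF trivial_limit_at_right_real] by metis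
 qed
 hence "AE x in HB. 0 < ennreal (W x) * indicator (frontier \<Omega>) x \<longrightarrow> boundary_trace \<Omega> v x = Tb u x \<and> boundary_trace \<Omega> v' x = Tb u' x"
  unfolding bX_def bm_def by (subst (asm) AE_density) auto
 hence "AE x in ?H. 0 < ennreal (W x) * indicator (frontier \<Omega>) x \<longrightarrow> boundary_trace \<Omega> v x = Tb u x \<and> boundary_trace \<Omega> v' x = Tb u' x"
  unfolding HB_def by (rule AE_distrD[OF id_measurable_hausdorff])
 hence ae: "AE x in ?H. g x = f x"
  using AE_space[of ?H]
 proof eventually_elim
  case (elim x)
  hence "x \<in> frontier \<Omega>" by (simp add: space_hausdorff)
  have "W x = 0 \<or> W x > 0" using W_bounds[of x] by linarith
  thus ?case using elim(1) \<open>x \<in> frontier \<Omega>\<close> by (auto simp: f_def g_def)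
 qed
 have gH: "g \<in> borel_measurable ?H" by (rule borel_measurable_hausdorff) measurable
 \<comment> \<open>\<open>f\<close> comes from limits over all radii and is not known to be Borel;
   it differs from the Borel function \<open>g\<close> only inside a null set, and completeness of
   the Hausdorff measure makes it measurable.\<close>
 obtain N where N: "N \<in> null_sets ?H" "{x\<in>space ?H. g x \<noteq> f x} \<subseteq> N" using ae unfolding eventually_ae_filter by auto
 have fH: "f \<in> borel_measurable ?H"
 proof (rule measurableI)
  fix A :: "real set" assume A: "A \<in> sets borel"
  have "f -` A \<inter> space ?H = ((g -` A \<inter> space ?H) - N) \<union> (f -` A \<inter> space ?H \<inter> N)" using N(2) by auto
  moreover have "f -` A \<inter> space ?H \<inter> N \<in> null_sets ?H" by (rule hausdorff_null_subset[OF N(1)]) auto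
  from sets.Un[OF sets.Diff[OF measurable_sets[OF gH A] null_setsD2[OF N(1)]] null_setsD2[OF this]]
  have "((g -` A \<inter> space ?H) - N) \<union> (f -` A \<inter> space ?H \<inter> N) \<in> sets ?H" .
  ultimately show "f -` A \<inter> space ?H \<in> sets ?H" by (simp only:)
 qed simp
 have "integral\<^sup>L ?H f = integral\<^sup>L ?H g" by (rule integral_cong_AE[OF fH gH]) (use ae in \<open>eventually_elim, simp\<close>)
 also have "... = integral\<^sup>L HB g" unfolding HB_def by (rule integral_distr[symmetric, OF id_measurable_hausdorff]) measurable
 also have "... = (\<integral>x. (W x * indicator (frontier \<Omega>) x) *\<^sub>R (Tb u x * Tb u' x) \<partial>HB)"
 proof (rule integral_cong_AE)
  have "AE x in HB. x \<in> frontier \<Omega>" unfolding HB_def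
   by (subst AE_distr_iff[OF id_measurable_hausdorff]) (auto simp: space_hausdorff intro!: AE_I2)
  thus "AE x in HB. g x = (W x * indicator (frontier \<Omega>) x) *\<^sub>R (Tb u x * Tb u' x)"
   by eventually_elim (simp add: g_def)
 qed (auto simp: sets_HB)
 also have "... = (\<integral>x. Tb u x * Tb u' x \<partial>density HB (\<lambda>x. ennreal (W x * indicator (frontier \<Omega>) x)))"
  by (rule integral_density[symmetric]) (use W_bounds in auto)
 also have "density HB (\<lambda>x. ennreal (W x * indicator (frontier \<Omega>) x)) = bX"
  unfolding bX_def bm_def by (rule arg_cong[where f="density HB"]) (auto simp: indicator_def)
 finally show ?thesis unfolding f_def .
qed

end

text \<open>Elimination: an unknown \<open>p\<close> with nonzero coefficient in the last of k + 1
  equations is expressed by the others. The lemma supplies the vectors for infinite rank and the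
  upper bound on multiplicities.\<close>

lemma homogeneous_system:
 fixes f :: "nat \<Rightarrow> nat \<Rightarrow> real"
 shows "\<exists>c. (\<exists>i\<le>k. c i \<noteq> 0) \<and> (\<forall>j<k. (\<Sum>i\<le>k. c i * f j i) = 0)"
proof (induction k arbitrary: f)
 case 0 show ?case by (intro exI[of _ "\<lambda>_. 1"]) auto
next
 case (Suc k)
 show ?case
 proof (cases "\<exists>p\<le>Suc k. f k p \<noteq> 0")
  case False
  obtain c where c: "\<exists>i\<le>k. c i \<noteq> 0" "\<And>j. j < k \<Longrightarrow> (\<Sum>i\<le>k. c i * f j i) = 0" using Suc[of f] by blast
  let ?c = "\<lambda>i. if i \<le> k then c i else 0"
  have "(\<Sum>i\<le>Suc k. ?c i * f j i) = 0" if "j < Suc k" for j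
  proof (cases "j = k")
   case True thus ?thesis using False by (intro sum.neutral) auto
  next
   case False
   have "(\<Sum>i\<le>Suc k. ?c i * f j i) = (\<Sum>i\<le>k. c i * f j i)" by simp
   thus ?thesis using c(2)[of j] that False by simp
  qed
  moreover have "\<exists>i\<le>Suc k. ?c i \<noteq> 0" using c(1) le_SucI by auto
  ultimately show ?thesis by (intro exI[of _ ?c]) auto
 next
  case True
  then obtain p where p: "p \<le> Suc k" "f k p \<noteq> 0" by blast
  \<comment> \<open>\<open>s\<close> numbers the unknowns other than \<open>p\<close>;
    \<open>t\<close> below inverts it.\<close>
  define s where "s i = (if i < p then i else Suc i)" for i
  have s: "bij_betw s {..k} ({..Suc k} - {p})"
   by (rule bij_betwI[where g="\<lambda>i. if i < p then i else i - 1"]) (use p in \<open>auto simp: s_def split: if_splits\<close>)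
  obtain c where c: "\<exists>i\<le>k. c i \<noteq> 0" "\<And>j. j < k \<Longrightarrow> (\<Sum>i\<le>k. c i * (f j (s i) - f k (s i) / f k p * f j p)) = 0"
   using Suc[of "\<lambda>j i. f j (s i) - f k (s i) / f k p * f j p"] by blast
  define t where "t i = (if i < p then i else i - 1)" for i
  define d where "d i = (if i = p then - (\<Sum>i\<le>k. c i * f k (s i)) / f k p else c (t i))" for i
  have ts: "t (s i) = i" "s i \<noteq> p" for i by (auto simp: t_def s_def)
  have sum: "(\<Sum>i\<le>Suc k. d i * g i) = d p * g p + (\<Sum>i\<le>k. c i * g (s i))" for g
  proof -
   have "(\<Sum>i\<le>Suc k. d i * g i) = d p * g p + (\<Sum>i\<in>{..Suc k} - {p}. d i * g i)" using p by (intro sum.remove) auto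
   also have "(\<Sum>i\<in>{..Suc k} - {p}. d i * g i) = (\<Sum>i\<le>k. d (s i) * g (s i))" by (rule sum.reindex_bij_betw[OF s, symmetric])
   also have "... = (\<Sum>i\<le>k. c i * g (s i))" by (simp add: d_def ts)
   finally show ?thesis .
  qed
  have "(\<Sum>i\<le>Suc k. d i * f j i) = 0" if j: "j < Suc k" for j
  proof (cases "j = k")
   case True thus ?thesis using p by (simp only: sum) (simp add: d_def)
  next
   case False
   have "(\<Sum>i\<le>k. c i * f j (s i)) = (\<Sum>i\<le>k. c i * f k (s i)) / f k p * f j p"
    using c(2)[of j] j False by (simp add: right_diff_distrib sum_subtractf sum_distrib_right sum_divide_distrib mult.assoc)
   thus ?thesis by (simp only: sum) (simp add: d_def)
  qed
  moreover obtain i where "i \<le> k" "c i \<noteq> 0" using c(1) by blast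
  hence "s i \<le> Suc k" "d (s i) \<noteq> 0" by (auto simp: d_def ts) (simp add: s_def)
  ultimately show ?thesis by blast
 qed
qed

section \<open>Trace, Poincare and Friedrichs inequalities\<close>

context cusp
begin

definition C6 :: real where "C6 = 4 * (C4 + C5)"

lemma C6_nonneg: "C6 \<ge> 0" using C345 by (simp add: C6_def)

lemma energy_off: "sob_pair \<Omega> u q \<Longrightarrow> energy q \<Omega> = energy q UNIV"
 unfolding energy_def by (intro nn_integral_cong) (auto simp: indicator_def dest: sob_pairD(6))

lemma nsq_eq_rsq: "integrable M (\<lambda>x. (f x)^2) \<Longrightarrow> nsq M f = ennreal (rsq M (\<lambda>x. f x :: real))"
 by (rule nn_integral_eq_integral) auto

lemma energy_real: "sob_pair \<Omega> u q \<Longrightarrow> energy q UNIV = ennreal (dirichlet q)"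
 unfolding energy_def by (simp add: nn_integral_eq_integral sob_pairD(4))

lemma piece_trace_bound:
 assumes sp: "sob_pair \<Omega> u q" and P: "piece P \<sigma>" and Yb[measurable]: "Y \<in> sets borel"
  and Y: "\<And>x y. x \<in> P \<Longrightarrow> y \<in> \<Omega> \<Longrightarrow> dist x y < KK * (\<kappa> * \<sigma> x) \<Longrightarrow> y \<in> Y" and s: "\<And>y. y \<in> Y \<Longrightarrow> \<sigma> y \<le> s"
 shows "nsq (bm P) (tr \<sigma> u) \<le> ennreal (2 * C4 * s^2) * energy q Y
  + ennreal (2 * C5) * nsq_on Y u"
proof -
 note [measurable] = sob_pairD(1)[OF sp] piece_measurable[OF P]
 note m[measurable] = tr_measurable[OF piece_measurable(2)[OF P] sob_pairD(1)[OF sp]] avg_measurable[OF _ sob_pairD(1)[OF sp], of "\<lambda>x. rk 0 * \<sigma> x"]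
 have e: "ennreal (enn2real (energy q Y)) = energy q Y" using energy_finite[OF sp, of Y] by simp
 have "nsq (bm P) (\<lambda>x. tr \<sigma> u x - 0) \<le> 2 * nsq (bm P) (\<lambda>x. tr \<sigma> u x - avg u x (rk 0 * \<sigma> x))
   + 2 * nsq (bm P) (\<lambda>x. avg u x (rk 0 * \<sigma> x) - 0)"
  by (rule nn_square_diff_le) measurable
 also have "... \<le> 2 * ennreal (C4 * s^2 * (1 / 2) ^ 0 * enn2real (energy q Y)) + 2 * (ennreal C5 * nsq_on Y u)"
  using trace_approx[OF sp P Yb Y s, where m=0] trace_start[OF sp P Yb Y s] by (intro add_mono mult_left_mono) auto
 also have "... = ennreal (2 * C4 * s^2) * energy q Y + ennreal (2 * C5) * nsq_on Y u"
  using C345 e by (simp add: ennreal_mult mult.assoc)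
 finally show ?thesis by simp
qed

lemma Tb_piece:
 assumes "P \<subseteq> Cus" "P \<in> sets borel" shows "nsq (bm P) (Tb u) = nsq (bm P) (tr (\<lambda>x. gam (x $ e)) u)"
proof (rule nn_integral_cong_AE)
 show "AE x in bm P. ennreal ((Tb u x)^2) = ennreal ((tr (\<lambda>x. gam (x $ e)) u x)^2)"
  using AE_bm[OF assms(2)] by eventually_elim (use assms(1) in \<open>auto simp: Tb_def\<close>)
qed

lemma Tb_Sph: "nsq (bm Sph) (Tb u) = nsq (bm Sph) (tr (\<lambda>_. 1) u)"
 by (rule nn_integral_cong_AE) (use AE_bm[OF Sph_borel] in \<open>eventually_elim, auto simp: Tb_def Cus_def Sph_def\<close>)

lemma Tb_bound:
 assumes sp: "sob_pair \<Omega> u q"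
 shows "integrable bX (\<lambda>x. (Tb u x)^2)"
  and "rsq bX (Tb u) \<le> C6 * (rsq lborel u + dirichlet q)"
proof -
 note [measurable] = Tb_measurable[OF sob_pairD(1)[OF sp]]
 let ?N = "\<integral>x. (u x)^2 \<partial>lborel" and ?E = "\<integral>x. (norm (q x))^2 \<partial>lborel"
 have N: "nsq_on \<Omega> u \<le> ennreal ?N"
  using nsq_eq_rsq[OF sob_pairD(3)[OF sp]] by (subst (asm) eq_commute) (auto intro!: nn_integral_mono simp: indicator_def)
 have one: "ennreal (2 * C4 * 1^2) * energy q \<Omega> + ennreal (2 * C5) * nsq_on \<Omega> u \<le> ennreal (2 * C4 * ?E + 2 * C5 * ?N)"
 proof -
  have "ennreal (2 * C4 * 1^2) * energy q \<Omega> + ennreal (2 * C5) * nsq_on \<Omega> u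
   \<le> ennreal (2 * C4) * ennreal ?E + ennreal (2 * C5) * ennreal ?N"
   using energy_off[OF sp] energy_real[OF sp] N by (intro add_mono mult_left_mono) auto
  also have "... = ennreal (2 * C4 * ?E + 2 * C5 * ?N)" using C345 by (simp add: ennreal_mult ennreal_plus mult.assoc)
  finally show ?thesis .
 qed
 have "nsq bX (Tb u) = nsq (bm Cus) (Tb u) + nsq (bm Sph) (Tb u)"
  by (rule nn_integral_bX) measurable
 also have "... \<le> ennreal (2 * C4 * ?E + 2 * C5 * ?N) + ennreal (2 * C4 * ?E + 2 * C5 * ?N)"
 proof (rule add_mono)
  show "nsq (bm Cus) (Tb u) \<le> ennreal (2 * C4 * ?E + 2 * C5 * ?N)"
   unfolding Tb_piece[OF order_refl Cus_borel]
   by (rule order_trans[OF piece_trace_bound[OF sp piece_Cus \<Omega>_borel, of 1] one]) (use gam_bounds in auto)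
  show "nsq (bm Sph) (Tb u) \<le> ennreal (2 * C4 * ?E + 2 * C5 * ?N)"
   unfolding Tb_Sph
   by (rule order_trans[OF piece_trace_bound[OF sp piece_Sph \<Omega>_borel, of 1] one]) auto
 qed
 also have "... = ennreal (4 * C4 * ?E + 4 * C5 * ?N)"
  using C345 by (subst ennreal_plus[symmetric]) (auto intro!: add_nonneg_nonneg mult_nonneg_nonneg simp: mult.assoc)
 also have "... \<le> ennreal (C6 * (?N + ?E))"
 proof (rule ennreal_leI)
  have "0 \<le> C4 * ?N" "0 \<le> C5 * ?E" using C345 by (auto intro!: mult_nonneg_nonneg)
  moreover have "C6 * (?N + ?E) = 4 * C4 * ?E + 4 * C5 * ?N + 4 * (C4 * ?N) + 4 * (C5 * ?E)" by (simp add: C6_def algebra_simps)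
  ultimately show "4 * C4 * ?E + 4 * C5 * ?N \<le> C6 * (?N + ?E)" by linarith
 qed
 finally have B: "nsq bX (Tb u) \<le> ennreal (C6 * (?N + ?E))" .
 show i: "integrable bX (\<lambda>x. (Tb u x)^2)"
  using B by (intro integrableI_bounded) (auto simp: le_less_trans)
 have "0 \<le> C6 * (?N + ?E)" using C6_nonneg by (intro mult_nonneg_nonneg) auto
 thus "rsq bX (Tb u) \<le> C6 * (?N + ?E)" using B unfolding nsq_eq_rsq[OF i] by simp
qed

definition CP :: real where "CP = 2 + 3 * (1 / (V * sqrt 2 ^ CARD('n)) * (8 * (V * (2 * sqrt 2) ^ CARD('n))))"

text \<open>\<open>m\<close> is the mean over the ball, where the convex Poincare inequality
  applies. The part of the domain below height 1 is shifted by one unit into the ball. In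
  \<open>CP\<close> the ball estimate is counted three times: once directly and twice after the
  shift, whose own cost is the summand 2.\<close>

lemma poincare_domain:
 assumes sp: "sob_pair \<Omega> u q"
 obtains m where "nsq_on \<Omega> (\<lambda>x. u x - m) \<le> ennreal CP * energy q UNIV"
proof -
 note [measurable] = sob_pairD(1,2)[OF sp]
 let ?B = "ball (axis e 2 :: real^'n) (sqrt 2)"
 define vb where "vb = V * sqrt 2 ^ CARD('n)"
 have vb: "vb > 0" "emeasure lborel ?B = ennreal vb" using V_pos emeasure_ball_V[of "sqrt 2" "axis e 2"] by (auto simp: vb_def)
 define m where "m = (LBINT x. indicator ?B x * u x) / vb"
 define P1 where "P1 = 1 / vb * (8 * (V * (2 * sqrt 2) ^ CARD('n)))"
 have P1: "P1 \<ge> 0" using vb V_pos by (simp add: P1_def)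
 have pt: "ennreal ((u y - m)^2) \<le> ennreal (1 / vb) * nsq_on ?B (\<lambda>z. u z - u y)" for y
 proof -
  have iu: "integrable lborel (\<lambda>x. indicator ?B x * u x)"
   using integrable_real_mult_indicator[OF _ sob_integrable(1)[OF open_\<Omega> bounded_\<Omega> sp], of ?B] by (simp add: mult.commute)
  have iB: "integrable lborel (indicator ?B :: _ \<Rightarrow> real)" using vb by simp
  have "(LBINT z. indicator ?B z * (u z - u y)) = (LBINT z. indicator ?B z * u z - u y * indicator ?B z)"
   by (simp add: algebra_simps)
  also have "... = (LBINT z. indicator ?B z * u z) - u y * vb" using iu iB vb by (simp add: measure_def)
  also have "... = vb * (m - u y)" using vb by (simp add: m_def algebra_simps)
  finally have e: "(u y - m)^2 = (1 / vb^2) * (LBINT z. indicator ?B z * (u z - u y))^2"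
   using vb by (simp add: power_mult_distrib power2_commute)
  have "ennreal ((u y - m)^2) = ennreal (1 / vb^2) * ennreal ((LBINT z. indicator ?B z * (u z - u y))^2)"
   unfolding e by (rule ennreal_mult) auto
  also have "... \<le> ennreal (1 / vb^2) * (ennreal vb * nsq_on ?B (\<lambda>z. u z - u y))"
   using set_integral_square_le[of "\<lambda>z. u z - u y" lborel ?B] vb by (intro mult_left_mono) auto
  also have "... = ennreal (1 / vb) * nsq_on ?B (\<lambda>z. u z - u y)"
  proof -
   have "ennreal (1 / vb^2) * ennreal vb = ennreal (1 / vb^2 * vb)" using vb by (intro ennreal_mult[symmetric]) auto
   also have "1 / vb^2 * vb = 1 / vb" using vb by (simp add: power2_eq_square)
   finally show ?thesis by (simp only: mult.assoc[symmetric])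
  qed
  finally show ?thesis .
 qed
 have B: "nsq_on ?B (\<lambda>x. u x - m) \<le> ennreal P1 * energy q UNIV"
 proof -
  have "nsq_on ?B (\<lambda>x. u x - m)
   \<le> (\<integral>\<^sup>+y. ennreal (1 / vb) * (nsq_on ?B (\<lambda>z. u z - u y) * indicator ?B y) \<partial>lborel)"
   by (intro nn_integral_mono) (use pt in \<open>auto simp: indicator_def\<close>)
  also have "... = ennreal (1 / vb) * (\<integral>\<^sup>+y. nsq_on ?B (\<lambda>z. u z - u y) * indicator ?B y \<partial>lborel)"
   by (rule nn_integral_cmult) measurable
  also have "... \<le> ennreal (1 / vb) * (ennreal ((2 * sqrt 2)^2) * emeasure lborel (ball (0::real^'n) (2 * sqrt 2)) * energy q ?B)"
  proof (intro mult_left_mono sob_poincare[OF open_\<Omega> bounded_\<Omega> sp])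
   fix y z assume "y \<in> ?B" "z \<in> ?B"
   hence "dist y z < sqrt 2 + sqrt 2" by (intro dist_triangle_less_add[of _ "axis e 2"]) (auto simp: dist_commute)
   thus "norm (z - y) < 2 * sqrt 2" by (simp add: dist_norm norm_minus_commute)
  qed (use ball_subset in auto)
  also have "... \<le> ennreal (1 / vb) * (ennreal 8 * ennreal (V * (2 * sqrt 2) ^ CARD('n)) * energy q UNIV)"
   by (intro mult_left_mono mult_mono energy_mono) (auto simp: emeasure_ball_V power_mult_distrib)
  also have "... = ennreal P1 * energy q UNIV"
  proof -
   have "ennreal (1 / vb) * (ennreal 8 * ennreal (V * (2 * sqrt 2) ^ CARD('n))) = ennreal P1"
    unfolding P1_def using vb V_pos by (subst ennreal_mult, simp, simp, subst ennreal_mult) auto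
   thus ?thesis by (simp only: mult.assoc[symmetric])
  qed
  finally show ?thesis .
 qed
 \<comment> \<open>The strict cut at height 1 keeps this part open; it may overlap the ball, and the
   points left out are in the ball.\<close>
 let ?E = "\<Omega> \<inter> {y. y $ e < 1}"
 have oE: "open ?E" by (intro open_Int open_\<Omega> open_Collect_less continuous_intros)
 have into: "y + axis e 1 \<in> ?B" if y: "y \<in> ?E" for y
 proof (cases "y \<in> ?B")
  case False thus ?thesis using shift_into_ball(1)[of y] y by blast
 next
  case True
  hence b: "(norm (xprime e y))^2 + (y $ e - 2)^2 < 2" by (simp only: mem_ball_c)
  have "(y $ e - 1)^2 \<le> (y $ e - 2)^2" using y by (intro abs_le_square_iff[THEN iffD1]) auto
  thus ?thesis unfolding mem_ball_c using b by (simp add: xprime_linear xprime_axis)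
 qed
 have shift: "nsq_on ?E (\<lambda>y. u (y + axis e 1) - u y) \<le> energy q UNIV"
 proof -
  have "nsq_on ?E (\<lambda>y. u (y + axis e 1) - u y) \<le> ennreal ((norm (axis e 1 :: real^'n))^2) * energy q UNIV"
  proof (rule sob_translation[OF open_\<Omega> bounded_\<Omega> sp oE])
   fix y s assume "y \<in> ?E" "0 \<le> s" "s \<le> (1::real)"
   moreover have "s *\<^sub>R axis e 1 = (axis e s :: real^'n)" by (simp add: axis_def vec_eq_iff)
   ultimately show "y + s *\<^sub>R axis e 1 \<in> \<Omega> \<inter> UNIV" using up_shift[of y s] by simp
  qed simp
  thus ?thesis by simp
 qed
 have "nsq_on ?E (\<lambda>y. u y - m) \<le> 2 * nsq_on ?E (\<lambda>y. u (y + axis e 1) - u y) + 2 * nsq_on ?B (\<lambda>y. u y - m)"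
  by (rule nsq_on_shift) (use oE into in auto)
 hence E: "nsq_on ?E (\<lambda>y. u y - m) \<le> 2 * energy q UNIV + 2 * (ennreal P1 * energy q UNIV)"
  using shift B by (meson add_mono mult_left_mono order_trans zero_le)
 have "nsq_on \<Omega> (\<lambda>x. u x - m)
   \<le> (\<integral>\<^sup>+x. ennreal ((u x - m)^2) * indicator ?E x + ennreal ((u x - m)^2) * indicator ?B x \<partial>lborel)"
 proof (rule nn_integral_mono)
  fix x
  have "x \<in> ?E \<or> x \<in> ?B" if "x \<in> \<Omega>"
  proof (rule ccontr)
   assume n: "\<not> ?thesis"
   hence x: "x \<notin> ?B" "\<not> x $ e < 1" using that by auto
   have "x $ e = 1" "norm (xprime e x) < gam (x $ e)" using shift_into_ball(2,4)[OF that x(1)] x(2) by auto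
   hence "norm (xprime e x) < 1" by (simp add: gam_ge1)
   hence "(norm (xprime e x))^2 < 1" by (simp add: abs_square_less_1)
   thus False using x(1) \<open>x $ e = 1\<close> unfolding mem_ball_c by simp
  qed
  thus "ennreal ((u x - m)^2) * indicator \<Omega> x \<le> ennreal ((u x - m)^2) * indicator ?E x + ennreal ((u x - m)^2) * indicator ?B x"
   by (auto simp: indicator_def)
 qed
 also have "... = nsq_on ?E (\<lambda>x. u x - m) + nsq_on ?B (\<lambda>x. u x - m)"
  using oE by (subst nn_integral_add) auto
 also have "... \<le> (2 * energy q UNIV + 2 * (ennreal P1 * energy q UNIV)) + ennreal P1 * energy q UNIV"
  by (intro add_mono E B)
 also have "... = ennreal CP * energy q UNIV"
 proof -
  have "ennreal CP = 2 + 2 * ennreal P1 + ennreal P1"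
  proof -
   have "ennreal CP = ennreal (2 + 2 * P1 + P1)" by (simp add: CP_def P1_def vb_def)
   moreover have "3 * ennreal P1 = (2 + 1) * ennreal P1" by simp
   hence "3 * ennreal P1 = 2 * ennreal P1 + ennreal P1" by (simp only: distrib_right mult_1)
   ultimately show ?thesis using P1 by (simp add: ennreal_plus ennreal_mult' add_ac)
  qed
  thus ?thesis by (simp add: distrib_right mult.assoc)
 qed
 finally show ?thesis by (rule that)
qed

text \<open>Polynomials in x_n, cut off to the domain, with their gradients. They serve as explicit
  vectors: \<open>PF 1\<close> for constants, \<open>PF 0\<close> for null functions and monomials
  for infinite rank.\<close>

definition PF :: "real poly \<Rightarrow> real^'n \<Rightarrow> real" where "PF p x = indicator \<Omega> x * poly p (x $ e)"
definition PG :: "real poly \<Rightarrow> real^'n \<Rightarrow> real^'n" where "PG p x = (indicator \<Omega> x * poly (pderiv p) (x $ e)) *\<^sub>R axis e 1"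

lemma poly_coord_borel[measurable]: "(\<lambda>x::real^'n. poly p (x $ i)) \<in> borel_measurable borel"
 by (intro borel_measurable_continuous_onI continuous_intros)

lemma PF_borel[measurable]: "PF p \<in> borel_measurable borel" unfolding PF_def by measurable

lemma bounded_integrable:
 fixes f :: "real^'n \<Rightarrow> real"
 assumes "f \<in> borel_measurable borel" "\<And>x. \<bar>f x\<bar> \<le> K * indicator \<Omega> x" shows "integrable lborel f"
proof (rule Bochner_Integration.integrable_bound)
 show "integrable lborel (\<lambda>x::real^'n. K * indicator \<Omega> x :: real)" using emeasure_\<Omega>_finite by simp
 show "AE x in lborel. norm (f x) \<le> norm (K * indicator \<Omega> x)" using assms(2) by (intro AE_I2) (auto intro: order_trans[OF _ abs_ge_self])
qed (use assms in simp)

lemma poly_bounded_on_\<Omega>: obtains K where "K \<ge> 0" "\<And>x. x \<in> \<Omega> \<Longrightarrow> \<bar>poly p (x $ e)\<bar> \<le> K"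
proof -
 have "compact ((\<lambda>x::real^'n. poly p (x $ e)) ` closure \<Omega>)"
  using bounded_\<Omega> by (intro compact_continuous_image continuous_intros) auto
 then obtain K where K: "\<And>x. x \<in> closure \<Omega> \<Longrightarrow> \<bar>poly p (x $ e)\<bar> \<le> K" using compact_imp_bounded bounded_iff by (metis imageI real_norm_def)
 show ?thesis by (rule that[of "max K 0"]) (use K subsetD[OF closure_subset[of \<Omega>]] in \<open>auto simp: max.coboundedI1\<close>)
qed

text \<open>The product of the polynomial and a test function is again a test function, so its
  derivative has integral 0; the product rule splits this into the two sides of the weak
  identity.\<close>

lemma sob_pair_poly: "sob_pair \<Omega> (PF p) (PG p)"
 unfolding sob_pair_def
proof (intro conjI allI ballI impI)
 show "PF p \<in> borel_measurable borel" by measurable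
 show m: "PG p \<in> borel_measurable borel" unfolding PG_def by measurable
 have sq: "integrable lborel (\<lambda>x. (indicator \<Omega> x * poly r (x $ e))^2)" for r
 proof -
  obtain K where K: "K \<ge> 0" "\<And>x. x \<in> \<Omega> \<Longrightarrow> \<bar>poly r (x $ e)\<bar> \<le> K" using poly_bounded_on_\<Omega>[of r] by blast
  show ?thesis
  proof (rule bounded_integrable[where K="K^2"])
   fix x show "\<bar>(indicator \<Omega> x * poly r (x $ e))^2\<bar> \<le> K^2 * indicator \<Omega> x"
    using K(2)[of x] K(1) by (cases "x \<in> \<Omega>") (auto simp: abs_le_square_iff[symmetric])
  qed measurable
 qed
 show "integrable lborel (\<lambda>x. (PF p x)^2)" unfolding PF_def by (rule sq)
 show "integrable lborel (\<lambda>x. (norm (PG p x))^2)" using sq[of "pderiv p"] by (simp add: PG_def)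
 fix x assume "x \<notin> \<Omega>" thus "PF p x = 0" "PG p x = 0" by (auto simp: PF_def PG_def)
next
 fix \<phi> i assume \<phi>: "\<phi> \<in> test_functions \<Omega>"
 note t = test_functionsD[OF \<phi>]
 let ?P = "\<lambda>x::real^'n. poly p (x $ e)"
 have PC: "?P \<in> C_k k" for k
  using C_k_coord[of "\<lambda>m. poly ((pderiv ^^ m) p)" 0 e k] poly_DERIV by simp
 have D: "(?P has_derivative (\<lambda>h. h $ e * poly (pderiv p) (x $ e))) (at x)" for x
 proof -
  have "((\<lambda>x::real^'n. x $ e) has_derivative (\<lambda>h. h $ e)) (at x)" by (simp add: bounded_linear_imp_has_derivative bounded_linear_vec_nth)
  from has_derivative_compose[OF this poly_DERIV[unfolded has_field_derivative_def]] show ?thesis by (simp add: mult.commute)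
 qed
 let ?\<psi> = "\<lambda>x. ?P x * \<phi> x"
 have "?\<psi> \<in> C_infinity" using t(1) C_k_mult[OF PC] unfolding C_infinity_def by blast
 moreover have sub: "closure {x. ?\<psi> x \<noteq> 0} \<subseteq> closure {x. \<phi> x \<noteq> 0}" by (intro closure_mono) auto
 ultimately have \<psi>: "?\<psi> \<in> test_functions \<Omega>"
  using t(2,3) bounded_subset[OF compact_imp_bounded[OF t(2)] sub] unfolding test_functions_def
  by (simp add: compact_eq_bounded_closed)
 have pd: "partial_deriv i ?\<psi> x = PF p x * partial_deriv i \<phi> x + PG p x $ i * \<phi> x" for x
 proof -
  have "(?\<psi> has_derivative (\<lambda>h. ?P x * (\<Sum>i\<in>UNIV. h $ i * partial_deriv i \<phi> x) + h $ e * poly (pderiv p) (x $ e) * \<phi> x)) (at x)"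
   by (rule has_derivative_mult[OF D C_infinity_derivative(1)[OF t(1)]])
  hence "partial_deriv i ?\<psi> x = ?P x * (\<Sum>j\<in>UNIV. (axis i 1 :: real^'n) $ j * partial_deriv j \<phi> x) + (axis i 1 :: real^'n) $ e * poly (pderiv p) (x $ e) * \<phi> x"
   by (rule partial_deriv_eq)
  moreover have "(\<Sum>j\<in>UNIV. (axis i 1 :: real^'n) $ j * partial_deriv j \<phi> x) = partial_deriv i \<phi> x"
   by (subst sum.remove[of _ i]) (auto simp: axis_def intro!: sum.neutral)
  ultimately have e: "partial_deriv i ?\<psi> x = ?P x * partial_deriv i \<phi> x + (axis i 1 :: real^'n) $ e * poly (pderiv p) (x $ e) * \<phi> x" by simp
  show ?thesis
  proof (cases "x \<in> \<Omega>")
   case True thus ?thesis unfolding e by (simp add: PF_def PG_def axis_def)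
  next
   case False
   hence "x \<notin> closure {x. \<phi> x \<noteq> 0}" using t(3) by blast
   hence "partial_deriv i \<phi> x = 0" "\<phi> x = 0" using partial_deriv_zero closure_subset[of "{x. \<phi> x \<noteq> 0}"] by auto
   thus ?thesis unfolding e by simp
  qed
 qed
 obtain K where K: "\<And>x. \<bar>\<phi> x\<bar> \<le> K" "\<And>i x. \<bar>partial_deriv i \<phi> x\<bar> \<le> K" using test_functions_bounded[OF \<phi>] by metis
 note [measurable] = test_ext_measurable[OF \<phi>]
 have int: "integrable lborel (\<lambda>x. (indicator \<Omega> x * poly r (x $ e)) * f x)" if [measurable]: "f \<in> borel_measurable borel" and f: "\<And>x. \<bar>f x\<bar> \<le> K" for r f
 proof -
  obtain B where B: "B \<ge> 0" "\<And>x. x \<in> \<Omega> \<Longrightarrow> \<bar>poly r (x $ e)\<bar> \<le> B" using poly_bounded_on_\<Omega>[of r] by blast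
  show ?thesis
   by (rule bounded_integrable[where K="B * K"]) (use B f in \<open>auto simp: indicator_def abs_mult intro!: mult_mono\<close>)
 qed
 have i1: "integrable lborel (\<lambda>x. PF p x * partial_deriv i \<phi> x)" unfolding PF_def by (rule int) (auto simp: K)
 have "integrable lborel (\<lambda>x. (axis e 1 :: real^'n) $ i * ((indicator \<Omega> x * poly (pderiv p) (x $ e)) * \<phi> x))"
  by (intro integrable_mult_right int) (auto simp: K)
 hence i2: "integrable lborel (\<lambda>x. PG p x $ i * \<phi> x)" by (simp add: PG_def mult_ac)
 have "0 = (LBINT x. partial_deriv i ?\<psi> x)" by (rule integral_partial_deriv_zero[OF \<psi>, symmetric])
 also have "... = (LBINT x. PF p x * partial_deriv i \<phi> x) + (LBINT x. PG p x $ i * \<phi> x)" unfolding pd using i1 i2 by simp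
 finally show "(LBINT x. PF p x * partial_deriv i \<phi> x) = - (LBINT x. PG p x $ i * \<phi> x)" by simp
qed

text \<open>At a point of positive weight the sets averaged over have positive volume, so the
  averages of a continuous function tend to its value.\<close>

lemma Tb_poly: "AE x in bX. Tb (PF p) x = poly p (x $ e)"
proof -
 have "AE x in bX. x \<in> frontier \<Omega> \<and> W x > 0" unfolding bX_def by (rule AE_bm) measurable
 thus ?thesis using Tb_limit[OF sob_pair_poly, of p]
 proof eventually_elim
  case (elim x)
  have "(avg (PF p) x \<longlongrightarrow> poly p (x $ e)) (at_right 0)"
  proof (rule tendstoI)
   fix \<epsilon> :: real assume \<epsilon>: "\<epsilon> > 0"
   have "isCont (\<lambda>y::real^'n. poly p (y $ e)) x" by (intro continuous_intros)
   then obtain d where d: "d > 0" "\<And>y. dist y x < d \<Longrightarrow> dist (poly p (y $ e)) (poly p (x $ e)) < \<epsilon> / 2"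
    using \<epsilon> unfolding continuous_at_eps_delta by (metis half_gt_zero)
   have cW: "c0 * W x > 0" using c0 elim by simp
   have "dist (avg (PF p) x r) (poly p (x $ e)) < \<epsilon>" if r: "0 < r" "r < min d (c0 * W x)" for r
   proof -
    let ?A = "\<Omega> \<inter> ball x r"
    let ?m = "measure lborel ?A"
    have "V * (r / KK) ^ CARD('n) > 0" using V_pos r KK by simp
    hence m: "?m > 0" using vol_lower[of x r] elim r by linarith
    have iA: "integrable lborel (\<lambda>y. indicator ?A y :: real)" using emeasure_sub[of ?A] by simp
    have iP: "integrable lborel (\<lambda>y. indicator ?A y * PF p y)"
     using integrable_real_mult_indicator[OF _ sob_integrable(1)[OF open_\<Omega> bounded_\<Omega> sob_pair_poly], of ?A p] by (simp add: mult.commute)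
    have le: "\<bar>indicator ?A y * PF p y - poly p (x $ e) * indicator ?A y\<bar> \<le> \<epsilon> / 2 * indicator ?A y" for y
     using d(2)[of y] r by (cases "y \<in> ?A") (auto simp: PF_def dist_real_def dist_commute intro: less_imp_le)
    have "\<bar>(LBINT y. indicator ?A y * PF p y - poly p (x $ e) * indicator ?A y)\<bar> \<le> (LBINT y. \<epsilon> / 2 * indicator ?A y)"
     by (rule order_trans[OF integral_abs_bound], rule integral_mono) (use iA iP le in auto)
    hence "\<bar>(LBINT y. indicator ?A y * PF p y) - poly p (x $ e) * ?m\<bar> \<le> \<epsilon> / 2 * ?m" using iA iP by simp
    hence "\<bar>(LBINT y. indicator ?A y * PF p y) - poly p (x $ e) * ?m\<bar> / ?m \<le> \<epsilon> / 2" using m by (simp add: divide_le_eq)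
    moreover have "\<bar>(LBINT y. indicator ?A y * PF p y) - poly p (x $ e) * ?m\<bar> / ?m = \<bar>avg (PF p) x r - poly p (x $ e)\<bar>"
    proof -
     have "avg (PF p) x r - poly p (x $ e) = ((LBINT y. indicator ?A y * PF p y) - poly p (x $ e) * ?m) / ?m"
      using m by (simp add: avg_def diff_divide_distrib)
     thus ?thesis using m by (simp only: abs_divide abs_of_pos)
    qed
    ultimately show ?thesis using \<epsilon> by (simp add: dist_real_def)
   qed
   thus "\<forall>\<^sub>F r in at_right 0. dist (avg (PF p) x r) (poly p (x $ e)) < \<epsilon>"
    unfolding eventually_at_right_field using d(1) cW by (intro exI[of _ "min d (c0 * W x)"]) auto
  qed
  thus ?case using elim by (intro tendsto_unique[OF trivial_limit_at_right_real]) auto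
 qed
qed

text \<open>A band of the upper hemisphere projects along the axis onto a nonempty open annulus, so
  \<open>hausdorff_lower\<close> makes its surface positive; above height 2 the weight is 1.\<close>

lemma bX_strip_pos:
 assumes st: "2 \<le> s" "s < t" "t \<le> 3"
 shows "emeasure bX {x. s < x $ e \<and> x $ e < t} > 0"
proof -
 let ?A = "{x \<in> frontier \<Omega>. s < x $ e \<and> x $ e < t}"
 \<comment> \<open>The bounds on |z'| say that 2 + sqrt(2 - |z'|^2), the height of the sphere over
   z', lies between \<open>s\<close> and \<open>t\<close>; the height of \<open>z\<close> itself is
   a dummy coordinate in the unit interval.\<close>
 define Q where "Q = {z::real^'n. 0 < z $ e \<and> z $ e < 1 \<and> 2 - (t - 2)^2 < (norm (xprime e z))^2 \<and> (norm (xprime e z))^2 < 2 - (s - 2)^2}"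
 have oQ: "open Q" unfolding Q_def
  by (intro open_Collect_conj open_Collect_less continuous_intros continuous_xprime)
 have "\<exists>x\<in>?A. \<forall>j. j \<noteq> e \<longrightarrow> x $ j = z $ j" if z: "z \<in> Q" for z
 proof -
  define h where "h = sqrt (2 - (norm (xprime e z))^2)"
  have zz: "(s - 2)^2 < 2 - (norm (xprime e z))^2" "2 - (norm (xprime e z))^2 < (t - 2)^2" using z by (auto simp: Q_def)
  have p: "0 \<le> 2 - (norm (xprime e z))^2" using zz(1) zero_le_power2[of "s - 2"] by linarith
  have h: "s - 2 < h" "h < t - 2" unfolding h_def using zz st by (auto intro: real_less_rsqrt real_less_lsqrt p)
  define x where "x = xprime e z + axis e (2 + h)"
  have xe: "x $ e = 2 + h" "xprime e x = xprime e z" by (simp_all add: x_def xprime_nth xprime_linear xprime_axis)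
  have h2: "h^2 = 2 - (norm (xprime e z))^2" using p by (simp add: h_def)
  have "x \<notin> \<Omega>" unfolding mem_\<Omega> xe using h st h2 by auto
  moreover have "x \<in> cball (axis e 2) (sqrt 2)" unfolding mem_cball_c xe using h2 by simp
  hence "x \<in> closure \<Omega>" using closure_mono[OF ball_subset] by (auto simp: closure_ball)
  ultimately have "x \<in> ?A" using h open_\<Omega> xe by (simp add: frontier_def interior_open)
  moreover have "x $ j = z $ j" if "j \<noteq> e" for j using that by (simp add: x_def xprime_nth axis_def)
  ultimately show ?thesis by blast
 qed
 hence low: "emeasure lborel Q \<le> ennreal (4 ^ (CARD('n) - 1) / hausdorff_const (real CARD('n) - 1)) * surface_outer ?A"
  using oQ by (intro hausdorff_lower[OF n2]) (auto simp: Q_def)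
 have "Q \<noteq> {}"
 proof -
  obtain j :: 'n where j: "j \<noteq> e" using n2 by (metis card_2_iff' card_le_Suc0_iff_eq finite_code not_less_eq_eq numeral_2_eq_2 UNIV_I)
  have "(s - 2)^2 < (t - 2)^2" using st by (intro power_strict_mono) auto
  then obtain r2 where r2: "2 - (t - 2)^2 < r2" "r2 < 2 - (s - 2)^2" using dense[of "2 - (t - 2)^2" "2 - (s - 2)^2"] by auto
  have "(t - 2)^2 \<le> 1" using st by (simp add: power_le_one)
  hence "r2 > 0" using r2 by linarith
  define z where "z = (axis e (1/2) + axis j (sqrt r2) :: real^'n)"
  have "xprime e z = sqrt r2 *\<^sub>R axis j 1" using j by (auto simp: z_def xprime_linear vec_eq_iff xprime_nth axis_def)
  hence "(norm (xprime e z))^2 = r2" using \<open>r2 > 0\<close> by simp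
  moreover have "z $ e = 1/2" using j by (simp add: z_def axis_def)
  ultimately have "z \<in> Q" using r2 by (simp add: Q_def)
  thus ?thesis by blast
 qed
 hence "emeasure lborel Q > 0" using oQ open_nonempty_emeasure_pos by blast
 hence pos: "surface_outer ?A \<noteq> 0" using low by auto
 have "emeasure bX {x. s < x $ e \<and> x $ e < t} = (\<integral>\<^sup>+x. ennreal (W x) * indicator (frontier \<Omega>) x * indicator {x. s < x $ e \<and> x $ e < t} x \<partial>HB)"
  unfolding bX_def bm_def by (subst emeasure_density) auto
 also have "... = (\<integral>\<^sup>+x. indicator ?A x \<partial>HB)"
 proof (rule nn_integral_cong)
  fix x
  have "W x = 1" if "s < x $ e" using that st by (auto simp: W_eq cuspcond_def)
  thus "ennreal (W x) * indicator (frontier \<Omega>) x * indicator {x. s < x $ e \<and> x $ e < t} x = indicator ?A x" by (auto simp: indicator_def)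
 qed
 also have "... = emeasure HB ?A" by (rule nn_integral_indicator) (simp add: sets_HB)
 also have "... = surface_outer (frontier \<Omega> \<inter> ?A)" by (rule emeasure_HB) measurable
 also have "frontier \<Omega> \<inter> ?A = ?A" by auto
 finally show ?thesis using pos by (simp add: zero_less_iff_neq_zero)
qed

text \<open>A nonzero polynomial has no roots on some interval between 2 and 3, and the
  corresponding band of the sphere has positive measure.\<close>

lemma poly_form_pos:
 assumes "p \<noteq> 0" shows "rsq bX (Tb (PF p)) > 0"
proof (rule ccontr)
 assume "\<not> ?thesis"
 moreover have "rsq bX (Tb (PF p)) \<ge> 0" by (rule integral_nonneg_AE) auto
 ultimately have "rsq bX (Tb (PF p)) = 0" by simp
 hence "AE x in bX. (Tb (PF p) x)^2 = 0"
  using Tb_bound(1)[OF sob_pair_poly] by (subst (asm) integral_nonneg_eq_0_iff_AE) auto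
 hence z: "AE x in bX. poly p (x $ e) = 0" using Tb_poly[of p] by eventually_elim simp
 have "finite {t. poly p t = 0}" using assms by (rule poly_roots_finite)
 hence o: "open ({2<..<3::real} - {t. poly p t = 0})" by (intro open_Diff finite_imp_closed) auto
 have "infinite {2<..<3::real}" by (rule infinite_Ioo) simp
 then obtain c where c: "c \<in> {2<..<3} - {t. poly p t = 0}" using \<open>finite {t. poly p t = 0}\<close> by (metis Diff_eq_empty_iff finite_subset ex_in_conv)
 then obtain d where d: "d > 0" "\<And>t. dist t c < d \<Longrightarrow> t \<in> {2<..<3} - {t. poly p t = 0}" using o unfolding open_dist by blast
 define t where "t = min (c + d) 3"
 have t: "c < t" "t \<le> 3" "t \<le> c + d" using c d by (auto simp: t_def)
 have "poly p (x $ e) \<noteq> 0" if "c < x $ e" "x $ e < t" for x :: "real^'n"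
  using d(2)[of "x $ e"] that t by (auto simp: dist_real_def)
 hence "AE x in bX. x \<notin> {x. c < x $ e \<and> x $ e < t}" using z by (auto elim!: eventually_mono)
 hence "emeasure bX {x. c < x $ e \<and> x $ e < t} = 0"
  by (subst (asm) AE_iff_null_sets[symmetric]) (auto simp: sets_bX null_sets_def)
 thus False using bX_strip_pos[of c t] c t by auto
qed

definition \<beta> :: real where "\<beta> = measure bX UNIV"

lemma beta_pos: "\<beta> > 0" and bX_finite: "emeasure bX UNIV < \<infinity>"
proof -
 show f: "emeasure bX UNIV < \<infinity>" unfolding bX_def by (rule bm_finite) measurable
 have "0 < emeasure bX {x. 2 < x $ e \<and> x $ e < 3}" by (rule bX_strip_pos) auto
 also have "... \<le> emeasure bX UNIV" by (rule emeasure_mono) (auto simp: sets_bX)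
 finally show "\<beta> > 0" using f unfolding \<beta>_def measure_def by (simp add: enn2real_positive_iff)
qed

definition C7 :: real where
 "C7 = 2 * CP + 2 * (measure lborel \<Omega>) * ((2 + 2 * C6 * (CP + 1)) / \<beta>)"

text \<open>Poincare's inequality controls \<open>u - m\<close>. The constant \<open>m\<close> is
  recovered from the boundary as the trace of \<open>u\<close> minus that of \<open>u - m\<close>,
  on a weighted boundary of positive mass \<beta>. This is why the two forms together are complete
  without an extra L2 term.\<close>

lemma friedrichs:
 assumes sp: "sob_pair \<Omega> u q"
 shows "rsq lborel u \<le> C7 * (dirichlet q + rsq bX (Tb u))"
  and "dirichlet q = 0 \<Longrightarrow> \<exists>m. AE x in lborel. u x = m * PF 1 x"
proof -
 let ?E = "\<integral>x. (norm (q x))^2 \<partial>lborel" and ?N = "\<lambda>u. \<integral>x. (u x)^2 \<partial>lborel" and ?S = "\<lambda>u. \<integral>x. (Tb u x)^2 \<partial>bX"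
 obtain m where m: "nsq_on \<Omega> (\<lambda>x. u x - m) \<le> ennreal CP * energy q UNIV"
  using poincare_domain[OF sp] by blast
 define w where "w x = 1 * u x + (- m) * PF 1 x" for x
 have "sob_pair \<Omega> w (\<lambda>x. 1 *\<^sub>R q x + (- m) *\<^sub>R PG 1 x)" unfolding w_def by (rule sob_pair_lin[OF sp sob_pair_poly])
 moreover have "(\<lambda>x. 1 *\<^sub>R q x + (- m) *\<^sub>R PG 1 x) = q" by (rule ext) (simp add: PG_def pderiv_1)
 ultimately have sw: "sob_pair \<Omega> w q" by simp
 have CP0: "CP \<ge> 0" using V_pos by (simp add: CP_def)
 have wE: "?N w \<le> CP * ?E"
 proof -
  have "ennreal ((w x)^2) = ennreal ((u x - m)^2) * indicator \<Omega> x" for x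
   using sob_pairD(5)[OF sp, of x] by (cases "x \<in> \<Omega>") (auto simp: w_def PF_def)
  hence "ennreal (?N w) \<le> ennreal CP * ennreal ?E"
   using m nsq_eq_rsq[OF sob_pairD(3)[OF sw]] energy_real[OF sp] by simp
  hence "ennreal (?N w) \<le> ennreal (CP * ?E)" using CP0 by (simp add: ennreal_mult)
  moreover have "0 \<le> CP * ?E" using CP0 by (intro mult_nonneg_nonneg) auto
  ultimately show ?thesis by simp
 qed
 show "\<exists>m. AE x in lborel. u x = m * PF 1 x" if "?E = 0"
 proof (intro exI[of _ m])
  have "?N w \<le> 0" using wE that by simp
  moreover have "?N w \<ge> 0" by (rule integral_nonneg_AE) auto
  ultimately have "AE x in lborel. (w x)^2 = 0" using sob_pairD(3)[OF sw] by (subst integral_nonneg_eq_0_iff_AE[symmetric]) auto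
  thus "AE x in lborel. u x = m * PF 1 x" by eventually_elim (simp add: w_def)
 qed
 have Sw: "?S w \<le> C6 * (CP + 1) * ?E"
 proof -
  have "?S w \<le> C6 * (?N w + ?E)" by (rule Tb_bound(2)[OF sw])
  also have "... \<le> C6 * (CP * ?E + ?E)" using wE C6_nonneg by (intro mult_left_mono) auto
  finally show ?thesis by (simp add: algebra_simps)
 qed
 note [measurable] = Tb_measurable[OF sob_pairD(1)[OF sp]] Tb_measurable[OF sob_pairD(1)[OF sw]]
 have m2: "m^2 * \<beta> \<le> 2 * ?S u + 2 * ?S w"
 proof -
  have ae: "AE x in bX. m^2 \<le> 2 * (Tb u x)^2 + 2 * (Tb w x)^2"
   using Tb_lin[OF sp sob_pair_poly, of 1 "- m" 1] Tb_poly[of 1]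
  proof eventually_elim
   case (elim x)
   hence "Tb w x = Tb u x - m" by (simp add: w_def[abs_def])
   thus ?case using square_diff_le[of 0 "m" "Tb u x"] square_diff_le[of m 0 "Tb u x"] by (simp add: power2_commute)
  qed
  have ic: "integrable bX (\<lambda>x. m^2)" using bX_finite by (intro finite_measure.integrable_const finite_measureI) (simp add: space_bX)
  have "m^2 * \<beta> = (\<integral>x. m^2 \<partial>bX)" by (simp add: \<beta>_def space_bX)
  also have "... \<le> (\<integral>x. 2 * (Tb u x)^2 + 2 * (Tb w x)^2 \<partial>bX)"
   by (rule integral_mono_AE[OF ic _ ae]) (use Tb_bound(1)[OF sp] Tb_bound(1)[OF sw] in simp)
  also have "... = 2 * ?S u + 2 * ?S w" using Tb_bound(1)[OF sp] Tb_bound(1)[OF sw] by simp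
  finally show ?thesis .
 qed
 have E0: "?E \<ge> 0" and S0: "?S u \<ge> 0" by (rule integral_nonneg_AE; simp)+
 have "m^2 * \<beta> \<le> (2 + 2 * C6 * (CP + 1)) * (?E + ?S u)"
 proof -
  have "0 \<le> C6 * (CP + 1) * ?S u" using C6_nonneg CP0 S0 by (intro mult_nonneg_nonneg) auto
  moreover have "(2 + 2 * C6 * (CP + 1)) * (?E + ?S u) = 2 * ?E + 2 * ?S u + 2 * (C6 * (CP + 1) * ?E) + 2 * (C6 * (CP + 1) * ?S u)"
   by (simp add: algebra_simps)
  ultimately show ?thesis using m2 Sw E0 by linarith
 qed
 hence m3: "m^2 \<le> (2 + 2 * C6 * (CP + 1)) / \<beta> * (?E + ?S u)" using beta_pos by (simp add: field_simps)
 have "?N u \<le> (LBINT x. 2 * (w x)^2 + 2 * (m^2 * indicator \<Omega> x))"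
 proof (rule integral_mono)
  show "integrable lborel (\<lambda>x. 2 * (w x)^2 + 2 * (m^2 * indicator \<Omega> x))" using sob_pairD(3)[OF sw] emeasure_\<Omega>_finite by simp
  fix x show "(u x)^2 \<le> 2 * (w x)^2 + 2 * (m^2 * indicator \<Omega> x)"
   using square_diff_le[of "u x" 0 m] sob_pairD(5)[OF sp, of x] by (cases "x \<in> \<Omega>") (auto simp: w_def PF_def)
 qed (rule sob_pairD(3)[OF sp])
 also have "... = 2 * ?N w + 2 * (m^2 * measure lborel \<Omega>)" using sob_pairD(3)[OF sw] emeasure_\<Omega>_finite by simp
 also have "... \<le> 2 * (CP * (?E + ?S u)) + 2 * ((2 + 2 * C6 * (CP + 1)) / \<beta> * (?E + ?S u) * measure lborel \<Omega>)"
 proof -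
  have "CP * ?E \<le> CP * (?E + ?S u)" using CP0 S0 by (intro mult_left_mono) auto
  moreover have "m^2 * measure lborel \<Omega> \<le> (2 + 2 * C6 * (CP + 1)) / \<beta> * (?E + ?S u) * measure lborel \<Omega>" using m3 by (rule mult_right_mono) simp
  ultimately show ?thesis using wE by linarith
 qed
 also have "... = C7 * (?E + ?S u)" by (simp add: C7_def algebra_simps)
 finally show "?N u \<le> C7 * (?E + ?S u)" .
qed


subsection \<open>Compactness of the trace\<close>

text \<open>\<open>N\<close> disjoint strips of equal height are stacked, the given one lying in the
  lowest. The mass of the lowest is bounded by twice that of any strip plus a shift error, and the
  masses of all strips add up to at most the whole; so it is of order 1/N.\<close>

lemma strip_small:
 assumes N: "N \<ge> (1::nat)"
 shows "\<exists>\<eta>>0. \<forall>u q. sob_pair \<Omega> u q \<longrightarrow>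
  of_nat N * nsq_on {y\<in>\<Omega>. 0 < gam (y $ e) \<and> gam (y $ e) < 2 * \<eta>} u
   \<le> ennreal (2 * (rsq lborel u + dirichlet q))"
proof -
 \<comment> \<open>\<gamma> may vanish on an initial interval; the cusp starts at the last zero
   \<open>a\<close>, above which \<gamma> is positive.\<close>
 define Z where "Z = {0..1} \<inter> gam -` {0}"
 have "closed Z" unfolding Z_def by (intro continuous_closed_preimage continuous_gam) auto
 moreover have "gam 0 = 0" using g0 by (simp add: gam_eq)
 hence Z0: "0 \<in> Z" by (simp add: Z_def)
 moreover have bdd: "bdd_above Z" unfolding Z_def by (intro bdd_above_Int1) auto
 ultimately have "Sup Z \<in> Z" by (intro closed_contains_Sup) auto
 define a where "a = Sup Z"
 have a: "0 \<le> a" "gam a = 0" "a \<le> 1" using \<open>Sup Z \<in> Z\<close> by (auto simp: a_def Z_def)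
 have "a \<noteq> 1" using a(2) gam_ge1[of 1] by auto
 hence a1: "a < 1" using a by simp
 have pos: "gam t > 0" if "t > a" for t
 proof (rule ccontr)
  assume "\<not> ?thesis"
  hence "gam t = 0" using gam_bounds[of t] by simp
  hence "t \<in> Z" using that a gam_ge1[of t] by (cases "t \<le> 1") (auto simp: Z_def)
  thus False using cSup_upper[OF _ bdd, of t] that by (simp add: a_def)
 qed
 \<comment> \<open>The stack of \<open>N\<close> strips has total height 1/N: the shifts stay under
   height 2 as \<open>up_shift\<close> requires, and their squared length is at most 1/N, which
   compensates for adding \<open>N\<close> error terms.\<close>
 define \<delta> where "\<delta> = 1 / (real N)^2"
 have \<delta>: "\<delta> > 0" "real N * \<delta> \<le> 1" "\<And>k. k < N \<Longrightarrow> (real k * \<delta>)^2 \<le> 1 / real N"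
 proof -
  show "\<delta> > 0" using N by (simp add: \<delta>_def)
  have Nd: "real N * \<delta> = 1 / real N" using N by (simp add: \<delta>_def power2_eq_square)
  thus "real N * \<delta> \<le> 1" using N by simp
  fix k assume "k < N"
  hence "real k * \<delta> \<le> 1 / real N" unfolding Nd[symmetric] using \<open>\<delta> > 0\<close> by (intro mult_right_mono) auto
  hence "(real k * \<delta>)^2 \<le> (1 / real N)^2" using \<open>\<delta> > 0\<close> by (intro power_mono) auto
  also have "... \<le> 1 / real N" using N by (simp add: power2_eq_square field_simps)
  finally show "(real k * \<delta>)^2 \<le> 1 / real N" .
 qed
 \<comment> \<open>By monotonicity a value of \<gamma> below \<open>2 * \<eta>\<close> forces the
   height below \<open>a + \<delta>\<close>.\<close>
 define \<eta> where "\<eta> = gam (a + \<delta>) / 2"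
 let ?S = "\<Omega> \<inter> {y. a < y $ e \<and> y $ e < a + \<delta>}"
 have oS: "open ?S" by (intro open_Int open_\<Omega> open_Collect_conj open_Collect_less continuous_intros)
 have sub: "{y\<in>\<Omega>. 0 < gam (y $ e) \<and> gam (y $ e) < 2 * \<eta>} \<subseteq> ?S"
 proof safe
  fix y :: "real^'n" assume "0 < gam (y $ e)" "gam (y $ e) < 2 * \<eta>"
  thus "a < y $ e" "y $ e < a + \<delta>"
   using gam_mono[of "y $ e" a] gam_mono[of "a + \<delta>" "y $ e"] a by (force simp: \<eta>_def)+
 qed
 have main: "of_nat N * nsq_on ?S u
   \<le> ennreal (2 * (rsq lborel u + dirichlet q))" if sp: "sob_pair \<Omega> u q" for u q
 proof -
  note [measurable] = sob_pairD(1)[OF sp] borel_open[OF oS]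
  define h where "h k = (axis e (real k * \<delta>) :: real^'n)" for k
  let ?E = "\<integral>x. (norm (q x))^2 \<partial>lborel" and ?N = "\<integral>x. (u x)^2 \<partial>lborel"
  let ?T = "\<lambda>k. {z::real^'n. a + real k * \<delta> < z $ e \<and> z $ e < a + real (Suc k) * \<delta>}"
  have one: "nsq_on ?S u
    \<le> 2 * ennreal (1 / real N * ?E) + 2 * nsq_on (?T k) u" if k: "k < N" for k
  proof -
   have "h k = (real k * \<delta>) *\<^sub>R axis e 1" by (simp add: h_def axis_def vec_eq_iff)
   hence hk: "(norm (h k))^2 = (real k * \<delta>)^2" by (simp add: power_mult_distrib)
   have T: "y + h k \<in> ?T k" if "y \<in> ?S" for y using that by (auto simp: h_def algebra_simps)
   have "nsq_on ?S u \<le> 2 * nsq_on ?S (\<lambda>y. u (y + h k) - u y) + 2 * nsq_on (?T k) u"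
    using nsq_on_shift[of u ?S "?T k" "h k" 0] T by simp
   also have "nsq_on ?S (\<lambda>y. u (y + h k) - u y) \<le> ennreal ((norm (h k))^2) * energy q UNIV"
   proof (rule sob_translation[OF open_\<Omega> bounded_\<Omega> sp oS])
    fix y s assume y: "y \<in> ?S" and s: "0 \<le> s" "s \<le> (1::real)"
    have "s * (real k * \<delta>) \<le> real k * \<delta>" using s \<delta>(1) by (intro mult_left_le_one_le) auto
    moreover have "real k * \<delta> + \<delta> \<le> real N * \<delta>" using mult_right_mono[of "real (Suc k)" "real N" \<delta>] k \<delta>(1) by (simp add: algebra_simps)
    ultimately have "y $ e + s * (real k * \<delta>) < 2" using y a1 \<delta>(2) by auto
    moreover have "s *\<^sub>R h k = axis e (s * (real k * \<delta>))" by (simp add: h_def axis_def vec_eq_iff)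
    ultimately show "y + s *\<^sub>R h k \<in> \<Omega> \<inter> UNIV" using up_shift[of y "s * (real k * \<delta>)"] y s \<delta>(1) by simp
   qed simp
   also have "... \<le> ennreal (1 / real N) * ennreal ?E"
    using \<delta>(3)[OF k] unfolding energy_real[OF sp] by (intro mult_right_mono ennreal_leI) (auto simp: hk)
   also have "... = ennreal (1 / real N * ?E)" by (rule ennreal_mult[symmetric]) auto
   finally show ?thesis by (simp add: add_mono mult_left_mono)
  qed
  have "of_nat N * nsq_on ?S u = (\<Sum>k<N. \<integral>\<^sup>+y. ennreal ((u y)^2) * indicator ?S y \<partial>lborel)" by simp
  also have "... \<le> (\<Sum>k<N. 2 * ennreal (1 / real N * ?E) + 2 * nsq_on (?T k) u)"
   by (intro sum_mono one) auto
  also have "... = 2 * (of_nat N * ennreal (1 / real N * ?E)) + 2 * (\<Sum>k<N. \<integral>\<^sup>+z. ennreal ((u z)^2) * indicator (?T k) z \<partial>lborel)"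
   by (simp add: sum.distrib sum_distrib_left mult_ac)
  also have "of_nat N * ennreal (1 / real N * ?E) = ennreal ?E"
   using N by (simp add: ennreal_of_nat_eq_real_of_nat flip: ennreal_mult')
  also have "(\<Sum>k<N. \<integral>\<^sup>+z. ennreal ((u z)^2) * indicator (?T k) z \<partial>lborel) = (\<integral>\<^sup>+z. (\<Sum>k<N. ennreal ((u z)^2) * indicator (?T k) z) \<partial>lborel)"
   by (rule nn_integral_sum[symmetric]) measurable
  also have "... \<le> nsq lborel u"
  proof (rule nn_integral_mono)
   fix z
   have dis: "k = l" if "z \<in> ?T k" "z \<in> ?T l" for k l
   proof -
    have "real k * \<delta> < real (Suc l) * \<delta>" "real l * \<delta> < real (Suc k) * \<delta>" using that by auto
    thus ?thesis using \<delta>(1) by simp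
   qed
   show "(\<Sum>k<N. ennreal ((u z)^2) * indicator (?T k) z) \<le> ennreal ((u z)^2)"
   proof (cases "\<exists>k<N. z \<in> ?T k")
    case True
    then obtain k where k: "k < N" "z \<in> ?T k" by blast
    have "(\<Sum>j<N. ennreal ((u z)^2) * indicator (?T j) z) = (\<Sum>j<N. if j = k then ennreal ((u z)^2) else 0)"
    proof (rule sum.cong[OF refl])
     fix j show "ennreal ((u z)^2) * indicator (?T j) z = (if j = k then ennreal ((u z)^2) else 0)"
      using dis[of j k] k(2) by (cases "z \<in> ?T j") auto
    qed
    thus ?thesis by simp
   next
    case False
    hence "(\<Sum>j<N. ennreal ((u z)^2) * indicator (?T j) z) = 0" by (intro sum.neutral) (auto simp: indicator_def)
    thus ?thesis by (simp only: zero_le)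
   qed
  qed
  also have "... = ennreal ?N" by (rule nsq_eq_rsq[OF sob_pairD(3)[OF sp]])
  finally have "of_nat N * nsq_on ?S u \<le> 2 * ennreal ?E + 2 * ennreal ?N" by (simp add: add_mono mult_left_mono)
  also have "... = ennreal (2 * ?E) + ennreal (2 * ?N)" by (simp add: ennreal_mult')
  also have "... = ennreal (2 * ?E + 2 * ?N)" by (rule ennreal_plus[symmetric]) auto
  also have "2 * ?E + 2 * ?N = 2 * (?N + ?E)" by simp
  finally show ?thesis .
 qed
 show ?thesis
 proof (intro exI[of _ \<eta>] conjI allI impI)
  show "\<eta> > 0" using pos[of "a + \<delta>"] \<delta> by (simp add: \<eta>_def)
  fix u q assume sp: "sob_pair \<Omega> u q"
  show "of_nat N * nsq_on {y\<in>\<Omega>. 0 < gam (y $ e) \<and> gam (y $ e) < 2 * \<eta>} u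
   \<le> ennreal (2 * (rsq lborel u + dirichlet q))"
   by (rule order_trans[OF mult_left_mono[OF nn_integral_mono] main[OF sp]]) (use sub in \<open>auto intro!: mult_left_mono split: split_indicator\<close>)
 qed
qed

definition Tip :: "real \<Rightarrow> (real^'n) set" where "Tip \<eta> = {x\<in>Cus. gam (x $ e) < \<eta>}"

lemma Tip_borel[measurable]: "Tip \<eta> \<in> sets borel"
proof -
 have "Tip \<eta> = Cus \<inter> {x. gam (x $ e) < \<eta>}" by (auto simp: Tip_def)
 thus ?thesis using Cus_borel by simp
qed

text \<open>Points seen from the tip satisfy 0 < \<gamma> < 2 \<eta>. On them the energy enters the
  trace bound with a factor of order \<eta>^2, and the mass is small by
  \<open>strip_small\<close>.\<close>

lemma tip_small:
 assumes \<epsilon>: "\<epsilon> > 0"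
 shows "\<exists>\<eta>>0. \<forall>u q. sob_pair \<Omega> u q \<longrightarrow> nsq (bm (Tip \<eta>)) (Tb u)
   \<le> ennreal (\<epsilon> * (rsq lborel u + dirichlet q))"
proof -
 \<comment> \<open>\<open>8 * C4\<close> stems from \<open>2 * C4 * (2 * \<eta>)^2\<close>, and
   \<open>4 * C5\<close> from \<open>2 * C5\<close> times the factor 2 of the strip
   estimate.\<close>
 define C where "C = 8 * C4 + 4 * C5"
 have C: "C \<ge> 0" using C345 by (simp add: C_def)
 obtain N where N: "real N > C / \<epsilon> + 1" using reals_Archimedean2 by blast
 have "C / \<epsilon> \<ge> 0" using C \<epsilon> by simp
 hence "real N > 1" "C / \<epsilon> \<le> real N" using N by linarith+
 hence N1: "N \<ge> 1" "C / real N \<le> \<epsilon>" using \<epsilon> by (auto simp: pos_divide_le_eq mult.commute)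
 obtain \<eta>0 where \<eta>0: "\<eta>0 > 0" "\<And>u q. sob_pair \<Omega> u q \<Longrightarrow>
  of_nat N * nsq_on {y\<in>\<Omega>. 0 < gam (y $ e) \<and> gam (y $ e) < 2 * \<eta>0} u
   \<le> ennreal (2 * (rsq lborel u + dirichlet q))" using strip_small[OF N1(1)] by blast
 define \<eta> where "\<eta> = min \<eta>0 (1 / real N)"
 have \<eta>: "\<eta> > 0" "\<eta> \<le> \<eta>0" "\<eta>^2 \<le> 1 / real N"
 proof -
  show p: "\<eta> > 0" "\<eta> \<le> \<eta>0" using \<eta>0(1) N1 by (auto simp: \<eta>_def)
  have "\<eta>^2 \<le> (1 / real N)^2" using p by (intro power_mono) (auto simp: \<eta>_def)
  also have "... \<le> 1 / real N" using N1 by (simp add: power2_eq_square field_simps)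
  finally show "\<eta>^2 \<le> 1 / real N" .
 qed
 let ?Y = "{y\<in>\<Omega>. 0 < gam (y $ e) \<and> gam (y $ e) < 2 * \<eta>}"
 have Yb: "?Y \<in> sets borel"
 proof -
  have "?Y = \<Omega> \<inter> {y. 0 < gam (y $ e) \<and> gam (y $ e) < 2 * \<eta>}" by auto
  thus ?thesis by simp
 qed
 have P: "piece (Tip \<eta>) (\<lambda>x. gam (x $ e))" by (rule piece_subset[OF piece_Cus]) (auto simp: Tip_def Tip_borel[unfolded Tip_def])
 have Y: "y \<in> ?Y" if x: "x \<in> Tip \<eta>" and y: "y \<in> \<Omega>" and d: "dist x y < KK * (\<kappa> * gam (x $ e))" for x y
 proof -
  have "\<bar>gam (x $ e) - gam (y $ e)\<bar> \<le> L * \<bar>x $ e - y $ e\<bar>" by (rule gam_lip)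
  also have "... \<le> L * (KK * (\<kappa> * gam (x $ e)))" using L1 d dist_vec_nth_le[of x e y] by (intro mult_left_mono) (auto simp: dist_real_def)
  also have "... = (L * KK * \<kappa>) * gam (x $ e)" by simp
  also have "... \<le> 1 / 2 * gam (x $ e)" using kappa(4) gam_bounds by (intro mult_right_mono) auto
  finally have "\<bar>gam (x $ e) - gam (y $ e)\<bar> \<le> 1 / 2 * gam (x $ e)" .
  moreover have "gam (x $ e) > 0"
  proof (rule ccontr)
   assume "\<not> ?thesis"
   hence "gam (x $ e) = 0" using gam_bounds[of "x $ e"] by simp
   thus False using d by (simp add: not_less)
  qed
  moreover have "gam (x $ e) < \<eta>" using x by (simp add: Tip_def)
  ultimately have "0 < gam (y $ e)" "gam (y $ e) < 2 * \<eta>" by linarith+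
  thus ?thesis using y by simp
 qed
 show ?thesis
 proof (intro exI[of _ \<eta>] conjI allI impI)
  show "\<eta> > 0" by (rule \<eta>)
  fix u q assume sp: "sob_pair \<Omega> u q"
  let ?E = "\<integral>x. (norm (q x))^2 \<partial>lborel" and ?N = "\<integral>x. (u x)^2 \<partial>lborel"
  have E: "?E \<ge> 0" "?N \<ge> 0" by (rule integral_nonneg_AE; simp)+
  let ?I = "\<integral>\<^sup>+y. ennreal ((u y)^2) * indicator ?Y y \<partial>lborel"
  have "of_nat N * ?I \<le> of_nat N * nsq_on {y\<in>\<Omega>. 0 < gam (y $ e) \<and> gam (y $ e) < 2 * \<eta>0} u"
   using \<eta>(2) by (intro mult_left_mono nn_integral_mono) (auto simp: indicator_def)
  hence "of_nat N * ?I \<le> ennreal (2 * (?N + ?E))" using \<eta>0(2)[OF sp] by (rule order_trans)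
  hence "ennreal (1 / real N) * (ennreal (real N) * ?I) \<le> ennreal (1 / real N) * ennreal (2 * (?N + ?E))"
   by (intro mult_left_mono) (auto simp: ennreal_of_nat_eq_real_of_nat)
  moreover have "ennreal (1 / real N) * ennreal (real N) = 1" using N1 by (simp flip: ennreal_mult')
  moreover have "ennreal (1 / real N) * ennreal (2 * (?N + ?E)) = ennreal (1 / real N * (2 * (?N + ?E)))"
   using E by (intro ennreal_mult[symmetric]) auto
  ultimately have I: "?I \<le> ennreal (2 * (?N + ?E) / real N)" by (simp only: mult.assoc[symmetric] mult_1 times_divide_eq_left)
  have "nsq (bm (Tip \<eta>)) (Tb u) = nsq (bm (Tip \<eta>)) (tr (\<lambda>x. gam (x $ e)) u)"
   by (rule Tb_piece) (auto simp: Tip_def Tip_borel[unfolded Tip_def])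
  also have "... \<le> ennreal (2 * C4 * (2 * \<eta>)^2) * energy q ?Y + ennreal (2 * C5) * ?I"
   by (rule piece_trace_bound[OF sp P Yb Y]) auto
  also have "... \<le> ennreal (2 * C4 * (2 * \<eta>)^2) * ennreal ?E + ennreal (2 * C5) * ennreal (2 * (?N + ?E) / real N)"
   using energy_mono[of ?Y UNIV q] I unfolding energy_real[OF sp] by (intro add_mono mult_left_mono) auto
  also have "... = ennreal (2 * C4 * (2 * \<eta>)^2 * ?E + 2 * C5 * (2 * (?N + ?E) / real N))"
  proof -
   have T: "0 \<le> 2 * (?N + ?E) / real N" using E by simp
   have "0 \<le> 2 * C4 * (2 * \<eta>)^2 * ?E" "0 \<le> 2 * C5 * (2 * (?N + ?E) / real N)"
    using C345 E(1) T by (auto intro!: mult_nonneg_nonneg simp del: times_divide_eq_right)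
   thus ?thesis by (simp only: ennreal_mult''[OF E(1)] ennreal_mult''[OF T] ennreal_plus)
  qed
  also have "... \<le> ennreal (\<epsilon> * (?N + ?E))"
  proof (rule ennreal_leI)
   have "2 * C4 * (2 * \<eta>)^2 * ?E = 8 * C4 * (\<eta>^2 * ?E)" by (simp add: power_mult_distrib)
   also have "... \<le> 8 * C4 * (1 / real N * (?N + ?E))" using \<eta>(3) E C345 by (intro mult_left_mono mult_mono) auto
   finally have "2 * C4 * (2 * \<eta>)^2 * ?E + 2 * C5 * (2 * (?N + ?E) / real N) \<le> C / real N * (?N + ?E)"
    by (simp add: C_def algebra_simps add_divide_distrib)
   also have "... \<le> \<epsilon> * (?N + ?E)" using N1 E by (intro mult_right_mono) auto
   finally show "2 * C4 * (2 * \<eta>)^2 * ?E + 2 * C5 * (2 * (?N + ?E) / real N) \<le> \<epsilon> * (?N + ?E)" .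
  qed
  finally show "nsq (bm (Tip \<eta>)) (Tb u) \<le> ennreal (\<epsilon> * (?N + ?E))" .
 qed
qed

text \<open>At a fixed scale averages are integrals over fixed sets: they converge pointwise by
  \<open>cv\<close> and are bounded because \<sigma> is at least \<eta>, so dominated convergence
  applies. The traces differ from them by an error that is small uniformly in \<open>m\<close> once
  the scale index \<open>k\<close> is large.\<close>

lemma piece_compact:
 fixes u :: "nat \<Rightarrow> real^'n \<Rightarrow> real"
 assumes sp: "\<And>m. sob_pair \<Omega> (u m) (q m)" and bd: "\<And>m. rsq lborel (u m) \<le> C" "\<And>m. dirichlet (q m) \<le> C"
  and cv: "\<And>S. S \<in> sets borel \<Longrightarrow> convergent (\<lambda>m. \<integral>x. indicator S x * u m x \<partial>lborel)"
  and P: "piece P \<sigma>" and \<eta>: "\<eta> > 0" "\<And>x. x \<in> P \<Longrightarrow> \<eta> \<le> \<sigma> x" and \<epsilon>: "\<epsilon> > 0"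
 shows "\<exists>N. \<forall>m\<ge>N. \<forall>l\<ge>N. nsq (bm P) (\<lambda>x. tr \<sigma> (u m) x - tr \<sigma> (u l) x) < ennreal \<epsilon>"
proof -
 note [measurable] = sob_pairD(1)[OF sp] piece_measurable[OF P] tr_measurable[OF piece_measurable(2)[OF P] sob_pairD(1)[OF sp]]
 have "0 \<le> rsq lborel (u 0)" by (rule integral_nonneg_AE) auto
 hence C: "C \<ge> 0" using bd(1)[of 0] by linarith
 interpret finite_measure "bm P" by (rule finite_measure_bm) measurable
 have "(\<lambda>k. 16 * (C4 * C) * (1 / 2) ^ k) \<longlonglongrightarrow> 16 * (C4 * C) * 0" by (intro tendsto_intros LIMSEQ_power_zero) auto
 hence "\<forall>\<^sub>F k in sequentially. 16 * (C4 * C) * (1 / 2) ^ k < \<epsilon>" using \<epsilon> by (intro order_tendstoD) auto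
 then obtain k where k: "16 * (C4 * C) * (1 / 2) ^ k < \<epsilon>" by (auto simp: eventually_sequentially)
 \<comment> \<open>The indicator makes the bound \<open>K\<close> valid everywhere; off
   \<open>P\<close> the averages have no lower volume bound.\<close>
 define f where "f m x = indicator P x * avg (u m) x (rk k * \<sigma> x)" for m x
 have fm[measurable]: "f m \<in> borel_measurable borel" for m unfolding f_def using avg_measurable[of "\<lambda>x. rk k * \<sigma> x" "u m"] by measurable
 define K where "K = KK ^ CARD('n) / V * (1 / (rk k * \<eta>) ^ CARD('n)) * C"
 have K: "K \<ge> 0" using C KK V_pos rk(1)[of k] \<eta>(1) by (simp add: K_def)
 have f2: "(f m x)^2 \<le> K" for m x
 proof (cases "x \<in> P")
  case True
  have s: "\<sigma> x \<ge> \<eta>" "W x = \<sigma> x" "x \<in> frontier \<Omega>" using True \<eta>(2) P by (auto simp: piece_def)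
  have r: "rk k * \<eta> > 0" "rk k * \<eta> \<le> rk k * \<sigma> x" "rk k * \<sigma> x \<le> c0 * \<sigma> x"
   using rk(1,2)[of k] s(1) \<eta>(1) kappa(2) by (auto intro!: mult_right_mono)
  have "ennreal ((avg (u m) x (rk k * \<sigma> x))^2) \<le> ennreal (KK ^ CARD('n) / V * (1 / (rk k * \<sigma> x) ^ CARD('n))) *
    nsq_on (\<Omega> \<inter> ball x (rk k * \<sigma> x)) (u m)"
   using r s by (intro avg_square_le) auto
  also have "... \<le> ennreal (KK ^ CARD('n) / V * (1 / (rk k * \<eta>) ^ CARD('n))) * ennreal C"
  proof (rule mult_mono)
   show "ennreal (KK ^ CARD('n) / V * (1 / (rk k * \<sigma> x) ^ CARD('n))) \<le> ennreal (KK ^ CARD('n) / V * (1 / (rk k * \<eta>) ^ CARD('n)))"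
    using r KK V_pos rk(1)[of k] \<eta>(1) less_le_trans[OF \<eta>(1) s(1)] by (intro ennreal_leI mult_left_mono divide_left_mono power_mono[OF r(2)] mult_pos_pos zero_less_power) auto
   have "nsq_on (\<Omega> \<inter> ball x (rk k * \<sigma> x)) (u m) \<le> nsq lborel (u m)"
    by (intro nn_integral_mono) (auto simp: indicator_def)
   also have "... \<le> ennreal C" unfolding nsq_eq_rsq[OF sob_pairD(3)[OF sp]] using bd(1) by (rule ennreal_leI)
   finally show "nsq_on (\<Omega> \<inter> ball x (rk k * \<sigma> x)) (u m) \<le> ennreal C" .
  qed auto
  also have "... = ennreal K" unfolding K_def by (rule ennreal_mult''[OF C, symmetric])
  finally show ?thesis using True K by (simp add: f_def)
 qed (use K in \<open>simp add: f_def\<close>)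
 define F where "F x = lim (\<lambda>m. f m x)" for x
 have fF: "(\<lambda>m. f m x) \<longlonglongrightarrow> F x" for x
 proof (cases "x \<in> P")
  case True
  obtain l where "(\<lambda>m. \<integral>y. indicator (\<Omega> \<inter> ball x (rk k * \<sigma> x)) y * u m y \<partial>lborel) \<longlonglongrightarrow> l"
   using cv[of "\<Omega> \<inter> ball x (rk k * \<sigma> x)"] by (auto simp: convergent_def)
  hence "(\<lambda>m. f m x) \<longlonglongrightarrow> l * inverse (measure lborel (\<Omega> \<inter> ball x (rk k * \<sigma> x)))"
   unfolding f_def avg_def divide_inverse using True by (simp add: tendsto_mult_right)
  thus ?thesis unfolding F_def by (metis limI)
 qed (simp add: F_def f_def)
 have Fm[measurable]: "F \<in> borel_measurable borel" unfolding F_def by measurable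
 have F2: "(F x)^2 \<le> K" for x by (rule LIMSEQ_le_const2[OF tendsto_power[OF fF, of _ 2]]) (use f2 in blast)
 have d2: "(f m x - F x)^2 \<le> 4 * K" for m x using square_diff_le[of "f m x" "F x" 0] f2[of m x] F2[of x] by simp
 have "(\<lambda>m. \<integral>x. (f m x - F x)^2 \<partial>bm P) \<longlonglongrightarrow> (\<integral>x. 0 \<partial>bm P)"
 proof (rule integral_dominated_convergence[where w="\<lambda>_. 4 * K"])
  show "AE x in bm P. (\<lambda>m. (f m x - F x)^2) \<longlonglongrightarrow> 0"
  proof (rule AE_I2)
   fix x show "(\<lambda>m. (f m x - F x)^2) \<longlonglongrightarrow> 0" using tendsto_power[OF tendsto_diff[OF fF[of x] tendsto_const[of "F x"]], of 2] by simp
  qed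
  show "AE x in bm P. norm ((f m x - F x)^2) \<le> 4 * K" for m using d2 by simp
 qed auto
 moreover have "\<epsilon> / 32 > 0" using \<epsilon> by simp
 ultimately have "\<forall>\<^sub>F m in sequentially. rsq (bm P) (\<lambda>x. f m x - F x) < \<epsilon> / 32" by (intro order_tendstoD(2)) auto
 then obtain N where N: "\<And>m. m \<ge> N \<Longrightarrow> rsq (bm P) (\<lambda>x. f m x - F x) < \<epsilon> / 32" by (auto simp: eventually_sequentially)
 let ?n = "\<lambda>g h. \<integral>\<^sup>+x. ennreal ((g x - h x)^2) \<partial>bm P"
 have flip: "?n g h = ?n h g" for g h :: "real^'n \<Rightarrow> real" by (simp add: power2_commute)
 have fn: "?n (f m) F \<le> ennreal (\<epsilon> / 32)" if "m \<ge> N" for m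
 proof -
  have "integrable (bm P) (\<lambda>x. (f m x - F x)^2)"
   by (rule integrable_const_bound[where B="4 * K"]) (use d2 in auto)
  thus ?thesis using nsq_eq_rsq[of "bm P" "\<lambda>x. f m x - F x"] N[OF that] by (simp add: ennreal_leI)
 qed
 have tf: "?n (tr \<sigma> (u m)) (f m) \<le> ennreal (\<epsilon> / 16)" for m
 proof -
  have "?n (tr \<sigma> (u m)) (f m) = nsq (bm P) (\<lambda>x. tr \<sigma> (u m) x - avg (u m) x (rk k * \<sigma> x))"
   by (rule nn_integral_cong_AE) (use AE_bm[OF piece_measurable(1)[OF P]] in \<open>eventually_elim, simp add: f_def\<close>)
  also have "... \<le> ennreal (C4 * 1^2 * (1 / 2) ^ k * enn2real (energy (q m) \<Omega>))"
   using P by (intro trace_approx[OF sp P]) (auto simp: piece_def)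
  also have "... \<le> ennreal (\<epsilon> / 16)"
  proof (rule ennreal_leI)
   have "enn2real (energy (q m) \<Omega>) \<le> C"
    unfolding energy_off[OF sp] energy_real[OF sp] using bd(2)[of m] C by (simp add: enn2real_leI ennreal_leI)
   hence "C4 * (1 / 2) ^ k * enn2real (energy (q m) \<Omega>) \<le> C4 * (1 / 2) ^ k * C" using C345 by (intro mult_left_mono) auto
   thus "C4 * 1^2 * (1 / 2) ^ k * enn2real (energy (q m) \<Omega>) \<le> \<epsilon> / 16" using k by (simp add: algebra_simps)
  qed
  finally show ?thesis .
 qed
 have tF: "?n (tr \<sigma> (u m)) F \<le> ennreal (3 * \<epsilon> / 16)" if "m \<ge> N" for m
 proof -
  have "?n (tr \<sigma> (u m)) F \<le> 2 * ?n (tr \<sigma> (u m)) (f m) + 2 * ?n (f m) F" by (rule nn_square_diff_le) measurable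
  also have "... \<le> 2 * ennreal (\<epsilon> / 16) + 2 * ennreal (\<epsilon> / 32)" by (intro add_mono mult_left_mono tf fn that) auto
  also have "... = ennreal (3 * \<epsilon> / 16)" using \<epsilon> by (simp flip: ennreal_plus ennreal_mult' ennreal_numeral)
  finally show ?thesis .
 qed
 show ?thesis
 proof (intro exI[of _ N] allI impI)
  fix m l assume ml: "m \<ge> N" "l \<ge> N"
  show "?n (tr \<sigma> (u m)) (tr \<sigma> (u l)) < ennreal \<epsilon>"
  proof -
   have "?n (tr \<sigma> (u m)) (tr \<sigma> (u l)) \<le> 2 * ?n (tr \<sigma> (u m)) F + 2 * ?n F (tr \<sigma> (u l))" by (rule nn_square_diff_le) measurable
   also have "... \<le> 2 * ennreal (3 * \<epsilon> / 16) + 2 * ennreal (3 * \<epsilon> / 16)"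
    unfolding flip[of F] by (intro add_mono mult_left_mono tF ml) auto
   also have "... = ennreal (3 * \<epsilon> / 4)" using \<epsilon> by (simp flip: ennreal_plus ennreal_mult' ennreal_numeral)
   also have "... < ennreal \<epsilon>" using \<epsilon> by (intro ennreal_lessI) auto
   finally show ?thesis .
  qed
 qed
qed

text \<open>One weakly convergent subsequence is fixed first and serves every \<epsilon>. For given
  \<epsilon> the tip contributes little for all indices, while on the rest of the cusp and on the
  sphere the scale is bounded below, so \<open>piece_compact\<close> applies.\<close>

lemma trace_compact:
 fixes u :: "nat \<Rightarrow> real^'n \<Rightarrow> real"
 assumes sp: "\<And>m. sob_pair \<Omega> (u m) (q m)" and bd: "\<And>m. rsq lborel (u m) \<le> C" "\<And>m. dirichlet (q m) \<le> C"
 shows "\<exists>r::nat \<Rightarrow> nat. strict_mono r \<and> (\<forall>\<epsilon>>0. \<exists>N. \<forall>m\<ge>N. \<forall>l\<ge>N. nsq bX (\<lambda>x. Tb (u (r m)) x - Tb (u (r l)) x) < ennreal \<epsilon>)"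
proof -
 note [measurable] = sob_pairD(1)[OF sp] Tb_measurable[OF sob_pairD(1)[OF sp]]
 have "0 \<le> rsq lborel (u 0)" by (rule integral_nonneg_AE) auto
 hence C: "C \<ge> 0" using bd(1)[of 0] by linarith
 have "\<And>m. nsq lborel (u m) \<le> ennreal C" unfolding nsq_eq_rsq[OF sob_pairD(3)[OF sp]] using bd(1) by (rule ennreal_leI)
 then obtain r :: "nat \<Rightarrow> nat" where r: "strict_mono r" "\<And>S. S \<in> sets borel \<Longrightarrow> convergent (\<lambda>m. \<integral>x. indicator S x * u (r m) x \<partial>lborel)"
  using weak_subsequence[of u \<Omega> C] sob_pairD(5)[OF sp] emeasure_\<Omega>_finite C by (metis \<Omega>_borel sob_pairD(1)[OF sp])
 let ?n = "\<lambda>P m l. \<integral>\<^sup>+x. ennreal ((Tb (u (r m)) x - Tb (u (r l)) x)^2) \<partial>bm P"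
 have "\<exists>N. \<forall>m\<ge>N. \<forall>l\<ge>N. nsq bX (\<lambda>x. Tb (u (r m)) x - Tb (u (r l)) x) < ennreal \<epsilon>" if \<epsilon>: "\<epsilon> > 0" for \<epsilon> :: real
 proof -
  obtain \<eta> where \<eta>: "\<eta> > 0" "\<And>u q. sob_pair \<Omega> u q \<Longrightarrow> nsq (bm (Tip \<eta>)) (Tb u)
   \<le> ennreal (\<epsilon> / (16 * (C + 1)) * (rsq lborel u + dirichlet q))"
   using tip_small[of "\<epsilon> / (16 * (C + 1))"] \<epsilon> C by auto
  have T1: "nsq (bm (Tip \<eta>)) (Tb (u m)) \<le> ennreal (\<epsilon> / 8)" for m
  proof (rule order_trans[OF \<eta>(2)[OF sp] ennreal_leI])
   have "\<epsilon> / (16 * (C + 1)) * (rsq lborel (u m) + dirichlet (q m)) \<le> \<epsilon> / (16 * (C + 1)) * (2 * (C + 1))"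
    using bd(1,2)[of m] \<epsilon> C by (intro mult_left_mono) auto
   also have "... = \<epsilon> / 8" using C by (simp add: field_simps)
   finally show "\<epsilon> / (16 * (C + 1)) * (rsq lborel (u m) + dirichlet (q m)) \<le> \<epsilon> / 8" .
  qed
  have T: "?n (Tip \<eta>) m l \<le> ennreal (\<epsilon> / 2)" for m l
  proof -
   have "?n (Tip \<eta>) m l \<le> 2 * nsq (bm (Tip \<eta>)) (\<lambda>x. Tb (u (r m)) x - 0) + 2 * nsq (bm (Tip \<eta>)) (\<lambda>x. 0 - Tb (u (r l)) x)"
    by (rule nn_square_diff_le) measurable
   also have "... \<le> 2 * ennreal (\<epsilon> / 8) + 2 * ennreal (\<epsilon> / 8)" using T1 by (intro add_mono mult_left_mono) auto
   also have "... = ennreal (\<epsilon> / 2)" using \<epsilon> by (simp flip: ennreal_plus ennreal_mult' ennreal_numeral)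
   finally show ?thesis .
  qed
  let ?B = "Cus - Tip \<eta>"
  have pB: "piece ?B (\<lambda>x. gam (x $ e))" by (rule piece_subset[OF piece_Cus]) auto
  obtain N1 where N1: "\<And>m l. m \<ge> N1 \<Longrightarrow> l \<ge> N1 \<Longrightarrow> nsq (bm ?B) (\<lambda>x. tr (\<lambda>x. gam (x $ e)) (u (r m)) x - tr (\<lambda>x. gam (x $ e)) (u (r l)) x) < ennreal (\<epsilon> / 4)"
   using piece_compact[OF sp bd r(2) pB \<eta>(1), of "\<epsilon> / 4"] \<epsilon> by (auto simp: Tip_def not_less)
  obtain N2 where N2: "\<And>m l. m \<ge> N2 \<Longrightarrow> l \<ge> N2 \<Longrightarrow> nsq (bm Sph) (\<lambda>x. tr (\<lambda>_. 1) (u (r m)) x - tr (\<lambda>_. 1) (u (r l)) x) < ennreal (\<epsilon> / 4)"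
   using piece_compact[OF sp bd r(2) piece_Sph, of 1 "\<epsilon> / 4"] \<epsilon> by auto
  show ?thesis
  proof (intro exI[of _ "max N1 N2"] allI impI)
   fix m l assume ml: "max N1 N2 \<le> m" "max N1 N2 \<le> l"
   have B: "?n ?B m l = nsq (bm ?B) (\<lambda>x. tr (\<lambda>x. gam (x $ e)) (u (r m)) x - tr (\<lambda>x. gam (x $ e)) (u (r l)) x)"
   proof (rule nn_integral_cong_AE)
    have "AE x in bm ?B. x \<in> ?B \<and> W x > 0" by (rule AE_bm) simp
    thus "AE x in bm ?B. ennreal ((Tb (u (r m)) x - Tb (u (r l)) x)^2) = ennreal ((tr (\<lambda>x. gam (x $ e)) (u (r m)) x - tr (\<lambda>x. gam (x $ e)) (u (r l)) x)^2)"
     by eventually_elim (simp add: Tb_def)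
   qed
   have S: "?n Sph m l = nsq (bm Sph) (\<lambda>x. tr (\<lambda>_. 1) (u (r m)) x - tr (\<lambda>_. 1) (u (r l)) x)"
   proof (rule nn_integral_cong_AE)
    show "AE x in bm Sph. ennreal ((Tb (u (r m)) x - Tb (u (r l)) x)^2) = ennreal ((tr (\<lambda>_. 1) (u (r m)) x - tr (\<lambda>_. 1) (u (r l)) x)^2)"
     using AE_bm[OF Sph_borel] by eventually_elim (simp add: Tb_def Cus_def Sph_def)
   qed
   have "Tip \<eta> \<union> ?B = Cus" by (auto simp: Tip_def)
   hence "?n Cus m l = ?n (Tip \<eta>) m l + ?n ?B m l" using nn_integral_bm_split[of "\<lambda>x. ennreal ((Tb (u (r m)) x - Tb (u (r l)) x)^2)" "Tip \<eta>" ?B] by simp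
   hence "nsq bX (\<lambda>x. Tb (u (r m)) x - Tb (u (r l)) x) = (?n (Tip \<eta>) m l + ?n ?B m l) + ?n Sph m l"
    by (subst nn_integral_bX) auto
   also have "... \<le> (ennreal (\<epsilon> / 2) + ennreal (\<epsilon> / 4)) + ?n Sph m l"
    using T[of m l] N1[of m l] ml unfolding B by (intro add_mono) auto
   also have "... < (ennreal (\<epsilon> / 2) + ennreal (\<epsilon> / 4)) + ennreal (\<epsilon> / 4)"
    using N2[of m l] ml unfolding S by (simp add: ennreal_add_left_cancel_less)
   also have "... = ennreal \<epsilon>" using \<epsilon> by (simp flip: ennreal_plus)
   finally show "nsq bX (\<lambda>x. Tb (u (r m)) x - Tb (u (r l)) x) < ennreal \<epsilon>" .
  qed
 qed
 thus ?thesis using r(1) by blast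
qed

end

section \<open>The Steklov spectrum\<close>

lemma (in semi_inner) linear_combination:
 fixes k :: nat
 assumes "\<And>j. j \<le> k \<Longrightarrow> w j \<in> V"
 shows "(\<lambda>x. \<Sum>j\<le>k. c j * w j x) \<in> V"
  and "z \<in> V \<Longrightarrow> f (\<lambda>x. \<Sum>j\<le>k. c j * w j x) z = (\<Sum>j\<le>k. c j * f (w j) z)"
proof -
 have "(\<lambda>x. \<Sum>j\<le>k. c j * w j x) \<in> V \<and> (\<forall>z\<in>V. f (\<lambda>x. \<Sum>j\<le>k. c j * w j x) z = (\<Sum>j\<le>k. c j * f (w j) z))"
  using assms
 proof (induction k)
  case 0 thus ?case by (simp add: scale_in scale_left)
 next
  case (Suc k)
  have "(\<lambda>x. \<Sum>j\<le>k. c j * w j x) \<in> V" "w (Suc k) \<in> V" using Suc by auto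
  from lin[OF this, of 1 "c (Suc k)"] add_left[OF this, of _ 1 "c (Suc k)"] show ?case using Suc by simp
 qed
 thus "(\<lambda>x. \<Sum>j\<le>k. c j * w j x) \<in> V" "z \<in> V \<Longrightarrow> f (\<lambda>x. \<Sum>j\<le>k. c j * w j x) z = (\<Sum>j\<le>k. c j * f (w j) z)" by auto
qed

lemma L2_limit:
 fixes f :: "nat \<Rightarrow> 'a \<Rightarrow> real"
 assumes f[measurable]: "\<And>m. f m \<in> borel_measurable M" and i: "\<And>m. integrable M (\<lambda>x. (f m x)^2)"
  and cau: "\<And>\<epsilon>. \<epsilon> > 0 \<Longrightarrow> \<exists>N. \<forall>m\<ge>N. \<forall>l\<ge>N. rsq M (\<lambda>x. f m x - f l x) < \<epsilon>"
 obtains F where "F \<in> borel_measurable M" "integrable M (\<lambda>x. (F x)^2)" "\<And>x. (\<And>m. f m x = 0) \<Longrightarrow> F x = 0"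
  "\<And>m. integrable M (\<lambda>x. (f m x - F x)^2)" "(\<lambda>m. \<integral>x. (f m x - F x)^2 \<partial>M) \<longlonglongrightarrow> 0"
proof -
 have id: "integrable M (\<lambda>x. (g x - h x)^2)"
  if [measurable]: "g \<in> borel_measurable M" "h \<in> borel_measurable M" and "integrable M (\<lambda>x. (g x)^2)" "integrable M (\<lambda>x. (h x)^2)" for g h :: "'a \<Rightarrow> real"
  by (rule Bochner_Integration.integrable_bound[of _ "\<lambda>x. 2 * (g x)^2 + 2 * (h x)^2"])
   (use that square_diff_le[of "g _" "h _" 0] in \<open>auto intro!: AE_I2 order_trans[OF _ abs_ge_self]\<close>)
 have nn: "nsq M (\<lambda>x. f m x - f l x) = ennreal (rsq M (\<lambda>x. f m x - f l x))" for m l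
  by (rule nn_integral_eq_integral) (auto intro!: id i)
 have "\<exists>N. \<forall>m\<ge>N. \<forall>l\<ge>N. nsq M (\<lambda>x. f m x - f l x) < ennreal \<epsilon>" if "\<epsilon> > 0" for \<epsilon> :: real
  unfolding nn using cau[OF that] by (simp add: ennreal_less_iff integral_nonneg_AE)
 from L2_complete[OF f this] obtain F where F[measurable]: "F \<in> borel_measurable M"
  and lim: "\<And>\<epsilon>. \<epsilon> > 0 \<Longrightarrow> \<exists>N. \<forall>m\<ge>N. nsq M (\<lambda>x. f m x - F x) < ennreal \<epsilon>"
  and z: "\<And>x. (\<And>m. f m x = 0) \<Longrightarrow> F x = 0" by blast
 obtain N where "nsq M (\<lambda>x. f N x - F x) < ennreal 1" using lim[of 1] by auto
 hence iN: "integrable M (\<lambda>x. (f N x - F x)^2)" by (intro integrableI_bounded) (auto intro: less_trans)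
 have "integrable M (\<lambda>x. (f N x - (f N x - F x))^2)" by (rule id) (auto intro: i iN)
 hence iF: "integrable M (\<lambda>x. (F x)^2)" by simp
 have im: "integrable M (\<lambda>x. (f m x - F x)^2)" for m by (intro id i iF) auto
 have "(\<lambda>m. \<integral>x. (f m x - F x)^2 \<partial>M) \<longlonglongrightarrow> 0"
 proof (rule LIMSEQ_I)
  fix \<epsilon> :: real assume "\<epsilon> > 0"
  have "nsq M (\<lambda>x. f m x - F x) = ennreal (rsq M (\<lambda>x. f m x - F x))" for m by (rule nn_integral_eq_integral) (auto intro: im)
  thus "\<exists>N. \<forall>m\<ge>N. norm (rsq M (\<lambda>x. f m x - F x) - 0) < \<epsilon>"
   using lim[OF \<open>\<epsilon> > 0\<close>] by (simp add: ennreal_less_iff integral_nonneg_AE)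
 qed
 thus ?thesis using that F iF z im by blast
qed

lemma AE_lebesgue_on:
 fixes \<Omega> :: "(real^'n) set"
 assumes "\<Omega> \<in> sets borel"
 shows "(AE x in lebesgue_on \<Omega>. P x) \<longleftrightarrow> (AE x in lborel. x \<in> \<Omega> \<longrightarrow> P x)"
 using assms by (subst AE_restrict_space_iff) (auto simp: AE_completion_iff)

context cusp
begin

lemma sob_pair_diff: "sob_pair \<Omega> u q \<Longrightarrow> sob_pair \<Omega> u' q' \<Longrightarrow> sob_pair \<Omega> (\<lambda>x. u x - u' x) (\<lambda>x. q x - q' x)"
 using sob_pair_lin[of u q u' q' 1 "- 1"] by simp

lemma pairing_limit:
 fixes f :: "nat \<Rightarrow> real^'n \<Rightarrow> real"
 assumes f[measurable]: "\<And>m. f m \<in> borel_measurable borel" "F \<in> borel_measurable borel" "(h :: real^'n \<Rightarrow> real) \<in> borel_measurable borel"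
  and z: "\<And>m x. x \<notin> \<Omega> \<Longrightarrow> f m x = 0" "\<And>x. x \<notin> \<Omega> \<Longrightarrow> F x = 0" and K: "\<And>x. \<bar>h x\<bar> \<le> K"
  and i: "\<And>m. integrable lborel (\<lambda>x. (f m x)^2)" "integrable lborel (\<lambda>x. (F x)^2)" "\<And>m. integrable lborel (\<lambda>x. (f m x - F x)^2)"
  and lim: "(\<lambda>m. \<integral>x. (f m x - F x)^2 \<partial>lborel) \<longlonglongrightarrow> 0"
 shows "(\<lambda>m. \<integral>x. f m x * h x \<partial>lborel) \<longlonglongrightarrow> (LBINT x. F x * h x)"
proof -
 have int: "integrable lborel (\<lambda>x. g x * h x)" if [measurable]: "g \<in> borel_measurable borel" and "\<And>x. x \<notin> \<Omega> \<Longrightarrow> g x = 0" "integrable lborel (\<lambda>x. (g x)^2)" for g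
 proof (rule Bochner_Integration.integrable_bound)
  show "integrable lborel (\<lambda>x. K * g x)" by (rule integrable_mult_right, rule integrable_of_square[OF _ _ bounded_\<Omega> \<Omega>_borel]) (use that in auto)
  show "AE x in lborel. norm (g x * h x) \<le> norm (K * g x)"
  proof (rule AE_I2)
   fix x
   have "\<bar>h x\<bar> * \<bar>g x\<bar> \<le> \<bar>K\<bar> * \<bar>g x\<bar>" using order_trans[OF K abs_ge_self] by (rule mult_right_mono) simp
   thus "norm (g x * h x) \<le> norm (K * g x)" by (simp add: abs_mult mult.commute)
  qed
 qed measurable
 have sq: "(LBINT x. f m x * h x) - (LBINT x. F x * h x) = (LBINT x. indicator \<Omega> x * ((f m x - F x) * h x))" for m
 proof -
  have "indicator \<Omega> x * ((f m x - F x) * h x) = f m x * h x - F x * h x" for x using z[of x] by (cases "x \<in> \<Omega>") (auto simp: left_diff_distrib)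
  thus ?thesis using int[OF f(1) z(1) i(1)] int[OF f(2) z(2) i(2)] by simp
 qed
 have le: "((LBINT x. f m x * h x) - (LBINT x. F x * h x))^2 \<le> measure lborel \<Omega> * (K^2 * rsq lborel (\<lambda>x. f m x - F x))" (is "?l \<le> ?r") for m
 proof -
  have "ennreal ?l \<le> emeasure lborel \<Omega> * nsq_on \<Omega> (\<lambda>x. (f m x - F x) * h x)"
   unfolding sq by (rule set_integral_square_le) auto
  also have "... \<le> emeasure lborel \<Omega> * (\<integral>\<^sup>+x. ennreal (K^2 * (f m x - F x)^2) \<partial>lborel)"
  proof (intro mult_left_mono nn_integral_mono)
   fix x
   have "(h x)^2 \<le> K^2" using K[of x] by (simp add: abs_le_square_iff[symmetric])
   hence "((f m x - F x) * h x)^2 \<le> K^2 * (f m x - F x)^2" by (simp add: power_mult_distrib mult.commute[of _ "(h x)^2"] mult_right_mono)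
   thus "ennreal (((f m x - F x) * h x)^2) * indicator \<Omega> x \<le> ennreal (K^2 * (f m x - F x)^2)" by (auto simp: indicator_def intro: ennreal_leI)
  qed simp
  also have "(\<integral>\<^sup>+x. ennreal (K^2 * (f m x - F x)^2) \<partial>lborel) = ennreal (K^2 * rsq lborel (\<lambda>x. f m x - F x))"
   by (subst nn_integral_eq_integral) (use i(3) in auto)
  also have "emeasure lborel \<Omega> = ennreal (measure lborel \<Omega>)" using emeasure_\<Omega>_finite by (simp add: emeasure_eq_ennreal_measure)
  also have "... * ennreal (K^2 * rsq lborel (\<lambda>x. f m x - F x)) = ennreal ?r" by (rule ennreal_mult[symmetric]) (auto intro!: mult_nonneg_nonneg)
  finally show ?thesis by (simp add: ennreal_le_iff)
 qed
 have "(\<lambda>m. measure lborel \<Omega> * (K^2 * rsq lborel (\<lambda>x. f m x - F x))) \<longlonglongrightarrow> measure lborel \<Omega> * (K^2 * 0)" by (intro tendsto_intros lim)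
 hence L: "(\<lambda>m. measure lborel \<Omega> * (K^2 * rsq lborel (\<lambda>x. f m x - F x))) \<longlonglongrightarrow> 0" by simp
 have "(\<lambda>m. ((LBINT x. f m x * h x) - (LBINT x. F x * h x))^2) \<longlonglongrightarrow> 0"
  by (rule tendsto_sandwich[OF always_eventually always_eventually tendsto_const L]) (use le zero_le_power2 in blast)+
 from tendsto_real_sqrt[OF this] have "(\<lambda>m. (LBINT x. f m x * h x) - (LBINT x. F x * h x)) \<longlonglongrightarrow> 0"
  by (simp add: tendsto_rabs_zero_iff)
 thus ?thesis by (simp add: LIM_zero_iff)
qed

lemma C7_nonneg: "C7 \<ge> 0"
proof -
 have "CP \<ge> 0" using V_pos by (simp add: CP_def)
 thus ?thesis using C6_nonneg beta_pos by (auto simp: C7_def intro!: add_nonneg_nonneg mult_nonneg_nonneg divide_nonneg_nonneg)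
qed

text \<open>\<open>friedrichs\<close> upgrades the Cauchy condition to L2. Limits of the functions
  and of the gradient components exist by \<open>L2_limit\<close>; the weak derivative identity
  passes to the limit against bounded test functions, and \<open>Tb_bound\<close> returns
  convergence of the traces.\<close>

lemma sob_complete:
 fixes u :: "nat \<Rightarrow> real^'n \<Rightarrow> real"
 assumes sp: "\<And>m. sob_pair \<Omega> (u m) (q m)"
  and cau: "\<And>\<epsilon>. \<epsilon> > 0 \<Longrightarrow> \<exists>N. \<forall>m\<ge>N. \<forall>l\<ge>N.
    dirichlet (\<lambda>x. q m x - q l x) + rsq bX (Tb (\<lambda>x. u m x - u l x)) < \<epsilon>"
 obtains U Q where "sob_pair \<Omega> U Q"
  "(\<lambda>m. dirichlet (\<lambda>x. q m x - Q x) + rsq bX (Tb (\<lambda>x. u m x - U x))) \<longlonglongrightarrow> 0"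
proof -
 note [measurable] = sob_pairD(1,2)[OF sp]
 have C7: "C7 + 1 > 0" using C7_nonneg by simp
 have qi: "integrable lborel (\<lambda>x. (norm (q m x - q l x))^2)" for m l using sob_pairD(4)[OF sob_pair_diff[OF sp sp]] .
 have nb: "0 \<le> rsq bX (Tb f)" "0 \<le> dirichlet g" for f and g :: "real^'n \<Rightarrow> real^'n" by (rule integral_nonneg_AE; simp)+
 have "\<exists>N. \<forall>m\<ge>N. \<forall>l\<ge>N. rsq lborel (\<lambda>x. u m x - u l x) < \<epsilon>" if \<epsilon>: "\<epsilon> > 0" for \<epsilon>
 proof -
  obtain N where N: "\<And>m l. m \<ge> N \<Longrightarrow> l \<ge> N \<Longrightarrow> dirichlet (\<lambda>x. q m x - q l x) + rsq bX (Tb (\<lambda>x. u m x - u l x)) < \<epsilon> / (C7 + 1)"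
   using cau[of "\<epsilon> / (C7 + 1)"] divide_pos_pos[OF \<epsilon> C7] by blast
  have "rsq lborel (\<lambda>x. u m x - u l x) < \<epsilon>" if "m \<ge> N" "l \<ge> N" for m l
  proof -
   have "rsq lborel (\<lambda>x. u m x - u l x) \<le> C7 * (dirichlet (\<lambda>x. q m x - q l x) + rsq bX (Tb (\<lambda>x. u m x - u l x)))" (is "_ \<le> C7 * ?s")
    by (rule friedrichs(1)[OF sob_pair_diff[OF sp sp]])
   also have "... \<le> (C7 + 1) * ?s" using nb by (intro mult_right_mono add_nonneg_nonneg) auto
   also have "... < \<epsilon>" using N[OF that] C7 by (simp add: pos_less_divide_eq mult.commute)
   finally show ?thesis .
  qed
  thus ?thesis by blast
 qed
 from L2_limit[OF _ sob_pairD(3)[OF sp] this] obtain U where U[measurable]: "U \<in> borel_measurable borel" and U2: "integrable lborel (\<lambda>x. (U x)^2)"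
  "\<And>x. (\<And>m. u m x = 0) \<Longrightarrow> U x = 0" "\<And>m. integrable lborel (\<lambda>x. (u m x - U x)^2)" "(\<lambda>m. \<integral>x. (u m x - U x)^2 \<partial>lborel) \<longlonglongrightarrow> 0" by auto
 have comp: "integrable lborel (\<lambda>x. (g x $ i)^2)" if [measurable]: "g \<in> borel_measurable borel" and "integrable lborel (\<lambda>x. (norm (g x))^2)" for g :: "real^'n \<Rightarrow> real^'n" and i
  by (rule Bochner_Integration.integrable_bound[OF that(2)]) (auto intro!: AE_I2 power_mono simp: component_le_norm_cart abs_le_square_iff[symmetric])
 define R where "R i G \<longleftrightarrow> G \<in> borel_measurable borel \<and> integrable lborel (\<lambda>x. (G x)^2) \<and> (\<forall>x. (\<forall>m. q m x $ i = 0) \<longrightarrow> G x = 0) \<and>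
   (\<forall>m. integrable lborel (\<lambda>x. (q m x $ i - G x)^2)) \<and> (\<lambda>m. \<integral>x. (q m x $ i - G x)^2 \<partial>lborel) \<longlonglongrightarrow> 0" for i G
 have "\<exists>G. R i G" for i
 proof -
  have "\<exists>N. \<forall>m\<ge>N. \<forall>l\<ge>N. rsq lborel (\<lambda>x. q m x $ i - q l x $ i) < \<epsilon>" if "\<epsilon> > 0" for \<epsilon>
  proof -
   have le: "rsq lborel (\<lambda>x. q m x $ i - q l x $ i) \<le> dirichlet (\<lambda>x. q m x - q l x)" for m l
   proof (rule integral_mono)
    show "integrable lborel (\<lambda>x. (q m x $ i - q l x $ i)^2)" using comp[OF _ qi[of m l], of i] by simp
    fix x show "(q m x $ i - q l x $ i)^2 \<le> (norm (q m x - q l x))^2"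
     using component_le_norm_cart[of "q m x - q l x" i] by (simp add: abs_le_square_iff[symmetric])
   qed (rule qi)
   obtain N where N: "\<And>m l. m \<ge> N \<Longrightarrow> l \<ge> N \<Longrightarrow> dirichlet (\<lambda>x. q m x - q l x) + rsq bX (Tb (\<lambda>x. u m x - u l x)) < \<epsilon>"
    using cau[OF \<open>\<epsilon> > 0\<close>] by blast
   have "rsq lborel (\<lambda>x. q m x $ i - q l x $ i) < \<epsilon>" if "m \<ge> N" "l \<ge> N" for m l
    using N[OF that] le[of m l] nb(1)[of "\<lambda>x. u m x - u l x"] by linarith
   thus ?thesis by blast
  qed
  from L2_limit[OF _ comp[OF _ sob_pairD(4)[OF sp]] this] obtain G where "G \<in> borel_measurable lborel" "integrable lborel (\<lambda>x. (G x)^2)" "\<And>x. (\<And>m. q m x $ i = 0) \<Longrightarrow> G x = 0"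
   "\<And>m. integrable lborel (\<lambda>x. (q m x $ i - G x)^2)" "(\<lambda>m. \<integral>x. (q m x $ i - G x)^2 \<partial>lborel) \<longlonglongrightarrow> 0" by auto
  thus ?thesis by (intro exI[of _ G]) (simp add: R_def)
 qed
 then obtain G where "\<And>i. R i (G i)" by metis
 hence G: "\<And>i. G i \<in> borel_measurable borel" "\<And>i. integrable lborel (\<lambda>x. (G i x)^2)" "\<And>i x. (\<And>m. q m x $ i = 0) \<Longrightarrow> G i x = 0"
   "\<And>i m. integrable lborel (\<lambda>x. (q m x $ i - G i x)^2)" "\<And>i. (\<lambda>m. \<integral>x. (q m x $ i - G i x)^2 \<partial>lborel) \<longlonglongrightarrow> 0"
  by (simp_all add: R_def)
 define Q where "Q x = (\<chi> i. G i x)" for x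
 note [measurable] = G(1)
 have Qm[measurable]: "Q \<in> borel_measurable borel" by (subst borel_measurable_euclidean_space) (auto simp: Basis_vec_def inner_axis Q_def)
 have S: "sob_pair \<Omega> U Q" unfolding sob_pair_def
 proof (intro conjI allI ballI impI)
  show "integrable lborel (\<lambda>x. (norm (Q x))^2)" unfolding norm_square_sum Q_def using G(2) by simp
  fix x assume "x \<notin> \<Omega>"
  thus "U x = 0" "Q x = 0" using U2(2)[of x] G(3)[of x] sob_pairD(5,6)[OF sp] by (auto simp: Q_def vec_eq_iff)
 next
  fix \<phi> i assume \<phi>: "\<phi> \<in> test_functions \<Omega>"
  note [measurable] = test_ext_measurable[OF \<phi>]
  obtain K where K: "\<And>x. \<bar>\<phi> x\<bar> \<le> K" "\<And>i x. \<bar>partial_deriv i \<phi> x\<bar> \<le> K" using test_functions_bounded[OF \<phi>] by metis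
  have A: "(\<lambda>m. \<integral>x. u m x * partial_deriv i \<phi> x \<partial>lborel) \<longlonglongrightarrow> (LBINT x. U x * partial_deriv i \<phi> x)"
   by (rule pairing_limit[OF _ _ _ _ _ K(2) sob_pairD(3)[OF sp] U2(1,3,4)]) (use U2(2) sob_pairD(5)[OF sp] in auto)
  have B: "(\<lambda>m. \<integral>x. q m x $ i * \<phi> x \<partial>lborel) \<longlonglongrightarrow> (LBINT x. G i x * \<phi> x)"
   by (rule pairing_limit[OF _ _ _ _ _ K(1) comp[OF _ sob_pairD(4)[OF sp]] G(2,4,5)]) (use G(3) sob_pairD(6)[OF sp] in auto)
  have "(\<lambda>m. \<integral>x. u m x * partial_deriv i \<phi> x \<partial>lborel) \<longlonglongrightarrow> - (LBINT x. G i x * \<phi> x)"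
   using tendsto_minus[OF B] unfolding sob_pairD(7)[OF sp \<phi>] .
  from LIMSEQ_unique[OF A this] show "(LBINT x. U x * partial_deriv i \<phi> x) = - (LBINT x. Q x $ i * \<phi> x)" by (simp add: Q_def)
 qed (use U2 in auto)
 let ?E = "\<lambda>m. \<integral>x. (norm (q m x - Q x))^2 \<partial>lborel" and ?N = "\<lambda>m. \<integral>x. (u m x - U x)^2 \<partial>lborel"
 have "(\<lambda>m. \<Sum>i\<in>UNIV. \<integral>x. (q m x $ i - G i x)^2 \<partial>lborel) \<longlonglongrightarrow> (\<Sum>i\<in>(UNIV::'n set). 0)" by (intro tendsto_sum G(5))
 hence E: "?E \<longlonglongrightarrow> 0" unfolding norm_square_sum using G(4) by (simp add: Q_def)
 have "(\<lambda>m. C6 * (?N m + ?E m)) \<longlonglongrightarrow> C6 * (0 + 0)" by (intro tendsto_intros E U2(4))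
 hence L: "(\<lambda>m. C6 * (?N m + ?E m)) \<longlonglongrightarrow> 0" by simp
 have "(\<lambda>m. \<integral>x. (Tb (\<lambda>x. u m x - U x) x)^2 \<partial>bX) \<longlonglongrightarrow> 0"
  by (rule tendsto_sandwich[OF always_eventually always_eventually tendsto_const L]) (use Tb_bound(2)[OF sob_pair_diff[OF sp S]] nb(1) in blast)+
 from tendsto_add[OF E this] show ?thesis using that S by simp
qed

end

text \<open>By symmetry \<open>w\<close> is b-orthogonal to every \<open>us j\<close> of another
  eigenvalue, hence to all of them. The lower bound with some \<open>lam k > mu\<close> then leaves
  only \<open>b w w = 0\<close>. This one argument yields both the completeness of the list of
  eigenvalues and the upper bound on multiplicities.\<close>

lemma (in form_pair) eigen_component_null:
 assumes us: "\<And>k. us k \<in> V" "\<And>k v. v \<in> V \<Longrightarrow> a (us k) v = lam k * b (us k) v"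
  and top: "filterlim lam at_top sequentially"
  and min: "\<And>v k. v \<in> V \<Longrightarrow> (\<forall>j<k. b v (us j) = 0) \<Longrightarrow> lam k * b v v \<le> a v v"
  and w: "w \<in> V" "\<And>v. v \<in> V \<Longrightarrow> a w v = mu * b w v" and o: "\<And>j. lam j = mu \<Longrightarrow> b w (us j) = 0"
 shows "a w w + b w w = 0"
proof -
 have o': "b w (us j) = 0" for j
 proof (cases "lam j = mu")
  case False
  have "mu * b w (us j) = lam j * b w (us j)"
   using w us(1)[of j] us(2)[OF w(1), of j] by (simp add: A.sym[of w] B.sym[of w])
  thus ?thesis using False by simp
 qed (rule o)
 obtain k where "lam k > mu"
  using filterlim_at_top_dense[THEN iffD1, OF top] eventually_sequentially by (metis order_refl)
 moreover have "lam k * b w w \<le> mu * b w w" using min[OF w(1), of k] o' w by simp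
 ultimately have "b w w \<le> 0" by (metis linorder_not_le mult_less_cancel_right)
 hence "b w w = 0" using B.pos[OF w(1)] by simp
 thus ?thesis using w by simp
qed

context cusp
begin

definition fa :: "(real^'n \<Rightarrow> real) \<Rightarrow> (real^'n \<Rightarrow> real) \<Rightarrow> real" where
 "fa v v' = integral\<^sup>L (lebesgue_on \<Omega>) (\<lambda>x. weak_gradient \<Omega> v x \<bullet> weak_gradient \<Omega> v' x)"

definition fb :: "(real^'n \<Rightarrow> real) \<Rightarrow> (real^'n \<Rightarrow> real) \<Rightarrow> real" where
 "fb v v' = integral\<^sup>L (hausdorff_measure_on (real CARD('n) - 1) (frontier \<Omega>))
   (\<lambda>x. boundary_trace \<Omega> v x * boundary_trace \<Omega> v' x * W x)"

lemma fa_eq: "Rep v u q \<Longrightarrow> Rep v' u' q' \<Longrightarrow> fa v v' = (LBINT x. q x \<bullet> q' x)"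
 and fb_eq: "Rep v u q \<Longrightarrow> Rep v' u' q' \<Longrightarrow> fb v v' = (\<integral>x. Tb u x * Tb u' x \<partial>bX)"
 unfolding fa_def fb_def by (simp_all only: form_a form_b)

lemma fa_quad: "Rep v u q \<Longrightarrow> fa v v = dirichlet q"
 and fb_quad: "Rep v u q \<Longrightarrow> fb v v = rsq bX (Tb u)"
 using fa_eq[of v u q v u q] fb_eq[of v u q v u q] by (simp_all only: power2_norm_eq_inner) (simp_all add: power2_eq_square)

lemma Rep_sob: "Rep v u q \<Longrightarrow> sob_pair \<Omega> u q" by (simp add: Rep_def)

lemma Rep_diff: "Rep v u q \<Longrightarrow> Rep v' u' q' \<Longrightarrow> Rep (\<lambda>x. v x - v' x) (\<lambda>x. u x - u' x) (\<lambda>x. q x - q' x)"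
 using Rep_lin[of v u q v' u' q' 1 "- 1"] by simp

lemma Rep_poly: "Rep (PF p) (PF p) (PG p)" using sob_pair_poly by (simp add: Rep_def)

lemma PF_in: "PF p \<in> sobolev_W12 \<Omega>" by (rule Rep_W12(1)[OF Rep_poly])

lemma Tb_product_integrable: "sob_pair \<Omega> u q \<Longrightarrow> sob_pair \<Omega> u' q' \<Longrightarrow> integrable bX (\<lambda>x. Tb u x * Tb u' x)"
 using Tb_measurable[OF sob_pairD(1)] Tb_bound(1) by (intro product_integrable) (auto cong: measurable_cong_sets simp: sets_bX)

lemma forms_semi_inner: "semi_inner (sobolev_W12 \<Omega>) fa" "semi_inner (sobolev_W12 \<Omega>) fb"
proof -
 have lin: "(\<lambda>x. c * u x + d * v x) \<in> sobolev_W12 \<Omega>" if u: "u \<in> sobolev_W12 \<Omega>" and v: "v \<in> sobolev_W12 \<Omega>" for u v :: "real^'n \<Rightarrow> real" and c d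
 proof -
  obtain u1 q1 where r1: "Rep u u1 q1" using Rep_ex[OF u] by blast
  obtain u2 q2 where r2: "Rep v u2 q2" using Rep_ex[OF v] by blast
  show ?thesis by (rule Rep_W12(1)[OF Rep_lin[OF r1 r2]])
 qed
 show "semi_inner (sobolev_W12 \<Omega>) fa"
 proof
  fix u v z :: "real^'n \<Rightarrow> real" and c d assume u: "u \<in> sobolev_W12 \<Omega>" and v: "v \<in> sobolev_W12 \<Omega>" and z: "z \<in> sobolev_W12 \<Omega>"
  obtain u1 q1 where r1: "Rep u u1 q1" using Rep_ex[OF u] by blast
  obtain u2 q2 where r2: "Rep v u2 q2" using Rep_ex[OF v] by blast
  obtain u3 q3 where r3: "Rep z u3 q3" using Rep_ex[OF z] by blast
  show "fa (\<lambda>x. c * u x + d * v x) z = c * fa u z + d * fa v z"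
   using inner_integrable[OF Rep_sob[OF r1] Rep_sob[OF r3]] inner_integrable[OF Rep_sob[OF r2] Rep_sob[OF r3]]
   by (simp add: fa_eq[OF Rep_lin[OF r1 r2] r3] fa_eq[OF r1 r3] fa_eq[OF r2 r3] inner_add_left)
 next
  fix u :: "real^'n \<Rightarrow> real" assume "u \<in> sobolev_W12 \<Omega>"
  then obtain u1 q1 where "Rep u u1 q1" using Rep_ex by blast
  thus "0 \<le> fa u u" by (simp add: fa_quad)
 qed (auto simp: lin fa_def inner_commute)
 show "semi_inner (sobolev_W12 \<Omega>) fb"
 proof
  fix u v z :: "real^'n \<Rightarrow> real" and c d assume u: "u \<in> sobolev_W12 \<Omega>" and v: "v \<in> sobolev_W12 \<Omega>" and z: "z \<in> sobolev_W12 \<Omega>"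
  obtain u1 q1 where r1: "Rep u u1 q1" using Rep_ex[OF u] by blast
  obtain u2 q2 where r2: "Rep v u2 q2" using Rep_ex[OF v] by blast
  obtain u3 q3 where r3: "Rep z u3 q3" using Rep_ex[OF z] by blast
  note i = Tb_product_integrable[OF Rep_sob[OF r1] Rep_sob[OF r3]] Tb_product_integrable[OF Rep_sob[OF r2] Rep_sob[OF r3]]
  note [measurable] = Tb_measurable[OF sob_pairD(1)[OF Rep_sob[OF r1]]] Tb_measurable[OF sob_pairD(1)[OF Rep_sob[OF r2]]] Tb_measurable[OF sob_pairD(1)[OF Rep_sob[OF r3]]] Tb_measurable[OF sob_pairD(1)[OF Rep_sob[OF Rep_lin[OF r1 r2, of c d]]]]
  have "fb (\<lambda>x. c * u x + d * v x) z = (\<integral>x. c * (Tb u1 x * Tb u3 x) + d * (Tb u2 x * Tb u3 x) \<partial>bX)"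
   unfolding fb_eq[OF Rep_lin[OF r1 r2] r3]
  proof (rule integral_cong_AE)
   show "AE x in bX. Tb (\<lambda>x. c * u1 x + d * u2 x) x * Tb u3 x = c * (Tb u1 x * Tb u3 x) + d * (Tb u2 x * Tb u3 x)"
    using Tb_lin[OF Rep_sob[OF r1] Rep_sob[OF r2], of c d] by eventually_elim (simp add: algebra_simps)
  qed measurable
  thus "fb (\<lambda>x. c * u x + d * v x) z = c * fb u z + d * fb v z" using i by (simp add: fb_eq[OF r1 r3] fb_eq[OF r2 r3])
 next
  fix u :: "real^'n \<Rightarrow> real" assume "u \<in> sobolev_W12 \<Omega>"
  then obtain u1 q1 where "Rep u u1 q1" using Rep_ex by blast
  thus "0 \<le> fb u u" by (simp add: fb_quad)
 qed (auto simp: lin fb_def mult.commute)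
qed

lemma Tb_diff_integral:
 assumes "sob_pair \<Omega> u q" "sob_pair \<Omega> u' q'"
 shows "ennreal (rsq bX (Tb (\<lambda>x. u x - u' x))) = nsq bX (\<lambda>x. Tb u x - Tb u' x)"
 unfolding nsq_eq_rsq[OF Tb_bound(1)[OF sob_pair_diff[OF assms]], symmetric]
 by (rule nn_integral_cong_AE) (use Tb_lin[OF assms, of 1 "- 1"] in \<open>auto elim!: eventually_mono\<close>)

lemma form_pair_forms: "form_pair (sobolev_W12 \<Omega>) fa fb"
proof -
 interpret A: semi_inner "sobolev_W12 \<Omega>" fa by (rule forms_semi_inner)
 interpret B: semi_inner "sobolev_W12 \<Omega>" fb by (rule forms_semi_inner)
 show ?thesis
 proof
  fix U :: "nat \<Rightarrow> real^'n \<Rightarrow> real" and C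
  assume U: "\<And>m. U m \<in> sobolev_W12 \<Omega>" and C: "\<And>m. fa (U m) (U m) + fb (U m) (U m) \<le> C"
  have "\<exists>u q. Rep (U m) u q" for m using Rep_ex[OF U] by blast
  then obtain u q where R: "\<And>m. Rep (U m) (u m) (q m)" by metis
  note sp = Rep_sob[OF R]
  define D where "D = max C (C7 * C)"
  have nb: "0 \<le> fa (U m) (U m)" "0 \<le> fb (U m) (U m)" for m using A.pos[OF U] B.pos[OF U] by auto
  have 1: "dirichlet (q m) \<le> D" for m using C[of m] nb[of m] unfolding D_def fa_quad[OF R, symmetric] by linarith
  have 2: "rsq lborel (u m) \<le> D" for m
  proof -
   have "rsq lborel (u m) \<le> C7 * (fa (U m) (U m) + fb (U m) (U m))"
    unfolding fa_quad[OF R] fb_quad[OF R] by (rule friedrichs(1)[OF sp])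
   also have "... \<le> C7 * C" by (rule mult_left_mono[OF C C7_nonneg])
   finally show ?thesis by (simp add: D_def)
  qed
  from trace_compact[of u q D, OF sp 2 1] obtain r :: "nat \<Rightarrow> nat" where r: "strict_mono r"
   and N: "\<forall>\<epsilon>>0. \<exists>N. \<forall>m\<ge>N. \<forall>l\<ge>N. nsq bX (\<lambda>x. Tb (u (r m)) x - Tb (u (r l)) x) < ennreal \<epsilon>"
   by blast
  have e: "nsq bX (\<lambda>x. Tb (u (r m)) x - Tb (u (r l)) x) = ennreal (fb (\<lambda>x. U (r m) x - U (r l) x) (\<lambda>x. U (r m) x - U (r l) x))" for m l
   unfolding fb_quad[OF Rep_diff[OF R R]] by (rule Tb_diff_integral[OF sp sp, symmetric])
  have p: "0 \<le> fb (\<lambda>x. U (r m) x - U (r l) x) (\<lambda>x. U (r m) x - U (r l) x)" for m l by (rule B.pos[OF B.diff_in[OF U U]])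
  show "\<exists>r::nat\<Rightarrow>nat. strict_mono r \<and> (\<forall>\<epsilon>>0. \<exists>N. \<forall>m\<ge>N. \<forall>l\<ge>N.
     fb (\<lambda>x. U (r m) x - U (r l) x) (\<lambda>x. U (r m) x - U (r l) x) < \<epsilon>)"
   using N r unfolding e by (intro exI[of _ r]) (simp add: ennreal_less_iff p)
 next
  fix U :: "nat \<Rightarrow> real^'n \<Rightarrow> real"
  assume U: "\<And>m. U m \<in> sobolev_W12 \<Omega>" and C: "\<And>\<epsilon>. \<epsilon> > 0 \<Longrightarrow> \<exists>N. \<forall>m\<ge>N. \<forall>l\<ge>N. fa (\<lambda>x. U m x - U l x) (\<lambda>x. U m x - U l x)
     + fb (\<lambda>x. U m x - U l x) (\<lambda>x. U m x - U l x) < \<epsilon>"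
  have "\<exists>u q. Rep (U m) u q" for m using Rep_ex[OF U] by blast
  then obtain u q where R: "\<And>m. Rep (U m) (u m) (q m)" by metis
  obtain v Q where v: "sob_pair \<Omega> v Q"
   "(\<lambda>m. dirichlet (\<lambda>x. q m x - Q x) + rsq bX (Tb (\<lambda>x. u m x - v x))) \<longlonglongrightarrow> 0"
   by (rule sob_complete[of u q, OF Rep_sob[OF R] C[unfolded fa_quad[OF Rep_diff[OF R R]] fb_quad[OF Rep_diff[OF R R]]]])
  have Rv: "Rep v v Q" using v by (simp add: Rep_def)
  show "\<exists>u\<in>sobolev_W12 \<Omega>. (\<lambda>m. fa (\<lambda>x. U m x - u x) (\<lambda>x. U m x - u x) + fb (\<lambda>x. U m x - u x) (\<lambda>x. U m x - u x)) \<longlonglongrightarrow> 0"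
   using v(2) Rep_W12(1)[OF Rv] unfolding fa_quad[OF Rep_diff[OF R Rv], symmetric] fb_quad[OF Rep_diff[OF R Rv], symmetric] by (rule bexI)
 next
  fix k and us :: "nat \<Rightarrow> real^'n \<Rightarrow> real" assume us: "\<And>j. j < k \<Longrightarrow> us j \<in> sobolev_W12 \<Omega>"
  \<comment> \<open>Among k + 1 monomials some nontrivial combination is orthogonal to the
    \<open>k\<close> given functions; as a nonzero polynomial it has positive boundary form.\<close>
  let ?M = "\<lambda>i. PF (monom 1 i)"
  obtain c where c: "\<exists>i\<le>k. c i \<noteq> 0" "\<And>j. j < k \<Longrightarrow> (\<Sum>i\<le>k. c i * fb (?M i) (us j)) = 0"
   using homogeneous_system[of k "\<lambda>j i. fb (?M i) (us j)"] by blast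
  define p where "p = (\<Sum>i\<le>k. monom (c i) i)"
  have "coeff p i = c i" if "i \<le> k" for i using that by (simp add: p_def coeff_sum)
  hence "p \<noteq> 0" using c(1) by auto
  have pe: "PF p = (\<lambda>x. \<Sum>i\<le>k. c i * ?M i x)" by (rule ext) (simp add: PF_def p_def poly_sum poly_monom sum_distrib_left mult_ac)
  have "fb (PF p) (us j) = 0" if "j < k" for j unfolding pe using B.linear_combination(2)[of k ?M "us j" c] PF_in us[OF that] c(2)[OF that] by simp
  moreover have "fb (PF p) (PF p) > 0" unfolding fb_quad[OF Rep_poly] by (rule poly_form_pos[OF \<open>p \<noteq> 0\<close>])
  ultimately show "\<exists>u\<in>sobolev_W12 \<Omega>. fb u u > 0 \<and> (\<forall>j<k. fb u (us j) = 0)" using PF_in by blast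
 qed
qed


text \<open>Translates the almost everywhere statements in the definitions of eigenpair and
  independence into the forms; \<open>friedrichs\<close> gives the direction that starts from the
  forms.\<close>

lemma null_iff:
 assumes v: "v \<in> sobolev_W12 \<Omega>"
 shows "(AE x in lebesgue_on \<Omega>. v x = 0) \<longleftrightarrow> fa v v + fb v v = 0"
proof
 obtain u q where R: "Rep v u q" using Rep_ex[OF v] by blast
 note sp = Rep_sob[OF R]
 assume "fa v v + fb v v = 0"
 hence "rsq lborel u \<le> 0" using friedrichs(1)[OF sp] by (simp add: fa_quad[OF R] fb_quad[OF R])
 moreover have "rsq lborel u \<ge> 0" by (rule integral_nonneg_AE) auto
 ultimately have "AE x in lborel. (u x)^2 = 0" using sob_pairD(3)[OF sp] by (subst integral_nonneg_eq_0_iff_AE[symmetric]) auto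
 moreover have "AE x in lborel. x \<in> \<Omega> \<longrightarrow> v x = u x" using R by (simp add: Rep_def)
 ultimately have "AE x in lborel. x \<in> \<Omega> \<longrightarrow> v x = 0" by eventually_elim simp
 thus "AE x in lebesgue_on \<Omega>. v x = 0" by (simp add: AE_lebesgue_on)
next
 assume "AE x in lebesgue_on \<Omega>. v x = 0"
 hence "Rep v (PF 0) (PG 0)" using sob_pair_poly by (simp add: AE_lebesgue_on Rep_def PF_def)
 moreover have "rsq bX (Tb (PF 0)) = 0"
  by (rule integral_eq_zero_AE) (use Tb_poly[of 0] in \<open>auto elim!: eventually_mono\<close>)
 ultimately show "fa v v + fb v v = 0" by (simp add: fa_quad fb_quad PG_def)
qed

lemma Rep_const:
 assumes v: "v \<in> sobolev_W12 \<Omega>" and 0: "fa v v = 0"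
 obtains m where "Rep v (PF [:m:]) (PG [:m:])"
proof -
 obtain u q where R: "Rep v u q" using Rep_ex[OF v] by blast
 obtain m where m: "AE x in lborel. u x = m * PF 1 x" using friedrichs(2)[OF Rep_sob[OF R]] 0 by (auto simp: fa_quad[OF R])
 have "AE x in lborel. x \<in> \<Omega> \<longrightarrow> v x = u x" using R by (simp add: Rep_def)
 hence "AE x in lborel. x \<in> \<Omega> \<longrightarrow> v x = PF [:m:] x" using m by eventually_elim (simp add: PF_def)
 thus ?thesis using that sob_pair_poly by (simp add: Rep_def)
qed

lemma fb_const: "Rep v (PF [:m:]) (PG [:m:]) \<Longrightarrow> Rep v' (PF [:m':]) (PG [:m':]) \<Longrightarrow> fb v v' = m * m' * \<beta>"
proof -
 assume R: "Rep v (PF [:m:]) (PG [:m:])" "Rep v' (PF [:m':]) (PG [:m':])"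
 note [measurable] = Tb_measurable[OF PF_borel]
 have "fb v v' = (\<integral>x. m * m' \<partial>bX)" unfolding fb_eq[OF R]
 proof (rule integral_cong_AE)
  show "AE x in bX. Tb (PF [:m:]) x * Tb (PF [:m':]) x = m * m'" using Tb_poly[of "[:m:]"] Tb_poly[of "[:m':]"] by eventually_elim simp
 qed measurable
 thus ?thesis by (simp add: \<beta>_def space_bX)
qed

lemma eigenpair_iff: "steklov_eigenpair \<Omega> W mu u \<longleftrightarrow>
  u \<in> sobolev_W12 \<Omega> \<and> fa u u + fb u u \<noteq> 0 \<and> (\<forall>v\<in>sobolev_W12 \<Omega>. fa u v = mu * fb u v)"
 unfolding steklov_eigenpair_def steklov_form_eq_def fa_def[symmetric] fb_def[symmetric] using null_iff by blast

lemma eigenspace_iff: "u \<in> steklov_eigenspace \<Omega> W mu \<longleftrightarrow>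
  u \<in> sobolev_W12 \<Omega> \<and> (\<forall>v\<in>sobolev_W12 \<Omega>. fa u v = mu * fb u v)"
 unfolding steklov_eigenspace_def steklov_form_eq_def fa_def[symmetric] fb_def[symmetric] by blast

lemma steklov_spectrum:
 "\<exists>lam :: nat \<Rightarrow> real. lam 0 = 0 \<and> lam 0 < lam 1 \<and> mono lam \<and> filterlim lam at_top sequentially \<and>
   {mu. \<exists>u. steklov_eigenpair \<Omega> W mu u} = range lam \<and>
   (\<forall>k. has_multiplicity \<Omega> W (lam k) (card {j. lam j = lam k}))"
proof -
 interpret form_pair "sobolev_W12 \<Omega>" fa fb by (rule form_pair_forms)
 obtain us lam where us: "\<And>k. us k \<in> sobolev_W12 \<Omega>" "\<And>k j. fb (us k) (us j) = (if k = j then 1 else 0)"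
  "\<And>k v. v \<in> sobolev_W12 \<Omega> \<Longrightarrow> fa (us k) v = lam k * fb (us k) v"
  and lam: "mono lam" "filterlim lam at_top sequentially" "0 \<le> lam 0"
  and min: "\<And>v k. v \<in> sobolev_W12 \<Omega> \<Longrightarrow> (\<forall>j<k. fb v (us j) = 0) \<Longrightarrow> lam k * fb v v \<le> fa v v"
  using eigen_sequence by blast
 note comp0 = eigen_component_null[OF us(1) us(3) lam(2) min]
 \<comment> \<open>Constants have zero energy and positive boundary form, so the first minimum is
   0.\<close>
 have "fa (PF 1) (PF 1) = 0" by (simp add: fa_quad[OF Rep_poly] PG_def pderiv_1)
 moreover have "fb (PF 1) (PF 1) > 0" unfolding fb_quad[OF Rep_poly] by (rule poly_form_pos) simp
 moreover have "lam 0 * fb (PF 1) (PF 1) \<le> fa (PF 1) (PF 1)" by (rule min[OF PF_in]) simp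
 ultimately have "lam 0 \<le> 0" by (simp add: mult_le_0_iff)
 hence l0: "lam 0 = 0" using lam(3) by simp
 \<comment> \<open>Two eigenfunctions of eigenvalue 0 are constants m0 and m1; b-orthogonality gives
   m0 m1 = 0, although normalization makes both nonzero.\<close>
 have l1: "lam 0 < lam 1"
 proof (rule ccontr)
  assume "\<not> ?thesis"
  hence "lam 1 = 0" using monoD[OF lam(1), of 0 1] l0 by simp
  have "fa (us 0) (us 0) = 0" "fa (us 1) (us 1) = 0" using us(3)[OF us(1)] l0 \<open>lam 1 = 0\<close> by simp_all
  then obtain m0 m1 where R: "Rep (us 0) (PF [:m0:]) (PG [:m0:])" "Rep (us 1) (PF [:m1:]) (PG [:m1:])"
   using Rep_const[OF us(1)] by metis
  have "m0 * m1 * \<beta> = 0" "m0 * m0 * \<beta> = 1" "m1 * m1 * \<beta> = 1"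
   using fb_const[OF R] fb_const[OF R(1) R(1)] fb_const[OF R(2) R(2)] by (simp_all add: us(2))
  thus False by auto
 qed
 have not0: "fa (us k) (us k) + fb (us k) (us k) \<noteq> 0" for k using A.pos[OF us(1), of k] by (simp add: us(2))
 have ev: "{mu. \<exists>u. steklov_eigenpair \<Omega> W mu u} = range lam"
 proof safe
  fix k show "\<exists>u. steklov_eigenpair \<Omega> W (lam k) u" using us(1,3) not0[of k] unfolding eigenpair_iff by blast
 next
  fix mu u assume "steklov_eigenpair \<Omega> W mu u"
  hence u: "u \<in> sobolev_W12 \<Omega>" "fa u u + fb u u \<noteq> 0" "\<And>v. v \<in> sobolev_W12 \<Omega> \<Longrightarrow> fa u v = mu * fb u v"
   unfolding eigenpair_iff by auto
  show "mu \<in> range lam" using comp0[OF _ _ _ u(1) u(3)] u(2) by (metis rangeI)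
 qed
 have mult: "has_multiplicity \<Omega> W (lam k) (card {j. lam j = lam k})" for k
 proof -
  let ?J = "{j. lam j = lam k}"
  obtain N where N: "\<And>n. n \<ge> N \<Longrightarrow> lam k < lam n"
   using filterlim_at_top_dense[THEN iffD1, OF lam(2), rule_format, of "lam k"] by (auto simp: eventually_sequentially)
  have "?J \<subseteq> {..<N}" using N by (fastforce simp: not_less[symmetric])
  hence fin: "finite ?J" by (rule finite_subset) simp
  then obtain h where h: "bij_betw h {..<card ?J} ?J" using ex_bij_betw_nat_finite[of ?J] by (auto simp: atLeast0LessThan)
  \<comment> \<open>\<open>linear_combination\<close> sums up to and including its bound; as the
    index set contains \<open>k\<close>, the number of terms is a successor.\<close>
  obtain m where m: "card ?J = Suc m" using fin by (metis (mono_tags) card_0_eq empty_iff mem_Collect_eq not0_implies_Suc)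
  have hJ: "lam (h i) = lam k" if "i < card ?J" for i using bij_betwE[OF h] that by blast
  have hin: "us (h i) \<in> steklov_eigenspace \<Omega> W (lam k)" if "i < card ?J" for i
   unfolding eigenspace_iff using us(1,3) hJ[OF that] by metis
  \<comment> \<open>A combination that vanishes almost everywhere is null for \<open>b\<close>,
    hence b-orthogonal to each of these vectors, and orthonormality reads off its
    coefficients.\<close>
  have li: "ae_lin_indep \<Omega> (\<lambda>i. us (h i)) (card ?J)" unfolding ae_lin_indep_def
  proof (intro allI impI)
   fix c i assume ae: "AE x in lebesgue_on \<Omega>. (\<Sum>i<card ?J. c i * us (h i) x) = 0" and i: "i < card ?J"
   let ?w = "\<lambda>x. \<Sum>j\<le>m. c j * us (h j) x"
   have w: "?w \<in> sobolev_W12 \<Omega>" by (rule B.linear_combination(1)) (rule us(1))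
   have "fa ?w ?w + fb ?w ?w = 0" using ae unfolding null_iff[OF w, symmetric] m lessThan_Suc_atMost .
   hence "fb ?w ?w = 0" using A.pos[OF w] B.pos[OF w] by linarith
   hence "fb ?w (us (h i)) = 0" using B.null_right[OF us(1) w] B.sym[OF w us(1)] by metis
   moreover have "fb ?w (us (h i)) = (\<Sum>j\<le>m. c j * fb (us (h j)) (us (h i)))" by (rule B.linear_combination(2)) (rule us(1))+
   moreover have "(\<Sum>j\<le>m. c j * fb (us (h j)) (us (h i))) = (\<Sum>j\<le>m. if j = i then c j else 0)"
   proof (rule sum.cong[OF refl])
    fix j assume "j \<in> {..m}"
    hence "h j = h i \<longleftrightarrow> j = i" using h i m by (auto simp: bij_betw_def inj_on_def)
    thus "c j * fb (us (h j)) (us (h i)) = (if j = i then c j else 0)" by (simp add: us(2))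
   qed
   ultimately show "c i = 0" using i m by simp
  qed
  \<comment> \<open>With one eigenfunction too many, some nontrivial combination is b-orthogonal to
    all \<open>us j\<close> of this eigenvalue, so \<open>eigen_component_null\<close> makes it
    null, against independence.\<close>
  have up: False if ws: "\<forall>i<Suc (card ?J). ws i \<in> steklov_eigenspace \<Omega> W (lam k)" "ae_lin_indep \<Omega> ws (Suc (card ?J))" for ws
  proof -
   let ?n = "card ?J"
   have wi: "ws i \<in> sobolev_W12 \<Omega>" "\<And>v. v \<in> sobolev_W12 \<Omega> \<Longrightarrow> fa (ws i) v = lam k * fb (ws i) v" if "i \<le> ?n" for i
    using ws(1) that by (auto simp: eigenspace_iff less_Suc_eq_le)
   obtain c where c: "\<exists>i\<le>?n. c i \<noteq> 0" "\<And>j. j < ?n \<Longrightarrow> (\<Sum>i\<le>?n. c i * fb (ws i) (us (h j))) = 0"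
    using homogeneous_system[of ?n "\<lambda>j i. fb (ws i) (us (h j))"] by blast
   let ?w = "\<lambda>x. \<Sum>j\<le>?n. c j * ws j x"
   have w: "?w \<in> sobolev_W12 \<Omega>" by (rule B.linear_combination(1)) (rule wi)
   have fbw: "fb ?w z = (\<Sum>j\<le>?n. c j * fb (ws j) z)" if "z \<in> sobolev_W12 \<Omega>" for z by (rule B.linear_combination(2)[OF wi(1) that])
   have faw: "fa ?w z = lam k * fb ?w z" if z: "z \<in> sobolev_W12 \<Omega>" for z
   proof -
    have "fa ?w z = (\<Sum>j\<le>?n. c j * fa (ws j) z)" by (rule A.linear_combination(2)[OF wi(1) z])
    also have "... = lam k * fb ?w z" unfolding fbw[OF z] sum_distrib_left by (rule sum.cong) (auto simp: wi(2)[OF _ z])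
    finally show ?thesis .
   qed
   have "fa ?w ?w + fb ?w ?w = 0"
   proof (rule comp0[OF _ _ _ w faw])
    fix j assume "lam j = lam k"
    then obtain i where "i < ?n" "j = h i" using h by (auto simp: bij_betw_def)
    thus "fb ?w (us j) = 0" using c(2) fbw[OF us(1)] by simp
   qed
   hence "AE x in lebesgue_on \<Omega>. (\<Sum>i<Suc ?n. c i * ws i x) = 0" unfolding null_iff[OF w, symmetric] lessThan_Suc_atMost .
   with ws(2)[unfolded ae_lin_indep_def, THEN spec, of c] have "\<forall>i<Suc ?n. c i = 0" by (rule mp)
   thus False using c(1) by (auto simp: less_Suc_eq_le)
  qed
  show ?thesis unfolding has_multiplicity_def
  proof (intro conjI)
   show "\<exists>us. (\<forall>i<card ?J. us i \<in> steklov_eigenspace \<Omega> W (lam k)) \<and> ae_lin_indep \<Omega> us (card ?J)"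
    using hin li by (intro exI[of _ "\<lambda>i. us (h i)"]) auto
   show "\<nexists>us. (\<forall>i<Suc (card ?J). us i \<in> steklov_eigenspace \<Omega> W (lam k)) \<and> ae_lin_indep \<Omega> us (Suc (card ?J))"
    by (intro notI, elim exE conjE) (rule up)
  qed
 qed
 show ?thesis using l0 l1 lam(1,2) ev mult by blast
qed

end

theorem theorem3p2:
 fixes \<gamma> :: "real \<Rightarrow> real" and e :: "'n::finite"
 assumes n2: "CARD('n) \<ge> 2"
  and cont: "continuous_on {0..1} \<gamma>"
  and nonneg: "\<forall>t\<in>{0..1}. 0 \<le> \<gamma> t"
  and incr: "mono_on {0..1} \<gamma>"
  and diff: "\<forall>t\<in>{0..1}. \<gamma> differentiable (at t within {0..1})"
  and g0: "\<gamma> 0 = 0" and g1: "\<gamma> 1 = 1"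
  and dincr: "mono_on {0<..<1} (deriv \<gamma>)"
  and dlim: "(deriv \<gamma> \<longlongrightarrow> 0) (at_right 0)"
 shows "\<exists>lam :: nat \<Rightarrow> real.
      lam 0 = 0 \<and> lam 0 < lam 1 \<and> mono lam \<and> filterlim lam at_top sequentially \<and>
      {mu. \<exists>u :: real^'n \<Rightarrow> real.
         steklov_eigenpair (cusp_domain \<gamma> e) (cusp_weight \<gamma> e) mu u} = range lam \<and>
      (\<forall>k. has_multiplicity (cusp_domain \<gamma> e) (cusp_weight \<gamma> e) (lam k)
          (card {j. lam j = lam k}))"
proof -
 have der: "(\<gamma> has_real_derivative deriv \<gamma> t) (at t)" if "0 < t" "t < 1" for t
 proof -
  have "\<gamma> differentiable (at t within {0..1})" using diff that by auto
  hence "\<gamma> differentiable (at t)" using at_within_interior[of t "{0..1}"] that by (simp add: interior_atLeastAtMost_real)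
  thus ?thesis by (simp add: DERIV_deriv_iff_real_differentiable)
 qed
 have mvt: "\<exists>z. s < z \<and> z < t \<and> \<gamma> t - \<gamma> s = (t - s) * deriv \<gamma> z" if "0 \<le> s" "s < t" "t \<le> 1" for s t
 proof -
  have "\<exists>l z. s < z \<and> z < t \<and> (\<gamma> has_real_derivative l) (at z) \<and> \<gamma> t - \<gamma> s = (t - s) * l"
  proof (rule MVT)
   show "continuous_on {s..t} \<gamma>" using that by (intro continuous_on_subset[OF cont]) auto
   fix x assume "s < x" "x < t"
   thus "\<gamma> differentiable (at x)" using der[of x] that unfolding real_differentiable_def by auto
  qed (rule that)
  thus ?thesis using DERIV_imp_deriv by blast
 qed
 \<comment> \<open>The one-sided derivative at 1; by convexity it dominates all slopes and so
   provides the Lipschitz constant.\<close>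
 obtain D where D: "(\<gamma> has_real_derivative D) (at 1 within {0..1})" using diff by (force simp: real_differentiable_def)
 \<comment> \<open>The mean value theorem on [t, 1] represents the slope of the chord as a
   derivative at a later point, which is at least the derivative at \<open>s\<close>.\<close>
 have quot: "deriv \<gamma> s \<le> (1 - \<gamma> t) / (1 - t)" if "0 < s" "s \<le> t" "t < 1" for s t
 proof -
  obtain z where z: "t < z" "z < 1" "\<gamma> 1 - \<gamma> t = (1 - t) * deriv \<gamma> z" using mvt[of t 1] \<open>0 < s\<close> \<open>s \<le> t\<close> \<open>t < 1\<close> by auto
  have "deriv \<gamma> s \<le> deriv \<gamma> z" using mono_onD[OF dincr, of s z] that z by auto
  moreover have "(1 - \<gamma> t) / (1 - t) = deriv \<gamma> z" using z(3) g1 that by simp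
  ultimately show ?thesis by simp
 qed
 \<comment> \<open>The slopes of the chords from \<open>t\<close> to 1 tend to \<open>D\<close>, so
   the bound \<open>quot\<close> passes to the limit.\<close>
 have dD: "deriv \<gamma> s \<le> D" if s: "0 < s" "s < 1" for s
 proof (rule tendsto_lowerbound)
  have "((\<lambda>t. (\<gamma> t - \<gamma> 1) / (t - 1)) \<longlongrightarrow> D) (at 1 within {0..1})" using D by (simp add: has_field_derivative_iff)
  moreover have "at (1::real) within {0..1} = at_left 1" by (simp add: at_within_Icc_at_left)
  ultimately show "((\<lambda>t. (\<gamma> t - \<gamma> 1) / (t - 1)) \<longlongrightarrow> D) (at_left 1)" by simp
  show "\<forall>\<^sub>F t in at_left 1. deriv \<gamma> s \<le> (\<gamma> t - \<gamma> 1) / (t - 1)"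
   unfolding eventually_at_left_field
  proof (intro exI[of _ s] conjI allI impI)
   fix t assume t: "s < t" "t < 1"
   have "(\<gamma> t - \<gamma> 1) / (t - 1) = (1 - \<gamma> t) / (1 - t)" using minus_divide_divide[of "1 - \<gamma> t" "1 - t"] g1 by simp
   thus "deriv \<gamma> s \<le> (\<gamma> t - \<gamma> 1) / (t - 1)" using quot[of s t] s t by simp
  qed (rule s)
 qed simp
 have "cusp TYPE('n) \<gamma> (max 1 D)"
 proof
  have up: "\<bar>\<gamma> s - \<gamma> t\<bar> \<le> max 1 D * \<bar>s - t\<bar>" if "0 \<le> s" "s < t" "t \<le> 1" for s t
  proof -
   obtain z where z: "s < z" "z < t" "\<gamma> t - \<gamma> s = (t - s) * deriv \<gamma> z" using mvt \<open>0 \<le> s\<close> \<open>s < t\<close> \<open>t \<le> 1\<close> by blast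
   have "(t - s) * deriv \<gamma> z \<le> (t - s) * max 1 D" using dD[of z] z that by (intro mult_left_mono) auto
   moreover have "\<gamma> s \<le> \<gamma> t" using mono_onD[OF incr, of s t] that by auto
   ultimately show ?thesis using z(3) that by (simp add: mult.commute abs_real_def)
  qed
  fix s t :: real assume "s \<in> {0..1}" "t \<in> {0..1}"
  thus "\<bar>\<gamma> s - \<gamma> t\<bar> \<le> max 1 D * \<bar>s - t\<bar>" using up[of s t] up[of t s] by (cases s t rule: linorder_cases) (auto simp: abs_minus_commute)
 next
  fix t :: real assume t: "0 \<le> t" "t < 1"
  show "\<gamma> t < 1"
  proof (rule ccontr)
   assume "\<not> ?thesis"
   moreover have "\<gamma> t \<le> \<gamma> 1" using mono_onD[OF incr, of t 1] t by auto
   ultimately have g: "\<gamma> t = 1" using g1 by simp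
   \<comment> \<open>If \<gamma> reached 1 at this \<open>t\<close>, the chord from \<open>t\<close>
     to 1 would have slope 0, so by \<open>quot\<close> the derivative would be nonpositive before
     \<open>t\<close> and \<gamma> could not climb from 0 to 1.\<close>
   have t0: "0 < t" using t g g0 by (cases "t = 0") auto
   obtain z where z: "0 < z" "z < t" "\<gamma> t - \<gamma> 0 = (t - 0) * deriv \<gamma> z" using mvt[of 0 t] t0 t by auto
   have "deriv \<gamma> z \<le> 0" using quot[of z t] z t g by simp
   hence "t * deriv \<gamma> z \<le> 0" using t0 by (simp add: mult_le_0_iff)
   thus False using z(3) g g0 by simp
  qed
 qed (use n2 incr g0 g1 in auto)
 then interpret cusp \<gamma> e "max 1 D" .
 show ?thesis using steklov_spectrum unfolding \<Omega>_def W_def .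
qed

end
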